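(* Let $k$ be a perfect field, $C$ a smooth projective geometrically irreducible curve over $k$, $K=k(C)$, and $\overline K$ an algebraic closure of $K$. Let $E$ be an elliptic curve over $\overline K$, and let $G,H$ be two finite subgroup schemes of $E$. Then $$h\big(j(E/(G+H))\big)+h\big(j(E/(G\cap H))\big)\le h\big(j(E/G)\big)+h\big(j(E/H)\big).$$
   Context: Here $j(-)$ denotes the $j$-invariant of an elliptic curve and $h:\overline K\to\mathbb R$ is the absolute logarithmic Weil height relative to $K$: for $f\in K$, $h(f)$ is the degree of $f$ viewed as a morphism $C\to\mathbb P^1$ (so $h(f)=[K:k(f)]$ if $f$ is non-constant, and $h(f)=0$ if $f$ is constant); for $f$ in a finite extension $K'$ of $K$, $h(f)=[K':k(f)]/[K':K]$ if $f$ is transcendental over $k$, and $h(f)=0$ if $f$ is algebraic over $k$ (independent of the choice of $K'$). $G+H$ is the image of the sum morphism $G\times H\to E$, and $G\cap H$ is the scheme-theoretic intersection. *)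

theory Defs
  imports "HOL-Algebra.Algebra" "HOL-Algebra.Algebraic_Closure_Type" "HOL-Library.Poly_Mapping"
begin

text \<open>
  Throughout, the type \<open>'a\<close> plays the role of the algebraic closure of \<open>K\<close>; the fields
  \<open>k\<close> and \<open>K\<close> are subfields of it, represented as sets.  The explicit record \<open>amb\<close> gives access
  to the notions of field theory from HOL-Algebra.
\<close>

abbreviation amb :: "'a::comm_ring_1 ring" where
  "amb \<equiv> ring_of_type_algebra"

section \<open>Multivariate polynomials\<close>

type_synonym ('v, 'a) mpol = "('v \<Rightarrow>\<^sub>0 nat) \<Rightarrow>\<^sub>0 'a"

definition mpol_eval :: "('v, 'a::comm_ring_1) mpol \<Rightarrow> ('v \<Rightarrow> 'a) \<Rightarrow> 'a" where
  "mpol_eval p x = (\<Sum>m\<in>Poly_Mapping.keys p. Poly_Mapping.lookup p m *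
      (\<Prod>v\<in>Poly_Mapping.keys m. x v ^ Poly_Mapping.lookup m v))"

text \<open>The value at \<open>x\<close> of the partial derivative of \<open>p\<close> with respect to the variable \<open>v\<close>.\<close>

definition mpol_pderiv_eval :: "'v \<Rightarrow> ('v, 'a::comm_ring_1) mpol \<Rightarrow> ('v \<Rightarrow> 'a) \<Rightarrow> 'a" where
  "mpol_pderiv_eval v p x = (\<Sum>m\<in>Poly_Mapping.keys p. Poly_Mapping.lookup p m *
      of_nat (Poly_Mapping.lookup m v) *
      (\<Prod>w\<in>Poly_Mapping.keys m. x w ^ (Poly_Mapping.lookup m w - (if w = v then 1 else 0))))"

definition homogeneous :: "nat \<Rightarrow> ('v, 'a::zero) mpol \<Rightarrow> bool" where
  "homogeneous d p \<longleftrightarrow>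
     (\<forall>m\<in>Poly_Mapping.keys p. (\<Sum>v\<in>Poly_Mapping.keys m. Poly_Mapping.lookup m v) = d)"

definition bihomogeneous :: "nat \<Rightarrow> nat \<Rightarrow> ('v + 'w, 'a::zero) mpol \<Rightarrow> bool" where
  "bihomogeneous d e p \<longleftrightarrow> (\<forall>m\<in>Poly_Mapping.keys p.
     (\<Sum>v\<in>Poly_Mapping.keys m \<inter> range Inl. Poly_Mapping.lookup m v) = d \<and>
     (\<Sum>v\<in>Poly_Mapping.keys m \<inter> range Inr. Poly_Mapping.lookup m v) = e)"

section \<open>Fields, curves and function fields\<close>

definition perfect_subfield :: "'a::field set \<Rightarrow> bool" where
  "perfect_subfield k \<longleftrightarrow>
     subfield k amb \<and> (CHAR('a) = 0 \<or> (\<forall>x\<in>k. \<exists>y\<in>k. y ^ CHAR('a) = x))"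

definition algebraic_over :: "'a::field set \<Rightarrow> 'a \<Rightarrow> bool" where
  "algebraic_over k x \<longleftrightarrow> (ring.algebraic amb over k) x"

definition adjoin :: "'a::field set \<Rightarrow> 'a set \<Rightarrow> 'a set" where
  "adjoin k S = generate_field amb (k \<union> S)"

definition ext_degree :: "'a::field set \<Rightarrow> 'a set \<Rightarrow> nat" where
  "ext_degree F M = (ring.dim amb over F) M"

text \<open>The graded ring \<open>k[X\<^sub>0,\<dots>,X\<^sub>n]\<close>.\<close>

definition hom_coord_ring :: "'a::field set \<Rightarrow> nat \<Rightarrow> (nat, 'a) mpol ring" where
  "hom_coord_ring k n = amb\<lparr>carrier :=
     {p. (\<forall>m. Poly_Mapping.lookup p m \<in> k) \<and>
         (\<forall>m\<in>Poly_Mapping.keys p. Poly_Mapping.keys m \<subseteq> {..n})}\<rparr>"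

text \<open>
  Homogeneous coordinate vectors of the points with coordinates in \<open>k\<close> of the zero locus of \<open>S\<close>
  in \<open>n\<close>-dimensional projective space.
\<close>

definition proj_zeros :: "'a::field set \<Rightarrow> nat \<Rightarrow> (nat, 'a) mpol set \<Rightarrow> (nat \<Rightarrow> 'a) set" where
  "proj_zeros k n S = {x. (\<forall>i\<le>n. x i \<in> k) \<and> (\<forall>i>n. x i = 0) \<and> (\<exists>i\<le>n. x i \<noteq> 0) \<and>
     (\<forall>p\<in>S. mpol_eval p x = 0)}"

text \<open>Integral closed subschemes of projective space, given by their homogeneous prime ideal.\<close>

definition integral_projective :: "'a::field set \<Rightarrow> nat \<Rightarrow> (nat, 'a) mpol set \<Rightarrow> bool" where
  "integral_projective k n C \<longleftrightarrow>
     primeideal C (hom_coord_ring k n) \<and>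
     C = genideal (hom_coord_ring k n) {p \<in> C. \<exists>d. homogeneous d p}"

definition geometrically_irreducible :: "'a::field set \<Rightarrow> nat \<Rightarrow> (nat, 'a) mpol set \<Rightarrow> bool" where
  "geometrically_irreducible k n C \<longleftrightarrow>
     (let kbar = {x. algebraic_over k x};
          forms = {p \<in> carrier (hom_coord_ring kbar n). \<exists>d. homogeneous d p};
          V = proj_zeros kbar n C
      in V \<noteq> {} \<and>
         (\<forall>S T. S \<subseteq> forms \<longrightarrow> T \<subseteq> forms \<longrightarrow> V \<subseteq> proj_zeros kbar n S \<union> proj_zeros kbar n T \<longrightarrow>
            V \<subseteq> proj_zeros kbar n S \<or> V \<subseteq> proj_zeros kbar n T))"

text \<open>
  Jacobian criterion for a one-dimensional \<open>C\<close>: at every geometric point the Jacobian matrix has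
  rank at least \<open>n - 1\<close> (and hence exactly \<open>n - 1\<close>).
\<close>

definition smooth_curve :: "'a::field set \<Rightarrow> nat \<Rightarrow> (nat, 'a) mpol set \<Rightarrow> bool" where
  "smooth_curve k n C \<longleftrightarrow>
     (\<forall>x \<in> proj_zeros {x. algebraic_over k x} n C.
        \<exists>F :: nat \<Rightarrow> (nat, 'a) mpol. (\<forall>i<n-1. F i \<in> C) \<and>
          (\<forall>c :: nat \<Rightarrow> 'a. (\<forall>j\<le>n. (\<Sum>i<n-1. c i * mpol_pderiv_eval j (F i) x) = 0) \<longrightarrow>
             (\<forall>i<n-1. c i = 0)))"

text \<open>
  \<open>K\<close> is the function field of \<open>C\<close>: there is a point \<open>x\<close> of \<open>C\<close> with coordinates in \<open>K\<close>
  which is generic (the forms over \<open>k\<close> vanishing at \<open>x\<close> are those in \<open>C\<close>), and \<open>K\<close> is generated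
  over \<open>k\<close> by the ratios of its coordinates.
\<close>

definition function_field_of :: "'a::field set \<Rightarrow> nat \<Rightarrow> (nat, 'a) mpol set \<Rightarrow> 'a set \<Rightarrow> bool" where
  "function_field_of k n C K \<longleftrightarrow>
     (\<exists>x. (\<forall>i\<le>n. x i \<in> K) \<and> (\<exists>i\<le>n. x i \<noteq> 0) \<and>
        (\<forall>d. \<forall>p\<in>carrier (hom_coord_ring k n). homogeneous d p \<longrightarrow>
           (p \<in> C \<longleftrightarrow> mpol_eval p x = 0)) \<and>
        K = adjoin k {x i / x j | i j. i \<le> n \<and> j \<le> n \<and> x j \<noteq> 0})"

definition transcendence_degree_one :: "'a::field set \<Rightarrow> 'a set \<Rightarrow> bool" where
  "transcendence_degree_one k K \<longleftrightarrow>
     (\<exists>t\<in>K. \<not> algebraic_over k t \<and> (\<forall>y\<in>K. algebraic_over (adjoin k {t}) y))"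

text \<open>
  \<open>C\<close> is a smooth projective geometrically irreducible curve over \<open>k\<close> with function field \<open>K\<close>;
  its dimension is the transcendence degree of the function field.
\<close>

definition curve_with_function_field ::
    "'a::field set \<Rightarrow> nat \<Rightarrow> (nat, 'a) mpol set \<Rightarrow> 'a set \<Rightarrow> bool" where
  "curve_with_function_field k n C K \<longleftrightarrow>
     integral_projective k n C \<and> geometrically_irreducible k n C \<and> smooth_curve k n C \<and>
     function_field_of k n C K \<and> transcendence_degree_one k K"

section \<open>Height\<close>

definition height_via :: "'a::field set \<Rightarrow> 'a set \<Rightarrow> 'a set \<Rightarrow> 'a \<Rightarrow> real" where
  "height_via k K K' f =
     (if algebraic_over k f then 0
      else real (ext_degree (adjoin k {f}) K') / real (ext_degree K K'))"

text \<open>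
  The value of \<open>height_via\<close> does not depend on the finite extension \<open>K'\<close> of \<open>K\<close> containing \<open>f\<close>;
  we use the smallest one, \<open>K(f)\<close>.
\<close>

definition height :: "'a::field set \<Rightarrow> 'a set \<Rightarrow> 'a \<Rightarrow> real" where
  "height k K f = height_via k K (adjoin K {f}) f"

section \<open>Local rings of varieties\<close>

text \<open>
  A variety over an algebraically closed field is handled through its set \<open>V\<close> of closed points and
  a set \<open>Fr\<close> of pairs (numerator, denominator) of functions on \<open>V\<close>; the sets where a denominator
  does not vanish are the basic open sets.  \<open>local_ring V Fr P\<close> consists of the functions that are
  regular on some neighbourhood of \<open>P\<close>, and \<open>germ_zero V Fr P\<close> of those that vanish on some
  neighbourhood of \<open>P\<close>.  The stalk of the structure sheaf at \<open>P\<close> is the quotient of the former by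
  the latter, so that its ideals are the ideals of \<open>local_ring V Fr P\<close> containing
  \<open>germ_zero V Fr P\<close>.
\<close>

definition regular_at ::
    "'x set \<Rightarrow> (('x \<Rightarrow> 'a::field) \<times> ('x \<Rightarrow> 'a)) set \<Rightarrow> 'x \<Rightarrow> ('x \<Rightarrow> 'a) \<Rightarrow> bool" where
  "regular_at V Fr P f \<longleftrightarrow>
     (\<exists>(N, D)\<in>Fr. D P \<noteq> 0 \<and> (\<forall>Q\<in>V. D Q \<noteq> 0 \<longrightarrow> f Q = N Q / D Q))"

definition local_ring ::
    "'x set \<Rightarrow> (('x \<Rightarrow> 'a::field) \<times> ('x \<Rightarrow> 'a)) set \<Rightarrow> 'x \<Rightarrow> ('x \<Rightarrow> 'a) ring" where
  "local_ring V Fr P = \<lparr>carrier = {f. regular_at V Fr P f},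
     monoid.mult = (\<lambda>f g x. f x * g x), one = (\<lambda>_. 1),
     ring.zero = (\<lambda>_. 0), add = (\<lambda>f g x. f x + g x)\<rparr>"

definition germ_zero ::
    "'x set \<Rightarrow> (('x \<Rightarrow> 'a::field) \<times> ('x \<Rightarrow> 'a)) set \<Rightarrow> 'x \<Rightarrow> ('x \<Rightarrow> 'a) set" where
  "germ_zero V Fr P = {f \<in> carrier (local_ring V Fr P).
     \<exists>(N, D)\<in>Fr. D P \<noteq> 0 \<and> (\<forall>Q\<in>V. D Q \<noteq> 0 \<longrightarrow> f Q = 0)}"

section \<open>Elliptic curves\<close>

text \<open>
  Elliptic curves over \<open>'a\<close> as nonsingular long Weierstrass equations
  \<open>y\<^sup>2 + a\<^sub>1 x y + a\<^sub>3 y = x\<^sup>3 + a\<^sub>2 x\<^sup>2 + a\<^sub>4 x + a\<^sub>6\<close>, in any characteristic.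
\<close>

record 'a weierstrass =
  wa1 :: 'a
  wa2 :: 'a
  wa3 :: 'a
  wa4 :: 'a
  wa6 :: 'a

definition wb2 :: "'a::field weierstrass \<Rightarrow> 'a" where
  "wb2 E = wa1 E ^ 2 + 4 * wa2 E"

definition wb4 :: "'a::field weierstrass \<Rightarrow> 'a" where
  "wb4 E = 2 * wa4 E + wa1 E * wa3 E"

definition wb6 :: "'a::field weierstrass \<Rightarrow> 'a" where
  "wb6 E = wa3 E ^ 2 + 4 * wa6 E"

definition wb8 :: "'a::field weierstrass \<Rightarrow> 'a" where
  "wb8 E = wa1 E ^ 2 * wa6 E + 4 * wa2 E * wa6 E - wa1 E * wa3 E * wa4 E
     + wa2 E * wa3 E ^ 2 - wa4 E ^ 2"

definition wc4 :: "'a::field weierstrass \<Rightarrow> 'a" where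
  "wc4 E = wb2 E ^ 2 - 24 * wb4 E"

definition discriminant :: "'a::field weierstrass \<Rightarrow> 'a" where
  "discriminant E = - (wb2 E ^ 2) * wb8 E - 8 * wb4 E ^ 3 - 27 * wb6 E ^ 2
     + 9 * wb2 E * wb4 E * wb6 E"

definition elliptic_curve :: "'a::field weierstrass \<Rightarrow> bool" where
  "elliptic_curve E \<longleftrightarrow> discriminant E \<noteq> 0"

definition j_invariant :: "'a::field weierstrass \<Rightarrow> 'a" where
  "j_invariant E = wc4 E ^ 3 / discriminant E"

datatype 'a epoint = Infty | Aff 'a 'a

definition points :: "'a::field weierstrass \<Rightarrow> 'a epoint set" where
  "points E = insert Infty {Aff x y | x y.
     y ^ 2 + wa1 E * x * y + wa3 E * y = x ^ 3 + wa2 E * x ^ 2 + wa4 E * x + wa6 E}"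

text \<open>Homogeneous coordinates in the plane, indexed by \<open>0, 1, 2\<close>; further entries are \<open>0\<close>.\<close>

fun hcoord :: "'a::field epoint \<Rightarrow> nat \<Rightarrow> 'a" where
  "hcoord Infty i = (if i = 1 then 1 else 0)"
| "hcoord (Aff x y) i = (if i = 0 then x else if i = 1 then y else if i = 2 then 1 else 0)"

fun eneg :: "'a::field weierstrass \<Rightarrow> 'a epoint \<Rightarrow> 'a epoint" where
  "eneg E Infty = Infty"
| "eneg E (Aff x y) = Aff x (- y - wa1 E * x - wa3 E)"

text \<open>In \<open>eadd\<close>, \<open>l\<close> is the slope of the chord, respectively of the tangent.\<close>

fun eadd :: "'a::field weierstrass \<Rightarrow> 'a epoint \<Rightarrow> 'a epoint \<Rightarrow> 'a epoint" where
  "eadd E Infty Q = Q"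
| "eadd E (Aff x1 y1) Infty = Aff x1 y1"
| "eadd E (Aff x1 y1) (Aff x2 y2) =
     (if x1 = x2 \<and> y1 + y2 + wa1 E * x2 + wa3 E = 0 then Infty
      else
        let l = (if x1 = x2
                 then (3 * x1 ^ 2 + 2 * wa2 E * x1 + wa4 E - wa1 E * y1) /
                      (2 * y1 + wa1 E * x1 + wa3 E)
                 else (y2 - y1) / (x2 - x1));
            x3 = l ^ 2 + wa1 E * l - wa2 E - x1 - x2
        in Aff x3 (- (l + wa1 E) * x3 - (y1 - l * x1) - wa3 E))"

definition plane_fractions :: "(('a::field epoint \<Rightarrow> 'a) \<times> ('a epoint \<Rightarrow> 'a)) set" where
  "plane_fractions =
     {(\<lambda>P. mpol_eval F (hcoord P), \<lambda>P. mpol_eval G (hcoord P)) | F G d.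
        homogeneous d F \<and> homogeneous d G}"

definition biplane_fractions ::
    "(('a::field epoint \<times> 'a epoint \<Rightarrow> 'a) \<times> ('a epoint \<times> 'a epoint \<Rightarrow> 'a)) set" where
  "biplane_fractions =
     {(\<lambda>(P, Q). mpol_eval F (case_sum (hcoord P) (hcoord Q)),
       \<lambda>(P, Q). mpol_eval G (case_sum (hcoord P) (hcoord Q))) | F G d e.
        bihomogeneous d e F \<and> bihomogeneous d e G}"

abbreviation elocal :: "'a::field weierstrass \<Rightarrow> 'a epoint \<Rightarrow> ('a epoint \<Rightarrow> 'a) ring" where
  "elocal E \<equiv> local_ring (points E) plane_fractions"

abbreviation egerm_zero :: "'a::field weierstrass \<Rightarrow> 'a epoint \<Rightarrow> ('a epoint \<Rightarrow> 'a) set" where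
  "egerm_zero E \<equiv> germ_zero (points E) plane_fractions"

abbreviation eelocal ::
    "'a::field weierstrass \<Rightarrow> 'a epoint \<times> 'a epoint \<Rightarrow> ('a epoint \<times> 'a epoint \<Rightarrow> 'a) ring" where
  "eelocal E \<equiv> local_ring (points E \<times> points E) biplane_fractions"

abbreviation eegerm_zero ::
    "'a::field weierstrass \<Rightarrow> 'a epoint \<times> 'a epoint \<Rightarrow> ('a epoint \<times> 'a epoint \<Rightarrow> 'a) set" where
  "eegerm_zero E \<equiv> germ_zero (points E \<times> points E) biplane_fractions"

section \<open>Finite subgroup schemes\<close>

text \<open>
  A closed subscheme of \<open>E\<close> is given by the stalks of its ideal sheaf, one ideal for each point of
  \<open>E\<close>.  It is finite if its support is finite and its structure sheaf has finite-dimensional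
  stalks; conversely every family of stalks with these two properties comes from a (unique)
  coherent ideal sheaf.  Subschemes may be nonreduced.
\<close>

type_synonym 'a ideal_family = "'a epoint \<Rightarrow> ('a epoint \<Rightarrow> 'a) set"

definition finite_closed_subscheme :: "'a::field weierstrass \<Rightarrow> 'a ideal_family \<Rightarrow> bool" where
  "finite_closed_subscheme E I \<longleftrightarrow>
     (\<forall>P\<in>points E. ideal (I P) (elocal E P) \<and> egerm_zero E P \<subseteq> I P) \<and>
     finite {P \<in> points E. I P \<noteq> carrier (elocal E P)} \<and>
     (\<forall>P\<in>points E. \<exists>B. finite B \<and> B \<subseteq> carrier (elocal E P) \<and>
        (\<forall>f\<in>carrier (elocal E P). \<exists>c. (\<lambda>x. f x - (\<Sum>b\<in>B. c b * b x)) \<in> I P))"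

text \<open>The stalk at \<open>(P, Q)\<close> of the ideal sheaf of the product subscheme of \<open>E \<times> E\<close>.\<close>

definition product_ideal ::
    "'a::field weierstrass \<Rightarrow> 'a ideal_family \<Rightarrow> 'a ideal_family \<Rightarrow> 'a epoint \<Rightarrow> 'a epoint \<Rightarrow>
     ('a epoint \<times> 'a epoint \<Rightarrow> 'a) set" where
  "product_ideal E I J P Q = genideal (eelocal E (P, Q))
     ({f \<circ> fst | f. f \<in> I P} \<union> {g \<circ> snd | g. g \<in> J Q} \<union> eegerm_zero E (P, Q))"

text \<open>
  The unit section, the inverse and the addition of \<open>E\<close>, restricted to \<open>Spec 'a\<close>, \<open>G\<close> and
  \<open>G \<times> G\<close> respectively, factor through the closed subscheme \<open>G\<close>, that is, they pull back the
  ideal of \<open>G\<close> into the ideal of their source.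
\<close>

definition finite_subgroup_scheme :: "'a::field weierstrass \<Rightarrow> 'a ideal_family \<Rightarrow> bool" where
  "finite_subgroup_scheme E G \<longleftrightarrow>
     finite_closed_subscheme E G \<and>
     (\<forall>f\<in>G Infty. f Infty = 0) \<and>
     (\<forall>P\<in>points E. \<forall>f\<in>G (eneg E P). f \<circ> eneg E \<in> G P) \<and>
     (\<forall>P\<in>points E. \<forall>Q\<in>points E. \<forall>f\<in>G (eadd E P Q).
        (\<lambda>(x, y). f (eadd E x y)) \<in> product_ideal E G G P Q)"

text \<open>Scheme-theoretic intersection: the sum of the ideals.\<close>

definition scheme_inter ::
    "'a::field weierstrass \<Rightarrow> 'a ideal_family \<Rightarrow> 'a ideal_family \<Rightarrow> 'a ideal_family" where
  "scheme_inter E G H P = G P <+>\<^bsub>elocal E P\<^esub> H P"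

text \<open>
  Scheme-theoretic image of \<open>G \<times> H\<close> under addition: the kernel of the map from the structure sheaf
  of \<open>E\<close> to the direct image of the structure sheaf of \<open>G \<times> H\<close>.
\<close>

definition scheme_sum ::
    "'a::field weierstrass \<Rightarrow> 'a ideal_family \<Rightarrow> 'a ideal_family \<Rightarrow> 'a ideal_family" where
  "scheme_sum E G H R = {f \<in> carrier (elocal E R).
     \<forall>P\<in>points E. \<forall>Q\<in>points E. eadd E P Q = R \<longrightarrow>
       (\<lambda>(x, y). f (eadd E x y)) \<in> product_ideal E G H P Q}"

section \<open>Quotients\<close>

definition emorphism ::
    "'a::field weierstrass \<Rightarrow> 'a weierstrass \<Rightarrow> ('a epoint \<Rightarrow> 'a epoint) \<Rightarrow> bool" where
  "emorphism E E' \<phi> \<longleftrightarrow>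
     (\<forall>P\<in>points E. \<phi> P \<in> points E' \<and>
        (\<forall>f\<in>carrier (elocal E' (\<phi> P)). f \<circ> \<phi> \<in> carrier (elocal E P)))"

definition isogeny ::
    "'a::field weierstrass \<Rightarrow> 'a weierstrass \<Rightarrow> ('a epoint \<Rightarrow> 'a epoint) \<Rightarrow> bool" where
  "isogeny E E' \<phi> \<longleftrightarrow>
     emorphism E E' \<phi> \<and> \<phi> ` points E = points E' \<and>
     (\<forall>P\<in>points E. \<forall>Q\<in>points E. \<phi> (eadd E P Q) = eadd E' (\<phi> P) (\<phi> Q))"

text \<open>The reduced point \<open>Infty\<close> as a closed subscheme of \<open>E\<close>.\<close>

definition origin_subscheme :: "'a::field weierstrass \<Rightarrow> 'a ideal_family" where
  "origin_subscheme E P = {f \<in> carrier (elocal E P). P = Infty \<longrightarrow> f Infty = 0}"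

text \<open>Scheme-theoretic fibre of an isogeny over the origin.\<close>

definition kernel_scheme ::
    "'a::field weierstrass \<Rightarrow> 'a weierstrass \<Rightarrow> ('a epoint \<Rightarrow> 'a epoint) \<Rightarrow> 'a ideal_family" where
  "kernel_scheme E E' \<phi> P = genideal (elocal E P)
     ({f \<circ> \<phi> | f. f \<in> origin_subscheme E' (\<phi> P)} \<union> egerm_zero E P)"

text \<open>
  \<open>E'\<close> is (isomorphic to) the quotient of \<open>E\<close> by \<open>G\<close>: it is the target of an isogeny, possibly
  inseparable, whose scheme-theoretic kernel is \<open>G\<close>.
\<close>

definition is_quotient ::
    "'a::field weierstrass \<Rightarrow> 'a ideal_family \<Rightarrow> 'a weierstrass \<Rightarrow> bool" where
  "is_quotient E G E' \<longleftrightarrow> elliptic_curve E' \<and>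
     (\<exists>\<phi>. isogeny E E' \<phi> \<and> (\<forall>P\<in>points E. kernel_scheme E E' \<phi> P = G P))"

end

theory Submission
  imports Defs
begin

text \<open>
  Write q for the inseparability degree of the quotient map \<open>E \<rightarrow> E/G\<close> and beta for the order of the
  p-primary part of the group of points of G, where p is the characteristic
  (both are 1 if \<open>p = 0\<close>).  The proof rests on the formula \<open>h (j (E/G)) = (q / beta) h (j E)\<close> (\<open>height_isogeny\<close>).  Given this, the inequality is
  combinatorial: passing to \<open>G + H\<close> and \<open>G \<inter> H\<close>, the q's are at most the maximum and the minimum
  of those of G and H, the beta's are at least the maximum and the minimum, and quotients of
  two pairs of numbers have the smallest sum when both pairs are sorted alike (\<open>oppositely_sorted\<close>).

  For the formula, let \<open>phi : E \<rightarrow> E'\<close> be an isogeny with kernel points W.  Then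
  \<open>x' (phi P) = C g (P) ^ q + D\<close> with \<open>g (P) = \<Sum>Q\<in>W. x (P + Q)\<close> and constants C, \<open>D\<close>
  (\<open>trace_formula\<close>).  At every valuation ring of the field the torsion points of order 2, in
  characteristic 2 those of order 3, determine the ideal generated by \<open>c4 ^ 3\<close> and the
  discriminant: it is \<open>sigma ^ 6\<close>, where sigma is the difference of their x-coordinates that is largest there, and
  the x-coordinates of all torsion points of order prime to p are integral with respect to
  sigma (\<open>torsion_integral\<close>).  So the trace formula bounds the denominators of \<open>j E' ^ q\<close> by those
  of \<open>j E\<close> everywhere (\<open>j_invariant_local\<close>).  A function bounded in this way at all valuation
  rings satisfies an integral equation with degree bounds (\<open>graded_integralI\<close>), and counting
  dimensions converts these into an inequality of heights (\<open>degree_comparison\<close>).  A dual of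
  phi, for which the trace formula is derived from that of multiplication by \<open>n\<close>
  (\<open>vmap_dual\<close>), supplies the opposite inequality.

  Scheme structures are compared at infinity only: the ideal of the kernel of phi there consists
  of functions vanishing to order at least q, and the pullback of the local parameter \<open>x / y\<close>
  vanishes to order exactly q.  This pullback lies in the ideal of \<open>G \<inter> H\<close> for both G and H,
  and in the ideal of \<open>G + H\<close> for the group with the larger \<open>q\<close>
  (\<open>inter_inseparability_le\<close>, \<open>sum_inseparability_le\<close>).
\<close>


abbreviation (input) iff (infixr "<->" 25) where "A <-> B == (A :: bool) = B"

lemmas ring_pow = algebra_simps power2_eq_square power3_eq_cube power4_eq_xxxx

section \<open>Polynomials over an algebraically closed field\<close>

locale closed_field =
 fixes type_arg :: "'a::field itself"
 assumes root_exists: "!!f::'a poly. degree f > 0 ==> EX x. poly f x = 0"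

lemma closed_field_of_algebraic_closure:
 fixes K :: "'a::field set"
 assumes "algebraic_closure amb K"
 shows "closed_field TYPE('a)"
proof
 interpret algebraic_closure "amb :: 'a ring" K by (rule assms)
 fix f :: "'a poly" assume f: "degree f > 0"
 define P where "P = rev (coeffs f)"
 have fn0: "f ~= 0" using f by auto
 have "hd P ~= 0" unfolding P_def hd_rev using fn0 by (simp add: last_coeffs_eq_coeff_degree)
 hence carrier_P: "P:carrier (poly_ring amb)"
  by (auto simp: univ_poly_def polynomial_def ring_of_type_algebra_def P_def)
 hence "splitted P" using roots_over_carrier by blast
 hence "ring.roots amb P ~= {#}"
  unfolding splitted_def using f by (auto simp: P_def degree_eq_length_coeffs)
 then obtain x where "x:# ring.roots amb P" by blast
 hence x: "is_root P x" using roots_mem_iff_is_root[OF carrier_P] by auto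
 have "eval (rev xs) x = poly (Poly xs) x" for xs :: "'a list"
 proof (induction xs)
  case Nil thus ?case by simp (simp add: ring_of_type_algebra_def)
 next
  case (Cons a xs)
  have "eval (rev xs @ [a]) x = eval (rev xs) x * x + a"
   using eval_append_aux[of "rev xs" a x] by (simp add: ring_of_type_algebra_def)
  thus ?case using Cons by (simp add: algebra_simps)
 qed
 from this[of "coeffs f"] have "poly f x = 0"
  using x unfolding is_root_def P_def by (simp add: ring_of_type_algebra_def)
 thus "EX x. poly f x = 0" ..
qed

lemma poly_eqI_infinite:
 fixes f g :: "'a::idom poly"
 assumes "infinite S" "!!x. x:S ==> poly f x = poly g x"
 shows "f = g"
proof (rule ccontr)
 assume "f ~= g"
 hence "finite {x. poly (f - g) x = 0}" by (intro poly_roots_finite) auto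
 moreover have "S <= {x. poly (f - g) x = 0}" using assms(2) by auto
 ultimately show False using assms(1) finite_subset by blast
qed

context closed_field
begin

lemma infinite_field: "infinite (UNIV :: 'a set)"
proof
 assume fin: "finite (UNIV :: 'a set)"
 define f :: "'a poly" where "f = (PROD a:UNIV. [:- a, 1:])"
 have "degree f = card (UNIV::'a set)" unfolding f_def by (subst degree_prod_eq_sum_degree) auto
 hence deg: "degree f > 0" using fin by (simp add: card_gt_0_iff)
 hence "degree (f + 1) > 0" by (metis degree_add_eq_left degree_1)
 then obtain x where "poly (f + 1) x = 0" using root_exists by blast
 moreover have "poly f x = 0" unfolding f_def poly_prod using fin by (simp add: prod_zero_iff)
 ultimately show False by simp
qed

lemma cofinite_inhabited: "finite S ==> EX x::'a. x ~: S"
 using infinite_field by (metis ex_new_if_finite)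

lemma poly_eqI_cofinite:
 fixes f g :: "'a poly"
 assumes "finite S" "!!x. x ~: S ==> poly f x = poly g x"
 shows "f = g"
 by (rule poly_eqI_infinite[of "- S"]) (use assms infinite_field in "auto simp: Compl_eq_Diff_UNIV")

lemma nth_root_ex: "n > 0 ==> EX y::'a. y ^ n = x"
proof -
 assume n: "n > 0"
 have "degree (monom 1 n + [:- x:]) = n"
  using n by (subst degree_add_eq_left) (auto simp: degree_monom_eq)
 then obtain y where "poly (monom 1 n + [:- x:]) y = 0" using root_exists n by metis
 thus ?thesis by (auto simp: poly_monom)
qed

text \<open>The monic generator of the ideal spanned by two polynomials has no root, hence is constant.\<close>
lemma bezout_no_common_root:
 fixes a c :: "'a poly"
 assumes "!!x. ~ (poly a x = 0 & poly c x = 0)"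
 shows "EX u v. u * a + v * c = 1"
proof -
 define I where "I = {d. d ~= 0 & (EX u v. d = u * a + v * c)}"
 have ac: "a ~= 0 | c ~= 0" using assms[of 0] by auto
 have "a:I | c:I"
 proof -
  have "a = 1 * a + 0 * c" "c = 0 * a + 1 * c" by simp_all
  thus ?thesis using ac unfolding I_def by blast
 qed
 then obtain d where d: "d:I" "!!e. e:I ==> degree d <= degree e"
  using ex_has_least_nat[of "%d. d:I" _ degree] by blast
 then obtain u v where uv: "d = u * a + v * c" "d ~= 0" unfolding I_def by auto
 have dvd: "d dvd u' * a + v' * c" for u' v'
 proof -
  let ?e = "u' * a + v' * c"
  have eq: "?e mod d = (u' - ?e div d * u) * a + (v' - ?e div d * v) * c"
   using arg_cong[OF uv(1), of "%z. ?e div d * z"]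
   unfolding minus_div_mult_eq_mod[symmetric] by (simp add: algebra_simps)
  have "?e mod d = 0"
  proof (rule ccontr)
   assume n: "?e mod d ~= 0"
   hence "?e mod d:I" unfolding I_def using eq by blast
   moreover have "degree (?e mod d) < degree d" using n uv(2) by (metis degree_mod_less)
   ultimately show False using d(2) by (meson leD)
  qed
  thus ?thesis by auto
 qed
 have "d dvd a" "d dvd c" using dvd[of 1 0] dvd[of 0 1] by auto
 hence "degree d = 0" using root_exists[of d] assms by (metis dvd_trans gr0I poly_eq_0_iff_dvd)
 then obtain k where k: "d = [:k:]" "k ~= 0" using uv(2) by (metis degree_eq_zeroE pCons_0_0)
 have "smult (inverse k) u * a + smult (inverse k) v * c = smult (inverse k) d"
  unfolding uv(1) by (simp add: smult_add_right)
 also have "... = 1" using k by (simp add: one_pCons)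
 finally show ?thesis by blast
qed

lemma reduced_fraction:
 fixes a c :: "'a poly"
 assumes "c ~= 0"
 shows "EX a' c'. c' ~= 0 & a * c' = a' * c & (ALL x. ~ (poly a' x = 0 & poly c' x = 0))"
 using assms
proof (induction "degree c" arbitrary: a c rule: less_induct)
 case less
 show ?case
 proof (cases "EX x. poly a x = 0 & poly c x = 0")
  case False
  thus ?thesis using less.prems by blast
 next
  case True
  then obtain x where x: "poly a x = 0" "poly c x = 0" by auto
  then obtain a0 c0 where ac: "a = [:-x,1:] * a0" "c = [:-x,1:] * c0"
   by (meson dvdE poly_eq_0_iff_dvd)
  have c0: "c0 ~= 0" using ac less.prems by auto
  hence "degree c = Suc (degree c0)" unfolding ac(2) by (subst degree_mult_eq) auto
  then obtain a' c' where "c' ~= 0" "a0 * c' = a' * c0"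
    "ALL x. ~ (poly a' x = 0 & poly c' x = 0)"
   using less.hyps[of c0 a0] c0 by auto
  moreover from this have "a * c' = a' * c" unfolding ac by (metis (no_types) mult.assoc mult.left_commute)
  ultimately show ?thesis by blast
 qed
qed

lemma dvd_of_no_common_root:
 fixes a c :: "'a poly"
 assumes "!!x. ~ (poly a x = 0 & poly c x = 0)" "c dvd a * f"
 shows "c dvd f"
proof -
 obtain u v where "u * a + v * c = 1" using bezout_no_common_root assms(1) by blast
 hence "f = u * (a * f) + v * c * f" by (metis (no_types) distrib_right mult.assoc mult_1)
 thus ?thesis using assms(2) by (metis dvd_add dvd_mult dvd_triv_right mult.assoc mult.commute)
qed

end

text \<open>Exponents of iterates of the Frobenius endomorphism; in characteristic zero only the identity.\<close>
definition frob_exp :: "'a::field itself => nat => bool" where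
 "frob_exp t q <-> q > 0 & (EX i. q = CHAR('a) ^ i)"

context closed_field
begin

abbreviation "frob == frob_exp (type_arg :: 'a itself)"

lemma frob_1 [simp]: "frob 1" "frob (Suc 0)" unfolding frob_exp_def by (auto intro: exI[of _ 0])

lemma frob_pos: "frob q ==> q > 0" unfolding frob_exp_def by auto

lemma frob_mult: "frob q ==> frob r ==> frob (q * r)"
 unfolding frob_exp_def by (auto simp flip: power_add)

lemma frob_add:
 assumes "frob q" shows "(x + y :: 'a) ^ q = x ^ q + y ^ q"
proof (cases "CHAR('a) = 0")
 case True
 then obtain i where "q = 0 ^ i" "q > 0" using assms unfolding frob_exp_def by auto
 hence "q = 1" by (cases i) auto
 thus ?thesis by simp
next
 case False
 hence "Factorial_Ring.prime CHAR('a)" using prime_CHAR_semidom by blast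
 thus ?thesis using assms freshmans_dream'[where ?'a='a] unfolding frob_exp_def by auto
qed

lemma frob_uminus: "frob q ==> (- x :: 'a) ^ q = - (x ^ q)"
 using frob_add[of q x "- x"] frob_pos[of q] by (simp add: power_0_left eq_neg_iff_add_eq_0 add.commute)

lemma frob_diff: "frob q ==> (x - y :: 'a) ^ q = x ^ q - y ^ q"
 using frob_add[of q x "- y"] frob_uminus by simp

lemma frob_eq_iff: "frob q ==> x ^ q = y ^ q <-> x = (y :: 'a)"
 using frob_diff[of q x y] frob_pos[of q] by (metis eq_iff_diff_eq_0 power_eq_0_iff)

lemma frob_sum: "frob q ==> (SUM i:I. f i :: 'a) ^ q = (SUM i:I. f i ^ q)"
 by (induction I rule: infinite_finite_induct) (auto simp: frob_add power_0_left frob_pos)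

lemma coeff_pred_degree_prod_linear:
 fixes r :: "'b => 'a"
 assumes "finite I" "I ~= {}"
 shows "coeff (PROD i:I. [:- r i, 1:]) (card I - 1) = - (SUM i:I. r i)"
 using assms
proof (induction rule: finite_ne_induct)
 case (singleton x)
 thus ?case by simp
next
 case (insert x F)
 let ?P = "PROD i:F. [:- r i, 1:]"
 have deg: "degree ?P = card F" by (subst degree_prod_eq_sum_degree) auto
 have "lead_coeff ?P = 1" by (subst lead_coeff_prod) auto
 hence l: "coeff ?P (card F) = 1" using deg by simp
 have c: "card F > 0" using insert by (simp add: card_gt_0_iff)
 have "coeff ([:- r x, 1:] * ?P) (card F) = - r x * coeff ?P (card F) + coeff ?P (card F - 1)"
  using c by (simp add: coeff_pCons split: nat.splits)
 thus ?case using insert l by simp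
qed

text \<open>Division by the linear factors of finitely many distinct roots.\<close>
lemma poly_eq_smult_prod_roots:
 fixes f :: "'a poly"
 assumes "finite I" "inj_on r I" "!!i. i:I ==> poly f (r i) = 0" "degree f = card I" "f ~= 0"
 shows "f = smult (lead_coeff f) (PROD i:I. [:- r i, 1:])"
proof -
 let ?P = "PROD i:I. [:- r i, 1:]"
 have "?P dvd f"
  using assms(1-3)
 proof (induction I)
  case (insert x F)
  then obtain g where g: "f = (PROD i:F. [:- r i, 1:]) * g" by (auto elim: dvdE)
  have "poly (PROD i:F. [:- r i, 1:]) (r x) ~= 0"
   using insert by (auto simp: poly_prod prod_zero_iff inj_on_def)
  hence "poly g (r x) = 0" using insert.prems(2)[of x] g by auto
  then obtain h where h: "g = [:- r x, 1:] * h" unfolding poly_eq_0_iff_dvd by (elim dvdE)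
  have "f = (PROD i:insert x F. [:- r i, 1:]) * h"
   unfolding g h prod.insert[OF insert.hyps] by (simp only: mult_ac)
  thus ?case by simp
 qed auto
 then obtain g where g: "f = ?P * g" by (auto elim: dvdE)
 have "degree ?P = card I" by (subst degree_prod_eq_sum_degree) auto
 moreover have "degree f = degree ?P + degree g" using assms(5) unfolding g by (subst degree_mult_eq) auto
 ultimately have "degree g = 0" using assms(4) by simp
 then obtain k where k: "g = [:k:]" by (metis degree_eq_zeroE)
 have "lead_coeff ?P = 1" by (subst lead_coeff_prod) auto
 hence "lead_coeff f = k" unfolding g k by (simp add: lead_coeff_mult del: mult_pCons_right)
 thus ?thesis using g k by (simp only:) simp
qed

lemma poly_pcompose_monom: "poly (pcompose f (monom 1 q)) x = poly f (x ^ q)"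
 for f :: "'a poly"
 by (simp add: poly_pcompose poly_monom)

lemma degree_pcompose_monom: "degree (pcompose f (monom 1 q)) = degree f * q"
 for f :: "'a poly"
 by (simp add: degree_pcompose degree_monom_eq)

text \<open>A polynomial with vanishing derivative only involves powers divisible by the characteristic.\<close>
lemma pderiv_eq_0_imp_pcompose:
 fixes f :: "'a poly"
 assumes "pderiv f = 0" "degree f > 0"
 shows "CHAR('a) > 0" "EX g. f = pcompose g (monom 1 CHAR('a))"
proof -
 have *: "of_nat n * coeff f n = (0::'a)" if "n > 0" for n
  using arg_cong[OF assms(1), of "%p. coeff p (n - 1)"] that by (simp add: coeff_pderiv)
 have "of_nat (degree f) = (0::'a)" using *[of "degree f"] assms(2)
  by (metis degree_0 leading_coeff_neq_0 less_irrefl mult_eq_0_iff)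
 thus pos: "CHAR('a) > 0" using assms(2) CHAR_pos_iff by blast
 let ?p = "CHAR('a)"
 have dv: "coeff f n = 0" if "~ ?p dvd n" for n
  using *[of n] that by (cases "n = 0") (auto simp: of_nat_eq_0_iff_char_dvd)
 define g where "g = (SUM i<=degree f. monom (coeff f (i * ?p)) i)"
 have "f = pcompose g (monom 1 ?p)"
 proof (rule poly_eqI)
  fix n
  have "pcompose g (monom 1 ?p) = (SUM i<=degree f. monom (coeff f (i * ?p)) (i * ?p))"
   unfolding g_def pcompose_sum
   by (intro sum.cong refl poly_eqI_cofinite[of "{}"])
    (simp_all add: poly_pcompose poly_monom mult.commute flip: power_mult)
  hence "coeff (pcompose g (monom 1 ?p)) n = (SUM i<=degree f. if i * ?p = n then coeff f n else 0)"
   by (auto simp: coeff_sum intro!: sum.cong)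
  also have "... = coeff f n"
  proof (cases "?p dvd n & n <= degree f")
   case True
   then obtain m where m: "n = m * ?p" by (metis dvd_div_mult_self)
   have "m <= degree f" using True m pos by (metis le_trans mult.right_neutral mult_le_mono2 Suc_leI One_nat_def)
   have "(SUM i<=degree f. if i * ?p = n then coeff f n else 0) = (SUM i<=degree f. if i = m then coeff f n else 0)"
    using m pos by (intro sum.cong) auto
   thus ?thesis using `m <= degree f` by simp
  next
   case False
   hence "coeff f n = 0" using dv by (auto simp: coeff_eq_0)
   thus ?thesis by (simp cong: if_cong)
  qed
  finally show "coeff f n = coeff (pcompose g (monom 1 ?p)) n" by simp
 qed
 thus "EX g. f = pcompose g (monom 1 ?p)" by blast
qed

text \<open>
  Extraction of the inseparable part of a non-constant rational function \<open>a / c\<close>: the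
  fraction is a fraction in \<open>x ^ q\<close> whose derivative does not vanish.
\<close>
lemma inseparable_part:
 fixes a c :: "'a poly"
 assumes "!!x. ~ (poly a x = 0 & poly c x = 0)" "degree a > 0"
 shows "EX q a1 c1. frob q & a = pcompose a1 (monom 1 q) & c = pcompose c1 (monom 1 q) &
     (ALL x. ~ (poly a1 x = 0 & poly c1 x = 0)) & pderiv a1 * c1 ~= a1 * pderiv c1"
 using assms
proof (induction "degree a" arbitrary: a c rule: less_induct)
 case less
 show ?case
 proof (cases "pderiv a * c = a * pderiv c")
  case False
  have "f = pcompose f (monom 1 1)" for f :: "'a poly" by (simp add: monom_altdef pcompose_idR)
  with False less.prems(1) frob_1(1) show ?thesis by metis
 next
  case True
  have "c ~= 0"
  proof
   assume "c = 0"
   thus False using less.prems root_exists[of a] by auto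
  qed
  have "c dvd pderiv c"
   by (rule dvd_of_no_common_root[of a]) (use less.prems True in "auto simp flip: True")
  have pc: "pderiv c = 0"
  proof (rule ccontr)
   assume n: "pderiv c ~= 0"
   have "degree c <= degree (pderiv c)" using dvd_imp_degree_le[OF `c dvd pderiv c` n] .
   moreover have "degree (pderiv c) <= degree c - 1" by (intro degree_le) (auto simp: coeff_pderiv coeff_eq_0)
   ultimately have "degree c = 0" by simp
   hence "pderiv c = 0" by (metis degree_eq_zeroE pderiv_singleton)
   thus False using n by simp
  qed
  hence pa: "pderiv a = 0" using True `c ~= 0` by simp
  let ?p = "CHAR('a)"
  obtain a' where a': "a = pcompose a' (monom 1 ?p)" and pos: "?p > 0"
   using pderiv_eq_0_imp_pcompose[OF pa less.prems(2)] by auto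
  have "EX c'. c = pcompose c' (monom 1 ?p)"
  proof (cases "degree c > 0")
   case True thus ?thesis using pderiv_eq_0_imp_pcompose[OF pc] by auto
  next
   case False
   then obtain k where "c = [:k:]" by (metis degree_eq_zeroE gr0I)
   thus ?thesis by (intro exI[of _ "[:k:]"]) simp
  qed
  then obtain c' where c': "c = pcompose c' (monom 1 ?p)" by blast
  have p1: "?p > 1" using pos CHAR_not_1[where ?'a='a] by linarith
  have fp: "frob ?p" unfolding frob_exp_def using pos by (auto intro: exI[of _ 1])
  have ncr: "~ (poly a' x = 0 & poly c' x = 0)" for x
   using less.prems(1) nth_root_ex[OF pos, of x] unfolding a' c' poly_pcompose_monom by metis
  have deg: "degree a = degree a' * ?p" unfolding a' degree_pcompose_monom ..
  hence "degree a' > 0" "degree a' < degree a" using less.prems(2) p1 by auto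
  then obtain q a1 c1 where q: "frob q" "a' = pcompose a1 (monom 1 q)" "c' = pcompose c1 (monom 1 q)"
    "ALL x. ~ (poly a1 x = 0 & poly c1 x = 0)" "pderiv a1 * c1 ~= a1 * pderiv c1"
   using less.hyps[of a' c'] ncr by blast
  have comp: "pcompose (pcompose f (monom 1 q)) (monom 1 ?p) = pcompose f (monom 1 (q * ?p))" for f :: "'a poly"
   by (rule poly_eqI_cofinite[of "{}"]) (simp_all add: poly_pcompose_monom mult.commute flip: power_mult)
  show ?thesis
   using q fp frob_mult[OF q(1) fp] comp unfolding a' c' by metis
 qed
qed

end

section \<open>The group law\<close>

lemma Aff_on_curve:
 "Aff x y:points E <->
  y ^ 2 + wa1 E * x * y + wa3 E * y = x ^ 3 + wa2 E * x ^ 2 + wa4 E * x + wa6 E"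
 by (auto simp: points_def)

lemma Infty_on_curve [simp]: "Infty:points E"
 by (auto simp: points_def)

lemma eneg_on_curve [simp]: "P:points E ==> eneg E P:points E"
 by (cases P) (auto simp: Aff_on_curve ring_pow)

lemma eneg_eneg [simp]: "eneg E (eneg E P) = P"
 by (cases P) auto

lemma eneg_eq_Infty [simp]: "eneg E P = Infty <-> P = Infty"
 by (cases P) auto

lemma same_x:
 assumes "Aff x y:points E" "Aff x z:points E"
 shows "z = y | Aff x z = eneg E (Aff x y)"
proof -
 have "(z - y) * (z + y + wa1 E * x + wa3 E) = 0"
  using assms unfolding Aff_on_curve by (simp add: ring_pow)
 hence "z = y | z + y + wa1 E * x + wa3 E = 0" by simp
 moreover have "z + y + wa1 E * x + wa3 E = z - (- y - wa1 E * x - wa3 E)" by simp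
 ultimately show ?thesis by (metis eneg.simps(2) eq_iff_diff_eq_0)
qed

text \<open>Translations reduce statements about a point of the curve to the case \<open>x = 0\<close>.\<close>
lemma discriminant_shift:
 fixes b2 b4 b6 b8 r :: "'a::comm_ring_1"
 assumes "4 * b8 = b2 * b6 - b4^2"
 shows "- ((b2+12*r)^2)*(b8+3*r*b6+3*r^2*b4+r^3*b2+3*r^4) - 8*(b4+r*b2+6*r^2)^3 - 27*(b6+2*r*b4+r^2*b2+4*r^3)^2
 + 9*(b2+12*r)*(b4+r*b2+6*r^2)*(b6+2*r*b4+r^2*b2+4*r^3) = - (b2^2)*b8 - 8*b4^3-27*b6^2+9*b2*b4*b6"
  (is "?l = ?r")
proof -
 have "?l - ?r = (- 6*b2*r - 36*r^2) * (4 * b8 - (b2 * b6 - b4^2))"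
  by (simp add: ring_pow)
 thus ?thesis using assms by simp
qed

lemma wb_relation: "4 * wb8 E = wb2 E * wb6 E - wb4 E ^ 2"
 unfolding wb2_def wb4_def wb6_def wb8_def
 by (simp add: ring_pow)

text \<open>
  Translating the common zero to the origin makes \<open>b6 = b8 = 0\<close>, and then \<open>b4 = 0\<close> by the
  relation between the four quantities.
\<close>
lemma duplication_no_common_zero:
 assumes "elliptic_curve E"
  and "4 * x^3 + wb2 E * x^2 + 2 * wb4 E * x + wb6 E = 0"
  and "x^4 - wb4 E * x^2 - 2 * wb6 E * x - wb8 E = 0"
 shows False
proof -
 define b2 b4 b6 b8 where "b2 = wb2 E + 12 * x" "b4 = wb4 E + x * wb2 E + 6 * x^2"
  "b6 = wb6 E + 2 * x * wb4 E + x^2 * wb2 E + 4 * x^3"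
  "b8 = wb8 E + 3 * x * wb6 E + 3 * x^2 * wb4 E + x^3 * wb2 E + 3 * x^4"
 note d = this
 have disc: "discriminant E = - (b2^2)*b8 - 8*b4^3-27*b6^2+9*b2*b4*b6"
  unfolding d discriminant_def by (rule discriminant_shift[OF wb_relation, symmetric])
 have b6: "b6 = 0" using assms(2) unfolding d by (simp add: algebra_simps)
 have "b8 = x * (4 * x^3 + wb2 E * x^2 + 2 * wb4 E * x + wb6 E) - (x^4 - wb4 E * x^2 - 2 * wb6 E * x - wb8 E)"
  unfolding d by (simp add: ring_pow)
 hence b8: "b8 = 0" using assms by simp
 have "4 * b8 - (b2 * b6 - b4^2) = 4 * wb8 E - (wb2 E * wb6 E - wb4 E ^ 2)"
  unfolding d by (simp add: ring_pow)
 hence "b4 = 0" using wb_relation[of E] b6 b8 by simp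
 hence "discriminant E = 0" using disc b6 b8 by simp
 thus False using assms(1) unfolding elliptic_curve_def by simp
qed

lemma curve_b_form:
 assumes "Aff x y:points E"
 shows "(2 * y + wa1 E * x + wa3 E)^2 = 4 * x^3 + wb2 E * x^2 + 2 * wb4 E * x + wb6 E"
  and "(3*x^2+2*wa2 E*x+wa4 E-wa1 E*y)^2 + wa1 E*(3*x^2+2*wa2 E*x+wa4 E-wa1 E*y)*(2*y+wa1 E*x+wa3 E)
     - (wa2 E+2*x)*(2*y+wa1 E*x+wa3 E)^2
    = x^4 - wb4 E * x^2 - 2 * wb6 E * x - wb8 E"
proof -
 define a1 a2 a3 a4 a6 where d: "a1 = wa1 E" "a2 = wa2 E" "a3 = wa3 E" "a4 = wa4 E" "a6 = wa6 E"
 have e: "a6 = y^2 + a1*x*y + a3*y - x^3 - a2*x^2 - a4*x"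
  using assms unfolding Aff_on_curve d by (simp add: algebra_simps)
 show "(2 * y + wa1 E * x + wa3 E)^2 = 4 * x^3 + wb2 E * x^2 + 2 * wb4 E * x + wb6 E"
  unfolding wb2_def wb4_def wb6_def d[symmetric] unfolding e
  by (simp add: ring_pow)
 show "(3*x^2+2*wa2 E*x+wa4 E-wa1 E*y)^2 + wa1 E*(3*x^2+2*wa2 E*x+wa4 E-wa1 E*y)*(2*y+wa1 E*x+wa3 E)
     - (wa2 E+2*x)*(2*y+wa1 E*x+wa3 E)^2
    = x^4 - wb4 E * x^2 - 2 * wb6 E * x - wb8 E"
  unfolding wb4_def wb6_def wb8_def d[symmetric] unfolding e
  by (simp add: ring_pow)
qed

lemma nonsingular_point:
 assumes "elliptic_curve E" "Aff x y:points E" "2 * y + wa1 E * x + wa3 E = 0"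
 shows "3*x^2 + 2*wa2 E*x + wa4 E - wa1 E*y ~= 0"
proof
 assume "3*x^2 + 2*wa2 E*x + wa4 E - wa1 E*y = 0"
 with assms(3) curve_b_form[OF assms(2)] show False
  by (intro duplication_no_common_zero[OF assms(1), of x]) auto
qed

subsection \<open>Chords and tangents\<close>

definition slope :: "'a::field weierstrass => 'a => 'a => 'a => 'a => 'a" where
 "slope E x1 y1 x2 y2 = (if x1 = x2
   then (3 * x1 ^ 2 + 2 * wa2 E * x1 + wa4 E - wa1 E * y1) / (2 * y1 + wa1 E * x1 + wa3 E)
   else (y2 - y1) / (x2 - x1))"

lemma eadd_inverse: "x1 = x2 ==> y1 + y2 + wa1 E * x2 + wa3 E = 0 ==> eadd E (Aff x1 y1) (Aff x2 y2) = Infty"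
 by simp

lemma eadd_chord:
 assumes "~ (x1 = x2 & y1 + y2 + wa1 E * x2 + wa3 E = 0)"
 shows "eadd E (Aff x1 y1) (Aff x2 y2) =
  (let l = slope E x1 y1 x2 y2; x3 = l ^ 2 + wa1 E * l - wa2 E - x1 - x2
  in Aff x3 (- (l + wa1 E) * x3 - (y1 - l * x1) - wa3 E))"
 using assms by (simp add: slope_def Let_def)

declare eadd.simps(3) [simp del]

lemma eadd_Infty_right [simp]: "eadd E P Infty = P"
 by (cases P) auto

lemma eadd_eneg [simp]: "eadd E P (eneg E P) = Infty"
 by (cases P) (auto simp: eadd_inverse algebra_simps)

lemma eadd_eq_Infty: "eadd E P Q = Infty <-> Q = eneg E P"
proof (cases P; cases Q)
 fix x1 y1 x2 y2 assume P: "P = Aff x1 y1" "Q = Aff x2 y2"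
 show ?thesis
 proof (cases "x1 = x2 & y1 + y2 + wa1 E * x2 + wa3 E = 0")
  case True
  hence "y2 = - y1 - wa1 E * x1 - wa3 E" by (simp add: algebra_simps eq_neg_iff_add_eq_0)
  thus ?thesis using P True by (simp add: eadd_inverse)
 next
  case False
  thus ?thesis using P by (auto simp: eadd_chord Let_def algebra_simps)
 qed
qed auto

text \<open>The line through two points of the curve meets it in the two points and in one more.\<close>
lemma line_cubic:
 fixes E :: "'a::field weierstrass"
 assumes P: "Aff x1 y1:points E" and Q: "Aff x2 y2:points E"
  and n: "~ (x1 = x2 & y1 + y2 + wa1 E * x2 + wa3 E = 0)"
 defines "l == slope E x1 y1 x2 y2"
 defines "v == y1 - l * x1"
 defines "x3 == l ^ 2 + wa1 E * l - wa2 E - x1 - x2"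
 shows "t^3 + wa2 E * t^2 + wa4 E * t + wa6 E - (l*t+v)^2 - wa1 E * t * (l*t+v) - wa3 E * (l*t+v)
   = (t - x1) * (t - x2) * (t - x3)"
  and "y2 = l * x2 + v"
  and "x1 = x2 ==> y1 = y2 & 2 * y1 + wa1 E * x1 + wa3 E ~= 0"
proof -
 define a1 a2 a3 a4 a6 where d: "a1 = wa1 E" "a2 = wa2 E" "a3 = wa3 E" "a4 = wa4 E" "a6 = wa6 E"
 show tan: "y1 = y2 & 2 * y1 + wa1 E * x1 + wa3 E ~= 0" if "x1 = x2"
 proof -
  have "y1 = y2" using same_x[of x1 y1 E y2] P Q n that by auto
  thus ?thesis using n that by auto
 qed
 show y2: "y2 = l * x2 + v"
 proof (cases "x1 = x2")
  case True thus ?thesis using tan v_def by simp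
 next
  case False
  hence "l * (x2 - x1) = y2 - y1" unfolding l_def slope_def by simp
  thus ?thesis unfolding v_def by (simp add: algebra_simps)
 qed
 define p q r where pqr: "p = a2 - l^2 - a1*l" "q = a4 - 2*l*v - a1*v - a3*l" "r = a6 - v^2 - a3*v"
 have f: "Z^3 + a2*Z^2 + a4*Z + a6 - (l*Z+v)^2 - a1*Z*(l*Z+v) - a3*(l*Z+v) = Z^3 + p*Z^2 + q*Z + r" for Z
  unfolding pqr by (simp add: ring_pow)
 have y1: "y1 = l * x1 + v" unfolding v_def by simp
 have r1: "x1^3 + p*x1^2 + q*x1 + r = 0"
  using P unfolding f[symmetric] Aff_on_curve y1[symmetric] d by (simp add: algebra_simps)
 have r2: "x2^3 + p*x2^2 + q*x2 + r = 0"
  using Q unfolding f[symmetric] Aff_on_curve y2[symmetric] d by (simp add: algebra_simps)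
 have x3: "x3 = - p - x1 - x2" unfolding x3_def pqr d by simp
 have s: "x1^2 + x1*x2 + x2^2 + p*(x1+x2) + q = 0"
 proof (cases "x1 = x2")
  case False
  have "(x2 - x1) * (x1^2 + x1*x2 + x2^2 + p*(x1+x2) + q) = (x2^3 + p*x2^2 + q*x2 + r) - (x1^3 + p*x1^2 + q*x1 + r)"
   by (simp add: ring_pow)
  thus ?thesis using r1 r2 False by simp
 next
  case True
  have ne: "2 * y1 + a1 * x1 + a3 ~= 0" using tan[OF True] unfolding d by blast
  have "l = (3 * x1 ^ 2 + 2 * a2 * x1 + a4 - a1 * y1) / (2 * y1 + a1 * x1 + a3)"
   using True unfolding l_def slope_def d by simp
  hence "l * (2 * y1 + a1 * x1 + a3) = 3 * x1 ^ 2 + 2 * a2 * x1 + a4 - a1 * y1"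
   using ne by (metis nonzero_eq_divide_eq)
  hence "3 * x1^2 + 2*p*x1 + q = 0"
   unfolding pqr y1 by (simp add: ring_pow)
  thus ?thesis using True by (simp add: ring_pow)
 qed
 have "t^3 + p*t^2 + q*t + r - (t - x1) * (t - x2) * (t - x3)
   = (x1^3 + p*x1^2 + q*x1 + r) + (t - x1) * (x1^2 + x1*x2 + x2^2 + p*(x1+x2) + q)"
  unfolding x3 by (simp add: ring_pow)
 thus "t^3 + wa2 E * t^2 + wa4 E * t + wa6 E - (l*t+v)^2 - wa1 E * t * (l*t+v) - wa3 E * (l*t+v)
   = (t - x1) * (t - x2) * (t - x3)"
  using r1 s f[of t] unfolding d by simp
qed

lemma eadd_on_curve [simp]:
 fixes E :: "'a::field weierstrass"
 assumes "P:points E" "Q:points E"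
 shows "eadd E P Q:points E"
proof (cases P; cases Q)
 fix x1 y1 x2 y2 assume eq: "P = Aff x1 y1" "Q = Aff x2 y2"
 show ?thesis
 proof (cases "x1 = x2 & y1 + y2 + wa1 E * x2 + wa3 E = 0")
  case True
  thus ?thesis using eq by (simp add: eadd_inverse)
 next
  case False
  define l where "l = slope E x1 y1 x2 y2"
  define v where "v = y1 - l * x1"
  define x3 where "x3 = l ^ 2 + wa1 E * l - wa2 E - x1 - x2"
  have on: "Aff x1 y1:points E" "Aff x2 y2:points E" using assms eq by auto
  have "Aff x3 (l * x3 + v):points E"
   using line_cubic(1)[OF on False, folded l_def, folded v_def x3_def, of x3]
   unfolding Aff_on_curve by (simp add: algebra_simps)
  moreover have "eadd E P Q = eneg E (Aff x3 (l * x3 + v))"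
   using False eq unfolding x3_def v_def l_def by (simp add: eadd_chord Let_def algebra_simps)
  ultimately show ?thesis using eneg_on_curve by metis
 qed
qed (use assms in auto)

subsection \<open>The coordinate ring\<close>

text \<open>
  Functions given on the affine curve by polynomials in the coordinates.  Every such function is
  \<open>A(x) + B(x) y\<close>; values off the affine curve are irrelevant.
\<close>
definition regfun :: "'a::field weierstrass => ('a epoint => 'a) => 'a poly => 'a poly => bool" where
 "regfun E f A B <-> (ALL x y. Aff x y:points E --> f (Aff x y) = poly A x + poly B x * y)"

definition reg :: "'a::field weierstrass => ('a epoint => 'a) set" where
 "reg E = {f. EX A B. regfun E f A B}"

definition xfun :: "'a::field epoint => 'a" where "xfun P = (case P of Infty => 0 | Aff x y => x)"
definition yfun :: "'a::field epoint => 'a" where "yfun P = (case P of Infty => 0 | Aff x y => y)"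

lemma xfun_simps [simp]: "xfun Infty = 0" "xfun (Aff x y) = x" by (auto simp: xfun_def)
lemma yfun_simps [simp]: "yfun Infty = 0" "yfun (Aff x y) = y" by (auto simp: yfun_def)

abbreviation aff :: "'a::field weierstrass => 'a epoint set" where
 "aff E == points E - {Infty}"

lemma aff_cases:
 assumes "P:aff E" obtains x y where "P = Aff x y" "Aff x y:points E"
 using assms by (cases P) auto

lemma aff_coords: "P:aff E ==> P = Aff (xfun P) (yfun P)"
 by (cases P) auto

definition cubic :: "'a::field weierstrass => 'a poly" where
 "cubic E = [:wa6 E, wa4 E, wa2 E, 1:]"
definition ytrace :: "'a::field weierstrass => 'a poly" where
 "ytrace E = [:wa3 E, wa1 E:]"

lemma poly_cubic: "poly (cubic E) x = x ^ 3 + wa2 E * x ^ 2 + wa4 E * x + wa6 E"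
 unfolding cubic_def by (simp add: ring_pow)
lemma poly_ytrace: "poly (ytrace E) x = wa1 E * x + wa3 E"
 unfolding ytrace_def by simp

lemma Aff_on_curve_poly: "Aff x y:points E <-> y ^ 2 + poly (ytrace E) x * y = poly (cubic E) x"
 unfolding Aff_on_curve poly_cubic poly_ytrace by (simp add: algebra_simps)

lemma regfun_eval: "regfun E f A B ==> P:aff E ==> f P = poly A (xfun P) + poly B (xfun P) * yfun P"
 unfolding regfun_def by (cases P) auto

lemma regfun_const: "regfun E (%_. c) [:c:] 0"
 and regfun_x: "regfun E xfun [:0,1:] 0"
 and regfun_y: "regfun E yfun 0 1"
 and regfun_poly: "regfun E (%P. poly A (xfun P)) A 0"
 by (auto simp: regfun_def)

lemma regfun_add: "regfun E f A B ==> regfun E g C D ==> regfun E (%P. f P + g P) (A + C) (B + D)"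
 by (auto simp: regfun_def algebra_simps)

lemma regfun_mult:
 assumes "regfun E f A B" "regfun E g C D"
 shows "regfun E (%P. f P * g P) (A * C + B * D * cubic E) (A * D + B * C - B * D * ytrace E)"
 unfolding regfun_def
proof safe
 fix x y assume on: "Aff x y:points E"
 hence y2: "y * y = poly (cubic E) x - poly (ytrace E) x * y"
  unfolding Aff_on_curve_poly by (simp add: ring_pow)
 have "f (Aff x y) * g (Aff x y) = (poly A x + poly B x * y) * (poly C x + poly D x * y)"
  using assms on by (simp add: regfun_def)
 also have "... = poly A x * poly C x + (poly A x * poly D x + poly B x * poly C x) * y + poly B x * poly D x * (y * y)"
  by (simp add: algebra_simps)
 also have "... = poly (A * C + B * D * cubic E) x + poly (A * D + B * C - B * D * ytrace E) x * y"
  unfolding y2 by (simp add: algebra_simps)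
 finally show "f (Aff x y) * g (Aff x y) = ..." .
qed

lemma reg_add [intro]: "f:reg E ==> g:reg E ==> (%P. f P + g P):reg E"
 unfolding reg_def using regfun_add by blast
lemma reg_mult [intro]: "f:reg E ==> g:reg E ==> (%P. f P * g P):reg E"
 unfolding reg_def using regfun_mult by blast
lemma reg_const [intro, simp]: "(%_. c):reg E"
 and reg_x [intro, simp]: "xfun:reg E" and reg_y [intro, simp]: "yfun:reg E"
 unfolding reg_def using regfun_const regfun_x regfun_y by blast+
lemma reg_poly [intro, simp]: "(%P. poly A (xfun P)):reg E"
 unfolding reg_def using regfun_poly by blast
lemma reg_power [intro]: "f:reg E ==> (%P. f P ^ n):reg E"
 by (induction n) (auto intro: reg_mult)
lemma reg_uminus [intro]: "f:reg E ==> (%P. - f P):reg E"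
 using reg_mult[of "%_. - 1" E f] by simp
lemma reg_diff [intro]: "f:reg E ==> g:reg E ==> (%P. f P - g P):reg E"
 using reg_add[of f E "%P. - g P"] by auto
lemma reg_sum [intro]: "(!!i. i:I ==> f i:reg E) ==> (%P. SUM i:I. f i P):reg E"
 by (induction I rule: infinite_finite_induct) auto
lemma reg_prod [intro]: "(!!i. i:I ==> f i:reg E) ==> (%P. PROD i:I. f i P):reg E"
 by (induction I rule: infinite_finite_induct) auto

text \<open>
  The norm to \<open>k[x]\<close> of \<open>A + B y\<close> is the product with its conjugate under \<open>P \<mapsto> - P\<close>.
  Its degree, the order of the pole at infinity, never equals one.
\<close>
definition norm_poly :: "'a::field weierstrass => 'a poly => 'a poly => 'a poly" where
 "norm_poly E A B = A ^ 2 - A * B * ytrace E - B ^ 2 * cubic E"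

lemma degree_norm_poly:
 fixes A B :: "'a::field poly"
 shows "degree (norm_poly E A B) = (if B = 0 then 2 * degree A else max (2 * degree A) (2 * degree B + 3))"
  and "A ~= 0 | B ~= 0 ==> norm_poly E A B ~= 0"
proof -
 have dc: "degree (cubic E) = 3" "cubic E ~= 0" unfolding cubic_def by auto
 have dt: "degree (ytrace E) <= 1" unfolding ytrace_def by simp
 have main: "degree (norm_poly E A B) = max (2 * degree A) (2 * degree B + 3)" if B: "B ~= 0"
 proof -
  have d1: "degree (A ^ 2) = 2 * degree A" by (cases "A = 0") (simp_all add: degree_power_eq)
  have d2: "degree (B ^ 2 * cubic E) = 2 * degree B + 3"
   using B dc by (simp add: degree_mult_eq degree_power_eq)
  have d3: "degree (A * B * ytrace E) <= degree A + degree B + 1"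
   by (meson add_mono_thms_linordered_semiring(1) degree_mult_le dt le_trans)
  have "2 * degree A ~= 2 * degree B + 3" by presburger
  then consider "2 * degree A > 2 * degree B + 3" | "2 * degree A < 2 * degree B + 3" by linarith
  thus ?thesis
  proof cases
   case 1
   have "degree (- (A * B * ytrace E) - B ^ 2 * cubic E) < degree (A ^ 2)"
    using 1 d1 d2 d3 by (intro degree_diff_less) auto
   hence "degree (A ^ 2 + (- (A * B * ytrace E) - B ^ 2 * cubic E)) = 2 * degree A"
    using d1 by (metis degree_add_eq_left)
   thus ?thesis using 1 unfolding norm_poly_def by (simp add: algebra_simps)
  next
   case 2
   have "degree (A ^ 2 - A * B * ytrace E) < degree (- (B ^ 2 * cubic E))"
    using 2 d1 d2 d3 by (intro degree_diff_less) auto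
   hence "degree ((A ^ 2 - A * B * ytrace E) + - (B ^ 2 * cubic E)) = 2 * degree B + 3"
    using d2 by (metis degree_add_eq_right degree_minus)
   thus ?thesis using 2 unfolding norm_poly_def by (simp add: algebra_simps)
  qed
 qed
 show "degree (norm_poly E A B) = (if B = 0 then 2 * degree A else max (2 * degree A) (2 * degree B + 3))"
  using main by (cases "A = 0") (auto simp: norm_poly_def degree_power_eq)
 show "norm_poly E A B ~= 0" if "A ~= 0 | B ~= 0"
 proof (cases "B = 0")
  case True thus ?thesis using that by (simp add: norm_poly_def)
 next
  case False
  hence "degree (norm_poly E A B) > 0" using main by simp
  thus ?thesis by auto
 qed
qed

lemma eneg_Aff_poly: "eneg E (Aff x y) = Aff x (- y - poly (ytrace E) x)"
 by (simp add: poly_ytrace)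

lemma norm_poly_eval:
 assumes "regfun E f A B" "Aff x y:points E"
 shows "f (Aff x y) * f (eneg E (Aff x y)) = poly (norm_poly E A B) x"
proof -
 have on: "eneg E (Aff x y):points E" using assms(2) by (rule eneg_on_curve)
 have y2: "y * y = poly (cubic E) x - poly (ytrace E) x * y"
  using assms(2) unfolding Aff_on_curve_poly by (simp add: ring_pow)
 have "f (Aff x y) * f (eneg E (Aff x y)) =
  (poly A x + poly B x * y) * (poly A x + poly B x * (- y - poly (ytrace E) x))"
  using assms on unfolding regfun_def eneg_Aff_poly by metis
 also have "... = poly A x * poly A x - poly A x * poly B x * poly (ytrace E) x
   - poly B x * poly B x * (y * y + poly (ytrace E) x * y)"
  by (simp add: algebra_simps)
 also have "... = poly (norm_poly E A B) x"
  unfolding y2 norm_poly_def by (simp add: ring_pow)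
 finally show ?thesis .
qed

context closed_field
begin

lemma point_above: "EX y. Aff (x::'a) y:points E"
proof -
 have "EX y. poly [:- poly (cubic E) x, poly (ytrace E) x, 1:] y = 0"
  by (rule root_exists) simp
 thus ?thesis unfolding Aff_on_curve_poly by (auto simp: ring_pow eq_neg_iff_add_eq_0)
qed

lemma regfun_zero:
 assumes "regfun E f A B" "infinite {P:aff E. f P = (0::'a)}"
 shows "A = 0" "B = 0"
proof -
 let ?Z = "{P:aff E. f P = 0}"
 have fib: "finite {P:?Z. xfun P = x}" for x
 proof (cases "EX y. Aff x y:points E")
  case True
  then obtain y where y: "Aff x y:points E" by blast
  have "{P:?Z. xfun P = x} <= {Aff x y, eneg E (Aff x y)}"
  proof
   fix P assume "P:{P:?Z. xfun P = x}"
   hence "P:aff E" "xfun P = x" by auto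
   then obtain z where "P = Aff x z" "Aff x z:points E" by (cases P) auto
   thus "P:{Aff x y, eneg E (Aff x y)}" using same_x[OF y] by blast
  qed
  thus ?thesis by (rule finite_subset) simp
 next
  case False
  have "{P:?Z. xfun P = x} = {}"
  proof (rule equals0I)
   fix P assume "P:{P:?Z. xfun P = x}"
   hence "P:aff E" "xfun P = x" by auto
   thus False using False aff_coords[of P E] by (metis DiffD1)
  qed
  thus ?thesis by (simp only: finite.emptyI)
 qed
 have inf: "infinite (xfun ` ?Z)"
 proof
  assume "finite (xfun ` ?Z)"
  hence "finite (UN x:xfun ` ?Z. {P:?Z. xfun P = x})" using fib by blast
  moreover have "?Z <= (UN x:xfun ` ?Z. {P:?Z. xfun P = x})" by blast
  ultimately show False using assms(2) finite_subset by blast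
 qed
 have "norm_poly E A B = 0"
 proof (rule poly_eqI_infinite[OF inf])
  fix x assume "x:xfun ` ?Z"
  then obtain P where P: "P:aff E" "f P = 0" "x = xfun P" by auto
  have y: "Aff x (yfun P):points E" "f (Aff x (yfun P)) = 0" using P aff_coords[OF P(1)] by auto
  thus "poly (norm_poly E A B) x = poly 0 x" using norm_poly_eval[OF assms(1) y(1)] by simp
 qed
 thus "A = 0" "B = 0" using degree_norm_poly(2) by blast+
qed

lemma infinite_aff: "infinite (aff E :: 'a epoint set)"
proof
 assume "finite (aff E)"
 hence "finite (xfun ` aff E)" by blast
 moreover have "xfun ` aff E = UNIV"
 proof (safe; simp?)
  fix x :: 'a
  obtain y where "Aff x y:points E" using point_above by blast
  thus "x:xfun ` aff E" by (metis DiffI epoint.distinct(1) image_eqI singletonD xfun_simps(2))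
 qed
 ultimately show False using infinite_field by simp
qed

lemma infinite_aff_diff: "finite S ==> infinite (aff E - S :: 'a epoint set)"
 using infinite_aff by (rule Diff_infinite_finite[rotated])

lemma regfun_unique:
 assumes "regfun E f A B" "regfun E g C D" "finite S" "!!P. P:aff E - S ==> f P = (g P :: 'a)"
 shows "A = C" "B = D"
proof -
 have r: "regfun E (%P. f P + - 1 * g P) (A - C) (B - D)"
  using assms(1,2) by (auto simp: regfun_def algebra_simps)
 have "aff E - S <= {P:aff E. f P + - 1 * g P = 0}" using assms(4) by auto
 hence "infinite {P:aff E. f P + - 1 * g P = 0}" using infinite_aff_diff[OF assms(3)] finite_subset by blast
 from regfun_zero[OF r this] show "A = C" "B = D" by auto
qed

lemma reg_eqI:
 assumes "f:reg E" "g:reg E" "finite S" "!!P. P:aff E - S ==> f P = (g P :: 'a)" "P:aff E"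
 shows "f P = g P"
proof -
 obtain A B C D where r: "regfun E f A B" "regfun E g C D" using assms(1,2) unfolding reg_def by blast
 have "A = C" "B = D" using regfun_unique[OF r assms(3,4)] by auto
 thus ?thesis using r assms(5) by (simp add: regfun_eval)
qed

definition nonzero :: "'a weierstrass => ('a epoint => 'a) => bool" where
 "nonzero E f <-> (EX P:aff E. f P ~= 0)"

lemma finite_zeros:
 assumes "f:reg E" "nonzero E f" shows "finite {P:aff E. f P = 0}"
proof (rule ccontr)
 assume inf: "infinite {P:aff E. f P = 0}"
 obtain A B where r: "regfun E f A B" using assms(1) unfolding reg_def by blast
 from regfun_zero[OF r inf] r assms(2) show False
  by (auto simp: regfun_eval nonzero_def)
qed

lemma nonzero_mult:
 assumes "f:reg E" "g:reg E" "nonzero E f" "nonzero E g"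
 shows "nonzero E (%P. f P * g P)"
proof -
 have "infinite (aff E - ({P:aff E. f P = 0} Un {P:aff E. g P = 0}))"
  by (intro infinite_aff_diff finite_UnI finite_zeros assms)
 hence "aff E - ({P:aff E. f P = 0} Un {P:aff E. g P = 0}) ~= {}" by (rule infinite_imp_nonempty)
 then obtain P where "P:aff E - ({P:aff E. f P = 0} Un {P:aff E. g P = 0})" by blast
 thus ?thesis unfolding nonzero_def by auto
qed

lemma reg_cancel:
 assumes "f:reg E" "g:reg E" "h:reg E" "nonzero E h" "!!P. P:aff E ==> h P * f P = h P * g P" "P:aff E"
 shows "f P = g P"
 by (rule reg_eqI[OF assms(1,2) finite_zeros[OF assms(3,4)] _ assms(6)]) (use assms(5) in auto)

definition nrm :: "'a weierstrass => ('a epoint => 'a) => 'a poly" where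
 "nrm E f = (THE N. ALL x y. Aff x y:points E --> f (Aff x y) * f (eneg E (Aff x y)) = poly N x)"

lemma nrm_eqI:
 assumes "!!x y. Aff x y:points E ==> f (Aff x y) * f (eneg E (Aff x y)) = poly N x"
 shows "nrm E f = N"
 unfolding nrm_def
proof (rule the_equality)
 fix M assume M: "ALL x y. Aff x y:points E --> f (Aff x y) * f (eneg E (Aff x y)) = poly M x"
 show "M = N"
 proof (rule poly_eqI_cofinite[of "{}"])
  fix x
  obtain y where "Aff x y:points E" using point_above by blast
  thus "poly M x = poly N x" using M assms by metis
 qed simp
qed (use assms in blast)

lemma nrm_regfun: "regfun E f A B ==> nrm E f = norm_poly E A B"
 by (rule nrm_eqI) (rule norm_poly_eval)

lemma nrm_eval:
 assumes "f:reg E" "Aff x y:points E"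
 shows "f (Aff x y) * f (eneg E (Aff x y)) = poly (nrm E f) x"
 using assms nrm_regfun norm_poly_eval unfolding reg_def by fastforce

lemma nrm_mult:
 assumes "f:reg E" "g:reg E"
 shows "nrm E (%P. f P * g P) = nrm E f * nrm E g"
 by (rule nrm_eqI) (simp add: nrm_eval[OF assms(1), symmetric] nrm_eval[OF assms(2), symmetric] mult_ac del: eneg.simps)

lemma nrm_nonzero:
 assumes "f:reg E" "nonzero E f" shows "nrm E f ~= 0"
proof -
 obtain A B where r: "regfun E f A B" using assms(1) unfolding reg_def by blast
 have "A ~= 0 | B ~= 0" using r assms(2) by (auto simp: regfun_eval nonzero_def)
 thus ?thesis unfolding nrm_regfun[OF r] by (rule degree_norm_poly(2))
qed

text \<open>
  The order of the pole at infinity: the norm of f has twice the pole of f, and x has a double pole.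
\<close>
definition pole :: "'a weierstrass => ('a epoint => 'a) => nat" where
 "pole E f = degree (nrm E f)"

lemma pole_mult:
 assumes "f:reg E" "g:reg E" "nonzero E f" "nonzero E g"
 shows "pole E (%P. f P * g P) = pole E f + pole E g"
 unfolding pole_def nrm_mult[OF assms(1,2)]
 using nrm_nonzero[OF assms(1,3)] nrm_nonzero[OF assms(2,4)] by (rule degree_mult_eq)

lemma pole_regfun:
 "regfun E f A B ==> pole E f = (if B = 0 then 2 * degree A else max (2 * degree A) (2 * degree B + 3))"
 unfolding pole_def by (simp add: nrm_regfun degree_norm_poly)

lemma pole_poly: "pole E (%P. poly A (xfun P)) = 2 * degree A"
 using pole_regfun[OF regfun_poly] by simp

lemma pole_add_le:
 assumes "f:reg E" "g:reg E"
 shows "pole E (%P. f P + g P) <= max (pole E f) (pole E g)"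
proof -
 obtain A B C D where r: "regfun E f A B" "regfun E g C D" using assms unfolding reg_def by blast
 have "degree (A + C) <= max (degree A) (degree C)" "degree (B + D) <= max (degree B) (degree D)"
  by (rule degree_add_le_max)+
 thus ?thesis unfolding pole_regfun[OF r(1)] pole_regfun[OF r(2)] pole_regfun[OF regfun_add[OF r]]
  by (auto simp: max_def split: if_splits)
qed

end

subsection \<open>Ideal classes and associativity\<close>

text \<open>The ideal of the coordinate ring generated by S, up to equality on the affine curve.\<close>
inductive_set gen :: "'a::field weierstrass => ('a epoint => 'a) set => ('a epoint => 'a) set"
 for E S where
 gen_zero: "(!!P. P:aff E ==> h P = 0) ==> h:gen E S"
| gen_step: "f:gen E S ==> s:S ==> r:reg E ==> (!!P. P:aff E ==> h P = f P + r P * s P) ==> h:gen E S"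

lemma gen_cong: "f:gen E S ==> (!!P. P:aff E ==> h P = f P) ==> h:gen E S"
 by (erule gen.cases) (auto intro: gen_zero gen_step)

lemma gen_base: "s:S ==> s:gen E S"
 by (rule gen_step[OF gen_zero[of E "%_. 0"], where r = "%_. 1"]) auto

lemma gen_add: "g:gen E S ==> f:gen E S ==> (%P. f P + g P):gen E S"
proof (induction g rule: gen.induct)
 case (gen_zero h)
 show ?case by (rule gen_cong[OF gen_zero(2)]) (simp add: gen_zero(1))
next
 case (gen_step g s r h)
 show ?case
  by (rule gen.gen_step[OF gen_step.IH[OF gen_step.prems] gen_step.hyps(2,3)]) (simp add: gen_step.hyps)
qed

lemma gen_mult: "f:gen E S ==> r:reg E ==> (%P. r P * f P):gen E S"
proof (induction f rule: gen.induct)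
 case (gen_zero h)
 show ?case by (rule gen.gen_zero) (simp add: gen_zero(1))
next
 case (gen_step f s t h)
 show ?case
  by (rule gen.gen_step[OF gen_step.IH[OF gen_step.prems] gen_step.hyps(2) reg_mult[OF gen_step.prems gen_step.hyps(3)]])
   (simp add: gen_step.hyps algebra_simps)
qed

lemma gen_lin2:
 assumes "s:gen E S" "t:gen E S" "r:reg E" "q:reg E" "!!P. P:aff E ==> h P = r P * s P + q P * t P"
 shows "h:gen E S"
 by (rule gen_cong[OF gen_add[OF gen_mult[OF assms(2,4)] gen_mult[OF assms(1,3)]]]) (use assms(5) in auto)

lemma gen_subset: "(!!s. s:S ==> s:gen E T) ==> gen E S <= gen E T"
proof
 fix f assume S: "!!s. s:S ==> s:gen E T" and "f:gen E S"
 from this(2) show "f:gen E T"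
 proof (induction f rule: gen.induct)
  case (gen_zero h) thus ?case by (rule gen.gen_zero)
 next
  case (gen_step f s r h)
  show ?case by (rule gen_lin2[OF gen_step.IH S[OF gen_step.hyps(2)] reg_const[of 1] gen_step.hyps(3)])
   (simp add: gen_step.hyps)
 qed
qed

lemma gen_eqI:
 assumes "!!s. s:S ==> s:gen E T" "!!t. t:T ==> t:gen E S"
 shows "gen E S = gen E T"
 using gen_subset[of S E T] gen_subset[of T E S] assms by blast

definition prodset :: "('b => 'a::comm_ring_1) set => ('b => 'a) set => ('b => 'a) set" (infixl "**" 70) where
 "S ** T = {%P. s P * t P | s t. s:S & t:T}"

lemma prodset_commute: "S ** T = T ** S"
 unfolding prodset_def by (auto simp: mult.commute) (metis mult.commute)+
lemma prodset_assoc: "(S ** T) ** U = S ** (T ** U)"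
proof (intro equalityI subsetI)
 fix f assume "f:(S ** T) ** U"
 then obtain s t u where "f = (%P. s P * t P * u P)" "s:S" "t:T" "u:U"
  unfolding prodset_def by blast
 moreover from this have "(%P. t P * u P):T ** U" unfolding prodset_def by blast
 ultimately show "f:S ** (T ** U)" unfolding prodset_def[of S] by (auto simp: mult.assoc)
next
 fix f assume "f:S ** (T ** U)"
 then obtain s t u where "f = (%P. s P * (t P * u P))" "s:S" "t:T" "u:U"
  unfolding prodset_def by blast
 moreover from this have "(%P. s P * t P):S ** T" unfolding prodset_def by blast
 ultimately show "f:(S ** T) ** U" unfolding prodset_def[of _ U] by (auto simp flip: mult.assoc)
qed
lemma prodset_image: "{v} ** V = (%s P. v P * s P) ` V" "V ** {v} = (%s P. s P * v P) ` V"
 unfolding prodset_def by auto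
lemma prodset_pairs: "{a, b} ** {c, d} = {%P. a P * c P, %P. a P * d P, %P. b P * c P, %P. b P * d P}"
 unfolding prodset_def by blast

lemma gen_prodset:
 assumes "gen E S = gen E S'" shows "gen E (S ** T) = gen E (S' ** T)"
proof -
 have main: "gen E (S ** T) <= gen E (S' ** T)" if eq: "gen E S = gen E S'" for S S' :: "('a epoint => 'a) set"
 proof (rule gen_subset)
  fix h assume "h:S ** T"
  then obtain s t where h: "h = (%P. s P * t P)" "s:S" "t:T" unfolding prodset_def by blast
  have "s:gen E S'" using h(2) gen_base eq by blast
  thus "h:gen E (S' ** T)" unfolding h(1)
  proof (induction s rule: gen.induct)
   case (gen_zero f) show ?case by (rule gen.gen_zero) (simp add: gen_zero)
  next
   case (gen_step f s r g)
   have "(%P. s P * t P):S' ** T" using gen_step.hyps(2) h(3) unfolding prodset_def by blast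
   thus ?case
    by (rule gen.gen_step[OF gen_step.IH _ gen_step.hyps(3)]) (simp add: gen_step.hyps algebra_simps)
  qed
 qed
 show ?thesis using main[OF assms] main[OF assms[symmetric]] by blast
qed

lemma gen_singleton_mult:
 assumes "h:gen E ({a} ** T)"
 shows "EX g:gen E T. ALL P:aff E. h P = a P * g P"
 using assms
proof (induction h rule: gen.induct)
 case (gen_zero f)
 have "(%_. 0):gen E T" by (rule gen.gen_zero) simp
 thus ?case by (rule bexI[rotated]) (simp add: gen_zero)
next
 case (gen_step f s r h)
 obtain g where g: "g:gen E T" "ALL P:aff E. f P = a P * g P" using gen_step.IH by blast
 obtain t where t: "t:T" "s = (%P. a P * t P)" using gen_step.hyps(2) unfolding prodset_def by blast
 show ?case
 proof (rule bexI)
  show "(%P. g P + r P * t P):gen E T"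
   by (rule gen.gen_step[OF g(1) t(1) gen_step.hyps(3)]) simp
  show "ALL P:aff E. h P = a P * (g P + r P * t P)"
   using gen_step.hyps(4) g(2) t(2) by (simp add: algebra_simps)
 qed
qed

lemma gen_reg: "h:gen E S ==> S <= reg E ==> EX g:reg E. ALL P:aff E. h P = g P"
proof (induction h rule: gen.induct)
 case (gen_zero h)
 show ?case by (rule bexI[of _ "%_. 0"]) (simp_all add: gen_zero)
next
 case (gen_step f s r h)
 then obtain g where "g:reg E" "ALL P:aff E. f P = g P" by blast
 moreover have "s:reg E" using gen_step by blast
 ultimately show ?case using gen_step.hyps(3,4)
  by (intro bexI[of _ "%P. g P + r P * s P"] ballI reg_add reg_mult) simp_all
qed

text \<open>The ideal of a point; the point at infinity is the unit class.\<close>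
definition pt_ideal :: "'a::field epoint => ('a epoint => 'a) set" where
 "pt_ideal Q = (if Q = Infty then {%_. 1} else {%P. xfun P - xfun Q, %P. yfun P - yfun Q})"

context closed_field
begin

definition isim :: "'a weierstrass => ('a epoint => 'a) set => ('a epoint => 'a) set => bool" where
 "isim E S T <-> (EX a:reg E. EX b:reg E. nonzero E a & nonzero E b & gen E ({a} ** S) = gen E ({b} ** T))"

lemma nonzero_1 [simp]: "nonzero E (%_. 1)"
 using infinite_imp_nonempty[OF infinite_aff] unfolding nonzero_def by auto

lemma isim_refl: "isim E S S"
 unfolding isim_def by (intro bexI[of _ "%_. 1"]) auto

lemma isim_sym: "isim E S T ==> isim E T S"
 unfolding isim_def by metis

lemma prodset_single: "{a} ** {b} = {%P. a P * b P}"
 by (simp add: prodset_image)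

lemma isim_trans:
 assumes "isim E S T" "isim E T U" shows "isim E S U"
proof -
 obtain a b where ab: "a:reg E" "b:reg E" "nonzero E a" "nonzero E b"
   "gen E ({a} ** S) = gen E ({b} ** T)" using assms(1) unfolding isim_def by blast
 obtain c d where cd: "c:reg E" "d:reg E" "nonzero E c" "nonzero E d"
   "gen E ({c} ** T) = gen E ({d} ** U)" using assms(2) unfolding isim_def by blast
 have "gen E (({a} ** S) ** {c}) = gen E (({b} ** T) ** {c})" by (rule gen_prodset[OF ab(5)])
 moreover have "gen E (({c} ** T) ** {b}) = gen E (({d} ** U) ** {b})" by (rule gen_prodset[OF cd(5)])
 moreover have comm: "({v} ** V) ** {w} = ({w} ** V) ** {v}" "({v} ** V) ** {w} = ({v} ** {w}) ** V"
  for v w :: "'a epoint => 'a" and V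
  by (simp_all add: prodset_image image_image mult_ac)
 ultimately have "gen E (({a} ** {c}) ** S) = gen E (({d} ** {b}) ** U)"
  by (simp only: comm(2) comm(1)[of b])
 thus ?thesis unfolding prodset_single isim_def
  by (intro bexI[of _ "%P. a P * c P"] bexI[of _ "%P. d P * b P"] conjI nonzero_mult reg_mult ab cd)
qed

declare isim_trans [trans]

lemma isim_prodset:
 assumes "isim E S T" shows "isim E (S ** U) (T ** U)"
proof -
 obtain a b where ab: "a:reg E" "b:reg E" "nonzero E a" "nonzero E b"
   "gen E ({a} ** S) = gen E ({b} ** T)" using assms(1) unfolding isim_def by blast
 from gen_prodset[OF ab(5), of U] have "gen E ({a} ** (S ** U)) = gen E ({b} ** (T ** U))"
  unfolding prodset_assoc .
 thus ?thesis using ab unfolding isim_def by blast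
qed

lemma isim_gen: "gen E ({a} ** S) = gen E ({b} ** T) ==> a:reg E ==> b:reg E ==> nonzero E a ==> nonzero E b ==> isim E S T"
 unfolding isim_def by blast

lemma nonzero_x_minus: "nonzero E (%P. xfun P - c)"
proof -
 obtain x :: 'a where "x ~: {c}" using cofinite_inhabited[of "{c}"] by auto
 moreover obtain y where "Aff x y:points E" using point_above by blast
 ultimately show ?thesis unfolding nonzero_def by (intro bexI[of _ "Aff x y"]) auto
qed

lemma nonzero_line: "nonzero E (%P. yfun P - (l * xfun P + v))"
proof (rule ccontr)
 assume "~ nonzero E (%P. yfun P - (l * xfun P + v))"
 hence z: "yfun P = l * xfun P + v" if "P:aff E" for P using that unfolding nonzero_def by auto
 have "regfun E yfun [:v, l:] 0"
  unfolding regfun_def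
 proof safe
  fix x y assume "Aff x y:points E"
  thus "yfun (Aff x y) = poly [:v, l:] x + poly 0 x * y" using z[of "Aff x y"] by simp
 qed
 from regfun_unique(2)[OF regfun_y this, of "{}"] show False by simp
qed

lemma isim_prod_1: "isim E (S ** {%_. 1}) S"
proof -
 have "S ** {%_. 1} = S" unfolding prodset_def by auto
 thus ?thesis using isim_refl by simp
qed

text \<open>
  The product of the ideals of a point and its negative is generated by \<open>x - x1\<close>; smoothness at
  the point is what makes the generators suffice.
\<close>
lemma pt_ideal_eneg:
 assumes E: "elliptic_curve E" and Q: "Q:points E"
 shows "isim E (pt_ideal Q ** pt_ideal (eneg E Q)) {%_. 1}"
proof (cases Q)
 case Infty
 thus ?thesis using isim_prod_1[of E "{%_. 1}"] by (simp add: pt_ideal_def)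
next
 case (Aff x1 y1)
 define z1 where "z1 = - y1 - wa1 E * x1 - wa3 E"
 define fx where "fx = (%P::'a epoint. xfun P - x1)"
 define fy where "fy = (%P::'a epoint. yfun P - y1)"
 define fz where "fz = (%P::'a epoint. yfun P - z1)"
 define fm where "fm = (%P::'a epoint. xfun P ^ 2 + xfun P * x1 + x1^2 + wa2 E * (xfun P + x1) + wa4 E - wa1 E * yfun P)"
 have r: "fx:reg E" "fy:reg E" "fz:reg E" "fm:reg E"
  unfolding fx_def fy_def fz_def fm_def by (auto intro!: reg_diff reg_add reg_mult reg_power)
 have on: "y1^2 + wa1 E * x1 * y1 + wa3 E * y1 = x1^3 + wa2 E * x1^2 + wa4 E * x1 + wa6 E"
  using Q Aff Aff_on_curve by auto
 have YZ: "fy P * fz P = fx P * fm P" if "P:aff E" for P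
 proof -
  from that obtain x y where P: "P = Aff x y" "Aff x y:points E" by (rule aff_cases)
  have e: "y^2 + wa1 E * x * y + wa3 E * y = x^3 + wa2 E * x^2 + wa4 E * x + wa6 E"
   using P(2) Aff_on_curve by auto
  have "fy P * fz P - fx P * fm P = (y^2 + wa1 E * x * y + wa3 E * y - (x^3 + wa2 E * x^2 + wa4 E * x + wa6 E))
    - (y1^2 + wa1 E * x1 * y1 + wa3 E * y1 - (x1^3 + wa2 E * x1^2 + wa4 E * x1 + wa6 E))"
   unfolding fy_def fz_def fx_def fm_def P(1) z1_def
   by (simp add: ring_pow)
  thus ?thesis using e on by simp
 qed
 define S where "S = {%P. fx P * fx P, %P. fx P * fz P, %P. fy P * fx P, %P. fy P * fz P}"
 have prod: "pt_ideal Q ** pt_ideal (eneg E Q) = S"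
  unfolding pt_ideal_def Aff S_def fx_def fy_def fz_def z1_def by (simp add: prodset_pairs)
 have base: "(%P. fx P * fx P):gen E S" "(%P. fx P * fz P):gen E S" "(%P. fy P * fx P):gen E S" "(%P. fy P * fz P):gen E S"
  unfolding S_def by (auto intro!: gen_base)
 have XM: "(%P. fx P * fm P):gen E S" by (rule gen_cong[OF base(4)]) (simp add: YZ)
 define eta where "eta = 2 * y1 + wa1 E * x1 + wa3 E"
 define mu where "mu = 3*x1^2 + 2*wa2 E*x1 + wa4 E - wa1 E*y1"
 have "eta ~= 0 | mu ~= 0" using nonsingular_point[OF E, of x1 y1] Q Aff unfolding eta_def mu_def by blast
 hence fx: "fx:gen E S"
 proof
  assume n: "eta ~= 0"
  have "fx P = inverse eta * (fx P * fz P) + (- inverse eta) * (fy P * fx P)" for P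
  proof -
   have "fx P * fz P - fy P * fx P = eta * fx P" unfolding fz_def fy_def z1_def eta_def by (simp add: algebra_simps)
   hence "fx P = inverse eta * (fx P * fz P - fy P * fx P)" using n by (simp add: mult.assoc[symmetric])
   thus ?thesis by (simp add: algebra_simps)
  qed
  thus ?thesis by (rule gen_lin2[OF base(2,3) reg_const[of "inverse eta"] reg_const[of "- inverse eta"]])
 next
  assume n: "mu ~= 0"
  have q: "(%P. - (xfun P + 2 * x1 + wa2 E)):reg E" by (intro reg_uminus reg_add reg_const reg_x)
  have 1: "(%P. fx P * fm P + - (xfun P + 2 * x1 + wa2 E) * (fx P * fx P)):gen E S"
   by (rule gen_lin2[OF XM base(1) reg_const[of 1] q]) simp
  have "fx P = inverse mu * (fx P * fm P + - (xfun P + 2 * x1 + wa2 E) * (fx P * fx P)) + (inverse mu * wa1 E) * (fy P * fx P)" for P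
  proof -
   have "(fx P * fm P + - (xfun P + 2 * x1 + wa2 E) * (fx P * fx P)) + wa1 E * (fy P * fx P) = mu * fx P"
    unfolding fx_def fm_def fy_def mu_def by (simp add: ring_pow)
   hence "fx P = inverse mu * ((fx P * fm P + - (xfun P + 2 * x1 + wa2 E) * (fx P * fx P)) + wa1 E * (fy P * fx P))"
    using n by (simp add: mult.assoc[symmetric])
   thus ?thesis by (simp add: algebra_simps)
  qed
  thus ?thesis by (rule gen_lin2[OF 1 base(3) reg_const[of "inverse mu"] reg_const[of "inverse mu * wa1 E"]])
 qed
 have "gen E ({%_. 1} ** S) = gen E ({fx} ** {%_. 1})"
 proof (rule gen_eqI)
  fix s assume "s:{%_. 1} ** S"
  hence "s:S" unfolding prodset_def by auto
  then obtain g where "g:reg E" "!!P. P:aff E ==> s P = g P * fx P"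
   unfolding S_def using r YZ by (auto simp: mult.commute)
  moreover have "fx:{fx} ** {%_. 1}" unfolding prodset_def by auto
  ultimately show "s:gen E ({fx} ** {%_. 1})" by (intro gen_cong[OF gen_mult[OF gen_base]]) auto
 next
  fix t assume "t:{fx} ** {%_. 1}"
  hence "t = fx" unfolding prodset_def by auto
  moreover have "{%_. 1} ** S = S" unfolding prodset_def by auto
  ultimately show "t:gen E ({%_. 1} ** S)" using fx by simp
 qed
 from isim_gen[OF this] show ?thesis
  unfolding prod using r nonzero_x_minus fx_def by auto
qed

lemma isim_of_gen_eq: "gen E S = gen E T ==> isim E S T"
proof -
 assume "gen E S = gen E T"
 hence "gen E ({%_. 1} ** S) = gen E ({%_. 1} ** T)" by (simp add: prodset_image)
 thus ?thesis by (rule isim_gen) auto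
qed

lemma isim_prodset2: "isim E S S' ==> isim E T T' ==> isim E (S ** T) (S' ** T')"
 using isim_prodset[of E S S' T] isim_prodset[of E T T' S'] isim_trans
 unfolding prodset_commute[of S'] by blast

lemma gen_two:
 fixes f g g' :: "'a epoint => 'a"
 assumes "!!P. P:aff E ==> g P = f P * c + d * g' P" "!!P. P:aff E ==> g' P = f P * c' + d' * g P"
 shows "gen E {f, g} = gen E {f, g'}"
proof (rule gen_eqI)
 fix s assume "s:{f, g}"
 thus "s:gen E {f, g'}"
  using gen_lin2[OF gen_base[of f "{f,g'}"] gen_base[of g' "{f,g'}"] reg_const[of c] reg_const[of d], where h=g] assms(1)
  by (auto intro: gen_base simp: mult_ac)
next
 fix s assume "s:{f, g'}"
 thus "s:gen E {f, g}"
  using gen_lin2[OF gen_base[of f "{f,g}"] gen_base[of g "{f,g}"] reg_const[of c'] reg_const[of d'], where h=g'] assms(2)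
  by (auto intro: gen_base simp: mult_ac)
qed

text \<open>
  Let n be the equation of the line through two points and m its conjugate.  Then
  \<open>n m = - (x - x1) (x - x2) (x - x3)\<close>, and \<open>x - x1, x - x2, n, m\<close> have no common zero.
\<close>
lemma pt_ideal_chord:
 assumes P: "Aff x1 y1:points E" and Q: "Aff x2 y2:points E"
  and nv: "~ (x1 = x2 & y1 + y2 + wa1 E * x2 + wa3 E = (0::'a))"
 shows "isim E (pt_ideal (Aff x1 y1) ** pt_ideal (Aff x2 y2)) (pt_ideal (eadd E (Aff x1 y1) (Aff x2 y2)))"
proof -
 define l where "l = slope E x1 y1 x2 y2"
 define v where "v = y1 - l * x1"
 define x3 where "x3 = l ^ 2 + wa1 E * l - wa2 E - x1 - x2"
 define y3 where "y3 = - (l + wa1 E) * x3 - v - wa3 E"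
 have S: "eadd E (Aff x1 y1) (Aff x2 y2) = Aff x3 y3"
  using nv unfolding y3_def x3_def v_def l_def by (simp add: eadd_chord Let_def)
 note lc = line_cubic[OF P Q nv, folded l_def, folded v_def x3_def]
 define f1 f2 f3 where "f1 = (%P::'a epoint. xfun P - x1)" "f2 = (%P::'a epoint. xfun P - x2)" "f3 = (%P::'a epoint. xfun P - x3)"
 define n where "n = (%P::'a epoint. yfun P - (l * xfun P + v))"
 define m where "m = (%P::'a epoint. - yfun P - wa1 E * xfun P - wa3 E - (l * xfun P + v))"
 note fd = f1_f2_f3_def n_def m_def
 have r: "f1:reg E" "f2:reg E" "f3:reg E" "n:reg E" "m:reg E"
  unfolding fd by (auto intro!: reg_diff reg_add reg_mult reg_uminus)
 have nm: "n P * m P = - (f1 P * f2 P * f3 P)" if "P:aff E" for P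
 proof -
  from that obtain x y where Pxy: "P = Aff x y" "Aff x y:points E" by (rule aff_cases)
  have e: "y^2 + wa1 E * x * y + wa3 E * y = x^3 + wa2 E * x^2 + wa4 E * x + wa6 E"
   using Pxy(2) Aff_on_curve by auto
  have "n P * m P = - (y^2 + wa1 E * x * y + wa3 E * y) + (l*x+v)^2 + wa1 E * x * (l*x+v) + wa3 E * (l*x+v)"
   unfolding fd Pxy(1) by (simp add: ring_pow)
  also have "... = - (x^3 + wa2 E * x^2 + wa4 E * x + wa6 E - (l*x+v)^2 - wa1 E * x * (l*x+v) - wa3 E * (l*x+v))"
   unfolding e by (simp add: algebra_simps)
  also have "... = - (f1 P * f2 P * f3 P)" unfolding lc(1) fd Pxy(1) by simp
  finally show ?thesis .
 qed
 have g1: "gen E (pt_ideal (Aff x1 y1)) = gen E {f1, n}"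
 proof -
  have "gen E {f1, %P. yfun P - y1} = gen E {f1, n}"
   by (rule gen_two[where c=l and d=1 and c'="-l" and d'=1]) (simp_all add: fd v_def algebra_simps)
  thus ?thesis unfolding pt_ideal_def f1_f2_f3_def by simp
 qed
 have g2: "gen E (pt_ideal (Aff x2 y2)) = gen E {f2, n}"
 proof -
  have "gen E {f2, %P. yfun P - y2} = gen E {f2, n}"
   by (rule gen_two[where c=l and d=1 and c'="-l" and d'=1]) (simp_all add: fd lc(2) algebra_simps)
  thus ?thesis unfolding pt_ideal_def f1_f2_f3_def by simp
 qed
 have g3: "gen E (pt_ideal (Aff x3 y3)) = gen E {f3, m}"
 proof -
  have "gen E {f3, %P. yfun P - y3} = gen E {f3, m}"
   by (rule gen_two[where c="-(l + wa1 E)" and d="-1" and c'="-(l + wa1 E)" and d'="-1"])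
    (simp_all add: fd y3_def algebra_simps)
  thus ?thesis unfolding pt_ideal_def f1_f2_f3_def by simp
 qed
 define A where "A = {f3} ** ({f1, n} ** {f2, n})"
 define B where "B = {n} ** {f3, m}"
 have A: "A = {%P. f3 P * (f1 P * f2 P), %P. f3 P * (f1 P * n P), %P. f3 P * (n P * f2 P), %P. f3 P * (n P * n P)}"
  unfolding A_def by (simp add: prodset_pairs prodset_image)
 have B: "B = {%P. n P * f3 P, %P. n P * m P}"
  unfolding B_def by (simp add: prodset_image)
 have inA: "(%P. f3 P * (f1 P * f2 P)):gen E A" "(%P. f3 P * (f1 P * n P)):gen E A"
  "(%P. f3 P * (n P * f2 P)):gen E A" "(%P. f3 P * (n P * n P)):gen E A"
  unfolding A by (auto intro!: gen_base)
 have inB: "(%P. n P * f3 P):gen E B" "(%P. n P * m P):gen E B"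
  unfolding B by (auto intro!: gen_base)
 have nmA: "(%P. n P * m P):gen E A"
  by (rule gen_cong[OF gen_mult[OF inA(1) reg_const[of "-1"]]]) (subst nm, assumption, simp add: mult_ac)
 have nf3: "(%P. n P * f3 P):gen E A"
 proof (cases "x1 = x2")
  case False
  define k where "k = inverse (x2 - x1)"
  have k: "k * (x2 - x1) = 1" using False unfolding k_def by simp
  have "n P * f3 P = k * (f3 P * (f1 P * n P)) + (- k) * (f3 P * (n P * f2 P))" for P
  proof -
   have "k * (f3 P * (f1 P * n P)) + (- k) * (f3 P * (n P * f2 P)) = (k * (x2 - x1)) * (n P * f3 P)"
    unfolding f1_f2_f3_def by (simp add: algebra_simps)
   thus ?thesis using k by simp
  qed
  thus ?thesis by (intro gen_lin2[OF inA(2,3) reg_const[of k] reg_const[of "- k"]])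
 next
  case True
  define eta where "eta = 2 * y1 + wa1 E * x1 + wa3 E"
  have eta: "eta ~= 0" using lc(3)[OF True] unfolding eta_def by blast
  define k where "k = - inverse eta"
  have 1: "(%P. 1 * (f3 P * (n P * n P)) + f3 P * (n P * m P)):gen E A"
   by (rule gen_lin2[OF inA(4) nmA reg_const[of 1] r(3)]) simp
  have "n P * f3 P = k * (1 * (f3 P * (n P * n P)) + f3 P * (n P * m P)) + (k * (2 * l + wa1 E)) * (f3 P * (f1 P * n P))" for P
  proof -
   have "n P + m P + (2 * l + wa1 E) * f1 P = - eta"
    unfolding fd eta_def v_def by (simp add: algebra_simps)
   hence "k * (n P + m P + (2 * l + wa1 E) * f1 P) = 1" using eta unfolding k_def by simp
   hence "n P * f3 P = (k * (n P + m P + (2 * l + wa1 E) * f1 P)) * (n P * f3 P)" by simp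
   thus ?thesis by (simp add: algebra_simps)
  qed
  thus ?thesis by (intro gen_lin2[OF 1 inA(2) reg_const[of k] reg_const[of "k * (2 * l + wa1 E)"]])
 qed
 have eq: "gen E A = gen E B"
 proof (rule gen_eqI)
  fix s assume "s:A"
  then consider "s = (%P. f3 P * (f1 P * f2 P))" | "s = (%P. f3 P * (f1 P * n P))"
   | "s = (%P. f3 P * (n P * f2 P))" | "s = (%P. f3 P * (n P * n P))"
   unfolding A by auto
  thus "s:gen E B"
  proof cases
   case 1 show ?thesis unfolding 1
    by (rule gen_cong[OF gen_mult[OF inB(2) reg_const[of "-1"]]]) (subst nm, assumption, simp add: mult_ac)
  next
   case 2 show ?thesis unfolding 2 by (rule gen_cong[OF gen_mult[OF inB(1) r(1)]]) (simp add: algebra_simps)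
  next
   case 3 show ?thesis unfolding 3 by (rule gen_cong[OF gen_mult[OF inB(1) r(2)]]) (simp add: algebra_simps)
  next
   case 4 show ?thesis unfolding 4 by (rule gen_cong[OF gen_mult[OF inB(1) r(4)]]) (simp add: algebra_simps)
  qed
 next
  fix t assume "t:B"
  thus "t:gen E A" unfolding B using nf3 nmA by auto
 qed
 have "isim E ({f1, n} ** {f2, n}) {f3, m}"
  by (rule isim_gen[OF eq[unfolded A_def B_def] r(3,4)])
   (use nonzero_x_minus nonzero_line in "auto simp: fd")
 moreover have "isim E (pt_ideal (Aff x1 y1) ** pt_ideal (Aff x2 y2)) ({f1, n} ** {f2, n})"
  by (intro isim_prodset2 isim_of_gen_eq g1 g2)
 moreover have "isim E {f3, m} (pt_ideal (Aff x3 y3))"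
  by (intro isim_of_gen_eq g3[symmetric])
 ultimately show ?thesis unfolding S using isim_trans by blast
qed

lemma pt_ideal_eadd:
 assumes E: "elliptic_curve E" and "P:points E" "Q:points E"
 shows "isim E (pt_ideal P ** pt_ideal Q) (pt_ideal (eadd E P Q))"
proof (cases P)
 case Infty
 thus ?thesis using isim_prod_1[of E "pt_ideal Q"] by (simp add: pt_ideal_def prodset_commute)
next
 case P: (Aff x1 y1)
 show ?thesis
 proof (cases Q)
  case Infty
  thus ?thesis using isim_prod_1[of E "pt_ideal P"] by (simp add: pt_ideal_def)
 next
  case Q: (Aff x2 y2)
  show ?thesis
  proof (cases "x1 = x2 & y1 + y2 + wa1 E * x2 + wa3 E = 0")
   case True
   hence "eadd E P Q = Infty" using P Q by (simp add: eadd_inverse)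
   moreover from this have "Q = eneg E P" by (simp add: eadd_eq_Infty)
   ultimately show ?thesis using pt_ideal_eneg[OF E assms(2)] by (simp add: pt_ideal_def)
  next
   case False
   from pt_ideal_chord[OF _ _ False] show ?thesis using assms P Q by simp
  qed
 qed
qed

text \<open>
  The ideal of an affine point is not principal: a generator would have a pole of order one at infinity.
\<close>
lemma pt_ideal_not_principal:
 assumes U: "U:aff E"
 shows "~ isim E (pt_ideal U) {%_. (1::'a)}"
proof
 assume "isim E (pt_ideal U) {%_. 1}"
 then obtain a b where ab: "a:reg E" "b:reg E" "nonzero E a" "nonzero E b"
   "gen E ({a} ** pt_ideal U) = gen E ({b} ** {%_. 1})" unfolding isim_def by blast
 obtain x0 y0 where U0: "U = Aff x0 y0" "Aff x0 y0:points E" using U by (rule aff_cases)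
 define fx fy where "fx = (%P::'a epoint. xfun P - x0)" "fy = (%P::'a epoint. yfun P - y0)"
 have r: "fx:reg E" "fy:reg E" unfolding fx_fy_def by (auto intro!: reg_diff)
 have pt: "pt_ideal U = {fx, fy}" unfolding pt_ideal_def U0 fx_fy_def by simp
 have one: "EX g:reg E. ALL P:aff E. h P = g P" if "h:gen E {%_. 1}" for h :: "'a epoint => 'a"
  using gen_reg[OF that] by auto
 have div: "EX g:reg E. ALL P:aff E. a P * s P = b P * g P" if "s:{fx, fy}" for s
 proof -
  have "(%P. a P * s P):gen E ({a} ** pt_ideal U)" using that unfolding pt by (intro gen_base) (auto simp: prodset_image)
  hence "(%P. a P * s P):gen E ({b} ** {%_. 1})" using ab(5) by simp
  from gen_singleton_mult[OF this] one show ?thesis by metis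
 qed
 obtain g where g: "g:reg E" "!!P. P:aff E ==> a P * fx P = b P * g P" using div[of fx] by blast
 obtain h where h: "h:reg E" "!!P. P:aff E ==> a P * fy P = b P * h P" using div[of fy] by blast
 have "b:gen E ({b} ** {%_. 1})" by (intro gen_base) (simp add: prodset_image)
 hence "b:gen E ({a} ** pt_ideal U)" using ab(5) by simp
 from gen_singleton_mult[OF this] obtain e0 where e0: "e0:gen E {fx, fy}" "!!P. P:aff E ==> b P = a P * e0 P"
  unfolding pt by blast
 have e0U: "e0 U = 0" using e0(1)
  by (induction e0 rule: gen.induct) (use U in "auto simp: fx_fy_def U0")
 obtain e where e: "e:reg E" "!!P. P:aff E ==> e0 P = e P" using gen_reg[OF e0(1)] r by auto
 have eU: "e U = 0" using e(2)[OF U] e0U by simp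
 have fg: "fx P = e P * g P" if "P:aff E" for P
  by (rule reg_cancel[OF r(1) reg_mult[OF e(1) g(1)] ab(1,3) _ that]) (simp add: g(2) e0(2) e(2) mult_ac)
 have fh: "fy P = e P * h P" if "P:aff E" for P
  by (rule reg_cancel[OF r(2) reg_mult[OF e(1) h(1)] ab(1,3) _ that]) (simp add: h(2) e0(2) e(2) mult_ac)
 have nzx: "nonzero E fx" unfolding fx_fy_def by (rule nonzero_x_minus)
 have nze: "nonzero E e" and nzg: "nonzero E g" using nzx fg unfolding nonzero_def by force+
 have "pole E fx = pole E (%P. e P * g P)"
  unfolding pole_def
 proof (rule arg_cong[of _ _ degree], rule nrm_eqI)
  fix x y assume on: "Aff x y:points E"
  hence "Aff x y:aff E" "eneg E (Aff x y):aff E" using eneg_on_curve[OF on] by auto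
  thus "fx (Aff x y) * fx (eneg E (Aff x y)) = poly (nrm E (%P. e P * g P)) x"
   unfolding nrm_eval[OF reg_mult[OF e(1) g(1)] on, symmetric] by (simp add: fg del: eneg.simps)
 qed
 hence sum: "pole E e + pole E g = 2"
  using pole_mult[OF e(1) g(1) nze nzg] pole_poly[of E "[:- x0, 1:]"]
  unfolding fx_fy_def by simp
 have po: "pole E f = 0 ==> EX c. ALL P:aff E. f P = c" "pole E f ~= 1" if "f:reg E" for f
 proof -
  from that obtain A B where AB: "regfun E f A B" unfolding reg_def by blast
  show "pole E f ~= 1" unfolding pole_regfun[OF AB] by (simp add: max_def)
  assume "pole E f = 0"
  hence "B = 0" "degree A = 0" unfolding pole_regfun[OF AB] by (auto split: if_splits)
  then obtain c where "A = [:c:]" "B = 0" by (metis degree_eq_zeroE)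
  thus "EX c. ALL P:aff E. f P = c" using regfun_eval[OF AB] by auto
 qed
 have "pole E e = 0 | pole E g = 0" using sum po(2)[OF e(1)] po(2)[OF g(1)] by linarith
 thus False
 proof
  assume "pole E e = 0"
  then obtain c where "ALL P:aff E. e P = c" using po(1)[OF e(1)] by blast
  thus False using eU U nze unfolding nonzero_def by auto
 next
  assume "pole E g = 0"
  then obtain c where c: "ALL P:aff E. g P = c" using po(1)[OF g(1)] by blast
  hence c0: "c ~= 0" using nzg unfolding nonzero_def by auto
  obtain A B where AB: "regfun E h A B" using h(1) unfolding reg_def by blast
  have "regfun E (%P. poly [:- x0, 1:] (xfun P) * h P) ([:- x0, 1:] * A) ([:- x0, 1:] * B)"
   using regfun_mult[OF regfun_poly[of E "[:- x0, 1:]"] AB] by simp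
  moreover have "regfun E (%P. c * yfun P + - c * y0) [:- c * y0:] [:c:]"
   by (auto simp: regfun_def)
  moreover have "poly [:- x0, 1:] (xfun P) * h P = c * yfun P + - c * y0" if "P:aff E" for P
  proof -
   have "c * fy P = (e P * g P) * h P" using fh[OF that] c that by simp
   also have "... = fx P * h P" using fg[OF that] by simp
   finally show ?thesis unfolding fx_fy_def by (simp add: algebra_simps)
  qed
  ultimately have "[:- x0, 1:] * B = [:c:]" using regfun_unique(2)[of E _ _ _ _ _ _ "{}"] by blast
  hence "poly ([:- x0, 1:] * B) x0 = c" by simp
  thus False using c0 by simp
 qed
qed

lemma pt_ideal_inject:
 assumes E: "elliptic_curve E" and P: "P:points E" and Q: "Q:points E" and "isim E (pt_ideal P) (pt_ideal Q)"
 shows "P = Q"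
proof -
 let ?U = "eadd E P (eneg E Q)"
 have Q': "eneg E Q:points E" using Q by simp
 have "isim E (pt_ideal ?U) (pt_ideal P ** pt_ideal (eneg E Q))"
  by (rule isim_sym[OF pt_ideal_eadd[OF E P Q']])
 also have "isim E (pt_ideal P ** pt_ideal (eneg E Q)) (pt_ideal Q ** pt_ideal (eneg E Q))"
  by (rule isim_prodset[OF assms(4)])
 also have "isim E (pt_ideal Q ** pt_ideal (eneg E Q)) {%_. 1}"
  by (rule pt_ideal_eneg[OF E Q])
 finally have "?U ~: aff E" using pt_ideal_not_principal by blast
 hence "?U = Infty" using P Q' by auto
 thus ?thesis unfolding eadd_eq_Infty by (metis eneg_eneg)
qed

lemma eadd_assoc:
 fixes E :: "'a weierstrass"
 assumes E: "elliptic_curve E" and "P:points E" "Q:points E" "R:points E"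
 shows "eadd E (eadd E P Q) R = eadd E P (eadd E Q R)"
proof (rule pt_ideal_inject[OF E])
 have "isim E (pt_ideal (eadd E (eadd E P Q) R)) (pt_ideal (eadd E P Q) ** pt_ideal R)"
  using assms by (intro isim_sym[OF pt_ideal_eadd]) auto
 also have "isim E ... ((pt_ideal P ** pt_ideal Q) ** pt_ideal R)"
  using assms by (intro isim_prodset isim_sym[OF pt_ideal_eadd]) auto
 also have "... = (pt_ideal Q ** pt_ideal R) ** pt_ideal P"
  by (metis prodset_assoc prodset_commute)
 also have "isim E ((pt_ideal Q ** pt_ideal R) ** pt_ideal P) (pt_ideal (eadd E Q R) ** pt_ideal P)"
  using assms by (intro isim_prodset pt_ideal_eadd) auto
 also have "... = pt_ideal P ** pt_ideal (eadd E Q R)" by (rule prodset_commute)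
 also have "isim E ... (pt_ideal (eadd E P (eadd E Q R)))"
  using assms by (intro pt_ideal_eadd) auto
 finally show "isim E (pt_ideal (eadd E (eadd E P Q) R)) (pt_ideal (eadd E P (eadd E Q R)))" .
qed (use assms in auto)

lemma eadd_commute:
 fixes E :: "'a weierstrass"
 assumes E: "elliptic_curve E" and "P:points E" "Q:points E"
 shows "eadd E P Q = eadd E Q P"
proof (rule pt_ideal_inject[OF E])
 show "isim E (pt_ideal (eadd E P Q)) (pt_ideal (eadd E Q P))"
  using isim_trans[OF isim_sym[OF pt_ideal_eadd[OF E assms(2,3)]], unfolded prodset_commute[of "pt_ideal P"], OF pt_ideal_eadd[OF E assms(3,2)]] .
qed (use assms in auto)

definition egroup :: "'a weierstrass => 'a epoint monoid" where
 "egroup E = \<lparr>carrier = points E, monoid.mult = eadd E, one = Infty\<rparr>"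

lemma egroup_simps [simp]: "carrier (egroup E) = points E" "monoid.mult (egroup E) = eadd E" "one (egroup E) = Infty"
 by (simp_all add: egroup_def)

lemma egroup_comm_group: "elliptic_curve E ==> comm_group (egroup E)"
proof (rule comm_groupI; simp)
 show "!!x y z. elliptic_curve E ==> x:points E ==> y:points E ==> z:points E ==> eadd E (eadd E x y) z = eadd E x (eadd E y z)"
  by (rule eadd_assoc)
 show "!!x y. elliptic_curve E ==> x:points E ==> y:points E ==> eadd E x y = eadd E y x"
  by (rule eadd_commute)
 show "EX y:points E. eadd E y x = Infty" if "elliptic_curve E" "x:points E" for x
  using that eadd_commute[of E x "eneg E x"] by (intro bexI[of _ "eneg E x"]) auto
qed

end

section \<open>Multiplication by integers\<close>

text \<open>Homogeneous x-coordinates.\<close>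
definition xnum :: "'a::field epoint => 'a" where "xnum P = (case P of Infty => 1 | Aff x y => x)"
definition xden :: "'a::field epoint => 'a" where "xden P = (case P of Infty => 0 | Aff x y => 1)"

lemma xnum_simps [simp]: "xnum Infty = 1" "xnum (Aff x y) = x"
 and xden_simps [simp]: "xden Infty = 0" "xden (Aff x y) = 1"
 by (auto simp: xnum_def xden_def)

lemma xden_eq_0 [simp]: "xden P = 0 <-> P = Infty" by (cases P) auto

text \<open>
  The unordered pair \<open>{x (P + Q), x (P - Q)}\<close> is a point of the symmetric square of the
  projective line; its coordinates are forms of bidegree \<open>(2, 2)\<close> in \<open>x P\<close> and \<open>x Q\<close>.
\<close>
definition qD :: "'r::comm_ring_1 => 'r => 'r => 'r => 'r" where
 "qD x1 z1 x2 z2 = (x1 * z2 - x2 * z1) ^ 2"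
definition qS :: "'r::comm_ring_1 => 'r => 'r => 'r => 'r => 'r => 'r => 'r" where
 "qS b2 b4 b6 x1 z1 x2 z2 = 2 * x1^2 * x2 * z2 + 2 * x1 * z1 * x2^2 + b2 * x1 * z1 * x2 * z2
  + b4 * (x1 * z2 + x2 * z1) * z1 * z2 + b6 * z1^2 * z2^2"
definition qT :: "'r::comm_ring_1 => 'r => 'r => 'r => 'r => 'r => 'r => 'r" where
 "qT b4 b6 b8 x1 z1 x2 z2 = x1^2 * x2^2 - b4 * x1 * z1 * x2 * z2
  - b6 * (x1 * z2 + x2 * z1) * z1 * z2 - b8 * z1^2 * z2^2"

lemma chord_sum_product:
 fixes x1 x2 y1 y2 a1 a2 a3 a4 a6 :: "'r::comm_ring_1"
 assumes e1: "y1 ^ 2 + a1 * x1 * y1 + a3 * y1 = x1 ^ 3 + a2 * x1 ^ 2 + a4 * x1 + a6"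
 assumes e2: "y2 ^ 2 + a1 * x2 * y2 + a3 * y2 = x2 ^ 3 + a2 * x2 ^ 2 + a4 * x2 + a6"
 defines "u == (y2 - y1)^2 + a1*(y2-y1)*(x2-x1) - (a2+x1+x2)*(x2-x1)^2"
  and "w == (- y2 - a1*x2 - a3 - y1)^2 + a1*(- y2 - a1*x2 - a3-y1)*(x2-x1) - (a2+x1+x2)*(x2-x1)^2"
 shows "u + w = 2*x1^2*x2+2*x1*x2^2+(a1^2+4*a2)*x1*x2+(2*a4+a1*a3)*(x1+x2)+a3^2+4*a6" (is ?sum)
  and "u * w = (x1^2*x2^2-(2*a4+a1*a3)*x1*x2-(a3^2+4*a6)*(x1+x2)
      -(a1^2*a6+4*a2*a6-a1*a3*a4+a2*a3^2-a4^2)) * (x1-x2)^2" (is ?prod)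
proof -
 define d1 d2 where "d1 = y1 ^ 2 + a1 * x1 * y1 + a3 * y1 - (x1 ^ 3 + a2 * x1 ^ 2 + a4 * x1 + a6)"
  and "d2 = y2 ^ 2 + a1 * x2 * y2 + a3 * y2 - (x2 ^ 3 + a2 * x2 ^ 2 + a4 * x2 + a6)"
 have z: "d1 = 0" "d2 = 0" unfolding d1_def d2_def using e1 e2 by auto
 define c where "c = x1^2*x2 + x1*x2^2 + 2*a2*x1*x2 + a4*(x1+x2) + 2*a6"
 have "u = c - 2*y1*y2 - a1*(x1*y2 + x2*y1) - a3*(y1+y2) + d1 + d2"
  unfolding u_def c_def d1_def d2_def by (simp add: ring_pow)
 hence u: "u = c - 2*y1*y2 - a1*(x1*y2 + x2*y1) - a3*(y1+y2)" using z by simp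
 have "w = c + 2*y1*y2 + a1*(x1*y2 + x2*y1) + a3*(y1+y2) + a1^2*x1*x2 + a1*a3*(x1+x2) + a3^2 + d1 + d2"
  unfolding w_def c_def d1_def d2_def by (simp add: ring_pow)
 hence w: "w = c + 2*y1*y2 + a1*(x1*y2 + x2*y1) + a3*(y1+y2) + a1^2*x1*x2 + a1*a3*(x1+x2) + a3^2" using z by simp
 show ?sum unfolding u w c_def by (simp add: ring_pow)
 define m where "m = 2*y1*y2 + a1*(x1*y2 + x2*y1) + a3*(y1+y2)"
 define k where "k = a1^2*x1*x2 + a1*a3*(x1+x2) + a3^2"
 define f1 f2 where "f1 = x1 ^ 3 + a2 * x1 ^ 2 + a4 * x1 + a6" and "f2 = x2 ^ 3 + a2 * x2 ^ 2 + a4 * x2 + a6"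
 define h1 h2 where "h1 = a1*x1+a3" and "h2 = a1*x2+a3"
 have y1: "y1^2 = f1 - h1*y1" and y2: "y2^2 = f2 - h2*y2"
  using e1 e2 unfolding f1_def f2_def h1_def h2_def by (simp_all add: algebra_simps)
 have m: "m = 2*y1*y2 + h1*y2 + h2*y1" unfolding m_def h1_def h2_def by (simp add: algebra_simps)
 have k: "k = h1*h2" unfolding k_def h1_def h2_def by (simp add: ring_pow)
 \<comment> \<open>the mixed terms cancel: \<open>(2 y1 + h1)^2 = 4 f1 + h1^2\<close> and likewise for the second point\<close>
 have "m * (m + k) = 4*y1^2*y2^2 + 4*y1^2*y2*h2 + 4*y1*h1*y2^2 + 4*y1*h1*y2*h2 + y1^2*h2^2 + y1*h1*h2^2 + h1^2*y2^2 + h1^2*y2*h2"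
  unfolding m k by (simp add: ring_pow)
 also have "... = 4*f1*f2 + f1*h2^2 + h1^2*f2"
  unfolding y1 y2 by (simp add: ring_pow)
 finally have mk: "m * (m + k) = 4*f1*f2 + f1*h2^2 + h1^2*f2" .
 have "u * w = (c - m) * (c + m + k)" unfolding u w m_def k_def by (simp add: algebra_simps)
 also have "... = c*(c + k) - m*(m + k)" by (simp add: algebra_simps)
 also have "... = c*(c + h1*h2) - (4*f1*f2 + f1*h2^2 + h1^2*f2)" by (simp only: mk[unfolded k] k)
 also have "... = (x1^2*x2^2-(2*a4+a1*a3)*x1*x2-(a3^2+4*a6)*(x1+x2)
      -(a1^2*a6+4*a2*a6-a1*a3*a4+a2*a3^2-a4^2)) * (x1-x2)^2"
  unfolding c_def f1_def f2_def h1_def h2_def by (simp add: ring_pow)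
 finally show ?prod .
qed

context closed_field
begin

lemma biquadratic:
 fixes E :: "'a weierstrass"
 assumes E: "elliptic_curve E" and P: "P:points E" and Q: "Q:points E"
 defines "R == eadd E P Q" and "S == eadd E P (eneg E Q)"
 shows "EX kappa. kappa ~= 0 & qD (xnum P) (xden P) (xnum Q) (xden Q) = kappa * (xden R * xden S)
  & qS (wb2 E) (wb4 E) (wb6 E) (xnum P) (xden P) (xnum Q) (xden Q) = kappa * (xnum R * xden S + xden R * xnum S)
  & qT (wb4 E) (wb6 E) (wb8 E) (xnum P) (xden P) (xnum Q) (xden Q) = kappa * (xnum R * xnum S)"
proof -
 let ?goal = "%P Q R S. EX kappa. kappa ~= 0 & qD (xnum P) (xden P) (xnum Q) (xden Q) = kappa * (xden R * xden S)
  & qS (wb2 E) (wb4 E) (wb6 E) (xnum P) (xden P) (xnum Q) (xden Q) = kappa * (xnum R * xden S + xden R * xnum S)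
  & qT (wb4 E) (wb6 E) (wb8 E) (xnum P) (xden P) (xnum Q) (xden Q) = kappa * (xnum R * xnum S)"
 \<comment> \<open>doubling\<close>
 have dbl: "?goal P P (eadd E P P) Infty" if P: "P = Aff x y" "P:points E" for P x y
 proof -
  define eta where "eta = 2 * y + wa1 E * x + wa3 E"
  define mu where "mu = 3*x^2+2*wa2 E*x+wa4 E-wa1 E*y"
  have bf: "eta^2 = 4 * x^3 + wb2 E * x^2 + 2 * wb4 E * x + wb6 E"
   "mu^2 + wa1 E*mu*eta - (wa2 E+2*x)*eta^2 = x^4 - wb4 E * x^2 - 2 * wb6 E * x - wb8 E"
   using curve_b_form[OF P(2)[unfolded P(1)]] unfolding eta_def mu_def by simp_all
  have qs: "qS (wb2 E) (wb4 E) (wb6 E) x 1 x 1 = eta^2" and qd: "qD x 1 x 1 = 0"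
   unfolding bf(1) qS_def qD_def by (simp_all add: ring_pow)
  have qt: "qT (wb4 E) (wb6 E) (wb8 E) x 1 x 1 = mu^2 + wa1 E*mu*eta - (wa2 E+2*x)*eta^2"
   unfolding bf(2) qT_def by (simp add: ring_pow)
  show ?thesis
  proof (cases "eta = 0")
   case True
   hence "y + y + wa1 E * x + wa3 E = 0" unfolding eta_def by (simp only: mult_2)
   hence "eadd E P P = Infty" unfolding P(1) by (intro eadd_inverse refl)
   moreover have "mu ~= 0" using nonsingular_point[OF E, of x y] P True unfolding eta_def mu_def by blast
   ultimately show ?thesis using P qs qd qt True by (intro exI[of _ "mu^2"]) simp
  next
   case False
   define l where "l = mu / eta"
   have "eadd E P P = (let x3 = l ^ 2 + wa1 E * l - wa2 E - x - x in Aff x3 (- (l + wa1 E) * x3 - (y - l * x) - wa3 E))"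
   proof -
    have nz: "~ (x = x & y + y + wa1 E * x + wa3 E = 0)" using False unfolding eta_def mult_2 by blast
    have "slope E x y x y = l" unfolding slope_def l_def mu_def eta_def by simp
    thus ?thesis unfolding P(1) eadd_chord[OF nz] by simp
   qed
   hence xn: "xnum (eadd E P P) = l ^ 2 + wa1 E * l - wa2 E - x - x" "xden (eadd E P P) = 1"
    by (simp_all add: Let_def)
   have "l * eta = mu" unfolding l_def using False by simp
   hence "eta^2 * (l ^ 2 + wa1 E * l - wa2 E - x - x) = mu^2 + wa1 E*mu*eta - (wa2 E+2*x)*eta^2"
    by (simp add: ring_pow flip: `l * eta = mu`)
   thus ?thesis using P qs qd qt False xn by (intro exI[of _ "eta^2"]) simp
  qed
 qed
 consider "P = Infty" | "Q = Infty" | x1 y1 x2 y2 where "P = Aff x1 y1" "Q = Aff x2 y2"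
  by (cases P; cases Q) auto
 thus ?thesis
 proof cases
  case 1
  have "xnum (eneg E Q) = xnum Q" "xden (eneg E Q) = xden Q" by (cases Q; simp)+
  thus ?thesis unfolding R_def S_def 1 qD_def qS_def qT_def by (intro exI[of _ 1]) (cases Q, auto simp: power2_eq_square)
 next
  case 2
  thus ?thesis unfolding R_def S_def 2 qD_def qS_def qT_def by (intro exI[of _ 1]) (cases P, auto simp: power2_eq_square)
 next
  case 3
  note PQ = 3
  show ?thesis
  proof (cases "x1 = x2")
   case True
   have "Q = P | Q = eneg E P" using same_x[of x1 y1 E y2] P Q PQ True by auto
   thus ?thesis
   proof
    assume "Q = P"
    thus ?thesis unfolding R_def S_def using dbl[OF PQ(1) P] by simp
   next
    assume Q': "Q = eneg E P"
    have "xnum Q = xnum P" "xden Q = xden P" using PQ True by auto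
    thus ?thesis unfolding R_def S_def using dbl[OF PQ(1) P] Q' by (simp add: add.commute mult.commute)
   qed
  next
   case False
   define d where "d = x2 - x1"
   have d: "d ~= 0" using False unfolding d_def by simp
   define y3 where "y3 = - y2 - wa1 E * x2 - wa3 E"
   define u where "u = (y2 - y1)^2 + wa1 E*(y2-y1)*d - (wa2 E+x1+x2)*d^2"
   define w where "w = (y3 - y1)^2 + wa1 E*(y3-y1)*d - (wa2 E+x1+x2)*d^2"
   have e: "y1 ^ 2 + wa1 E * x1 * y1 + wa3 E * y1 = x1 ^ 3 + wa2 E * x1 ^ 2 + wa4 E * x1 + wa6 E"
     "y2 ^ 2 + wa1 E * x2 * y2 + wa3 E * y2 = x2 ^ 3 + wa2 E * x2 ^ 2 + wa4 E * x2 + wa6 E"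
    using P Q PQ Aff_on_curve by auto
   note sp = chord_sum_product[OF e, folded y3_def, folded d_def, folded u_def w_def]
   have xs: "xnum (eadd E (Aff x1 y1) (Aff x2 y)) * d^2 = (y - y1)^2 + wa1 E*(y-y1)*d - (wa2 E+x1+x2)*d^2"
    "xden (eadd E (Aff x1 y1) (Aff x2 y)) = 1" for y
   proof -
    have sl: "slope E x1 y1 x2 y * d = y - y1" using False d unfolding slope_def d_def by simp
    have eq: "xnum (eadd E (Aff x1 y1) (Aff x2 y)) = (slope E x1 y1 x2 y)^2 + wa1 E * slope E x1 y1 x2 y - wa2 E - x1 - x2"
     using False by (simp add: eadd_chord Let_def)
    have "xnum (eadd E (Aff x1 y1) (Aff x2 y)) * d^2 = (slope E x1 y1 x2 y * d)^2 + wa1 E * (slope E x1 y1 x2 y * d) * d - (wa2 E + x1 + x2) * d^2"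
     unfolding eq by (simp add: ring_pow)
    thus "xnum (eadd E (Aff x1 y1) (Aff x2 y)) * d^2 = (y - y1)^2 + wa1 E*(y-y1)*d - (wa2 E+x1+x2)*d^2"
     unfolding sl .
    show "xden (eadd E (Aff x1 y1) (Aff x2 y)) = 1" using False by (simp add: eadd_chord Let_def)
   qed
   have RS: "R = eadd E (Aff x1 y1) (Aff x2 y2)" "S = eadd E (Aff x1 y1) (Aff x2 y3)"
    unfolding R_def S_def PQ y3_def by simp_all
   have xR: "xnum R * d^2 = u" "xden R = 1" and xS: "xnum S * d^2 = w" "xden S = 1"
    unfolding RS u_def w_def by (rule xs)+
   have "qD x1 1 x2 1 = d^2" unfolding qD_def d_def by (simp add: power2_commute)
   moreover have "qS (wb2 E) (wb4 E) (wb6 E) x1 1 x2 1 = d^2 * (xnum R + xnum S)"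
    using sp(1) unfolding xR(1)[symmetric] xS(1)[symmetric] qS_def wb2_def wb4_def wb6_def
    by (simp add: algebra_simps)
   moreover have "qT (wb4 E) (wb6 E) (wb8 E) x1 1 x2 1 * d^2 = (d^2 * (xnum R * xnum S)) * d^2"
    using sp(2) unfolding xR(1)[symmetric] xS(1)[symmetric] qT_def wb4_def wb6_def wb8_def
    by (simp add: d_def power2_commute[of x1 x2] algebra_simps)
   hence "qT (wb4 E) (wb6 E) (wb8 E) x1 1 x2 1 = d^2 * (xnum R * xnum S)" using d by simp
   ultimately show ?thesis using PQ xR(2) xS(2) d by (intro exI[of _ "d^2"]) simp
  qed
 qed
qed

abbreviation emul :: "'a weierstrass => nat => 'a epoint => 'a epoint" where
 "emul E n P == P [^]\<^bsub>egroup E\<^esub> n"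

lemma emul_on_curve [simp]: "elliptic_curve E ==> P:points E ==> emul E n P:points E"
proof -
 assume E: "elliptic_curve E" and P: "P:points E"
 interpret comm_group "egroup E" by (rule egroup_comm_group[OF E])
 show ?thesis using nat_pow_closed[of P n] P by simp
qed

definition lead_at :: "'a poly => nat => 'a => bool" where
 "lead_at f n l <-> degree f <= n & coeff f n = l"

lemma lead_at_mult: "lead_at f m k ==> lead_at g n l ==> lead_at (f * g) (m + n) (k * l)"
proof -
 assume f: "lead_at f m k" and g: "lead_at g n l"
 have d: "degree f <= m" "degree g <= n" using f g by (auto simp: lead_at_def)
 have deg: "degree (f * g) <= m + n" using degree_mult_le[of f g] d by linarith
 have "coeff (f * g) (m + n) = (SUM i<=m + n. coeff f i * coeff g (m + n - i))" by (rule coeff_mult)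
 also have "... = (SUM i:{m}. coeff f i * coeff g (m + n - i))"
 proof (rule sum.mono_neutral_right)
  show "ALL i:{..m + n} - {m}. coeff f i * coeff g (m + n - i) = 0"
  proof
   fix i assume i: "i:{..m + n} - {m}"
   then consider "i < m" | "i > m" by (cases "i < m") auto
   thus "coeff f i * coeff g (m + n - i) = 0"
   proof cases
    case 1 thus ?thesis using d i by (simp add: coeff_eq_0)
   next
    case 2 thus ?thesis using d by (simp add: coeff_eq_0)
   qed
  qed
 qed auto
 finally show ?thesis using f g deg unfolding lead_at_def by auto
qed

lemma lead_at_add: "lead_at f n k ==> lead_at g n l ==> lead_at (f + g) n (k + l)"
 unfolding lead_at_def by (auto intro: degree_add_le)
lemma lead_at_diff: "lead_at f n k ==> lead_at g n l ==> lead_at (f - g) n (k - l)"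
 unfolding lead_at_def by (auto intro: degree_diff_le)
lemma lead_at_small: "degree f < n ==> lead_at f n 0"
 unfolding lead_at_def by (auto simp: coeff_eq_0)
lemma lead_at_div:
 assumes "lead_at f m 1" "lead_at (f * g) (m + n) l"
 shows "lead_at g n l"
proof (cases "g = 0")
 case True
 thus ?thesis using assms unfolding lead_at_def by auto
next
 case False
 have f: "degree f = m" "f ~= 0" using assms(1) le_degree[of f m] unfolding lead_at_def by auto
 hence "degree f + degree g <= m + n"
  using assms(2) degree_mult_eq[OF f(2) False] unfolding lead_at_def by simp
 hence g: "degree g <= n" using f by simp
 hence "lead_at g n (coeff g n)" unfolding lead_at_def by simp
 from lead_at_mult[OF assms(1) this] have "coeff g n = l" using assms(2) unfolding lead_at_def by simp
 thus ?thesis using g unfolding lead_at_def by simp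
qed

definition xrep :: "'a epoint => 'a => 'a => bool" where
 "xrep Q a c <-> (EX kappa. kappa ~= 0 & a = kappa * xnum Q & c = kappa * xden Q)"

lemma xrep_step:
 assumes kappa: "kappa ~= 0" "u * c = kappa * (xden R * xden S)" "u * a + v * c = kappa * (xnum R * xden S + xden R * xnum S)"
  "v * a = kappa * (xnum R * xnum S)" and S: "xrep S v u"
 shows "xrep R a (c::'a)"
proof -
 obtain mu where mu: "mu ~= 0" "v = mu * xnum S" "u = mu * xden S" using S unfolding xrep_def by blast
 have "a = kappa / mu * xnum R & c = kappa / mu * xden R"
 proof (cases S)
  case Infty
  thus ?thesis using kappa mu by (simp add: field_simps)
 next
  case (Aff x y)
  hence c: "c = kappa / mu * xden R" using kappa(2) mu by (simp add: field_simps)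
  have "mu * a = kappa * (xnum R + xden R * x) - mu * x * c" using kappa(3) mu Aff by (simp add: algebra_simps)
  also have "... = kappa * xnum R" unfolding c using mu(1) by (simp add: field_simps)
  finally show ?thesis using c mu(1) by (simp add: field_simps)
 qed
 thus ?thesis unfolding xrep_def using kappa(1) mu(1) by (intro exI[of _ "kappa / mu"]) auto
qed

lemma poly_q: "poly (qD f g h k) x = qD (poly f x) (poly g x) (poly h x) (poly k x)"
 "poly (qS [:b2:] [:b4:] [:b6:] f g h k) x = qS b2 b4 b6 (poly f x) (poly g x) (poly h x) (poly k x)"
 "poly (qT [:b4:] [:b6:] [:b8:] f g h k) x = qT b4 b6 b8 (poly f x) (poly g x) (poly h x) (poly k x)"
 for x :: 'a
 unfolding qD_def qS_def qT_def by simp_all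

lemma q_scale: "qD (kappa * x1) (kappa * z1) x2 z2 = kappa^2 * qD x1 z1 x2 z2"
 "qS b2 b4 b6 (kappa * x1) (kappa * z1) x2 z2 = kappa^2 * qS b2 b4 b6 x1 z1 x2 z2"
 "qT b4 b6 b8 (kappa * x1) (kappa * z1) x2 z2 = kappa^2 * qT b4 b6 b8 x1 z1 x2 z2"
 for kappa :: 'a
 unfolding qD_def qS_def qT_def by (simp_all add: ring_pow)

text \<open>
  \<open>[a : c]\<close> is the x-coordinate of \<open>n P\<close> in terms of that of P.  The statement on
  \<open>x c\<close> says that c has degree below \<open>n\<^sup>2\<close> with coefficient \<open>n\<^sup>2\<close> in degree \<open>n\<^sup>2 - 1\<close>.
\<close>
definition mulpoly :: "'a weierstrass => nat => 'a poly => 'a poly => bool" where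
 "mulpoly E n a c <-> lead_at a (n^2) 1 & lead_at ([:0,1:] * c) (n^2) (of_nat (n^2)) &
  (ALL x y. Aff x y:points E --> xrep (emul E n (Aff x y)) (poly a x) (poly c x))"

lemma mulpoly_no_common_root:
 assumes "mulpoly E n a c" shows "~ (poly a x = 0 & poly c x = 0)"
proof -
 obtain y where "Aff x y:points E" using point_above by blast
 hence "xrep (emul E n (Aff x y)) (poly a x) (poly c x)" using assms unfolding mulpoly_def by blast
 thus ?thesis unfolding xrep_def by (cases "emul E n (Aff x y)") auto
qed

text \<open>
  The quadratic form \<open>D s\<^sup>2 - S s t + T t\<^sup>2\<close> vanishes at the coordinates of \<open>(n - 1) P\<close>; its other
  linear factor gives those of \<open>(n + 1) P\<close>.
\<close>
lemma mulpoly_Suc: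
 assumes E: "elliptic_curve E" and m0: "mulpoly E n v u" and m1: "mulpoly E (Suc n) f g"
 shows "EX a c. mulpoly E (Suc (Suc n)) a c"
proof -
 interpret comm_group "egroup E" by (rule egroup_comm_group[OF E])
 define x :: "'a poly" where "x = [:0, 1:]"
 define D where "D = qD f g x 1"
 define S where "S = qS [:wb2 E:] [:wb4 E:] [:wb6 E:] f g x 1"
 define T where "T = qT [:wb4 E:] [:wb6 E:] [:wb8 E:] f g x 1"
 have pt: "EX kappa. kappa ~= 0 & poly D z = kappa * (xden R * xden Q) & poly S z = kappa * (xnum R * xden Q + xden R * xnum Q)
   & poly T z = kappa * (xnum R * xnum Q)"
  if on: "Aff z y:points E" and R: "R = emul E (Suc (Suc n)) (Aff z y)" and Q: "Q = emul E n (Aff z y)" for z y R Q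
 proof -
  let ?P = "Aff z y" let ?N = "emul E (Suc n) ?P"
  have "eadd E ?N (eneg E ?P) = eadd E (eadd E (emul E n ?P) ?P) (eneg E ?P)" by simp
  also have "... = eadd E (emul E n ?P) (eadd E ?P (eneg E ?P))"
   using on E by (intro eadd_assoc) (auto simp del: eneg.simps)
  finally have Q': "Q = eadd E ?N (eneg E ?P)" unfolding Q by (simp del: eneg.simps)
  have R': "R = eadd E ?N ?P" unfolding R by simp
  obtain kappa where kappa: "kappa ~= 0" "qD (xnum ?N) (xden ?N) z 1 = kappa * (xden R * xden Q)"
   "qS (wb2 E) (wb4 E) (wb6 E) (xnum ?N) (xden ?N) z 1 = kappa * (xnum R * xden Q + xden R * xnum Q)"
   "qT (wb4 E) (wb6 E) (wb8 E) (xnum ?N) (xden ?N) z 1 = kappa * (xnum R * xnum Q)"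
   using biquadratic[OF E, of ?N ?P] on E unfolding R'[symmetric] Q'[symmetric] by auto
  have "xrep ?N (poly f z) (poly g z)" using m1 on unfolding mulpoly_def by blast
  then obtain mu where mu: "mu ~= 0" "poly f z = mu * xnum ?N" "poly g z = mu * xden ?N" unfolding xrep_def by blast
  show ?thesis
   unfolding D_def S_def T_def poly_q mu(2,3) q_scale x_def
   using kappa mu(1) by (intro exI[of _ "mu^2 * kappa"]) (simp add: mult.assoc)
 qed
 have vanish: "D * v^2 - S * v * u + T * u^2 = 0"
 proof (rule poly_eqI_cofinite[of "{}"])
  fix z
  obtain y where on: "Aff z y:points E" using point_above by blast
  obtain kappa where kappa: "poly D z = kappa * (xden (emul E (Suc (Suc n)) (Aff z y)) * xden (emul E n (Aff z y)))"
   "poly S z = kappa * (xnum (emul E (Suc (Suc n)) (Aff z y)) * xden (emul E n (Aff z y)) + xden (emul E (Suc (Suc n)) (Aff z y)) * xnum (emul E n (Aff z y)))"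
   "poly T z = kappa * (xnum (emul E (Suc (Suc n)) (Aff z y)) * xnum (emul E n (Aff z y)))"
   using pt[OF on refl refl] by blast
  obtain mu where "poly v z = mu * xnum (emul E n (Aff z y))" "poly u z = mu * xden (emul E n (Aff z y))"
   using m0 on unfolding mulpoly_def xrep_def by blast
  thus "poly (D * v^2 - S * v * u + T * u^2) z = poly 0 z"
   by (simp only: kappa poly_diff poly_add poly_mult poly_power poly_0) (simp add: ring_pow)
 qed simp
 obtain p q where pq: "p * v + q * u = 1"
  using bezout_no_common_root[OF mulpoly_no_common_root[OF m0]] by blast
 define c where "c = p^2 * (S * v - T * u) + D * (2 * p * q * v + q^2 * u)"
 define a where "a = q^2 * (S * u - D * v) + T * (p^2 * v + 2 * p * q * u)"
 have van': "D * v^2 = u * (S * v - T * u)" "T * u^2 = v * (S * u - D * v)"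
  using vanish by (simp_all add: ring_pow)
 have Dc: "D = u * c"
 proof -
  have "D = D * (p * v + q * u)^2" unfolding pq by simp
  also have "... = p^2 * (D * v^2) + u * (D * (2 * p * q * v + q^2 * u))"
   by (simp add: ring_pow)
  also have "... = u * c" unfolding van' c_def by (simp add: algebra_simps)
  finally show ?thesis .
 qed
 have Ta: "T = v * a"
 proof -
  have "T = T * (p * v + q * u)^2" unfolding pq by simp
  also have "... = q^2 * (T * u^2) + v * (T * (p^2 * v + 2 * p * q * u))"
   by (simp add: ring_pow)
  also have "... = v * a" unfolding van' a_def by (simp add: algebra_simps)
  finally show ?thesis .
 qed
 have v0: "v ~= 0" using m0 unfolding mulpoly_def lead_at_def by auto
 have Sac: "S = u * a + v * c"
 proof (cases "u = 0")
  case True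
  have pv: "p * v = 1" using pq True by simp
  have "c = p^2 * (S * v) + D * (2 * p * q * v)" unfolding c_def True by simp
  moreover have "D = 0" using Dc True by simp
  ultimately have "v * c = S * (p * v)^2" by (simp add: ring_pow)
  thus ?thesis using pv True by simp
 next
  case False
  have "(u * v) * S = (u * v) * (u * a + v * c)"
   using vanish unfolding Dc Ta by (simp add: ring_pow)
  thus ?thesis using False v0 by simp
 qed
 have rep: "xrep (emul E (Suc (Suc n)) (Aff z y)) (poly a z) (poly c z)" if on: "Aff z y:points E" for z y
 proof -
  from pt[OF on refl refl] obtain kappa where kappa: "kappa ~= 0"
   "poly D z = kappa * (xden (emul E (Suc (Suc n)) (Aff z y)) * xden (emul E n (Aff z y)))"
   "poly S z = kappa * (xnum (emul E (Suc (Suc n)) (Aff z y)) * xden (emul E n (Aff z y)) + xden (emul E (Suc (Suc n)) (Aff z y)) * xnum (emul E n (Aff z y)))"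
   "poly T z = kappa * (xnum (emul E (Suc (Suc n)) (Aff z y)) * xnum (emul E n (Aff z y)))" by blast
  have s: "xrep (emul E n (Aff z y)) (poly v z) (poly u z)" using m0 on unfolding mulpoly_def by blast
  show ?thesis
   by (rule xrep_step[OF kappa(1) _ _ _ s]) (use kappa(2-4) in "simp_all add: Dc Sac Ta del: nat_pow_Suc")
 qed
 \<comment> \<open>leading coefficients; \<open>x c\<close> rather than c avoids a case distinction at \<open>n = 0\<close>\<close>
 define w where "w = of_nat ((Suc n)^2) * (1::'a)"
 have lf: "lead_at f ((Suc n)^2) 1" and lg: "lead_at (x * g) ((Suc n)^2) w"
  and lv: "lead_at v (n^2) 1" and lu: "lead_at (x * u) (n^2) (of_nat (n^2))"
  using m0 m1 unfolding mulpoly_def x_def w_def by auto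
 have lx: "lead_at x 1 1" unfolding lead_at_def x_def by simp
 have dg: "degree g < (Suc n)^2"
 proof (cases "g = 0")
  case False
  hence "degree (x * g) = Suc (degree g)" unfolding x_def by simp
  thus ?thesis using lg unfolding lead_at_def by simp
 qed simp
 have df: "degree f <= (Suc n)^2" and dx: "degree x <= 1" using lf lx unfolding lead_at_def by auto
 define N where "N = (Suc n)^2 + (Suc n)^2 + 2"
 note dml = degree_mult_le[THEN order_trans]
 have N: "n^2 + (Suc (Suc n))^2 = N" unfolding N_def by (simp add: ring_pow)
 have lT: "lead_at T N 1"
 proof -
  have 1: "lead_at (f * f * (x * x)) N (1 * 1 * (1 * 1))"
   using lead_at_mult[OF lead_at_mult[OF lf lf] lead_at_mult[OF lx lx]] unfolding N_def by simp
  have d: "degree (f * g) < (Suc n)^2 + (Suc n)^2" "degree (g * g) < (Suc n)^2 + (Suc n)^2"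
   using degree_mult_le[of f g] degree_mult_le[of g g] df dg by linarith+
  have d2: "degree (f * g * x) < N" "degree (g * g * x) < N" "degree (f * g) < N" "degree (g * g) < N"
   using d degree_mult_le[of "f * g" x] degree_mult_le[of "g * g" x] dx unfolding N_def by linarith+
  have d3: "degree ([:b:] * h) < N" if "degree h < N" for b h
   using that degree_mult_le[of "[:b:]" h] by simp
  have "T = f * f * (x * x) - ([:wb4 E:] * (f * g * x) + [:wb6 E:] * (f * g) + [:wb6 E:] * (g * g * x) + [:wb8 E:] * (g * g))"
   unfolding T_def qT_def by (simp add: ring_pow)
  moreover have "degree ([:wb4 E:] * (f * g * x) + [:wb6 E:] * (f * g) + [:wb6 E:] * (g * g * x) + [:wb8 E:] * (g * g)) < N"
   by (intro degree_add_less d3 d2)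
  ultimately show ?thesis using lead_at_diff[OF 1 lead_at_small] by simp
 qed
 have la: "lead_at a ((Suc (Suc n))^2) 1"
  by (rule lead_at_div[OF lv]) (use lT in "simp add: N Ta[symmetric]")
 have lS: "lead_at (x * S) N (2 + 2 * w)"
 proof -
  have 1: "lead_at (f * f * (x * x)) N (1 * 1 * (1 * 1))"
   using lead_at_mult[OF lead_at_mult[OF lf lf] lead_at_mult[OF lx lx]] unfolding N_def by simp
  have 2: "lead_at (f * (x * g) * (x * x)) N (1 * w * (1 * 1))"
   using lead_at_mult[OF lead_at_mult[OF lf lg] lead_at_mult[OF lx lx]] unfolding N_def by simp
  have dxg: "degree (x * g) <= (Suc n)^2" using lg unfolding lead_at_def by simp
  have d: "degree (f * (x * g)) <= (Suc n)^2 + (Suc n)^2" "degree (g * (x * g)) <= (Suc n)^2 + (Suc n)^2"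
   using degree_mult_le[of f "x * g"] degree_mult_le[of g "x * g"] df dg dxg by linarith+
  have d2: "degree (f * (x * g) * x) < N" "degree (g * (x * g) * x) < N" "degree (f * (x * g)) < N" "degree (g * (x * g)) < N"
   using d degree_mult_le[of "f * (x * g)" x] degree_mult_le[of "g * (x * g)" x] dx unfolding N_def by linarith+
  have d3: "degree ([:b:] * h) < N" if "degree h < N" for b h
   using that degree_mult_le[of "[:b:]" h] by simp
  have "x * S = (f * f * (x * x) + f * f * (x * x)) + (f * (x * g) * (x * x) + f * (x * g) * (x * x))
    + ([:wb2 E:] * (f * (x * g) * x) + [:wb4 E:] * (f * (x * g)) + [:wb4 E:] * (g * (x * g) * x) + [:wb6 E:] * (g * (x * g)))"
   unfolding S_def qS_def by (simp add: ring_pow)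
  moreover have "degree ([:wb2 E:] * (f * (x * g) * x) + [:wb4 E:] * (f * (x * g)) + [:wb4 E:] * (g * (x * g) * x) + [:wb6 E:] * (g * (x * g))) < N"
   by (intro degree_add_less d3 d2)
  ultimately have "lead_at (x * S) N (1 * 1 * (1 * 1) + 1 * 1 * (1 * 1) + (1 * w * (1 * 1) + 1 * w * (1 * 1)) + 0)"
   using lead_at_add[OF lead_at_add[OF lead_at_add[OF 1 1] lead_at_add[OF 2 2]] lead_at_small] by simp
  moreover have "1 * 1 * (1 * 1) + 1 * 1 * (1 * 1) + (1 * w * (1 * 1) + 1 * w * (1 * 1)) + 0 = 2 + 2 * w" by simp
  ultimately show ?thesis by (simp only:)
 qed
 have lc: "lead_at (x * c) ((Suc (Suc n))^2) (of_nat ((Suc (Suc n))^2))"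
 proof (rule lead_at_div[OF lv])
  have "lead_at ((x * u) * a) N (of_nat (n^2) * 1)" using lead_at_mult[OF lu la] unfolding N .
  from lead_at_diff[OF lS this] have "lead_at (x * S - (x * u) * a) N (2 + 2 * w - of_nat (n^2) * 1)" .
  moreover have "x * S - (x * u) * a = v * (x * c)" unfolding Sac by (simp add: algebra_simps)
  moreover have "2 + 2 * w - of_nat (n^2) * 1 = of_nat ((Suc (Suc n))^2)"
   unfolding w_def by (simp add: ring_pow)
  ultimately show "lead_at (v * (x * c)) (n^2 + (Suc (Suc n))^2) (of_nat ((Suc (Suc n))^2))" unfolding N by simp
 qed
 show ?thesis unfolding mulpoly_def using la lc rep unfolding x_def by blast
qed

lemma mulpoly_exists:
 assumes E: "elliptic_curve E" shows "EX a c. mulpoly E n a c"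
proof -
 have "(EX a c. mulpoly E n a c) & (EX a c. mulpoly E (Suc n) a c)"
 proof (induction n)
  case 0
  have "mulpoly E 0 1 0" unfolding mulpoly_def lead_at_def xrep_def by auto
  moreover have "mulpoly E (Suc 0) [:0,1:] 1"
   unfolding mulpoly_def lead_at_def xrep_def by (auto intro!: exI[of _ 1])
  ultimately show ?case by blast
 next
  case (Suc n)
  thus ?case using mulpoly_Suc[OF E] by blast
 qed
 thus ?thesis by blast
qed

lemma mulpoly_degree:
 assumes "mulpoly E n a c" "n > 0"
 shows "degree a = n^2" "degree c < n^2" "coeff c (n^2 - 1) = of_nat (n^2)" "c ~= 0"
proof -
 have la: "lead_at a (n^2) 1" and lc: "lead_at ([:0,1:] * c) (n^2) (of_nat (n^2))"
  using assms(1) unfolding mulpoly_def by auto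
 have n2: "n^2 > 0" using assms(2) by simp
 show da: "degree a = n^2" using la le_degree[of a "n^2"] unfolding lead_at_def by auto
 show "degree c < n^2" using lc n2 unfolding lead_at_def by (cases "c = 0") auto
 have "Suc (n^2 - 1) = n^2" using n2 by simp
 moreover have "coeff ([:0,1:] * c) (Suc (n^2 - 1)) = coeff c (n^2 - 1)" by simp
 ultimately show "coeff c (n^2 - 1) = of_nat (n^2)" using lc unfolding lead_at_def by metis
 obtain x where "poly a x = 0" using root_exists[of a] da n2 by auto
 thus "c ~= 0" using mulpoly_no_common_root[OF assms(1), of x] by auto
qed

lemma same_xfun:
 assumes "P:aff E" "Q:aff E" "xfun P = xfun Q" shows "P = Q | P = eneg E (Q :: 'a epoint)"
 using assms by (elim aff_cases) (use same_x in fastforce)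

lemma finite_xfun_fibre: "finite T ==> finite {P:aff E. xfun P:(T :: 'a set)}"
proof -
 assume "finite T"
 have "finite {P:aff E. xfun P = x}" for x :: 'a
 proof (cases "{P:aff E. xfun P = x} = {}")
  case False
  then obtain Q where Q: "Q:aff E" "xfun Q = x" by blast
  have "{P:aff E. xfun P = x} <= {Q, eneg E Q}"
  proof
   fix P assume "P:{P:aff E. xfun P = x}"
   hence "P:aff E" "xfun P = xfun Q" using Q by auto
   thus "P:{Q, eneg E Q}" using same_xfun[of P E Q] Q by blast
  qed
  thus ?thesis by (rule finite_subset) simp
 qed (simp only: finite.emptyI)
 hence "finite (UN x:T. {P:aff E. xfun P = x})" using `finite T` by blast
 moreover have "{P:aff E. xfun P:T} = (UN x:T. {P:aff E. xfun P = x})" by blast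
 ultimately show ?thesis by simp
qed

definition surj_hom :: "'a weierstrass => 'a weierstrass => ('a epoint => 'a epoint) => bool" where
 "surj_hom E E' psi <-> psi ` points E = points E' &
  (ALL P:points E. ALL Q:points E. psi (eadd E P Q) = eadd E' (psi P) (psi Q))"

definition kern :: "'a weierstrass => ('a epoint => 'a epoint) => 'a epoint set" where
 "kern E psi = {P:points E. psi P = Infty}"

text \<open>The effect of psi on x-coordinates is the reduced fraction \<open>a / c\<close>.\<close>
definition xmap :: "'a weierstrass => 'a weierstrass => ('a epoint => 'a epoint) => 'a poly => 'a poly => bool" where
 "xmap E E' psi a c <-> surj_hom E E' psi & (ALL x. ~ (poly a x = 0 & poly c x = 0)) & degree c < degree a &
  (ALL P:aff E. (psi P = Infty <-> poly c (xfun P) = 0) &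
    (psi P ~= Infty --> xfun (psi P) * poly c (xfun P) = poly a (xfun P)))"

lemma surj_hom_group_hom:
 assumes "elliptic_curve E" "elliptic_curve E'" "surj_hom E E' psi"
 shows "group_hom (egroup E) (egroup E') psi"
proof -
 interpret A: comm_group "egroup E" by (rule egroup_comm_group[OF assms(1)])
 interpret B: comm_group "egroup E'" by (rule egroup_comm_group[OF assms(2)])
 show ?thesis
  by unfold_locales (use assms(3) in "auto simp: hom_def surj_hom_def")
qed

lemma egroup_inv: 
 assumes "elliptic_curve E" "P:points (E :: 'a weierstrass)"
 shows "inv\<^bsub>egroup E\<^esub> P = eneg E P"
proof -
 interpret A: comm_group "egroup E" by (rule egroup_comm_group[OF assms(1)])
 show ?thesis using A.inv_equality[of "eneg E P" P] assms eadd_commute[OF assms(1), of P "eneg E P"] by simp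
qed

lemma surj_hom_basic:
 assumes "elliptic_curve E" "elliptic_curve E'" "surj_hom E E' psi"
 shows "psi Infty = Infty" "P:points E ==> psi P:points E'"
  "P:points E ==> psi (eneg E P) = eneg E' (psi P)"
  "P:points E ==> Q:points E ==> psi (eadd E P Q) = eadd E' (psi P) (psi Q)"
  "P:points E ==> psi (emul E n P) = emul E' n (psi P)"
proof -
 interpret h: group_hom "egroup E" "egroup E'" psi by (rule surj_hom_group_hom[OF assms])
 show "psi Infty = Infty" using h.hom_one by simp
 show *: "P:points E ==> psi P:points E'" using h.hom_closed by simp
 show "P:points E ==> psi (eneg E P) = eneg E' (psi P)"
  using h.hom_inv[of P] egroup_inv[OF assms(1), of P] egroup_inv[OF assms(2), of "psi P"] * by simp
 show "P:points E ==> Q:points E ==> psi (eadd E P Q) = eadd E' (psi P) (psi Q)" using h.hom_mult by simp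
 show "P:points E ==> psi (emul E n P) = emul E' n (psi P)" using h.hom_nat_pow[of P n] by simp
qed

lemma kern_subgroup:
 assumes "elliptic_curve E" "elliptic_curve E'" "surj_hom E E' psi"
 shows "subgroup (kern E psi) (egroup E)"
proof -
 interpret h: group_hom "egroup E" "egroup E'" psi by (rule surj_hom_group_hom[OF assms])
 have "kern E psi = kernel (egroup E) (egroup E') psi" by (simp add: kern_def kernel_def)
 thus ?thesis using h.subgroup_kernel by simp
qed

lemma fibre_kern:
 assumes E: "elliptic_curve E" and E': "elliptic_curve E'" and psi: "surj_hom E E' psi" and P: "P:points E"
 shows "{R:points E. psi R = psi P} = eadd E P ` kern E psi" "inj_on (eadd E P) (kern E psi)"
proof -
 interpret A: comm_group "egroup E" by (rule egroup_comm_group[OF E])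
 note hom = surj_hom_basic[OF E E' psi]
 show "inj_on (eadd E P) (kern E psi)" using A.l_cancel[of P] P by (auto simp: inj_on_def kern_def)
 show "{R:points E. psi R = psi P} = eadd E P ` kern E psi"
 proof (intro equalityI subsetI)
  fix R assume R: "R:{R:points E. psi R = psi P}"
  let ?Q = "eadd E (eneg E P) R"
  have "psi ?Q = Infty" using hom(2-4) P R eadd_commute[OF E', of "eneg E' (psi P)" "psi P"] by simp
  moreover have "eadd E P ?Q = R" using P R eadd_assoc[OF E, of P "eneg E P" R] by simp
  ultimately show "R:eadd E P ` kern E psi" using P R by (intro image_eqI[of _ _ ?Q]) (auto simp: kern_def)
 qed (use hom(2,4) P in "auto simp: kern_def")
qed

lemma xmap_emul:
 assumes E: "elliptic_curve E" and n: "n > 0" and m: "mulpoly E n a c"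
 shows "xmap E E (emul E n) a c"
proof -
 interpret A: comm_group "egroup E" by (rule egroup_comm_group[OF E])
 have pt: "(emul E n P = Infty <-> poly c (xfun P) = 0) &
    (emul E n P ~= Infty --> xfun (emul E n P) * poly c (xfun P) = poly a (xfun P))" if "P:aff E" for P
 proof -
  from that obtain x y where P: "P = Aff x y" "Aff x y:points E" by (rule aff_cases)
  hence "xrep (emul E n P) (poly a x) (poly c x)" using m unfolding mulpoly_def by blast
  then obtain kappa where k: "kappa ~= 0" "poly a x = kappa * xnum (emul E n P)" "poly c x = kappa * xden (emul E n P)"
   unfolding xrep_def by blast
  have x: "xfun P = x" using P by simp
  show ?thesis unfolding x using k by (cases "emul E n P") auto
 qed
 have neg: "emul E n (eneg E P) = eneg E (emul E n P)" if "P:points E" for P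
  using A.nat_pow_inv[of P n] that egroup_inv[OF E, of P] egroup_inv[OF E, of "emul E n P"] E by simp
 have "emul E n ` points E = points E"
 proof (intro equalityI subsetI)
  fix S assume "S:emul E n ` points E" thus "S:points E" using E by auto
 next
  fix S assume S: "S:points E"
  show "S:emul E n ` points E"
  proof (cases "S = Infty")
   case True
   have "emul E n Infty = Infty" using A.nat_pow_one[of n] by simp
   thus ?thesis using True by (intro image_eqI[of _ _ Infty]) auto
  next
   case False
   have "degree (a - smult (xfun S) c) = n^2"
    using mulpoly_degree[OF m n] degree_smult_le[of "xfun S" c]
    by (subst diff_conv_add_uminus, subst degree_add_eq_left) auto
   then obtain x where x: "poly (a - smult (xfun S) c) x = 0" using root_exists n by (metis zero_less_power)
   obtain y where on: "Aff x y:points E" using point_above by blast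
   hence P: "Aff x y:aff E" by simp
   have c: "poly c x ~= 0" using x mulpoly_no_common_root[OF m, of x] by auto
   hence ni: "emul E n (Aff x y) ~= Infty" and "xfun (emul E n (Aff x y)) * poly c x = poly a x"
    using pt[OF P] by auto
   hence "xfun (emul E n (Aff x y)) * poly c x = xfun S * poly c x" using x by simp
   hence "xfun (emul E n (Aff x y)) = xfun S" using c by simp
   hence "S = emul E n (Aff x y) | S = eneg E (emul E n (Aff x y))"
    using same_xfun[of S E "emul E n (Aff x y)"] ni S False on E by auto
   thus ?thesis
   proof
    assume "S = emul E n (Aff x y)" thus ?thesis using on by (rule image_eqI)
   next
    assume "S = eneg E (emul E n (Aff x y))"
    hence "S = emul E n (eneg E (Aff x y))" unfolding neg[OF on] .
    thus ?thesis using eneg_on_curve[OF on] by (rule image_eqI)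
   qed
  qed
 qed
 hence "surj_hom E E (emul E n)"
  unfolding surj_hom_def using A.pow_mult_distrib[OF A.m_comm] by simp
 thus ?thesis unfolding xmap_def using pt mulpoly_no_common_root[OF m] mulpoly_degree[OF m n] by simp
qed

lemma finite_kern:
 assumes E: "elliptic_curve E" "elliptic_curve E'" and "xmap E E' psi a c" shows "finite (kern E psi)"
proof -
 have "c ~= 0" using assms(3) root_exists[of a] unfolding xmap_def by force
 hence "finite {P:aff E. xfun P:{x. poly c x = 0}}" by (intro finite_xfun_fibre poly_roots_finite)
 moreover have "kern E psi <= insert Infty {P:aff E. xfun P:{x. poly c x = 0}}"
  using assms(3) unfolding kern_def xmap_def by auto
 ultimately show ?thesis by (meson finite.insertI finite_subset)
qed

lemma finite_torsion:
 assumes E: "elliptic_curve E" and n: "n > 0" shows "finite {P:points E. emul E n P = (Infty :: 'a epoint)}"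
proof -
 obtain a c where "mulpoly E n a c" using mulpoly_exists[OF E] by blast
 from finite_kern[OF E E xmap_emul[OF E n this]] show ?thesis by (simp add: kern_def)
qed

section \<open>Trace formula for isogenies\<close>

definition tsum :: "'a weierstrass => 'a epoint set => 'a epoint => 'a" where
 "tsum E W P = (SUM Q:W. xfun (eadd E P Q))"

lemma xfun_eadd_two_torsion:
 fixes E :: "'a weierstrass"
 assumes P: "P:aff E" and Q: "Q:aff E" "eneg E Q = Q" and x: "xfun P ~= xfun Q"
 shows "EX mu. (xfun (eadd E P Q) - xfun Q) * (xfun P - xfun Q) = mu
     & mu = 3 * xfun Q^2 + 2 * wa2 E * xfun Q + wa4 E - wa1 E * yfun Q"
proof -
 from P obtain x1 y1 where P': "P = Aff x1 y1" "Aff x1 y1:points E" by (rule aff_cases)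
 from Q(1) obtain x2 y2 where Q': "Q = Aff x2 y2" "Aff x2 y2:points E" by (rule aff_cases)
 define d where "d = x2 - x1"
 have d: "d ~= 0" "x1 ~= x2" using x P' Q' unfolding d_def by auto
 have "- y2 - wa1 E * x2 - wa3 E = y2" using Q(2) Q' by simp
 hence "wa3 E - (- (2 * y2) - wa1 E * x2) = 0" by (simp add: algebra_simps)
 hence a3: "wa3 E = - (2 * y2) - wa1 E * x2" by simp
 have e1: "y1 ^ 2 + wa1 E * x1 * y1 + wa3 E * y1 = x1 ^ 3 + wa2 E * x1 ^ 2 + wa4 E * x1 + wa6 E"
  and e2: "y2 ^ 2 + wa1 E * x2 * y2 + wa3 E * y2 = x2 ^ 3 + wa2 E * x2 ^ 2 + wa4 E * x2 + wa6 E"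
  using P'(2) Q'(2) Aff_on_curve by auto
 have y1: "y1^2 = x1 ^ 3 + wa2 E * x1 ^ 2 + wa4 E * x1 + wa6 E - wa1 E * x1 * y1 + 2 * y1 * y2 + wa1 E * x2 * y1"
  using e1 unfolding a3 by (simp add: algebra_simps)
 have "y2 ^ 2 + wa1 E * x2 * y2 + wa3 E * y2 = - (y2^2)" unfolding a3 by (simp add: ring_pow)
 hence y2: "y2^2 = - (x2 ^ 3 + wa2 E * x2 ^ 2 + wa4 E * x2 + wa6 E)" unfolding e2 by (metis add.inverse_inverse)
 define mu where "mu = 3 * x2^2 + 2 * wa2 E * x2 + wa4 E - wa1 E * y2"
 have sl: "slope E x1 y1 x2 y2 * d = y2 - y1" using d unfolding slope_def d_def by simp
 have eq: "xfun (eadd E P Q) = (slope E x1 y1 x2 y2)^2 + wa1 E * slope E x1 y1 x2 y2 - wa2 E - x1 - x2"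
  using d unfolding P' Q' by (simp add: eadd_chord Let_def)
 have "(xfun (eadd E P Q) - x2) * d^2 = (slope E x1 y1 x2 y2 * d)^2 + wa1 E * (slope E x1 y1 x2 y2 * d) * d - (wa2 E + x1 + 2 * x2) * d^2"
  unfolding eq by (simp add: ring_pow)
 also have "... = y1^2 + y2^2 - 2 * y1 * y2 + wa1 E * (y2 - y1) * d - (wa2 E + x1 + 2 * x2) * d^2"
  unfolding sl by (simp add: ring_pow)
 also have "... = - mu * d"
  unfolding y1 y2 mu_def d_def by (simp add: ring_pow)
 finally have "((xfun (eadd E P Q) - x2) * d) * d = - mu * d" by (simp add: power2_eq_square mult.assoc)
 hence "(xfun (eadd E P Q) - x2) * d = - mu" using d(1) by (metis mult_cancel_right)
 hence "(xfun (eadd E P Q) - x2) * (x1 - x2) = mu" unfolding d_def by (simp add: algebra_simps)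
 thus ?thesis unfolding mu_def P' Q' by simp
qed

text \<open>
  The terms for Q and - Q are taken together: \<open>x (P + Q) + x (P - Q)\<close> is a rational function of \<open>x P\<close>.
\<close>
lemma tsum_rational_symmetric:
 assumes E: "elliptic_curve E" and "finite W" "W <= aff E" "!!Q. Q:W ==> eneg E Q:W"
 shows "EX A C. C ~= 0 & degree A <= degree C &
  (ALL P:aff E - W. poly C (xfun P) ~= (0::'a) & tsum E W P * poly C (xfun P) = poly A (xfun P))"
 using assms(2-)
proof (induction "card W" arbitrary: W rule: less_induct)
 case less
 show ?case
 proof (cases "W = {}")
  case True
  thus ?thesis by (intro exI[of _ 0] exI[of _ 1]) (auto simp: tsum_def)
 next
  case False
  then obtain Q where Q: "Q:W" by blast
  have Qa: "Q:aff E" using Q less.prems by blast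
  define V where "V = {Q, eneg E Q}"
  have V: "V <= W" unfolding V_def using Q less.prems(3) by blast
  have cardlt: "card (W - V) < card W" using V less.prems(1) Q unfolding V_def
   by (intro psubset_card_mono) auto
  have neg': "eneg E R:W - V" if R: "R:W - V" for R
  proof -
   have "eneg E R ~= Q" "eneg E R ~= eneg E Q" using R unfolding V_def by (metis DiffD2 eneg_eneg insertCI)+
   thus ?thesis using less.prems(3)[of R] R unfolding V_def by blast
  qed
  have fW: "finite (W - V)" "W - V <= aff E" using less.prems(1,2) by auto
  obtain A C where AC: "C ~= 0" "degree A <= degree C"
   "!!P. P:aff E - (W - V) ==> poly C (xfun P) ~= 0 & tsum E (W - V) P * poly C (xfun P) = poly A (xfun P)"
   using less.hyps[OF cardlt fW neg'] by blast
  have split: "tsum E W P = tsum E (W - V) P + tsum E V P" for P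
   unfolding tsum_def using V less.prems(1) by (metis sum.subset_diff)
  define L where "L = [:- xfun Q, 1:]"
  have xne: "xfun P ~= xfun Q" if "P:aff E - W" for P
   using same_xfun[of P E Q] that Qa Q less.prems(3)[OF Q] by auto
  have "EX B D. D ~= 0 & degree B <= degree D &
   (ALL P:aff E - W. poly D (xfun P) ~= (0::'a) & tsum E V P * poly D (xfun P) = poly B (xfun P))"
  proof (cases "eneg E Q = Q")
   case True
   define mu where "mu = 3 * xfun Q^2 + 2 * wa2 E * xfun Q + wa4 E - wa1 E * yfun Q"
   have "tsum E V P * poly L (xfun P) = poly (smult (xfun Q) L + [:mu:]) (xfun P)" if "P:aff E - W" for P
    using xfun_eadd_two_torsion[OF _ Qa True xne[OF that]] that unfolding V_def True L_def mu_def
    by (auto simp: tsum_def algebra_simps)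
   moreover have "degree (smult (xfun Q) L + [:mu:]) <= degree L" unfolding L_def by simp
   moreover have "L ~= 0" unfolding L_def by simp
   moreover have "poly L (xfun P) ~= 0" if "P:aff E - W" for P using xne[OF that] unfolding L_def by simp
   ultimately show ?thesis by blast
  next
   case False
   define S where "S = [:wb4 E * xfun Q + wb6 E, 2 * xfun Q ^ 2 + wb2 E * xfun Q + wb4 E, 2 * xfun Q:]"
   have S: "poly S x = qS (wb2 E) (wb4 E) (wb6 E) x 1 (xfun Q) 1" for x
    unfolding S_def qS_def by (simp add: ring_pow)
   have "tsum E V P * poly (L^2) (xfun P) = poly S (xfun P)" if P: "P:aff E - W" for P
   proof -
    have Pe: "P = Aff (xfun P) (yfun P)" "Q = Aff (xfun Q) (yfun Q)" using P Qa aff_coords by blast+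
    have xP: "xnum P = xfun P" "xden P = 1" "xnum Q = xfun Q" "xden Q = 1" by (metis Pe xnum_simps(2) xden_simps(2))+
    have nI: "eadd E P Q ~= Infty" "eadd E P (eneg E Q) ~= Infty"
     unfolding eadd_eq_Infty using P Q less.prems(3)[OF Q] by (metis DiffD2 eneg_eneg)+
    have xn: "xnum R = xfun R" "xden R = 1" if "R ~= Infty" for R :: "'a epoint" using that by (cases R; simp)+
    obtain kappa where kappa: "qD (xfun P) 1 (xfun Q) 1 = kappa"
     "qS (wb2 E) (wb4 E) (wb6 E) (xfun P) 1 (xfun Q) 1 = kappa * (xfun (eadd E P Q) + xfun (eadd E P (eneg E Q)))"
     using biquadratic[OF E, of P Q] P Qa unfolding xP xn[OF nI(1)] xn[OF nI(2)] by auto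
    have "tsum E V P = xfun (eadd E P Q) + xfun (eadd E P (eneg E Q))"
     unfolding V_def tsum_def using False by simp
    thus ?thesis unfolding S kappa(2) unfolding kappa(1)[symmetric] L_def qD_def by (simp add: algebra_simps)
   qed
   moreover have "degree S <= 2" unfolding S_def by simp
   moreover have "degree (L^2) = 2" unfolding L_def by (simp add: degree_power_eq)
   moreover have "L^2 ~= 0" unfolding L_def by simp
   moreover have "poly (L^2) (xfun P) ~= 0" if "P:aff E - W" for P using xne[OF that] unfolding L_def by simp
   ultimately show ?thesis by metis
  qed
  then obtain B D where BD: "D ~= 0" "degree B <= degree D"
   "!!P. P:aff E - W ==> poly D (xfun P) ~= 0 & tsum E V P * poly D (xfun P) = poly B (xfun P)" by blast
  have deg: "degree (A * D + B * C) <= degree (C * D)"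
   using AC(1,2) BD(1,2) degree_mult_le[of A D] degree_mult_le[of B C]
   by (intro degree_add_le) (simp_all add: degree_mult_eq)
  have CD: "C * D ~= 0" using AC(1) BD(1) by simp
  have "poly (C * D) (xfun P) ~= 0 & tsum E W P * poly (C * D) (xfun P) = poly (A * D + B * C) (xfun P)"
   if P: "P:aff E - W" for P
  proof -
   have P': "P:aff E - (W - V)" using P by blast
   have "tsum E W P * poly (C * D) (xfun P)
    = (tsum E (W - V) P * poly C (xfun P)) * poly D (xfun P) + (tsum E V P * poly D (xfun P)) * poly C (xfun P)"
    unfolding split by (simp add: algebra_simps)
   thus ?thesis using AC(3)[OF P'] BD(3)[OF P] by simp
  qed
  thus ?thesis using CD deg by blast
 qed
qed

lemma tsum_rational:
 assumes E: "elliptic_curve E" and fin: "finite W" and sub: "subgroup W (egroup E)"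
 shows "EX A C. C ~= 0 & degree A = Suc (degree C) &
  (ALL P:points E - W. poly C (xfun P) ~= (0::'a) & tsum E W P * poly C (xfun P) = poly A (xfun P))"
proof -
 interpret A: comm_group "egroup E" by (rule egroup_comm_group[OF E])
 interpret W: subgroup W "egroup E" by (rule sub)
 have W: "W <= points E" "Infty:W" using W.subset W.one_closed by auto
 have neg: "eneg E Q:W" if "Q:W" for Q using W.m_inv_closed[OF that] unfolding egroup_inv[OF E subsetD[OF W(1) that]] .
 have W': "finite (W - {Infty})" "W - {Infty} <= aff E" using fin W by auto
 have neg': "eneg E Q:W - {Infty}" if "Q:W - {Infty}" for Q using neg[of Q] that by auto
 obtain A C where AC: "C ~= 0" "degree A <= degree C"
  "!!P. P:aff E - (W - {Infty}) ==> poly C (xfun P) ~= (0::'a) & tsum E (W - {Infty}) P * poly C (xfun P) = poly A (xfun P)"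
  using tsum_rational_symmetric[OF E W'(1,2) neg'] by blast
 have d: "degree ([:0,1:] * C) = Suc (degree C)" using AC(1) by simp
 have dA: "degree (A + [:0,1:] * C) = Suc (degree C)"
  using degree_add_eq_right[of A "[:0,1:] * C"] d AC(2) by simp
 have "poly C (xfun P) ~= 0 & tsum E W P * poly C (xfun P) = poly (A + [:0,1:] * C) (xfun P)"
  if P: "P:points E - W" for P
 proof -
  have P': "P:aff E - (W - {Infty})" using W P by auto
  have "tsum E W P = xfun P + tsum E (W - {Infty}) P"
   unfolding tsum_def using fin W(2) by (simp add: sum.remove)
  thus ?thesis using AC(3)[OF P'] by (auto simp: algebra_simps)
 qed
 thus ?thesis using AC(1) dA by blast
qed

lemma card_roots_simple:
 fixes f :: "'a poly"
 assumes "f ~= 0" "!!z. poly f z = 0 ==> poly (pderiv f) z ~= 0"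
 shows "card {z. poly f z = 0} = degree f"
 using assms
proof (induction "degree f" arbitrary: f)
 case 0
 then obtain k where "f = [:k:]" "k ~= 0" by (metis degree_eq_zeroE pCons_0_0)
 thus ?case by simp
next
 case (Suc n)
 then obtain z where z: "poly f z = 0" using root_exists[of f] by auto
 then obtain g where g: "f = [:- z, 1:] * g" unfolding poly_eq_0_iff_dvd by (elim dvdE)
 have g0: "g ~= 0" using Suc.prems g by auto
 have dg: "degree f = Suc (degree g)" unfolding g using g0 by (subst degree_mult_eq) auto
 have pd: "pderiv f = g + [:- z, 1:] * pderiv g" unfolding g pderiv_mult by (simp add: pderiv_pCons)
 have gz: "poly g z ~= 0" using Suc.prems(2)[OF z] unfolding pd by simp
 have "poly (pderiv g) w ~= 0" if "poly g w = 0" for w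
  using Suc.prems(2)[of w] that unfolding pd by (auto simp: g)
 hence IH: "card {z. poly g z = 0} = degree g" using Suc.hyps dg g0 by simp
 have "{w. poly f w = 0} = insert z {w. poly g w = 0}" unfolding g by auto
 thus ?case using IH dg gz poly_roots_finite[OF g0] by simp
qed

text \<open>
  For generic t the equation \<open>x (psi P) = t\<close> has the solutions \<open>x (P + Q)\<close>, Q in the kernel, all of
  the same inseparable multiplicity q.  The coefficient next to the leading one of
  \<open>a - t c\<close>, a polynomial in \<open>x ^ q\<close>, is affine in t; by Vieta it is minus the sum of the roots.
\<close>
theorem trace_formula:
 assumes E: "elliptic_curve E" and E': "elliptic_curve E'" and psi: "xmap E E' psi a c"
 shows "EX q C D. frob q & C ~= 0 & degree a = q * card (kern E psi) & degree a = degree c + q &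
  (q = 1 --> coeff c (degree a - 1) ~= 0) &
  (ALL P:points E - kern E psi. xfun (psi P) = C * tsum E (kern E psi) P ^ q + D)"
proof -
 let ?W = "kern E psi"
 have sh: "surj_hom E E' psi" and ncr: "!!x. ~ (poly a x = 0 & poly c x = 0)" and dac: "degree c < degree a"
  and pt: "!!P. P:aff E ==> (psi P = Infty <-> poly c (xfun P) = 0) &
    (psi P ~= Infty --> xfun (psi P) * poly c (xfun P) = poly a (xfun P))"
  using psi unfolding xmap_def by auto
 note hom = surj_hom_basic[OF E E' sh]
 interpret A: comm_group "egroup E" by (rule egroup_comm_group[OF E])
 interpret W: subgroup ?W "egroup E" by (rule kern_subgroup[OF E E' sh])
 have fin: "finite ?W" by (rule finite_kern[OF E E' psi])
 have c0: "c ~= 0" using root_exists[of a] ncr dac by force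
 obtain q a1 c1 where q: "frob q" "a = pcompose a1 (monom 1 q)" "c = pcompose c1 (monom 1 q)"
  "!!x. ~ (poly a1 x = 0 & poly c1 x = 0)" "pderiv a1 * c1 ~= a1 * pderiv c1"
  using inseparable_part[of a c] ncr dac by (metis bot_nat_0.extremum_strict neq0_conv)
 have q0: "q > 0" using frob_pos[OF q(1)] .
 have da: "degree a = degree a1 * q" and dc: "degree c = degree c1 * q"
  unfolding q(2,3) by (rule degree_pcompose_monom)+
 have dac1: "degree c1 < degree a1" using dac unfolding da dc by simp
 define n where "n = card ?W"
 define w where "w = pderiv a1 * c1 - a1 * pderiv c1"
 define T where "T = (%z. poly a1 z / poly c1 z) ` {z. poly w z = 0} Un xfun ` {S:points E'. emul E' 2 S = Infty}"
 have finT: "finite T"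
  unfolding T_def using q(5) poly_roots_finite[of w] finite_torsion[OF E', of 2] by (simp add: w_def)
 define L where "L = lead_coeff a1"
 have L: "L ~= 0" unfolding L_def using dac1 by (auto simp: leading_coeff_0_iff)
 have gen: "degree a1 = n & L * tsum E ?W P ^ q = xfun (psi P) * coeff c1 (n - 1) - coeff a1 (n - 1)"
  if P: "P:points E - ?W" and tT: "xfun (psi P) ~: T" for P
 proof -
  define t where "t = xfun (psi P)"
  define r where "r = (%Q. xfun (eadd E P Q) ^ q)"
  define f where "f = a1 - smult t c1"
  have Pp: "P:points E" "psi P ~= Infty" using P unfolding kern_def by auto
  have df: "degree f = degree a1"
   unfolding f_def using dac1 degree_smult_le[of t c1] by (subst diff_conv_add_uminus, subst degree_add_eq_left) auto
  have f0: "f ~= 0" using df dac1 by auto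
  have Win: "Q:points E" "psi Q = Infty" if "Q:?W" for Q using that unfolding kern_def by auto
  have PQ: "eadd E P Q:aff E" "psi (eadd E P Q) = psi P" if "Q:?W" for Q
  proof -
   show *: "psi (eadd E P Q) = psi P" using hom(4)[OF Pp(1) Win(1)[OF that]] Win(2)[OF that] by simp
   thus "eadd E P Q:aff E" using hom(1) Pp Win(1)[OF that] by auto
  qed
  have root: "poly f (r Q) = 0" if "Q:?W" for Q
  proof -
   have "t * poly c (xfun (eadd E P Q)) = poly a (xfun (eadd E P Q))"
    using pt[OF PQ(1)[OF that]] PQ(2)[OF that] Pp(2) unfolding t_def by simp
   thus ?thesis unfolding f_def r_def q(2,3) poly_pcompose_monom by simp
  qed
  have inj: "inj_on r ?W"
  proof (rule inj_onI)
   fix Q R assume QR: "Q:?W" "R:?W" "r Q = r R"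
   hence "xfun (eadd E P Q) = xfun (eadd E P R)" unfolding r_def using frob_eq_iff[OF q(1)] by blast
   hence "eadd E P Q = eadd E P R | eadd E P Q = eneg E (eadd E P R)" using same_xfun[OF PQ(1) PQ(1)] QR by blast
   thus "Q = R"
   proof
    assume "eadd E P Q = eadd E P R"
    thus ?thesis using A.l_cancel[of P Q R] Pp(1) Win(1) QR by simp
   next
    assume "eadd E P Q = eneg E (eadd E P R)"
    hence "psi P = eneg E' (psi P)" using PQ(2)[OF QR(1)] PQ(2)[OF QR(2)] hom(3)[of "eadd E P R"] Pp(1) Win(1)[OF QR(2)] by simp
    hence "eadd E' (psi P) (psi P) = Infty" by (simp add: eadd_eq_Infty)
    hence "emul E' 2 (psi P) = Infty" by (simp add: numeral_2_eq_2)
    hence "t:T" unfolding T_def t_def using hom(2)[OF Pp(1)] by blast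
    thus ?thesis using tT unfolding t_def by blast
   qed
  qed
  have roots: "{z. poly f z = 0} = r ` ?W"
  proof (intro equalityI subsetI)
   fix z assume "z:{z. poly f z = 0}"
   hence z: "poly a1 z = t * poly c1 z" unfolding f_def by simp
   obtain x where x: "x ^ q = z" using nth_root_ex[OF q0] by blast
   obtain y where on: "Aff x y:points E" using point_above by blast
   define R where "R = Aff x y"
   have R: "R:aff E" "xfun R = x" using on unfolding R_def by auto
   have ax: "poly a x = t * poly c x" using z unfolding q(2,3) poly_pcompose_monom x .
   hence cx: "poly c x ~= 0" using ncr[of x] by auto
   hence "psi R ~= Infty" "xfun (psi R) * poly c x = t * poly c x" using pt[OF R(1)] ax R(2) by auto
   hence "psi R:aff E'" "xfun (psi R) = t" using cx hom(2) R(1) by auto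
   moreover have "psi P:aff E'" using Pp hom(2) by auto
   ultimately have "psi R = psi P | psi R = eneg E' (psi P)" using same_xfun[of "psi R" E' "psi P"] unfolding t_def by auto
   hence "R:eadd E P ` ?W | eneg E R:eadd E P ` ?W"
    using fibre_kern(1)[OF E E' sh Pp(1), symmetric] hom(3)[of R] R eneg_eneg[of E' "psi P"] by auto
   then obtain Q where Q: "Q:?W" "eadd E P Q = R | eadd E P Q = eneg E R" by force
   moreover have "xfun (eneg E R) = x" unfolding R_def by simp
   ultimately have "r Q = z" using x R(2) unfolding r_def by auto
   thus "z:r ` ?W" using Q(1) by blast
  qed (use root in auto)
  have simple: "poly (pderiv f) z ~= 0" if z: "poly f z = 0" for z
  proof
   assume d: "poly (pderiv f) z = 0"
   have 1: "poly a1 z = t * poly c1 z" "poly (pderiv a1) z = t * poly (pderiv c1) z"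
    using z d unfolding f_def by (simp_all add: pderiv_diff pderiv_smult)
   have "poly w z = 0" unfolding w_def by (simp add: 1)
   moreover have "poly c1 z ~= 0" using q(4)[of z] 1(1) by auto
   hence "t = poly a1 z / poly c1 z" using 1(1) by simp
   ultimately have "t:T" unfolding T_def by blast
   thus False using tT unfolding t_def by blast
  qed
  have "card (r ` ?W) = degree f" using card_roots_simple[OF f0 simple] unfolding roots by simp
  hence deg: "degree f = n" using card_image[OF inj] unfolding n_def by simp
  have np: "?W ~= {}" using W.one_closed by blast
  have lf: "lead_coeff f = L" unfolding f_def L_def using df dac1 unfolding f_def by (simp add: coeff_eq_0)
  have "f = smult (lead_coeff f) (PROD Q:?W. [:- r Q, 1:])"
   by (rule poly_eq_smult_prod_roots[OF fin inj root _ f0]) (use deg in "auto simp: n_def")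
  hence "coeff f (n - 1) = L * coeff (PROD Q:?W. [:- r Q, 1:]) (n - 1)" using lf by (metis coeff_smult)
  also have "... = - (L * (SUM Q:?W. r Q))" using coeff_pred_degree_prod_linear[OF fin np] unfolding n_def by simp
  also have "(SUM Q:?W. r Q) = tsum E ?W P ^ q" unfolding r_def tsum_def by (rule frob_sum[OF q(1), symmetric])
  finally have "L * tsum E ?W P ^ q = - coeff f (n - 1)" by simp
  thus ?thesis using deg df unfolding f_def t_def by (simp add: algebra_simps)
 qed
 obtain A0 C0 where AC: "C0 ~= 0" "degree A0 = Suc (degree C0)"
  "!!P. P:points E - ?W ==> poly C0 (xfun P) ~= (0::'a) & tsum E ?W P * poly C0 (xfun P) = poly A0 (xfun P)"
  using tsum_rational[OF E fin kern_subgroup[OF E E' sh]] by blast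
 define kappa where "kappa = coeff c1 (n - 1)"
 define m where "m = coeff a1 (n - 1)"
 define G where "G = {x. poly c x ~= 0 & (ALL t:T. poly (a - smult t c) x ~= 0)}"
 have finG: "finite (- G)"
 proof -
  have "a - smult t c ~= 0" for t using dac degree_smult_le[of t c] by (metis eq_iff_diff_eq_0 leD)
  hence "finite ({x. poly c x = 0} Un (UN t:T. {x. poly (a - smult t c) x = 0}))"
   using c0 finT poly_roots_finite by blast
  moreover have "- G <= {x. poly c x = 0} Un (UN t:T. {x. poly (a - smult t c) x = 0})" unfolding G_def by blast
  ultimately show ?thesis using finite_subset by blast
 qed
 have Gpt: "EX P. P:points E - ?W & xfun P = x & xfun (psi P) ~: T & xfun (psi P) * poly c x = poly a x" if "x:G" for x
 proof -
  obtain y where on: "Aff x y:points E" using point_above by blast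
  have cx: "poly c x ~= 0" using that unfolding G_def by blast
  have P: "Aff x y:aff E" "xfun (Aff x y) = x" using on by auto
  have *: "psi (Aff x y) ~= Infty" "xfun (psi (Aff x y)) * poly c x = poly a x" using pt[OF P(1)] cx by auto
  have "xfun (psi (Aff x y)) ~: T"
  proof
   assume "xfun (psi (Aff x y)):T"
   hence "poly (a - smult (xfun (psi (Aff x y))) c) x ~= 0" using that unfolding G_def by blast
   thus False using * by simp
  qed
  thus ?thesis using on * unfolding kern_def by (intro exI[of _ "Aff x y"]) auto
 qed
 have "G ~= {}" using finG infinite_field by (metis Compl_empty_eq)
 then obtain x where "x:G" by blast
 from Gpt[OF this] gen have n: "degree a1 = n" by blast
 have id: "smult L (A0 ^ q) * c = (smult kappa a - smult m c) * C0 ^ q"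
 proof (rule poly_eqI_cofinite[OF finG])
  fix x assume "x ~: - G"
  then obtain P where P: "P:points E - ?W" "xfun P = x" "xfun (psi P) ~: T" "xfun (psi P) * poly c x = poly a x"
   using Gpt by blast
  have g: "L * tsum E ?W P ^ q = xfun (psi P) * kappa - m" using gen[OF P(1,3)] unfolding kappa_def m_def by blast
  have "poly (smult L (A0 ^ q) * c) x = L * (tsum E ?W P * poly C0 x) ^ q * poly c x"
   using AC(3)[OF P(1)] P(2) by simp
  also have "... = (xfun (psi P) * kappa - m) * poly c x * poly C0 x ^ q" unfolding g[symmetric] by (simp add: power_mult_distrib)
  also have "... = (kappa * (xfun (psi P) * poly c x) - m * poly c x) * poly C0 x ^ q" by (simp add: algebra_simps)
  finally show "poly (smult L (A0 ^ q) * c) x = poly ((smult kappa a - smult m c) * C0 ^ q) x" unfolding P(4) by simp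
 qed
 have A00: "A0 ~= 0" using AC(2) by auto
 have dl: "degree (smult L (A0 ^ q) * c) = q * Suc (degree C0) + degree c"
  using L A00 c0 AC(2) by (simp add: degree_mult_eq degree_power_eq)
 have kappa: "kappa ~= 0"
 proof
  assume k: "kappa = 0"
  have "degree (smult L (A0 ^ q) * c) <= degree c + q * degree C0"
   unfolding id k using degree_mult_le[of "- smult m c" "C0 ^ q"] degree_smult_le[of m c] AC(1) by (simp add: degree_power_eq)
  thus False unfolding dl using q0 by simp
 qed
 have "degree (smult kappa a - smult m c) = degree a"
  using kappa dac degree_smult_le[of m c] by (subst diff_conv_add_uminus, subst degree_add_eq_left) auto
 moreover have "smult kappa a - smult m c ~= 0" using calculation dac by auto
 ultimately have "degree (smult L (A0 ^ q) * c) = degree a + q * degree C0"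
  unfolding id using AC(1) by (simp add: degree_mult_eq degree_power_eq)
 hence dq: "degree a = degree c + q" unfolding dl by simp
 have main: "xfun (psi P) = (L / kappa) * tsum E ?W P ^ q + m / kappa" if P: "P:points E - ?W" for P
 proof -
  have Pa: "P:aff E" "psi P ~= Infty" using P hom(1) unfolding kern_def by auto
  have cx: "poly c (xfun P) ~= 0" "xfun (psi P) * poly c (xfun P) = poly a (xfun P)" using pt[OF Pa(1)] Pa(2) by auto
  have Cx: "poly C0 (xfun P) ~= 0" "tsum E ?W P * poly C0 (xfun P) = poly A0 (xfun P)" using AC(3)[OF P] by auto
  have "L * tsum E ?W P ^ q * (poly c (xfun P) * poly C0 (xfun P) ^ q) = poly (smult L (A0 ^ q) * c) (xfun P)"
   using Cx(2) by (simp add: power_mult_distrib flip: Cx(2))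
  also have "... = (kappa * xfun (psi P) - m) * (poly c (xfun P) * poly C0 (xfun P) ^ q)"
   unfolding id by (simp add: algebra_simps flip: cx(2))
  finally have "L * tsum E ?W P ^ q = kappa * xfun (psi P) - m" using cx(1) Cx(1) by simp
  thus ?thesis using kappa by (simp add: field_simps)
 qed
 have "coeff c (degree a - 1) ~= 0" if "q = 1"
 proof -
  have "pcompose c1 (monom 1 (Suc 0)) = c1" by (simp add: monom_altdef pcompose_idR)
  hence "c = c1" using q(3) that by simp
  thus ?thesis using kappa n da that unfolding kappa_def by simp
 qed
 thus ?thesis
  using q(1) L kappa da n dq main unfolding n_def by (intro exI[of _ q] exI[of _ "L / kappa"] exI[of _ "m / kappa"]) (auto simp: mult.commute)
qed


section \<open>Torsion\<close>


abbreviation tors :: "'a weierstrass => nat => 'a epoint set" where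
 "tors E n == kern E (emul E n)"

lemma tors_iff: "P:tors E n <-> P:points E & emul E n P = Infty"
 by (simp add: kern_def)

lemma tors_1: "tors E 1 = {Infty}"
proof -
 have "emul E 1 P = P" for P by simp
 thus ?thesis unfolding kern_def by auto
qed

lemma emul_emul: "elliptic_curve E ==> P:points E ==> emul E n (emul E m P) = emul E (m * n) P"
proof -
 assume E: "elliptic_curve E" and P: "P:points E"
 interpret comm_group "egroup E" by (rule egroup_comm_group[OF E])
 show ?thesis using nat_pow_pow[of P m n] P by simp
qed

lemma emul_Infty [simp]: "elliptic_curve E ==> emul E n Infty = Infty"
proof -
 assume E: "elliptic_curve E"
 interpret comm_group "egroup E" by (rule egroup_comm_group[OF E])
 show ?thesis using nat_pow_one[of n] by simp
qed

lemma surj_hom_emul: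
 assumes E: "elliptic_curve E" and n: "n > 0" shows "surj_hom E E (emul E n)"
 using mulpoly_exists[OF E] xmap_emul[OF E n] unfolding xmap_def by blast

lemma emul_eadd: "elliptic_curve E ==> P:points E ==> Q:points E ==> emul E n (eadd E P Q) = eadd E (emul E n P) (emul E n Q)"
 by (cases "n = 0") (use surj_hom_basic(4)[OF _ _ surj_hom_emul] in auto)

lemma tors_mono: "elliptic_curve E ==> m dvd n ==> tors E m <= tors E n"
proof
 fix P assume E: "elliptic_curve E" and "m dvd n" and P: "P:tors E m"
 then obtain k where k: "n = m * k" by (auto elim: dvdE)
 show "P:tors E n" using P E unfolding tors_iff k emul_emul[OF E, symmetric] by (auto simp: emul_emul[OF E, symmetric])
qed

text \<open>
  The trace formula up to Frobenius twists on both sides.  Unlike the property of being a morphism,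
  this relation is easily transferred to dual maps.
\<close>
definition vmap :: "'a weierstrass => 'a weierstrass => ('a epoint => 'a epoint) => nat => nat => bool" where
 "vmap E E' psi q r <-> surj_hom E E' psi & finite (kern E psi) & frob q & frob r &
  (EX C D. C ~= 0 & (ALL P:points E - kern E psi. xfun (psi P) ^ q = C * tsum E (kern E psi) P ^ r + D))"

text \<open>The inseparability degree q of multiplication by n.\<close>
lemma vmap_emul:
 assumes E: "elliptic_curve E" and n: "n > 0"
 shows "EX q. vmap E E (emul E n) 1 q & q * card (tors E n) = n^2 & (q = 1 --> of_nat n ~= (0::'a))"
proof -
 obtain a c where m: "mulpoly E n a c" using mulpoly_exists[OF E] by blast
 note x = xmap_emul[OF E n m]
 note d = mulpoly_degree[OF m n]
 obtain q C D where q: "frob q" "C ~= 0" "degree a = q * card (tors E n)"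
  "q = 1 --> coeff c (degree a - 1) ~= 0"
  "ALL P:points E - tors E n. xfun (emul E n P) = C * tsum E (tors E n) P ^ q + D"
  using trace_formula[OF E E x] by blast
 have "vmap E E (emul E n) 1 q"
  unfolding vmap_def using q finite_kern[OF E E x] surj_hom_emul[OF E n] frob_1 by auto
 moreover have "q = 1 --> of_nat n ~= (0::'a)"
  using q(4) unfolding d(1) d(3) by (auto simp: power2_eq_square)
 ultimately show ?thesis using q(3) d(1) by auto
qed

lemma frob_dvd_good:
 assumes "frob q" "q dvd n" "of_nat n ~= (0::'a)" shows "q = 1"
proof (rule ccontr)
 assume "q ~= 1"
 then obtain i where i: "q = CHAR('a) ^ Suc i" using assms(1) unfolding frob_exp_def by (metis power_0 not0_implies_Suc)
 hence "CHAR('a) dvd n" using assms(2) by (metis dvd_mult_left power_Suc)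
 thus False using assms(3) of_nat_eq_0_iff_char_dvd by blast
qed

lemma card_tors_good:
 assumes E: "elliptic_curve E" and n: "of_nat n ~= (0::'a)"
 shows "card (tors E n) = n^2" "vmap E E (emul E n) 1 1"
proof -
 have n0: "n > 0" using n by (cases n) auto
 obtain q where q: "vmap E E (emul E n) 1 q" "q * card (tors E n) = n^2" using vmap_emul[OF E n0] by blast
 have "of_nat (n^2) ~= (0::'a)" using n by simp
 hence "q = 1" using q by (intro frob_dvd_good[of q "n^2"]) (auto simp: vmap_def intro: dvdI[of _ _ "card (tors E n)"])
 thus "card (tors E n) = n^2" "vmap E E (emul E n) 1 1" using q by auto
qed

lemma card_tors_mult:
 assumes E: "elliptic_curve E" and m: "m > 0" and n: "n > 0"
 shows "card (tors E (m * n)) = card (tors E m) * card (tors E n)"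
proof -
 note sh = surj_hom_emul[OF E m]
 note hom = surj_hom_basic[OF E E sh]
 have fin: "finite (tors E k)" if "k > 0" for k using finite_torsion[OF E that] by (simp add: kern_def)
 have mn: "finite (tors E (m * n))" using fin m n by simp
 interpret A: comm_group "egroup E" by (rule egroup_comm_group[OF E])
 have img: "emul E m ` tors E (m * n) = tors E n"
 proof (intro equalityI subsetI)
  fix S assume "S:emul E m ` tors E (m * n)"
  thus "S:tors E n" using E by (auto simp: tors_iff emul_emul)
 next
  fix S assume S: "S:tors E n"
  then obtain P where P: "P:points E" "S = emul E m P" using sh unfolding surj_hom_def tors_iff by blast
  thus "S:emul E m ` tors E (m * n)" using S E by (auto simp: tors_iff emul_emul)
 qed
 have fib: "card {P:tors E (m * n). emul E m P = S} = card (tors E m)" if S: "S:tors E n" for S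
 proof -
  obtain P where P: "P:tors E (m * n)" "S = emul E m P" using S img by blast
  hence Pp: "P:points E" by (simp add: tors_iff)
  have "{R:tors E (m * n). emul E m R = S} = {R:points E. emul E m R = emul E m P}"
   using P S E by (auto simp: tors_iff emul_emul[symmetric])
  thus ?thesis using fibre_kern[OF E E sh Pp] by (simp add: card_image)
 qed
 have "card (tors E (m * n)) = (SUM S:tors E n. card {P:tors E (m * n). emul E m P = S})"
  using card_eq_sum sum.image_gen[OF mn, of "%_. 1::nat" "emul E m"] unfolding img by simp
 also have "... = card (tors E m) * card (tors E n)" using fib by simp
 finally show ?thesis .
qed

text \<open>
  The inseparability degree of multiplication by p is not 1, hence at least p.
\<close>
lemma card_tors_char_le:
 assumes E: "elliptic_curve E" and p: "CHAR('a) > 0"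
 shows "card (tors E (CHAR('a))) <= CHAR('a)"
proof -
 let ?p = "CHAR('a)"
 obtain q where q: "vmap E E (emul E ?p) 1 q" "q * card (tors E ?p) = ?p^2" "q = 1 --> of_nat ?p ~= (0::'a)"
  using vmap_emul[OF E p] by blast
 obtain i where i: "q = ?p ^ i" using q(1) unfolding vmap_def frob_exp_def by auto
 have "i ~= 0" using i q(3) by (cases i) auto
 hence "?p <= q" using i p by (cases i) auto
 hence "?p * card (tors E ?p) <= ?p * ?p" using q(2) mult_le_mono1[of ?p q "card (tors E ?p)"] by (simp add: power2_eq_square)
 thus ?thesis using p by simp
qed

lemma card_tors_char_power_le:
 assumes E: "elliptic_curve E" and p: "CHAR('a) > 0"
 shows "card (tors E (CHAR('a) ^ b)) <= CHAR('a) ^ b"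
proof (induction b)
 case 0
 show ?case unfolding power_0 tors_1 by simp
next
 case (Suc b)
 have "card (tors E (CHAR('a) ^ Suc b)) = card (tors E (CHAR('a))) * card (tors E (CHAR('a) ^ b))"
  using card_tors_mult[OF E p, of "CHAR('a) ^ b"] p by simp
 also have "... <= CHAR('a) * CHAR('a) ^ b" by (intro mult_le_mono Suc card_tors_char_le[OF E p])
 finally show ?case by simp
qed

text \<open>
  The p-primary part of a finite subgroup: since there are at most \<open>p ^ b\<close> points of order
  dividing \<open>p ^ b\<close>, a point of maximal order \<open>p ^ b\<close> generates it, and it consists of all points
  killed by \<open>p ^ b\<close>.
\<close>
definition ppart :: "'a weierstrass => 'a epoint set => nat => bool" where
 "ppart E W beta <-> frob beta & tors E beta <= W & card (tors E beta) = beta &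
  (EX N. of_nat N ~= (0::'a) & (ALL P:W. emul E (beta * N) P = Infty))"

text \<open>
  There are at most \<open>p ^ i\<close> points killed by \<open>p ^ i\<close>, so the multiples of P are all of them.
\<close>
lemma tors_ord:
 assumes E: "elliptic_curve E" and sub: "subgroup W (egroup E)" and P: "P:W"
  and p: "CHAR('a) > 0" and o: "group.ord (egroup E) P = CHAR('a) ^ i"
 shows "tors E (CHAR('a) ^ i) <= W" "card (tors E (CHAR('a) ^ i)) = CHAR('a) ^ i"
proof -
 interpret A: comm_group "egroup E" by (rule egroup_comm_group[OF E])
 let ?q = "CHAR('a) ^ i"
 have Pp: "P:points E" using P subgroup.subset[OF sub] by auto
 have inW: "emul E l P:W" for l
  by (induction l) (use P subgroup.one_closed[OF sub] subgroup.m_closed[OF sub] in auto)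
 have "emul E ?q P = Infty" using A.pow_ord_eq_1[of P] Pp o by simp
 hence "emul E ?q (emul E l P) = Infty" for l
  using emul_emul[OF E Pp, of ?q l] emul_emul[OF E Pp, of l ?q] E by (simp add: mult.commute)
 hence inT: "(%l. emul E l P) ` {..<?q} <= tors E ?q" using Pp E by (auto simp: tors_iff)
 have "inj_on (%l. emul E l P) {..<?q}" using A.ord_inj[of P] Pp o p by (auto simp: inj_on_def)
 hence c: "card ((%l. emul E l P) ` {..<?q}) = ?q" by (simp add: card_image)
 have fin: "finite (tors E ?q)" using finite_torsion[OF E, of ?q] p by (simp add: kern_def)
 have eq: "(%l. emul E l P) ` {..<?q} = tors E ?q"
  using card_subset_eq[OF fin inT] card_mono[OF fin inT] card_tors_char_power_le[OF E p, of i] c by simp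
 show "tors E ?q <= W" "card (tors E ?q) = ?q" using c inW unfolding eq[symmetric] by auto
qed

lemma ppart_exists:
 assumes E: "elliptic_curve E" and fin: "finite W" and sub: "subgroup W (egroup E)"
 shows "EX beta. ppart E W beta"
proof -
 interpret A: comm_group "egroup E" by (rule egroup_comm_group[OF E])
 have Wp: "W <= points E" using subgroup.subset[OF sub] by simp
 have OW: "Infty:W" using subgroup.one_closed[OF sub] by simp
 define n where "n = card W"
 have n0: "n > 0" using fin OW unfolding n_def by (auto simp: card_gt_0_iff)
 have kill: "emul E n P = Infty" if "P:W" for P
 proof -
  interpret H: group "(egroup E)\<lparr>carrier := W\<rparr>" using A.subgroup_imp_group[OF sub] .
  have "P [^]\<^bsub>(egroup E)\<lparr>carrier := W\<rparr>\<^esub> n = \<one>\<^bsub>(egroup E)\<lparr>carrier := W\<rparr>\<^esub>"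
   using H.pow_order_eq_1[of P] that unfolding n_def Coset.order_def by simp
  thus ?thesis by (simp add: nat_pow_def)
 qed
 show ?thesis
 proof (cases "of_nat n = (0::'a)")
  case False
  have "ppart E W 1" unfolding ppart_def tors_1 using False kill OW by auto
  thus ?thesis by blast
 next
  case True
  let ?p = "CHAR('a)"
  have p0: "?p > 0" using True n0 of_nat_eq_0_iff_char_dvd[where 'a = 'a, of n] by (cases "?p = 0") auto
  have pr: "Factorial_Ring.prime ?p" using p0 prime_CHAR_semidom by blast
  obtain k N where N: "n = ?p ^ k * N" "~ ?p dvd N"
   using n0 pr by (metis multiplicity_decompose' not_prime_unit neq0_conv)
  have Ngood: "of_nat N ~= (0::'a)" using N(2) of_nat_eq_0_iff_char_dvd by blast
  define I where "I = {i. tors E (?p ^ i) <= W & card (tors E (?p ^ i)) = ?p ^ i}"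
  have I0: "0:I" unfolding I_def mem_Collect_eq power_0 tors_1 using OW by simp
  have "i <= card W" if "i:I" for i
  proof -
   have "i < ?p ^ i" using pr prime_ge_2_nat by (metis less_exp le_less_trans less_le_trans power_mono zero_le)
   thus ?thesis using that card_mono[OF fin, of "tors E (?p ^ i)"] unfolding I_def by simp
  qed
  hence finI: "finite I" by (intro finite_subset[of I "{..card W}"]) auto
  define b where "b = Max I"
  have bI: "b:I" and bmax: "i:I ==> i <= b" for i
   unfolding b_def using Max_in[OF finI] Max_ge[OF finI] I0 by blast+
  have "emul E (?p ^ b * N) Q = Infty" if Q: "Q:W" for Q
  proof -
   have Qp: "Q:points E" using Q Wp by blast
   define R where "R = emul E N Q"
   have RW: "R:W" unfolding R_def by (induction N) (use Q OW subgroup.m_closed[OF sub] in auto)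
   have Rp: "R:points E" using RW Wp by blast
   have "emul E (?p ^ k) R = Infty" using kill[OF Q] emul_emul[OF E Qp] unfolding R_def N(1) by (simp add: mult.commute)
   hence "A.ord R dvd ?p ^ k" using A.pow_eq_id[of R "?p ^ k"] Rp by simp
   then obtain i where i: "A.ord R = ?p ^ i" using divides_primepow_nat[OF pr] by blast
   have "i:I" unfolding I_def using tors_ord[OF E sub RW p0 i] by blast
   hence "A.ord R dvd ?p ^ b" unfolding i using bmax by (simp add: le_imp_power_dvd)
   hence "emul E (?p ^ b) R = Infty" using A.pow_eq_id[of R "?p ^ b"] Rp by simp
   thus ?thesis unfolding R_def emul_emul[OF E Qp] by (simp add: mult.commute)
  qed
  hence "ppart E W (?p ^ b)" unfolding ppart_def frob_exp_def using bI Ngood p0 unfolding I_def by auto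
  thus ?thesis by blast
 qed
qed

lemma frob_le_imp_dvd: "frob q ==> frob r ==> q <= r ==> q dvd r"
proof -
 assume "frob q" "frob r" and le: "q <= r"
 hence pos: "q > 0" "r > 0" and "EX i. q = CHAR('a) ^ i" "EX j. r = CHAR('a) ^ j" unfolding frob_exp_def by blast+
 then obtain i j where ij: "q = CHAR('a) ^ i" "r = CHAR('a) ^ j" by blast
 show "q dvd r"
 proof (cases "i <= j")
  case True thus ?thesis unfolding ij by (rule le_imp_power_dvd)
 next
  case False
  hence "r dvd q" unfolding ij by (intro le_imp_power_dvd) simp
  hence "q = r" using le pos by (simp add: dvd_imp_le le_antisym)
  thus ?thesis by simp
 qed
qed

text \<open>
  Otherwise beta is the greatest common divisor of gamma and \<open>beta N\<close>, both of which kill the gamma-torsion.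
\<close>
lemma ppart_mono:
 assumes E: "elliptic_curve E" and W: "ppart E W beta" and T: "tors E gamma <= W" "frob gamma" "card (tors E gamma) = gamma"
 shows "gamma <= beta"
proof (rule ccontr)
 assume "~ gamma <= beta"
 obtain N where N: "of_nat N ~= (0::'a)" "!!P. P:W ==> emul E (beta * N) P = Infty" and b: "frob beta" "card (tors E beta) = beta"
  using W unfolding ppart_def by blast
 have dv: "beta dvd gamma" using frob_le_imp_dvd[OF b(1) T(2)] `~ gamma <= beta` by simp
 interpret A: comm_group "egroup E" by (rule egroup_comm_group[OF E])
 have "tors E gamma <= tors E beta"
 proof
  fix P assume P: "P:tors E gamma"
  hence Pp: "P:points E" by (simp add: tors_iff)
  have 1: "A.ord P dvd gamma" using A.pow_eq_id[of P gamma] Pp P by (simp add: tors_iff)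
  have 2: "A.ord P dvd beta * N" using A.pow_eq_id[of P "beta * N"] Pp N(2) P T(1) by auto
  have "gcd gamma (beta * N) = beta"
  proof -
   obtain c where c: "gamma = beta * c" using dv by (auto elim: dvdE)
   have "coprime c N"
   proof -
    obtain i where i: "gamma = CHAR('a) ^ i" using T(2) unfolding frob_exp_def by auto
    have g0: "gamma > 0" using frob_pos[OF T(2)] .
    show ?thesis
    proof (cases "CHAR('a) = 0")
     case True
     hence "gamma = 1" using i g0 by (cases i) auto
     thus ?thesis using c by simp
    next
     case False
     hence pr: "Factorial_Ring.prime CHAR('a)" using prime_CHAR_semidom by blast
     have "~ CHAR('a) dvd N" using N(1) of_nat_eq_0_iff_char_dvd by blast
     hence "coprime (CHAR('a) ^ i) N" using prime_imp_coprime[OF pr] by simp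
     thus ?thesis using c i by (metis coprime_mult_left_iff)
    qed
   qed
   thus ?thesis unfolding c by (simp add: gcd_mult_distrib_nat[symmetric] coprime_iff_gcd_eq_1)
  qed
  hence "A.ord P dvd beta" using 1 2 by (metis gcd_greatest)
  thus "P:tors E beta" using A.pow_eq_id[of P beta] Pp by (simp add: tors_iff)
 qed
 moreover have "finite (tors E beta)" using finite_torsion[OF E, of beta] frob_pos[OF b(1)] by (simp add: kern_def)
 ultimately have "gamma <= beta" using card_mono[of "tors E beta" "tors E gamma"] b(2) T(3) by simp
 thus False using `~ gamma <= beta` by simp
qed

lemma vmap_emul_ppart:
 assumes E: "elliptic_curve E" and b: "frob beta" "card (tors E beta) = beta" and N: "of_nat N ~= (0::'a)"
 shows "vmap E E (emul E (beta * N)) 1 beta"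
proof -
 have b0: "beta > 0" and N0: "N > 0" using frob_pos[OF b(1)] N by (auto intro: Nat.gr0I)
 hence "beta * N > 0" by simp
 then obtain q where q: "vmap E E (emul E (beta * N)) 1 q" "q * card (tors E (beta * N)) = (beta * N)^2"
  using vmap_emul[OF E] by blast
 have "q * (beta * N^2) = beta * (beta * N^2)"
  using q(2) unfolding card_tors_mult[OF E b0 N0] b(2) card_tors_good(1)[OF E N] by (simp add: ring_pow)
 hence "q = beta" using b0 N0 by simp
 thus ?thesis using q by simp
qed

section \<open>Dual maps\<close>

text \<open>
  Summing the trace formula of psi over the cosets of its kernel in the n-torsion compares it
  with the trace formula of multiplication by n; this gives the trace formula of the dual map.
\<close>
lemma vmap_dual:
 assumes E: "elliptic_curve E" and E': "elliptic_curve E'" and psi: "vmap E E' psi q r"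
  and n: "n > 0" and ker: "kern E psi <= tors E n" and vn: "vmap E E (emul E n) 1 s"
 shows "EX delta. vmap E' E delta r (q * s) & (ALL P:points E. delta (psi P) = emul E n P)"
proof -
 have sh: "surj_hom E E' psi" and finW: "finite (kern E psi)" and fq: "frob q" "frob r"
  using psi unfolding vmap_def by auto
 obtain C D where CD: "C ~= 0" "!!P. P:points E - kern E psi ==> xfun (psi P) ^ q = C * tsum E (kern E psi) P ^ r + D"
  using psi unfolding vmap_def by blast
 obtain c d where cd: "c ~= 0" "!!P. P:points E - tors E n ==> xfun (emul E n P) = c * tsum E (tors E n) P ^ s + d"
  using vn unfolding vmap_def by auto
 have fs: "frob s" using vn unfolding vmap_def by blast
 note hom = surj_hom_basic[OF E E' sh]
 interpret A: comm_group "egroup E" by (rule egroup_comm_group[OF E])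
 let ?W = "kern E psi" let ?T = "tors E n"
 have finT: "finite ?T" using finite_torsion[OF E n] by (simp add: kern_def)
 have Wp: "Q:points E" "psi Q = Infty" if "Q:?W" for Q using that by (auto simp: kern_def)
 have Tp: "Q:points E" "emul E n Q = Infty" if "Q:?T" for Q using that by (auto simp: kern_def)
 note coset = fibre_kern(1)[OF E E' sh]
 have welldef: "emul E n R = emul E n P" if "P:points E" "R:points E" "psi R = psi P" for P R
 proof -
  have "R:(%Q. eadd E P Q) ` ?W" using coset[OF that(1)] that by blast
  then obtain Q where "Q:?W" "R = eadd E P Q" by blast
  thus ?thesis using ker Tp[of Q] that(1) E by (auto simp: emul_eadd)
 qed
 define delta where "delta S = emul E n (SOME P. P:points E & psi P = S)" for S
 have delta: "delta (psi P) = emul E n P" if P: "P:points E" for P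
 proof -
  have "(SOME R. R:points E & psi R = psi P):points E & psi (SOME R. R:points E & psi R = psi P) = psi P"
   by (rule someI[of _ P]) (use P in simp)
  thus ?thesis unfolding delta_def using welldef P by blast
 qed
 have surj: "EX P:points E. S = psi P" if "S:points E'" for S using that sh unfolding surj_hom_def by blast
 have shdelta: "surj_hom E' E delta"
  unfolding surj_hom_def
 proof (intro conjI ballI)
  have "delta ` points E' = emul E n ` points E"
   using sh delta unfolding surj_hom_def by (metis (no_types, lifting) image_cong image_image)
  thus "delta ` points E' = points E" using surj_hom_emul[OF E n] unfolding surj_hom_def by simp
  fix S R assume "S:points E'" "R:points E'"
  then obtain P Q where "P:points E" "S = psi P" "Q:points E" "R = psi Q" using surj by metis
  thus "delta (eadd E' S R) = eadd E (delta S) (delta R)"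
   using hom(4)[of P Q] delta[of "eadd E P Q"] delta[of P] delta[of Q] E by (simp add: emul_eadd)
 qed
 have kerdelta: "kern E' delta = psi ` ?T"
 proof (intro equalityI subsetI)
  fix S assume S: "S:kern E' delta"
  then obtain P where "P:points E" "S = psi P" using surj unfolding kern_def by blast
  thus "S:psi ` ?T" using S delta by (auto simp: kern_def)
 qed (use delta hom(2) in "auto simp: kern_def")
 define K where "K = of_nat (card (psi ` ?T)) * D"
 have key: "tsum E' (psi ` ?T) (psi P) ^ q = C * tsum E ?T P ^ r + K" if P: "P:points E" "P ~: ?T" for P
 proof -
  have one: "xfun (eadd E' (psi P) S) ^ q = C * (SUM R:{R:?T. psi R = S}. xfun (eadd E P R)) ^ r + D"
   if "S:psi ` ?T" for S
  proof -
   from that obtain R where R: "R:?T" "S = psi R" by blast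
   have PR: "eadd E P R:points E" using P R Tp by simp
   have "emul E n (eadd E P R) ~= Infty" using P R Tp[OF R(1)] E by (simp add: emul_eadd tors_iff)
   hence "eadd E P R ~: ?W" using ker Tp by blast
   hence 1: "xfun (psi (eadd E P R)) ^ q = C * tsum E ?W (eadd E P R) ^ r + D" using CD(2) PR by blast
   have set: "{R':?T. psi R' = S} = (%Q. eadd E R Q) ` ?W"
   proof -
    have "R':?T" if "R':points E" "psi R' = psi R" for R'
     using welldef[OF Tp(1)[OF R(1)] that] that(1) Tp(2)[OF R(1)] unfolding tors_iff by simp
    hence "{R':?T. psi R' = S} = {R':points E. psi R' = psi R}"
     using Tp(1) unfolding R(2) by blast
    thus ?thesis using coset Tp R by simp
   qed
   note inj = fibre_kern(2)[OF E E' sh Tp(1)[OF R(1)]]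
   have "(SUM R':{R':?T. psi R' = S}. xfun (eadd E P R')) = (SUM Q:?W. xfun (eadd E P (eadd E R Q)))"
    unfolding set by (rule sum.reindex_cong[OF inj refl]) simp
   also have "... = tsum E ?W (eadd E P R)"
    unfolding tsum_def by (intro sum.cong refl) (use P R Tp Wp in "simp add: eadd_assoc[OF E]")
   finally show ?thesis using 1 hom(4)[of P R] P R Tp by simp
  qed
  have "tsum E' (psi ` ?T) (psi P) ^ q = (SUM S:psi ` ?T. xfun (eadd E' (psi P) S) ^ q)"
   unfolding tsum_def by (rule frob_sum[OF fq(1)])
  also have "... = (SUM S:psi ` ?T. C * (SUM R:{R:?T. psi R = S}. xfun (eadd E P R)) ^ r + D)"
   by (intro sum.cong refl one)
  also have "... = C * (SUM S:psi ` ?T. (SUM R:{R:?T. psi R = S}. xfun (eadd E P R))) ^ r + K"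
   unfolding K_def sum.distrib frob_sum[OF fq(2)] by (simp add: sum_distrib_left)
  also have "(SUM S:psi ` ?T. (SUM R:{R:?T. psi R = S}. xfun (eadd E P R))) = tsum E ?T P"
   unfolding tsum_def by (rule sum.image_gen[OF finT, symmetric])
  finally show ?thesis .
 qed
 have main: "xfun (delta S) ^ r = (c ^ r / C ^ s) * tsum E' (kern E' delta) S ^ (q * s) + (d ^ r - c ^ r * K ^ s / C ^ s)"
  if S: "S:points E' - kern E' delta" for S
 proof -
  obtain P where P: "P:points E" "S = psi P" using S surj by blast
  have PT: "P ~: ?T" using S P unfolding kerdelta by blast
  have "xfun (delta S) ^ r = (c * tsum E ?T P ^ s + d) ^ r" using cd(2) P PT delta by simp
  also have "... = c ^ r * (tsum E ?T P ^ r) ^ s + d ^ r"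
   by (simp add: frob_add[OF fq(2)] power_mult_distrib mult.commute flip: power_mult)
  also have "tsum E ?T P ^ r = (tsum E' (psi ` ?T) S ^ q - K) / C" using key[OF P(1) PT] P(2) CD(1) by simp
  also have "((tsum E' (psi ` ?T) S ^ q - K) / C) ^ s = (tsum E' (psi ` ?T) S ^ (q * s) - K ^ s) / C ^ s"
   by (simp add: power_divide frob_diff[OF fs] power_mult)
  finally show ?thesis unfolding kerdelta by (simp add: diff_divide_distrib right_diff_distrib)
 qed
 have "vmap E' E delta r (q * s)"
  unfolding vmap_def using shdelta finT fq frob_mult[OF fq(1) fs] main cd(1) CD(1)
  by (intro conjI exI[of _ "c ^ r / C ^ s"] exI[of _ "d ^ r - c ^ r * K ^ s / C ^ s"]) (auto simp: kerdelta)
 thus ?thesis using delta by blast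
qed

end

section \<open>Valuation rings\<close>

definition is_subring :: "'a::field set => bool" where
 "is_subring R <-> 1:R & (ALL x:R. ALL y:R. x - y:R & x * y:R)"

definition is_ideal :: "'a::field set => 'a set => bool" where
 "is_ideal R I <-> I <= R & 0:I & (ALL x:I. ALL y:I. x + y:I) & (ALL r:R. ALL x:I. r * x:I)"

definition valring :: "'a::field set => 'a set => bool" where
 "valring k V <-> k <= V & is_subring V & (ALL x. x:V | inverse x:V)"

text \<open>The maximal ideal of a valuation ring.\<close>
definition nonunits :: "'a::field set => 'a set" where
 "nonunits V = {x:V. x = 0 | inverse x ~: V}"

lemma subringD:
 assumes "is_subring R"
 shows "1:R" "0:R" "x:R ==> y:R ==> x * y:R" "x:R ==> y:R ==> x + y:R"
  "x:R ==> - x:R" "x:R ==> y:R ==> x - y:R"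
proof -
 note d = assms[unfolded is_subring_def]
 show "1:R" using d by blast
 show m: "x:R ==> y:R ==> x * y:R" for x y using d by blast
 show s: "x:R ==> y:R ==> x - y:R" for x y using d by blast
 have "1 - 1:R" using d by blast
 thus z: "0:R" by simp
 show u: "x:R ==> - x:R" for x using s[of 0 x] z by simp
 show "x:R ==> y:R ==> x + y:R" using s[of x "- y"] u[of y] by simp
qed

lemma subring_power: "is_subring R ==> x:R ==> x ^ n:R"
 by (induction n) (auto intro: subringD)
lemma subring_sum: "is_subring R ==> (!!i. i:I ==> f i:R) ==> (SUM i:I. f i):R"
 by (induction I rule: infinite_finite_induct) (auto intro: subringD)
lemma subring_of_nat: "is_subring R ==> of_nat n:R"
 by (induction n) (auto intro: subringD)
lemma subring_numeral: "is_subring R ==> numeral n:R"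
 using subring_of_nat[of R "numeral n"] by simp

lemma idealD:
 assumes "is_ideal R I"
 shows "x:I ==> x:R" "0:I" "x:I ==> y:I ==> x + y:I" "r:R ==> x:I ==> r * x:I"
 using assms unfolding is_ideal_def by auto

lemma ideal_sum: "is_ideal R I ==> (!!i. i:J ==> f i:I) ==> (SUM i:J. f i):I"
 by (induction J rule: infinite_finite_induct) (auto dest: idealD)

lemma ideal_diff: "is_subring R ==> is_ideal R I ==> x:I ==> y:I ==> x - y:I"
 using idealD(3)[of R I x "- 1 * y"] idealD(4)[of R I "- 1" y] subringD(1,5)[of R] by auto

lemma valringD:
 assumes "valring k V"
 shows "is_subring V" "k <= V" "x ~: V ==> inverse x:V" "x ~: V ==> inverse x:nonunits V"
 using assms subringD(2)[of V] unfolding valring_def nonunits_def by auto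

lemma nonunits_ideal:
 assumes "valring k V" shows "is_ideal V (nonunits V)" "1 ~: nonunits V"
proof -
 note R = valringD(1)[OF assms]
 show "1 ~: nonunits V" unfolding nonunits_def using subringD(1)[OF R] by simp
 have mult: "r * x:nonunits V" if "r:V" "x:nonunits V" for r x
 proof -
  have "x = 0 | r = 0 | inverse (r * x) ~: V"
  proof (rule ccontr)
   assume n: "~ (x = 0 | r = 0 | inverse (r * x) ~: V)"
   hence "r * inverse (r * x):V" using subringD(3)[OF R that(1)] by blast
   moreover have "r * inverse (r * x) = inverse x" using n by (simp add: field_simps)
   ultimately have "inverse x:V" by (rule back_subst[of "%t. t:V"])
   thus False using that(2) n unfolding nonunits_def by auto
  qed
  thus ?thesis using that subringD(3)[OF R] subringD(2)[OF R] unfolding nonunits_def by auto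
 qed
 have add: "x + y:nonunits V" if xy: "x:nonunits V" "y:nonunits V" for x y
 proof -
  have *: "x + y:nonunits V" if "x:nonunits V" "y:nonunits V" "y ~= 0" "x / y:V" for x y
  proof -
   have "x + y = (x / y + 1) * y" using that by (simp add: field_simps)
   thus ?thesis using mult[of "x / y + 1" y] subringD(4)[OF R that(4) subringD(1)[OF R]] that by simp
  qed
  show ?thesis
  proof (cases "x = 0 | y = 0")
   case True thus ?thesis using xy by auto
  next
   case False
   have "x / y:V | inverse (x / y):V" using assms unfolding valring_def by blast
   thus ?thesis using *[OF xy] *[OF xy(2,1)] False by (auto simp: add.commute)
  qed
 qed
 show "is_ideal V (nonunits V)"
  unfolding is_ideal_def using add mult subringD(2)[OF R] by (auto simp: nonunits_def)
qed

lemma valring_cases: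
 assumes "valring k V" "x:V" "x ~: nonunits V" shows "inverse x:V" "x ~= 0"
 using assms subringD(2) unfolding nonunits_def by auto

lemma valring_root:
 assumes V: "valring k V" and n: "n > 0" and x: "x ^ n:V" shows "x:V"
proof (rule ccontr)
 assume nx: "x ~: V"
 note I = nonunits_ideal[OF V]
 have i: "inverse x:nonunits V" using valringD(4)[OF V nx] .
 have "inverse x ^ Suc m:nonunits V" for m
  by (induction m) (use i idealD(1,4)[OF I(1)] in auto)
 hence "inverse x ^ n:nonunits V" using n by (metis gr0_implies_Suc)
 hence "x ^ n * inverse x ^ n:nonunits V" using idealD(4)[OF I(1) x] by blast
 moreover have "x ~= 0" using nx subringD(2)[OF valringD(1)[OF V]] by auto
 ultimately show False using I(2) by (simp flip: power_mult_distrib)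
qed

text \<open>
  Chevalley's extension theorem for an ideal with two generators: a subring that is maximal among
  those in which p and q generate a proper ideal \<open>I\<close> is a valuation ring.  If
  neither x nor its inverse belongs to it, then 1 is a polynomial in x and also one in its
  inverse with coefficients in \<open>I\<close>; of two such equations of least degree each can be used to
  shorten the other, because elements of \<open>1 + I\<close> are units.
\<close>
theorem chevalley:
 fixes A :: "'a::field set"
 assumes "is_subring A" "k <= A" "p:A" "q:A" "!!a b. a:A ==> b:A ==> a * p + b * q ~= 1"
 shows "EX V. valring k V & p:nonunits V & q:nonunits V"
proof -
 define F where "F = {R. is_subring R & A <= R & (ALL a:R. ALL b:R. a * p + b * q ~= 1)}"
 have "F ~= {}" using assms unfolding F_def by blast
 moreover have "\<Union>C:F" if C: "C ~= {}" "subset.chain F C" for C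
 proof -
  have CF: "is_subring Z" "A <= Z" "!!a b. a:Z ==> b:Z ==> a * p + b * q ~= 1" if "Z:C" for Z
   using C that unfolding subset.chain_def F_def by blast+
  have two: "EX Z:C. a:Z & b:Z" if "a:\<Union>C" "b:\<Union>C" for a b
   using C that unfolding subset.chain_def by blast
  have "a - b:\<Union>C & a * b:\<Union>C & a * p + b * q ~= 1" if "a:\<Union>C" "b:\<Union>C" for a b
   using two[OF that] CF(3) subringD(3,6)[OF CF(1)] by blast
  thus ?thesis using C(1) CF(2) subringD(1)[OF CF(1)] unfolding F_def is_subring_def by blast
 qed
 ultimately obtain V where "V:F" and max: "!!Y. Y:F ==> V <= Y ==> Y = V"
  using subset_Zorn_nonempty[of F] by auto
 hence V: "is_subring V" and sup: "A <= V" and no: "!!a b. a:V ==> b:V ==> a * p + b * q ~= 1"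
  unfolding F_def by auto
 note VD = subringD[OF V]
 have pq: "p:V" "q:V" using assms(3,4) sup by auto
 define I where "I = {a * p + b * q | a b. a:V & b:V}"
 have I: "is_ideal V I"
  unfolding is_ideal_def
 proof (intro conjI ballI subsetI)
  show "x:V" if "x:I" for x using that VD(3,4) pq unfolding I_def by blast
  show "0:I" unfolding I_def using VD(2) by (intro CollectI exI[of _ 0]) auto
  fix y assume y: "y:I"
  then obtain c d where y: "y = c * p + d * q" "c:V" "d:V" unfolding I_def by blast
  show "x + y:I" if "x:I" for x
  proof -
   from that obtain a b where "x = a * p + b * q" "a:V" "b:V" unfolding I_def by blast
   thus ?thesis unfolding I_def y(1) using VD(4) y
    by (intro CollectI exI[of _ "a + c"] exI[of _ "b + d"]) (auto simp: algebra_simps)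
  qed
  show "r * y:I" if "r:V" for r unfolding I_def y(1) using VD(3) y that
   by (intro CollectI exI[of _ "r * c"] exI[of _ "r * d"]) (auto simp: algebra_simps)
 qed
 have I1: "1 ~: I" using no unfolding I_def by force
 have ext: "EX f. (ALL i. coeff f i:I) & poly f x = 1" if x: "x ~: V" for x
 proof -
  define R where "R = {poly f x | f. ALL i. coeff f i:V}"
  have R: "is_subring R"
   unfolding is_subring_def
  proof (intro conjI ballI)
   show "1:R" unfolding R_def using VD(1,2) by (intro CollectI exI[of _ 1]) (auto simp: coeff_1)
   fix a b assume "a:R" "b:R"
   then obtain f g where fg: "a = poly f x" "b = poly g x" "!!i. coeff f i:V" "!!i. coeff g i:V"
    unfolding R_def by blast
   show "a - b:R" unfolding R_def fg(1,2)
    by (intro CollectI exI[of _ "f - g"]) (auto intro: VD(6) fg)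
   show "a * b:R" unfolding R_def fg(1,2)
    by (intro CollectI exI[of _ "f * g"]) (auto simp: coeff_mult intro!: subring_sum[OF V] VD(3) fg)
  qed
  have "v:R" if "v:V" for v unfolding R_def using that VD(2)
   by (intro CollectI exI[of _ "[:v:]"]) (auto simp: coeff_pCons split: nat.split)
  moreover have "x:R" unfolding R_def using VD(1,2)
   by (intro CollectI exI[of _ "[:0, 1:]"]) (auto simp: coeff_pCons split: nat.split)
  ultimately have "R ~: F" using max[of R] x by blast
  then obtain a b where "a:R" "b:R" and 1: "a * p + b * q = 1"
   using R `!!v. v:V ==> v:R` sup unfolding F_def by blast
  then obtain f g where fg: "a = poly f x" "b = poly g x" "!!i. coeff f i:V" "!!i. coeff g i:V"
   unfolding R_def by blast
  have "coeff (smult p f + smult q g) i:I" for i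
   unfolding I_def using fg(3,4)[of i]
   by (intro CollectI exI[of _ "coeff f i"] exI[of _ "coeff g i"]) (simp add: mult.commute)
  moreover have "poly (smult p f + smult q g) x = 1" using 1 fg(1,2) by (simp add: mult.commute)
  ultimately show ?thesis by blast
 qed
 have unit: "inverse u:V" if u: "1 - u:I" for u
 proof (rule ccontr)
  assume n: "inverse u ~: V"
  then obtain f where f: "!!i. coeff f i:I" "poly f (inverse u) = 1" using ext by blast
  have u0: "u ~= 0" using n VD(2) by auto
  have uV: "u:V" using VD(6)[OF VD(1) idealD(1)[OF I u]] by simp
  have "u ^ degree f = u ^ degree f * poly f (inverse u)" using f by simp
  also have "... = (SUM i<=degree f. u ^ (degree f - i) * coeff f i)"
   unfolding poly_altdef sum_distrib_left
   by (intro sum.cong refl) (use u0 in "simp add: power_diff field_simps")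
  also have "...:I" by (intro ideal_sum[OF I] idealD(4)[OF I] subring_power[OF V] uV f)
  finally have pw: "u ^ degree f:I" .
  have "1 - u ^ m:I" for m
  proof (induction m)
   case (Suc m)
   have "1 - u ^ Suc m = (1 - u) + u * (1 - u ^ m)" by (simp add: algebra_simps)
   thus ?case using idealD(3)[OF I u idealD(4)[OF I uV Suc.IH]] by (simp only:)
  qed (use idealD(2)[OF I] in simp)
  from idealD(3)[OF I this[of "degree f"] pw] show False using I1 by simp
 qed
 have step: False
  if f: "!!i. coeff f i:I" "poly f x = 1" and g: "!!i. coeff g i:I" "poly g (inverse x) = 1"
   and x: "x ~= 0" and le: "degree g <= degree f"
   and min: "!!h. (!!i. coeff h i:I) ==> poly h x = 1 ==> degree f <= degree h" for f g x
 proof -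
  define n where "n = degree f"
  have n0: "n > 0"
  proof (rule ccontr)
   assume "~ n > 0"
   hence "degree f = 0" unfolding n_def by simp
   then obtain c where "f = [:c:]" by (metis degree_eq_zeroE)
   thus False using f(2) f(1)[of 0] I1 by simp
  qed
  define v where "v = 1 - coeff g 0"
  have v: "inverse v:V" "v ~= 0" using unit[of v] g(1)[of 0] I1 unfolding v_def by auto
  define w where "w = coeff f n * inverse v"
  have wV: "w:V" unfolding w_def using idealD(1)[OF I f(1)] v(1) by (rule subringD(3)[OF V])
  define h where "h = f - monom (coeff f n) n + (SUM j:{1..degree g}. monom (w * coeff g j) (n - j))"
  have hI: "coeff h i:I" for i
  proof -
   have "coeff (monom (coeff f n) n) i:I" using f(1) idealD(2)[OF I] by simp
   moreover have "coeff (SUM j:{1..degree g}. monom (w * coeff g j) (n - j)) i:I"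
    unfolding coeff_sum using idealD(2,4)[OF I] wV g(1) by (intro ideal_sum[OF I]) simp
   ultimately show ?thesis unfolding h_def using idealD(3)[OF I] ideal_diff[OF V I(1)] f(1) by simp
  qed
  have "poly g (inverse x) = coeff g 0 + (SUM j:{1..degree g}. coeff g j * inverse x ^ j)"
   unfolding poly_altdef by (simp add: atMost_atLeast0 sum.atLeast_Suc_atMost)
  hence gs: "(SUM j:{1..degree g}. coeff g j * inverse x ^ j) = v" using g(2) unfolding v_def by (metis add_diff_cancel_left')
  have "poly (SUM j:{1..degree g}. monom (w * coeff g j) (n - j)) x = (SUM j:{1..degree g}. w * x ^ n * (coeff g j * inverse x ^ j))"
   unfolding poly_sum poly_monom
   by (intro sum.cong refl) (use le x in "auto simp: n_def power_diff field_simps")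
  also have "... = w * x ^ n * v" unfolding sum_distrib_left[symmetric] gs ..
  also have "... = coeff f n * x ^ n" unfolding w_def using v(2) by simp
  finally have "poly h x = 1" unfolding h_def using f(2) by (simp add: poly_monom)
  hence "n <= degree h" using min[OF hI] unfolding n_def by blast
  moreover have "degree h < n"
  proof -
   have "degree (f - monom (coeff f n) n) < n"
   proof (rule degree_lessI)
    show "f - monom (coeff f n) n ~= 0 | 0 < n" using n0 by simp
    show "ALL i>=n. coeff (f - monom (coeff f n) n) i = 0" by (auto simp: n_def coeff_eq_0)
   qed
   moreover have "degree (SUM j:{1..degree g}. monom (w * coeff g j) (n - j)) < n"
    by (rule degree_sum_less) (use n0 in "auto intro: le_less_trans[OF degree_monom_le]")
   ultimately show ?thesis unfolding h_def by (rule degree_add_less)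
  qed
  ultimately show False by simp
 qed
 have dich: "x:V | inverse x:V" for x
 proof (rule ccontr)
  assume n: "~ (x:V | inverse x:V)"
  hence x0: "x ~= 0" using VD(2) by auto
  let ?P = "%z f. (ALL i. coeff f i:I) & poly f z = 1"
  have exm: "EX f. ?P z f & (ALL h. ?P z h --> degree f <= degree h)" if "z ~: V" for z
   using ext[OF that] ex_has_least_nat[of "?P z" _ degree] by blast
  obtain f where f: "?P x f" "ALL h. ?P x h --> degree f <= degree h" using exm n by blast
  obtain g where g: "?P (inverse x) g" "ALL h. ?P (inverse x) h --> degree g <= degree h" using exm n by blast
  show False
  proof (cases "degree g <= degree f")
   case True thus ?thesis using step[of f x g] f g x0 by blast
  next
   case False thus ?thesis using step[of g "inverse x" f] f g x0 by auto
  qed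
 qed
 have "z:nonunits V" if z: "z:I" for z
  using idealD(4)[OF I, of "inverse z" z] z I1 idealD(1)[OF I z] unfolding nonunits_def by auto
 moreover have "p:I" unfolding I_def using VD(1,2) by (intro CollectI exI[of _ 1] exI[of _ 0]) simp
 moreover have "q:I" unfolding I_def using VD(1,2) by (intro CollectI exI[of _ 0] exI[of _ 1]) simp
 moreover have "valring k V" unfolding valring_def using assms(2) sup V dich by blast
 ultimately show ?thesis by blast
qed

text \<open>
  Graded integrality: s satisfies a monic equation whose coefficient of \<open>s ^ a\<close> is a polynomial
  over k in j of degree at most \<open>m - a\<close>.
\<close>
definition graded_integral :: "'a::field set => 'a => 'a => bool" where
 "graded_integral k j s <-> (EX m P. s ^ m = (SUM a<m. s ^ a * poly (P a) j) &
  (ALL a<m. (ALL i. coeff (P a) i:k) & degree (P a) + a <= m))"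

text \<open>The values at \<open>(s, j)\<close> of the polynomials of total degree at most m.\<close>
primrec values_of_degree :: "'a::field set => 'a => 'a => nat => 'a set" where
 "values_of_degree k j s 0 = k"
| "values_of_degree k j s (Suc m) = {x + s * y + j * z | x y z. x:values_of_degree k j s m &
  y:values_of_degree k j s m & z:values_of_degree k j s m}"

lemma values_of_degreeD:
 assumes "x:values_of_degree k j s m" "is_subring k"
 shows "EX P. x = (SUM a<=m. s ^ a * poly (P a) j) & (ALL a<=m. (ALL i. coeff (P a) i:k) & degree (P a) + a <= m)"
 using assms(1)
proof (induction m arbitrary: x)
 case 0
 thus ?case using subringD(2)[OF assms(2)]
  by (intro exI[of _ "%_. [:x:]"]) (auto simp: coeff_pCons split: nat.split)
next
 case (Suc m)
 let ?r = "%x P. x = (SUM a<=m. s ^ a * poly (P a) j) & (ALL a<=m. (ALL i. coeff (P a) i:k) & degree (P a) + a <= m)"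
 obtain x1 y z where x: "x = x1 + s * y + j * z" and m: "x1:values_of_degree k j s m" "y:values_of_degree k j s m"
  "z:values_of_degree k j s m" using Suc.prems by auto
 obtain P where P: "?r x1 P" using Suc.IH[OF m(1)] by blast
 obtain Q where Q: "?r y Q" using Suc.IH[OF m(2)] by blast
 obtain R where R: "?r z R" using Suc.IH[OF m(3)] by blast
 define T where "T = (%a. (if a <= m then P a + pCons 0 (R a) else 0) + (if a = 0 then 0 else Q (a - 1)))"
 have "(SUM a<=Suc m. s ^ a * poly (T a) j) = (SUM a<=Suc m. s ^ a * poly (if a <= m then P a + pCons 0 (R a) else 0) j)
   + (SUM a<=Suc m. s ^ a * poly (if a = 0 then 0 else Q (a - 1)) j)"
  unfolding T_def by (simp add: algebra_simps sum.distrib)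
 also have "(SUM a<=Suc m. s ^ a * poly (if a = 0 then 0 else Q (a - 1)) j) = s * y"
  unfolding sum.atMost_Suc_shift using Q by (simp add: sum_distrib_left mult_ac)
 also have "(SUM a<=Suc m. s ^ a * poly (if a <= m then P a + pCons 0 (R a) else 0) j) = x1 + j * z"
  using P R by (simp add: algebra_simps sum.distrib sum_distrib_left)
 finally have "x = (SUM a<=Suc m. s ^ a * poly (T a) j)" unfolding x by simp
 moreover have "coeff (T a) i:k" if "a <= Suc m" for a i
  using that P Q R subringD(2,4)[OF assms(2)] unfolding T_def by (auto simp: coeff_pCons split: nat.split)
 moreover have "degree (T a) <= Suc m - a" if "a <= Suc m" for a
  unfolding T_def
 proof (rule degree_add_le)
  have "degree (P a) + a <= m" "degree (pCons 0 (R a)) + a <= Suc m" if "a <= m"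
   using that P R degree_pCons_le[of 0 "R a"] by force+
  thus "degree (if a <= m then P a + pCons 0 (R a) else 0) <= Suc m - a" by (auto intro!: degree_add_le)
  have "degree (Q (a - 1)) + (a - 1) <= m" if "a ~= 0" using Q `a <= Suc m` by auto
  thus "degree (if a = 0 then 0 else Q (a - 1)) <= Suc m - a" by auto
 qed
 ultimately show ?case by (intro exI[of _ T]) force
qed

lemma values_of_degree_closed:
 assumes k: "is_subring k"
 shows "0:values_of_degree k j s m" "x:values_of_degree k j s m ==> x:values_of_degree k j s (Suc m)"
  "x:values_of_degree k j s m ==> y:values_of_degree k j s m ==> x - y:values_of_degree k j s m"
  "x:values_of_degree k j s m ==> y:values_of_degree k j s m ==> x + y:values_of_degree k j s m"
  "x:values_of_degree k j s m ==> y:values_of_degree k j s n ==> x * y:values_of_degree k j s (m + n)"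
  "s ^ m:values_of_degree k j s m"
proof -
 let ?L = "values_of_degree k j s"
 have mk: "x:?L m ==> y:?L m ==> z:?L m ==> x + s * y + j * z:?L (Suc m)" for x y z m by auto
 show 0: "0:?L m" for m by (induction m) (use subringD(2)[OF k] in force)+
 show up: "x:?L m ==> x:?L (Suc m)" for x m using 0 by force
 show d: "x:?L m ==> y:?L m ==> x - y:?L m" for x y m
 proof (induction m arbitrary: x y)
  case (Suc m)
  then obtain a b c a' b' c' where e: "x = a + s * b + j * c" "y = a' + s * b' + j * c'" and "a:?L m" "b:?L m" "c:?L m"
   "a':?L m" "b':?L m" "c':?L m" by auto
  hence "(a - a') + s * (b - b') + j * (c - c'):?L (Suc m)" using Suc.IH by (intro mk)
  thus ?case unfolding e by (simp only: algebra_simps)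
 qed (use subringD(6)[OF k] in auto)
 show p: "x:?L m ==> y:?L m ==> x + y:?L m" for x y m using d[of x m "0 - y"] d[OF 0, of y m] by simp
 have z: "x:k ==> y:?L n ==> x * y:?L n" for x y n
 proof (induction n arbitrary: y)
  case (Suc n)
  then obtain a b c where e: "y = a + s * b + j * c" and "a:?L n" "b:?L n" "c:?L n" by auto
  hence "x * a + s * (x * b) + j * (x * c):?L (Suc n)" using Suc by (intro mk)
  thus ?case unfolding e by (simp only: algebra_simps)
 qed (use subringD(3)[OF k] in auto)
 show "x:?L m ==> y:?L n ==> x * y:?L (m + n)" for x y
 proof (induction m arbitrary: x)
  case (Suc m)
  then obtain a b c where e: "x = a + s * b + j * c" and "a:?L m" "b:?L m" "c:?L m" by auto
  hence "a * y + s * (b * y) + j * (c * y):?L (Suc (m + n))" using Suc by (intro mk)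
  thus ?case unfolding e add_Suc by (simp only: distrib_right mult.assoc)
 qed (use z in auto)
 show "s ^ m:?L m" using subringD(1)[OF k] 0 by (induction m) force+
qed

text \<open>
  The fractions \<open>f / s ^ m\<close> with f a polynomial in s and j of degree at most m form a
  ring.  If \<open>1 / s\<close> and \<open>j / s\<close> generate a proper ideal in it, some valuation ring has both in its
  maximal ideal, against the hypothesis; otherwise the expression of 1 is the equation sought.
\<close>
lemma graded_integralI:
 fixes k :: "'a::field set"
 assumes k: "is_subring k" and V: "!!V. valring k V ==> (j:V --> s:V) & (j ~: V --> s / j:V)"
 shows "graded_integral k j s"
proof (cases "s = 0")
 case True
 thus ?thesis unfolding graded_integral_def using subringD(2)[OF k]
  by (intro exI[of _ 1] exI[of _ "%_. 0"]) auto
next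
 case s0: False
 let ?L = "values_of_degree k j s"
 note L = values_of_degree_closed[OF k, where j = j and s = s]
 define A where "A = {z. EX m. z * s ^ m:?L m}"
 have common: "x * s ^ (m + n):?L (m + n)" "y * s ^ (m + n):?L (m + n)"
  if "x * s ^ m:?L m" "y * s ^ n:?L n" for x y m n
  using L(5)[OF that(1) L(6)[of n]] L(5)[OF L(6)[of m] that(2)] by (simp_all add: power_add mult_ac)
 have kA: "k <= A" unfolding A_def by (auto intro: exI[of _ 0])
 have A: "is_subring A"
  unfolding is_subring_def
 proof (intro conjI ballI)
  show "1:A" using kA subringD(1)[OF k] by blast
  fix x y assume "x:A" "y:A"
  then obtain m n where mn: "x * s ^ m:?L m" "y * s ^ n:?L n" unfolding A_def by blast
  have "(x - y) * s ^ (m + n):?L (m + n)" using L(3)[OF common[OF mn]] by (simp add: left_diff_distrib)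
  moreover have "(x * y) * s ^ (m + n):?L (m + n)" using L(5)[OF mn] by (simp add: power_add mult_ac)
  ultimately show "x - y:A" "x * y:A" unfolding A_def by blast+
 qed
 have "1 / s * s ^ 1:?L 1" "j / s * s ^ 1:?L 1" using s0 subringD(1,2)[OF k] by force+
 hence in_A: "1 / s:A" "j / s:A" unfolding A_def by blast+
 have "EX a:A. EX b:A. a * (1 / s) + b * (j / s) = 1"
 proof (rule ccontr)
  assume "~ ?thesis"
  then obtain W where W: "valring k W" and n: "1 / s:nonunits W" "j / s:nonunits W"
   using chevalley[OF A kA in_A] by blast
  note I = nonunits_ideal[OF W(1)]
  show False
  proof (cases "j:W")
   case True
   hence "s * (1 / s):nonunits W" using V[OF W(1)] idealD(4)[OF I(1)] n(1) by blast
   thus False using I(2) s0 by simp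
  next
   case False
   hence "(s / j) * (j / s):nonunits W" using V[OF W(1)] idealD(4)[OF I(1)] n(2) by blast
   moreover have "j ~= 0" using False subringD(2)[OF valringD(1)[OF W(1)]] by auto
   ultimately show False using I(2) s0 by simp
  qed
 qed
 then obtain a b m n where ab: "a * s ^ m:?L m" "b * s ^ n:?L n" and 1: "a * (1 / s) + b * (j / s) = 1"
  unfolding A_def by blast
 define N where "N = m + n"
 have cN: "a * s ^ N:?L N" "b * s ^ N:?L N" using common[OF ab] unfolding N_def by auto
 obtain P where P: "a * s ^ N = (SUM i<=N. s ^ i * poly (P i) j)" "ALL i<=N. (ALL l. coeff (P i) l:k) & degree (P i) + i <= N"
  using values_of_degreeD[OF cN(1) k] by blast
 obtain Q where Q: "b * s ^ N = (SUM i<=N. s ^ i * poly (Q i) j)" "ALL i<=N. (ALL l. coeff (Q i) l:k) & degree (Q i) + i <= N"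
  using values_of_degreeD[OF cN(2) k] by blast
 have "s ^ Suc N = s ^ Suc N * (a * (1 / s) + b * (j / s))" unfolding 1 by simp
 also have "... = a * s ^ N + j * (b * s ^ N)" using s0 by (simp add: field_simps)
 also have "... = (SUM i<Suc N. s ^ i * poly (P i + pCons 0 (Q i)) j)"
  unfolding P(1) Q(1) by (simp add: lessThan_Suc_atMost algebra_simps sum.distrib sum_distrib_left)
 finally have "s ^ Suc N = ..." .
 moreover have "coeff (P i + pCons 0 (Q i)) l:k" if "i < Suc N" for i l
  using that P(2) Q(2) subringD(2,4)[OF k] by (auto simp: coeff_pCons split: nat.split)
 moreover have "degree (P i + pCons 0 (Q i)) <= Suc N - i" if "i < Suc N" for i
 proof (rule degree_add_le)
  have "degree (P i) + i <= N" "degree (Q i) + i <= N" using P(2) Q(2) that by auto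
  thus "degree (P i) <= Suc N - i" "degree (pCons 0 (Q i)) <= Suc N - i"
   using degree_pCons_le[of 0 "Q i"] by linarith+
 qed
 ultimately show ?thesis unfolding graded_integral_def
  by (intro exI[of _ "Suc N"] exI[of _ "%i. P i + pCons 0 (Q i)"]) force
qed

section \<open>Integrality of torsion points\<close>

lemma q_affine:
 fixes r sigma :: "'a::comm_ring_1"
 assumes "b2 + 12 * r = sigma * B2" "b4 + r * b2 + 6 * r^2 = sigma^2 * B4"
  "b6 + 2 * r * b4 + r^2 * b2 + 4 * r^3 = sigma^3 * B6"
  "b8 + 3 * r * b6 + 3 * r^2 * b4 + r^3 * b2 + 3 * r^4 = sigma^4 * B8"
  and x1: "x1 = sigma * u1 + r * z1" and x2: "x2 = sigma * u2 + r * z2"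
 shows "qS b2 b4 b6 x1 z1 x2 z2 - 2 * r * qD x1 z1 x2 z2 = sigma^3 * qS B2 B4 B6 u1 z1 u2 z2"
  and "qT b4 b6 b8 x1 z1 x2 z2 - r * qS b2 b4 b6 x1 z1 x2 z2 + r^2 * qD x1 z1 x2 z2 = sigma^4 * qT B4 B6 B8 u1 z1 u2 z2"
proof -
 have b2: "b2 = sigma * B2 - 12 * r" using assms(1) by (simp add: algebra_simps)
 have b4: "b4 = sigma^2 * B4 - r * b2 - 6 * r^2" using assms(2) by (simp add: algebra_simps)
 have b6: "b6 = sigma^3 * B6 - 2 * r * b4 - r^2 * b2 - 4 * r^3" using assms(3) by (simp add: algebra_simps)
 have b8: "b8 = sigma^4 * B8 - 3 * r * b6 - 3 * r^2 * b4 - r^3 * b2 - 3 * r^4" using assms(4) by (simp add: algebra_simps)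
 have "qS b2 b4 b6 x1 z1 x2 z2 - 2 * r * qD x1 z1 x2 z2 =
  2 * (sigma * u1)^2 * (sigma * u2) * z2 + 2 * (sigma * u1) * z1 * (sigma * u2)^2 + (b2 + 12 * r) * (sigma * u1) * z1 * (sigma * u2) * z2
  + (b4 + r * b2 + 6 * r^2) * ((sigma * u1) * z2 + (sigma * u2) * z1) * z1 * z2
  + (b6 + 2 * r * b4 + r^2 * b2 + 4 * r^3) * z1^2 * z2^2"
  unfolding qS_def qD_def x1 x2 by (simp add: ring_pow)
 thus "qS b2 b4 b6 x1 z1 x2 z2 - 2 * r * qD x1 z1 x2 z2 = sigma^3 * qS B2 B4 B6 u1 z1 u2 z2"
  unfolding assms(1-3) unfolding qS_def by (simp add: ring_pow)
 have "qT b4 b6 b8 x1 z1 x2 z2 - r * qS b2 b4 b6 x1 z1 x2 z2 + r^2 * qD x1 z1 x2 z2 =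
  (sigma * u1)^2 * (sigma * u2)^2 - (b4 + r * b2 + 6 * r^2) * (sigma * u1) * z1 * (sigma * u2) * z2
  - (b6 + 2 * r * b4 + r^2 * b2 + 4 * r^3) * ((sigma * u1) * z2 + (sigma * u2) * z1) * z1 * z2
  - (b8 + 3 * r * b6 + 3 * r^2 * b4 + r^3 * b2 + 3 * r^4) * z1^2 * z2^2"
  unfolding qS_def qT_def qD_def x1 x2 by (simp add: ring_pow)
 thus "qT b4 b6 b8 x1 z1 x2 z2 - r * qS b2 b4 b6 x1 z1 x2 z2 + r^2 * qD x1 z1 x2 z2 = sigma^4 * qT B4 B6 B8 u1 z1 u2 z2"
  unfolding assms(2-4) unfolding qT_def by (simp add: ring_pow)
qed

context closed_field
begin

definition integral_model :: "'a weierstrass => 'a set => 'a => 'a => bool" where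
 "integral_model E V r sigma <-> sigma ~= 0 &
  (wb2 E + 12 * r) / sigma:V & (wb4 E + r * wb2 E + 6 * r^2) / sigma^2:V &
  (wb6 E + 2 * r * wb4 E + r^2 * wb2 E + 4 * r^3) / sigma^3:V &
  (wb8 E + 3 * r * wb6 E + 3 * r^2 * wb4 E + r^3 * wb2 E + 3 * r^4) / sigma^4:V"

text \<open>
  If \<open>x P\<close> is not integral, then \<open>w = 1 / x\<close> satisfies \<open>w (n P) = w (P) (n\<^sup>2 + epsilon)\<close> with \<open>epsilon\<close> in the
  maximal ideal, by the recursion for \<open>w ((n + 1) P) + w ((n - 1) P)\<close>.
\<close>
theorem torsion_integral:
 assumes E: "elliptic_curve E" and V: "valring k V" and m: "integral_model E V r sigma"
  and P: "P:aff E" and n: "emul E n P = Infty" "of_nat n ~= (0::'a)" "inverse (of_nat n):V"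
 shows "(xfun P - r) / sigma:V"
proof (rule ccontr)
 assume notin: "(xfun P - r) / sigma ~: V"
 note R = valringD(1)[OF V] and I = nonunits_ideal(1)[OF V] and I1 = nonunits_ideal(2)[OF V]
 note rD = subringD[OF R]
 define t where "t = (xfun P - r) / sigma"
 define w where "w = inverse t"
 have wm: "w:nonunits V" unfolding w_def t_def using valringD(4)[OF V notin] .
 have t0: "t ~= 0" using notin rD(2) unfolding t_def by auto
 have w0: "w ~= 0" using t0 unfolding w_def by simp
 have wV: "w:V" using wm idealD(1)[OF I] by blast
 have sigma: "sigma ~= 0" using m unfolding integral_model_def by blast
 define B2 B4 B6 B8 where "B2 = (wb2 E + 12 * r) / sigma" and "B4 = (wb4 E + r * wb2 E + 6 * r^2) / sigma^2"
  and "B6 = (wb6 E + 2 * r * wb4 E + r^2 * wb2 E + 4 * r^3) / sigma^3"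
  and "B8 = (wb8 E + 3 * r * wb6 E + 3 * r^2 * wb4 E + r^3 * wb2 E + 3 * r^4) / sigma^4"
 have B: "B2:V" "B4:V" "B6:V" "B8:V"
  using m unfolding integral_model_def B2_def B4_def B6_def B8_def by auto
 have Beq: "wb2 E + 12 * r = sigma * B2" "wb4 E + r * wb2 E + 6 * r^2 = sigma^2 * B4"
  "wb6 E + 2 * r * wb4 E + r^2 * wb2 E + 4 * r^3 = sigma^3 * B6"
  "wb8 E + 3 * r * wb6 E + 3 * r^2 * wb4 E + r^3 * wb2 E + 3 * r^4 = sigma^4 * B8"
  unfolding B2_def B4_def B6_def B8_def using sigma by auto
 define u where "u Q = (xnum Q - r * xden Q) / sigma" for Q :: "'a epoint"
 have xu: "xnum Q = sigma * u Q + r * xden Q" for Q unfolding u_def using sigma by simp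
 have Pe: "xnum P = xfun P" "xden P = 1" using P by (cases P; simp)+
 have uP: "u P = t" unfolding u_def t_def Pe by simp
 have Pp: "P:points E" using P by blast
 let ?ok = "%n. u (emul E n P) ~= 0 & (EX v. v - of_nat (n^2):nonunits V & v:V & xden (emul E n P) = w * v * u (emul E n P))"
 have step: "?ok (Suc (Suc n))" if okn: "?ok n" and okS: "?ok (Suc n)" for n
 proof -
  define N where "N = emul E (Suc n) P"
  define S where "S = emul E (Suc (Suc n)) P"
  define Q where "Q = emul E n P"
  have Np: "N:points E" unfolding N_def using Pp E by (rule emul_on_curve[rotated])
  have S: "S = eadd E N P" unfolding S_def N_def by simp
  have Q: "Q = eadd E N (eneg E P)"
   unfolding Q_def N_def using Pp E eadd_assoc[OF E, of "emul E n P" P "eneg E P"] by simp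
  obtain kappa where kappa: "kappa ~= 0" "qD (xnum N) (xden N) (xnum P) (xden P) = kappa * (xden S * xden Q)"
   "qS (wb2 E) (wb4 E) (wb6 E) (xnum N) (xden N) (xnum P) (xden P) = kappa * (xnum S * xden Q + xden S * xnum Q)"
   "qT (wb4 E) (wb6 E) (wb8 E) (xnum N) (xden N) (xnum P) (xden P) = kappa * (xnum S * xnum Q)"
   using biquadratic[OF E Np Pp] unfolding S Q by blast
  define mu where "mu = kappa / sigma^2"
  have mu0: "mu ~= 0" unfolding mu_def using kappa(1) sigma by simp
  note aff = q_affine[OF Beq xu[of N] xu[of P]]
  have qs1: "sigma^3 * qS B2 B4 B6 (u N) (xden N) (u P) (xden P) = kappa * sigma * (u S * xden Q + xden S * u Q)"
   unfolding aff(1)[symmetric] kappa(2,3) unfolding xu[of S] xu[of Q] by (simp add: algebra_simps)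
  have qs: "qS B2 B4 B6 (u N) (xden N) t 1 = mu * (u S * xden Q + xden S * u Q)"
  proof -
   have "sigma * (sigma^2 * qS B2 B4 B6 (u N) (xden N) (u P) (xden P)) = sigma * (kappa * (u S * xden Q + xden S * u Q))"
    using qs1 by (simp add: ring_pow)
   hence "sigma^2 * qS B2 B4 B6 (u N) (xden N) (u P) (xden P) = kappa * (u S * xden Q + xden S * u Q)"
    using sigma mult_left_cancel by blast
   thus ?thesis unfolding mu_def Pe uP using sigma by (simp add: nonzero_eq_divide_eq mult.commute)
  qed
  have qt1: "sigma^4 * qT B4 B6 B8 (u N) (xden N) (u P) (xden P) = kappa * sigma^2 * (u S * u Q)"
   unfolding aff(2)[symmetric] kappa(2-4) unfolding xu[of S] xu[of Q] by (simp add: ring_pow)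
  have qt: "qT B4 B6 B8 (u N) (xden N) t 1 = mu * (u S * u Q)"
  proof -
   have "sigma^2 * (sigma^2 * qT B4 B6 B8 (u N) (xden N) (u P) (xden P)) = sigma^2 * (kappa * (u S * u Q))"
    using qt1 by (simp add: ring_pow)
   hence "sigma^2 * qT B4 B6 B8 (u N) (xden N) (u P) (xden P) = kappa * (u S * u Q)"
    by (rule mult_left_cancel[THEN iffD1, rotated]) (use sigma in simp)
   thus ?thesis unfolding mu_def Pe uP using sigma by (simp add: nonzero_eq_divide_eq mult.commute)
  qed
  obtain v1 where v1: "v1 - of_nat ((Suc n)^2):nonunits V" "v1:V" "xden N = w * v1 * u N" and uN: "u N ~= 0"
   using okS unfolding N_def by blast
  obtain v0 where v0: "v0 - of_nat (n^2):nonunits V" "v0:V" "xden Q = w * v0 * u Q" and uQ: "u Q ~= 0"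
   using okn unfolding Q_def by blast
  define e where "e = w * (B4 * v1 * w + B6 * (v1 + 1) * v1 * w^2 + B8 * v1^2 * w^3)"
  define d where "d = w * (B2 * v1 + B4 * (v1 + 1) * v1 * w + B6 * v1^2 * w^2)"
  have em: "e:nonunits V" and dm: "d:nonunits V"
  proof -
   have "B4 * v1 * w + B6 * (v1 + 1) * v1 * w^2 + B8 * v1^2 * w^3:V"
    "B2 * v1 + B4 * (v1 + 1) * v1 * w + B6 * v1^2 * w^2:V"
    by (intro rD subring_power[OF R] B v1 wV)+
   thus "e:nonunits V" "d:nonunits V" unfolding e_def d_def using idealD(4)[OF I _ wm] by (metis mult.commute)+
  qed
  have tw: "t * w = 1" unfolding w_def using t0 by simp
  have T: "qT B4 B6 B8 (u N) (xden N) t 1 = (u N)^2 * t^2 * (1 - e)"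
  proof -
   have "(u N)^2 * t^2 * (1 - e) = (u N)^2 * (t^2 - B4 * v1 * (t * w)^2 - B6 * (v1 + 1) * v1 * w * (t * w)^2 - B8 * v1^2 * w^2 * (t * w)^2)"
    unfolding e_def by (simp add: ring_pow)
   also have "... = (u N)^2 * (t^2 - B4 * v1 - B6 * (v1 + 1) * v1 * w - B8 * v1^2 * w^2)" unfolding tw by simp
   also have "... = (u N)^2 * (t^2 - B4 * v1 * (t * w) - B6 * (v1 + t * w * v1^2) * w - B8 * v1^2 * w^2)"
    unfolding tw by (simp add: ring_pow)
   also have "... = qT B4 B6 B8 (u N) (xden N) t 1"
    unfolding qT_def v1(3) by (simp add: ring_pow)
   finally show ?thesis ..
  qed
  have S': "qS B2 B4 B6 (u N) (xden N) t 1 = (u N)^2 * t^2 * w * (2 * (v1 + 1) + d)"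
  proof -
   have "(u N)^2 * t^2 * w * (2 * (v1 + 1) + d) = (u N)^2 * (2 * (v1 + 1) * t * (t * w) + B2 * v1 * (t * w)^2 + B4 * (v1 + 1) * v1 * w * (t * w)^2 + B6 * v1^2 * w^2 * (t * w)^2)"
    unfolding d_def by (simp add: ring_pow)
   also have "... = (u N)^2 * (2 * (v1 * t + t) + B2 * v1 + B4 * (v1 + 1) * v1 * w + B6 * v1^2 * w^2)" unfolding tw by (simp add: algebra_simps)
   also have "... = (u N)^2 * (2 * (v1 * t * (t * w) + t) + B2 * v1 * (t * w) + B4 * (1 + (t * w) * v1) * v1 * w + B6 * v1^2 * w^2)"
    unfolding tw by (simp add: algebra_simps)
   also have "... = qS B2 B4 B6 (u N) (xden N) t 1"
    unfolding qS_def v1(3) by (simp add: ring_pow)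
   finally show ?thesis ..
  qed
  have e1: "1 - e ~: nonunits V" using idealD(3)[OF I em, of "1 - e"] I1 by auto
  have e1V: "1 - e:V" using rD(1,6) idealD(1)[OF I em] by blast
  have ie: "inverse (1 - e):V" "1 - e ~= 0" using valring_cases[OF V e1V e1] by auto
  have prod: "mu * (u S * u Q) = (u N)^2 * t^2 * (1 - e)" using qt T by simp
  hence uS: "u S ~= 0" using uN t0 ie(2) by auto
  define v where "v = (2 * (v1 + 1) + d) * inverse (1 - e) - v0"
  have "mu * (u S * xden Q + xden S * u Q) = w * (2 * (v1 + 1) + d) * ((u N)^2 * t^2)" using qs S' by (simp add: algebra_simps)
  also have "(u N)^2 * t^2 = mu * (u S * u Q) * inverse (1 - e)" using prod ie(2) by (simp add: field_simps)
  finally have "mu * (u S * xden Q + xden S * u Q) = mu * (w * (2 * (v1 + 1) + d) * inverse (1 - e) * (u S * u Q))"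
   by (simp only: ac_simps)
  hence "u S * xden Q + xden S * u Q = w * (2 * (v1 + 1) + d) * inverse (1 - e) * (u S * u Q)"
   using mu0 mult_left_cancel by blast
  hence "xden S * u Q = w * v * u S * u Q" unfolding v0(3) v_def by (simp add: algebra_simps)
  hence xS: "xden S = w * v * u S" using uQ by simp
  have vV: "v:V" unfolding v_def
   by (intro rD v1 v0 ie idealD(1)[OF I dm] subring_numeral[OF R])
  have "v - of_nat ((Suc (Suc n))^2) = inverse (1 - e) * (d + (2 * (v1 + 1)) * e) + (2 * (v1 - of_nat ((Suc n)^2)) - (v0 - of_nat (n^2)))"
  proof -
   have "(2 * (v1 + 1) + d) * inverse (1 - e) - 2 * (v1 + 1) = inverse (1 - e) * (d + (2 * (v1 + 1)) * e)"
    using ie(2) by (simp add: field_simps)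
   hence "(2 * (v1 + 1) + d) * inverse (1 - e) = 2 * (v1 + 1) + inverse (1 - e) * (d + (2 * (v1 + 1)) * e)" by (simp add: algebra_simps)
   thus ?thesis unfolding v_def by (simp add: ring_pow)
  qed
  moreover have "inverse (1 - e) * (d + (2 * (v1 + 1)) * e):nonunits V"
   by (intro idealD(4)[OF I] idealD(3)[OF I] ie dm em rD v1 subring_numeral[OF R])
  moreover have "2 * (v1 - of_nat ((Suc n)^2)) - (v0 - of_nat (n^2)):nonunits V"
   by (intro ideal_diff[OF R I] idealD(4)[OF I] v1 v0 subring_numeral[OF R])
  ultimately have "v - of_nat ((Suc (Suc n))^2):nonunits V" using idealD(3)[OF I] by simp
  thus ?thesis using uS xS vV unfolding S_def by blast
 qed
 have "?ok n & ?ok (Suc n)" for n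
 proof (induction n)
  case 0
  have "?ok 0"
  proof (intro conjI exI[of _ 0])
   show "u (emul E 0 P) ~= 0" unfolding u_def using sigma by simp
  qed (use idealD(2)[OF I] rD(2) in auto)
  moreover have "?ok (Suc 0)"
  proof -
   have e1: "emul E (Suc 0) P = P" by simp
   have "xden P = w * 1 * u P" unfolding Pe uP w_def using t0 by simp
   thus ?thesis unfolding e1 using t0 uP rD(1) idealD(2)[OF I] by (intro conjI exI[of _ 1]) auto
  qed
  ultimately show ?case by blast
 next
  case (Suc n)
  thus ?case using step by blast
 qed
 then obtain v where v: "v - of_nat (n^2):nonunits V" "xden (emul E n P) = w * v * u (emul E n P)" "u (emul E n P) ~= 0"
  by blast
 hence "v = 0" using n(1) w0 by simp
 hence "of_nat (n^2):nonunits V" using v(1) idealD(4)[OF I, of "- 1" "- of_nat (n^2)"] rD(1,5) by auto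
 hence "inverse (of_nat n) * inverse (of_nat n) * of_nat (n^2):nonunits V" using idealD(4)[OF I] rD(3) n(3) by blast
 moreover have "inverse (of_nat n) * inverse (of_nat n) * of_nat (n^2) = (1::'a)" using n(2) by (simp add: power2_eq_square field_simps)
 ultimately show False using I1 by simp
qed

lemma cubic_splits:
 fixes b c d :: 'a
 obtains e1 e2 e3 where "b = - (e1 + e2 + e3)" "c = e1 * e2 + e1 * e3 + e2 * e3" "d = - (e1 * e2 * e3)"
proof -
 obtain e1 where e1: "poly [:d, c, b, 1:] e1 = 0" using root_exists[of "[:d, c, b, 1:]"] by auto
 obtain e2 where e2: "poly [:c + e1 * (b + e1), b + e1, 1:] e2 = 0"
  using root_exists[of "[:c + e1 * (b + e1), b + e1, 1:]"] by auto
 define e3 where "e3 = - b - e1 - e2"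
 have b: "b = - (e1 + e2 + e3)" unfolding e3_def by simp
 have "c + e1 * (b + e1) + e2 * (b + e1) + e2 * e2 = 0" using e2 by (simp add: algebra_simps)
 hence "c = - (e1 * (b + e1)) - e2 * (b + e1) - e2 * e2" by (simp add: algebra_simps eq_neg_iff_add_eq_0)
 hence c: "c = e1 * e2 + e1 * e3 + e2 * e3" unfolding b by (simp add: algebra_simps)
 have "d + e1 * c + e1 * e1 * b + e1 * e1 * e1 = 0" using e1 by (simp add: algebra_simps)
 hence "d = - (e1 * c) - e1 * e1 * b - e1 * e1 * e1" by (simp add: algebra_simps eq_neg_iff_add_eq_0)
 hence "d = - (e1 * e2 * e3)" unfolding b c by (simp add: algebra_simps)
 with b c show ?thesis using that by blast
qed

lemma two_torsion_point:
 assumes "4 * e^3 + wb2 E * e^2 + 2 * wb4 E * e + wb6 E = (0::'a)"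
 shows "EX S:aff E. emul E 2 S = Infty & xfun S = e"
proof -
 obtain y where y: "Aff e y:points E" using point_above by blast
 have "2 * y + wa1 E * e + wa3 E = 0" using curve_b_form(1)[OF y] assms by simp
 hence "y + y + wa1 E * e + wa3 E = 0" by (simp only: mult_2)
 hence "y = - y - wa1 E * e - wa3 E" by (simp add: algebra_simps eq_neg_iff_add_eq_0)
 hence "eadd E (Aff e y) (Aff e y) = Infty" unfolding eadd_eq_Infty by simp
 moreover have "emul E 2 (Aff e y) = eadd E (Aff e y) (Aff e y)" by (simp add: numeral_2_eq_2)
 ultimately show ?thesis using y by (intro bexI[of _ "Aff e y"]) auto
qed

text \<open>The equation says \<open>x (2 P) = x (P)\<close>.\<close>
lemma three_torsion_point:
 assumes E: "elliptic_curve E"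
  and e: "3 * e^4 + wb2 E * e^3 + 3 * wb4 E * e^2 + 3 * wb6 E * e + wb8 E = (0::'a)"
 shows "EX S:aff E. emul E 3 S = Infty & xfun S = e"
proof -
 obtain y where y: "Aff e y:points E" using point_above by blast
 define P where "P = Aff e y"
 have P: "P:points E" unfolding P_def by (rule y)
 define R where "R = eadd E P P"
 have R: "R:points E" unfolding R_def by (rule eadd_on_curve[OF P P])
 have PP: "eadd E P (eneg E P) = Infty" by (simp add: eadd_eq_Infty)
 obtain kappa where kappa: "kappa ~= 0" "qS (wb2 E) (wb4 E) (wb6 E) e 1 e 1 = kappa * xden R" "qT (wb4 E) (wb6 E) (wb8 E) e 1 e 1 = kappa * xnum R"
  using biquadratic[OF E P P] unfolding PP R_def[symmetric] by (auto simp: P_def)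
 have den: "4 * e^3 + wb2 E * e^2 + 2 * wb4 E * e + wb6 E = kappa * xden R"
  using kappa(2) unfolding qS_def by (simp add: ring_pow)
 have num: "e^4 - wb4 E * e^2 - 2 * wb6 E * e - wb8 E = kappa * xnum R"
  using kappa(3) unfolding qT_def by (simp add: ring_pow)
 have rel: "kappa * xnum R = e * (kappa * xden R)"
 proof -
  have "e * (kappa * xden R) - kappa * xnum R = 3 * e^4 + wb2 E * e^3 + 3 * wb4 E * e^2 + 3 * wb6 E * e + wb8 E"
   unfolding den[symmetric] num[symmetric] by (simp add: ring_pow)
  hence "e * (kappa * xden R) - kappa * xnum R = 0" unfolding e .
  thus ?thesis by (simp only: right_minus_eq)
 qed
 have RI: "R ~= Infty"
 proof
  assume "R = Infty"
  hence "xden R = 0" by simp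
  thus False using duplication_no_common_zero[OF E, of e] rel den num by simp
 qed
 hence "xfun R = e" "R:aff E" using rel kappa(1) R by (cases R; simp)+
 moreover have "P:aff E" "xfun P = e" using P unfolding P_def by auto
 ultimately consider "R = P" | "R = eneg E P" using same_xfun[of P E R] by auto
 hence R': "R = eneg E P"
 proof cases
  case 1
  hence "eadd E (eadd E P P) (eneg E P) = Infty" unfolding R_def using PP by simp
  hence "P = Infty" using eadd_assoc[OF E P P eneg_on_curve[OF P]] PP by simp
  thus ?thesis unfolding P_def by simp
 qed simp
 have "emul E 3 P = eadd E R P" unfolding R_def by (simp add: numeral_3_eq_3)
 also have "... = Infty" unfolding R' eadd_eq_Infty using P by (simp add: eneg_eneg)
 finally show ?thesis using P unfolding P_def by (intro bexI[of _ "Aff e y"]) auto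
qed

text \<open>
  Over a valuation ring in which 2 is invertible or zero, scaling the differences of the x-coordinates of the m-torsion points by the
  largest of them gives a model with good or multiplicative reduction.  In characteristic 2 the
  3-torsion does the same job as the 2-torsion does otherwise.
\<close>
definition torsion_scaling :: "'a weierstrass => nat => 'a => 'a set => bool" where
 "torsion_scaling E m r U <-> finite U & (EX u:U. u ~= 0) &
  (ALL u:U. EX S:aff E. EX S':aff E. emul E m S = Infty & emul E m S' = Infty & u = xfun S - xfun S') &
  (ALL k V sigma. valring k V --> (CHAR('a) ~= 2 --> inverse 2:V) --> sigma ~= 0 --> (ALL u:U. u / sigma:V) -->
    integral_model E V r sigma & wc4 E ^ 3 / sigma^6:V & discriminant E / sigma^6:V &
    (sigma:U --> ~ (wc4 E ^ 3 / sigma^6:nonunits V & discriminant E / sigma^6:nonunits V)))"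

lemma nonunits_power: "valring k V ==> x:V ==> x ^ n:nonunits V ==> x:nonunits V"
proof (rule ccontr)
 assume V: "valring k V" and x: "x:V" "x ^ n:nonunits V" "x ~: nonunits V"
 have i: "inverse x:V" "x ~= 0" using valring_cases[OF V x(1,3)] by auto
 have "inverse x ^ n * x ^ n:nonunits V"
  using idealD(4)[OF nonunits_ideal(1)[OF V] subring_power[OF valringD(1)[OF V] i(1)] x(2)] .
 thus False using i(2) nonunits_ideal(2)[OF V] by (simp add: power_mult_distrib[symmetric])
qed

lemma nonunits_cancel: "valring k V ==> inverse c:V ==> c ~= 0 ==> c * x:nonunits V ==> x:nonunits V"
 using idealD(4)[OF nonunits_ideal(1), of k V "inverse c" "c * x"] by (simp add: mult.assoc[symmetric])

text \<open>
  In terms of the differences \<open>alpha\<close>, beta of two of the roots to the third,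
  \<open>c4 = 16 (alpha\<^sup>2 - alpha beta + beta\<^sup>2)\<close> and the discriminant is \<open>16 (alpha beta (alpha - beta))\<^sup>2\<close>.  When the largest of
  \<open>alpha\<close>, beta, \<open>alpha - beta\<close> is scaled to 1, these do not both lie in the maximal ideal.
\<close>
lemma torsion_scaling_odd:
 assumes E: "elliptic_curve E" and char: "CHAR('a) ~= 2"
 shows "EX r U. torsion_scaling E 2 r U"
proof -
 have two: "(2::'a) ~= 0"
 proof
  assume "(2::'a) = 0"
  hence "CHAR('a) dvd 2" using of_nat_eq_0_iff_char_dvd[where 'a = 'a, of 2] by simp
  hence "CHAR('a) = 1 | CHAR('a) = 2" by (metis prime_nat_iff two_is_prime_nat)
  thus False using char CHAR_not_1' by auto
 qed
 have four: "(4::'a) ~= 0" using two by (metis mult_2 mult_eq_0_iff numeral_Bit0)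
 obtain e1 e2 r where e: "wb2 E / 4 = - (e1 + e2 + r)" "wb4 E / 2 = e1 * e2 + e1 * r + e2 * r" "wb6 E / 4 = - (e1 * e2 * r)"
  using cubic_splits by blast
 have b2: "wb2 E = - 4 * (e1 + e2 + r)" and b6: "wb6 E = - 4 * (e1 * e2 * r)" and b4: "wb4 E = 2 * (e1 * e2 + e1 * r + e2 * r)"
  using e two four by (simp_all add: field_simps)
 define alpha beta where "alpha = e1 - r" and "beta = e2 - r"
 define B8 where "B8 = wb8 E + 3 * r * wb6 E + 3 * r^2 * wb4 E + r^3 * wb2 E + 3 * r^4"
 have B2: "wb2 E + 12 * r = - 4 * (alpha + beta)" unfolding b2 alpha_def beta_def by (simp add: algebra_simps)
 have B4: "wb4 E + r * wb2 E + 6 * r^2 = 2 * (alpha * beta)" unfolding b2 b4 alpha_def beta_def by (simp add: ring_pow)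
 have B6: "wb6 E + 2 * r * wb4 E + r^2 * wb2 E + 4 * r^3 = 0"
  unfolding b2 b4 b6 by (simp add: ring_pow)
 have "4 * B8 = (wb2 E + 12 * r) * (wb6 E + 2 * r * wb4 E + r^2 * wb2 E + 4 * r^3) - (wb4 E + r * wb2 E + 6 * r^2)^2
   + (4 * wb8 E - (wb2 E * wb6 E - wb4 E^2))"
  unfolding B8_def by (simp add: ring_pow)
 hence "4 * B8 = - 4 * (alpha^2 * beta^2)" unfolding B6 B4 wb_relation by (simp add: ring_pow)
 hence "4 * B8 = 4 * (- (alpha^2 * beta^2))" by simp
 hence B8: "wb8 E + 3 * r * wb6 E + 3 * r^2 * wb4 E + r^3 * wb2 E + 3 * r^4 = - (alpha^2 * beta^2)"
  using four mult_left_cancel unfolding B8_def by blast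
 have "wc4 E = (wb2 E + 12 * r)^2 - 24 * (wb4 E + r * wb2 E + 6 * r^2)"
  unfolding wc4_def by (simp add: ring_pow)
 hence c4: "wc4 E = 16 * (alpha^2 - alpha * beta + beta^2)" unfolding B2 B4 by (simp add: ring_pow)
 have Delta: "discriminant E = 16 * alpha^2 * beta^2 * (alpha - beta)^2"
 proof -
  note discriminant_shift[OF wb_relation[of E], of r]
  note this[folded discriminant_def, unfolded B2 B4 B6 B8]
  thus ?thesis by (simp add: ring_pow)
 qed
 have root: "4 * z^3 + wb2 E * z^2 + 2 * wb4 E * z + wb6 E = 4 * ((z - e1) * (z - e2) * (z - r))" for z
  unfolding b2 b4 b6 by (simp add: ring_pow)
 have S: "EX S:aff E. emul E 2 S = Infty & xfun S = z" if "z:{e1, e2, r}" for z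
  by (rule two_torsion_point) (use that root[of z] in auto)
 have tor: "EX S:aff E. EX S':aff E. emul E 2 S = Infty & emul E 2 S' = Infty & u = xfun S - xfun S'" if u: "u:{alpha, beta}" for u
 proof -
  obtain R where R: "R:aff E" "emul E 2 R = Infty" "xfun R = r" using S[of r] by auto
  obtain z where z: "z:{e1, e2}" "u = z - r" using u unfolding alpha_def beta_def by auto
  obtain T where T: "T:aff E" "emul E 2 T = Infty" "xfun T = z" using S[of z] z by auto
  show ?thesis using R T z by blast
 qed
 have nz: "EX u:{alpha, beta}. u ~= 0" using Delta E unfolding elliptic_curve_def by auto
 have loc: "integral_model E V r sigma & wc4 E ^ 3 / sigma^6:V & discriminant E / sigma^6:V &
    (sigma:{alpha, beta} --> ~ (wc4 E ^ 3 / sigma^6:nonunits V & discriminant E / sigma^6:nonunits V))"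
  if V: "valring k V" and half: "inverse 2:V" and sigma: "sigma ~= 0" and int: "ALL u:{alpha, beta}. u / sigma:V" for k V sigma
 proof -
  note R = valringD(1)[OF V]
  note rD = subringD[OF R]
  note I = nonunits_ideal(1)[OF V]
  define a b where "a = alpha / sigma" and "b = beta / sigma"
  have ab: "a:V" "b:V" using int unfolding a_def b_def by auto
  have alpha': "alpha = sigma * a" and beta': "beta = sigma * b" unfolding a_def b_def using sigma by auto
  have "- 4 * (alpha + beta) / sigma = - 4 * (a + b)" "2 * (alpha * beta) / sigma^2 = 2 * (a * b)" "- (alpha^2 * beta^2) / sigma^4 = - (a^2 * b^2)"
   unfolding alpha' beta' using sigma by (simp_all add: field_simps power2_eq_square power4_eq_xxxx)
  moreover have "- 4 * (a + b):V" "2 * (a * b):V" "- (a^2 * b^2):V"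
   by (intro rD subring_power[OF R] subring_numeral[OF R] ab)+
  ultimately have im: "integral_model E V r sigma" unfolding integral_model_def B2 B4 B6 B8 using sigma rD(2) by simp
  have c: "wc4 E ^ 3 / sigma^6 = (16 * (a^2 - a * b + b^2))^3"
  proof -
   have "wc4 E = sigma^2 * (16 * (a^2 - a * b + b^2))" unfolding c4 alpha' beta' by (simp add: ring_pow)
   hence "wc4 E ^ 3 = sigma^6 * (16 * (a^2 - a * b + b^2))^3" by (simp add: power_mult_distrib power_mult[symmetric])
   thus ?thesis using sigma by simp
  qed
  have d: "discriminant E / sigma^6 = 16 * (a * b * (a - b))^2"
  proof -
   have "discriminant E = 16 * (sigma * a * (sigma * b) * (sigma * a - sigma * b))^2"
    unfolding Delta alpha' beta' by (simp add: power_mult_distrib)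
   also have "sigma * a * (sigma * b) * (sigma * a - sigma * b) = sigma^3 * (a * b * (a - b))" by (simp add: ring_pow)
   finally have "discriminant E = 16 * (a * b * (a - b))^2 * sigma^6" by (simp add: power_mult_distrib power_mult[symmetric])
   thus ?thesis using sigma by simp
  qed
  have cV: "wc4 E ^ 3 / sigma^6:V" "discriminant E / sigma^6:V" unfolding c d
   by (intro rD subring_power[OF R] subring_numeral[OF R] ab)+
  have "False" if s: "sigma:{alpha, beta}" and n: "wc4 E ^ 3 / sigma^6:nonunits V" "discriminant E / sigma^6:nonunits V"
  proof -
   have one: "a = 1 | b = 1" using s sigma unfolding a_def b_def by auto
   have i16: "inverse (16::'a):V" "(16::'a) ~= 0"
   proof -
    have "(16::'a) = 2^4" by simp
    thus "inverse (16::'a):V" "(16::'a) ~= 0" using subring_power[OF R half, of 4] two by (metis power_inverse, metis power_eq_0_iff)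
   qed
   have "16 * (a^2 - a * b + b^2):nonunits V" using n(1) unfolding c by (rule nonunits_power[OF V, rotated])
    (intro rD subring_power[OF R] subring_numeral[OF R] ab)
   hence q: "a^2 - a * b + b^2:nonunits V" by (rule nonunits_cancel[OF V i16])
   have "(a * b * (a - b))^2:nonunits V" using n(2) unfolding d by (rule nonunits_cancel[OF V i16])
   hence t: "a * b * (a - b):nonunits V" by (rule nonunits_power[OF V, rotated]) (intro rD ab)
   have "1:nonunits V"
   proof (cases "a = 1")
    case True
    have "(a^2 - a * b + b^2) + a * b * (a - b):nonunits V" using idealD(3)[OF I q t] .
    thus ?thesis unfolding True by (simp add: ring_pow)
   next
    case False
    hence b1: "b = 1" using one by blast
    have "(a^2 - a * b + b^2) - (a * (a - 1)):nonunits V"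
     using ideal_diff[OF R I q] t unfolding b1 by simp
    thus ?thesis unfolding b1 by (simp add: ring_pow)
   qed
   thus False using nonunits_ideal(2)[OF V] by blast
  qed
  with im cV show ?thesis by blast
 qed
 have "torsion_scaling E 2 r {alpha, beta}"
  unfolding torsion_scaling_def using tor nz loc char by blast
 thus ?thesis by blast
qed

text \<open>
  Here \<open>c4 = b2\<^sup>2\<close>, and the four roots of the 3-division polynomial replace the three roots of the
  2-division polynomial.
\<close>
lemma torsion_scaling_even:
 assumes E: "elliptic_curve E" and char: "CHAR('a) = 2"
 shows "EX r U. torsion_scaling E 3 r U"
proof -
 have two: "(2::'a) = 0" using of_nat_CHAR[where 'a = 'a] unfolding char by simp
 have dbl: "x + x = 0" for x :: 'a using two by (metis mult_2 mult_zero_left)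
 hence neg: "- x = x" for x :: 'a by (rule minus_unique)
 have ch2: "numeral (num.Bit0 n) = (0::'a)" "numeral (num.Bit1 n) = (1::'a)" for n
  unfolding numeral_Bit0 numeral_Bit1 dbl by simp_all
 obtain r where r: "3 * r^4 + wb2 E * r^3 + 3 * wb4 E * r^2 + 3 * wb6 E * r + wb8 E = 0"
 proof -
  have "EX r. poly [:wb8 E, 3 * wb6 E, 3 * wb4 E, wb2 E, 3:] r = 0"
   by (rule root_exists) (simp add: ch2)
  thus ?thesis using that by (auto simp: ring_pow)
 qed
 define B2 B4 B6 where "B2 = wb2 E + 12 * r" and "B4 = wb4 E + r * wb2 E + 6 * r^2"
  and "B6 = wb6 E + 2 * r * wb4 E + r^2 * wb2 E + 4 * r^3"
 have B8: "wb8 E + 3 * r * wb6 E + 3 * r^2 * wb4 E + r^3 * wb2 E + 3 * r^4 = 0"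
  using r by (simp add: algebra_simps)
 obtain u1 u2 u3 where "B2 = - (u1 + u2 + u3)" "B4 = u1 * u2 + u1 * u3 + u2 * u3" "B6 = - (u1 * u2 * u3)"
  using cubic_splits by blast
 hence u: "B2 = u1 + u2 + u3" "B4 = u1 * u2 + u1 * u3 + u2 * u3" "B6 = u1 * u2 * u3" using neg by auto
 define U where "U = {u1, u2, u3}"
 have rt: "x^3 + B2 * x^2 + B4 * x + B6 = 0" if "x:U" for x
 proof -
  have "x^3 + B2 * x^2 + B4 * x + B6 = x^3 - B2 * x^2 + B4 * x - B6" by (simp only: diff_conv_add_uminus neg)
  also have "... = (x - u1) * (x - u2) * (x - u3)" unfolding u by (simp add: ring_pow)
  finally show ?thesis using that unfolding U_def by auto
 qed
 have b4: "B4^2 = B2 * B6"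
 proof -
  have "4 * (wb8 E + 3 * r * wb6 E + 3 * r^2 * wb4 E + r^3 * wb2 E + 3 * r^4) = B2 * B6 - B4^2
   + (4 * wb8 E - (wb2 E * wb6 E - wb4 E^2))"
   unfolding B2_def B4_def B6_def by (simp add: ring_pow)
  thus ?thesis unfolding B8 wb_relation by simp
 qed
 have c4: "wc4 E = B2^2" unfolding wc4_def B2_def ch2 by simp
 have Delta: "discriminant E = B6^2 + B2 * B4 * B6"
 proof -
  note discriminant_shift[OF wb_relation[of E], of r]
  note this[folded discriminant_def B2_def B4_def B6_def, unfolded B8]
  hence "discriminant E = - (B6^2) + B2 * B4 * B6" unfolding ch2 by simp
  thus ?thesis unfolding neg .
 qed
 have S: "EX S:aff E. emul E 3 S = Infty & xfun S = r + x" if x: "x = 0 | x:U" for x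
 proof (rule three_torsion_point[OF E])
  let ?f = "%z. 3 * z^4 + wb2 E * z^3 + 3 * wb4 E * z^2 + 3 * wb6 E * z + wb8 E"
  have "?f (r + x) = ?f r + x * (3 * x^3 + B2 * x^2 + 3 * B4 * x + 3 * B6)"
   unfolding B2_def B4_def B6_def by (simp add: ring_pow)
  also have "... = x * (x^3 + B2 * x^2 + B4 * x + B6)" by (subst r) (simp add: ch2)
  finally show "?f (r + x) = 0" using x rt by auto
 qed
 have tor: "EX S:aff E. EX S':aff E. emul E 3 S = Infty & emul E 3 S' = Infty & x = xfun S - xfun S'" if x: "x:U" for x
 proof -
  obtain R where R: "R:aff E" "emul E 3 R = Infty" "xfun R = r" using S[of 0] by auto
  obtain T where T: "T:aff E" "emul E 3 T = Infty" "xfun T = r + x" using S[of x] x by auto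
  have "x = xfun T - xfun R" using R T by simp
  thus ?thesis using R T by blast
 qed
 have nz: "EX x:U. x ~= 0"
 proof (rule ccontr)
  assume "~ ?thesis"
  hence "u1 = 0" "u2 = 0" "u3 = 0" unfolding U_def by auto
  hence "discriminant E = 0" unfolding Delta u by simp
  thus False using E unfolding elliptic_curve_def by simp
 qed
 have loc: "integral_model E V r sigma & wc4 E ^ 3 / sigma^6:V & discriminant E / sigma^6:V &
    (sigma:U --> ~ (wc4 E ^ 3 / sigma^6:nonunits V & discriminant E / sigma^6:nonunits V))"
  if V: "valring k V" and sigma: "sigma ~= 0" and int: "ALL u:U. u / sigma:V" for k V sigma
 proof -
  note R = valringD(1)[OF V]
  note rD = subringD[OF R]
  note I = nonunits_ideal(1)[OF V]
  define a1 a2 a3 where "a1 = u1 / sigma" and "a2 = u2 / sigma" and "a3 = u3 / sigma"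
  have a: "a1:V" "a2:V" "a3:V" using int unfolding a1_def a2_def a3_def U_def by auto
  have u': "u1 = sigma * a1" "u2 = sigma * a2" "u3 = sigma * a3" unfolding a1_def a2_def a3_def using sigma by auto
  define e1 e2 e3 where "e1 = a1 + a2 + a3" and "e2 = a1 * a2 + a1 * a3 + a2 * a3" and "e3 = a1 * a2 * a3"
  have eV: "e1:V" "e2:V" "e3:V" unfolding e1_def e2_def e3_def by (intro rD a)+
  have Be: "B2 = sigma * e1" "B4 = sigma^2 * e2" "B6 = sigma^3 * e3"
   unfolding u e1_def e2_def e3_def u' by (simp_all add: ring_pow)
  have im: "integral_model E V r sigma"
   unfolding integral_model_def B2_def[symmetric] B4_def[symmetric] B6_def[symmetric] B8 Be using sigma eV rD(2) by simp
  have "(sigma^2 * e2)^2 = sigma * e1 * (sigma^3 * e3)" using b4 unfolding Be .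
  hence "sigma^4 * e2^2 = sigma^4 * (e1 * e3)" by (simp add: power_mult_distrib power_mult[symmetric] power3_eq_cube power4_eq_xxxx mult.assoc mult.left_commute)
  hence e2: "e2^2 = e1 * e3" using sigma by simp
  have c: "wc4 E ^ 3 / sigma^6 = e1^6"
  proof -
   have "wc4 E ^ 3 = sigma^6 * e1^6" unfolding c4 Be by (simp add: power_mult_distrib power_mult[symmetric])
   thus ?thesis using sigma by simp
  qed
  have d: "discriminant E / sigma^6 = e3^2 + e1 * e2 * e3"
  proof -
   have "sigma^6 = sigma^3 * sigma^3" by (simp add: power_add[symmetric])
   hence "discriminant E = sigma^6 * (e3^2 + e1 * e2 * e3)"
    unfolding Delta Be by (simp add: ring_pow)
   thus ?thesis using sigma by simp
  qed
  have cV: "wc4 E ^ 3 / sigma^6:V" "discriminant E / sigma^6:V" unfolding c d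
   by (intro rD subring_power[OF R] eV)+
  have "False" if s: "sigma:U" and n: "wc4 E ^ 3 / sigma^6:nonunits V" "discriminant E / sigma^6:nonunits V"
  proof -
   have E1: "e1:nonunits V" using n(1) unfolding c by (rule nonunits_power[OF V eV(1)])
   have "e3 * e1:nonunits V" by (rule idealD(4)[OF I eV(3) E1])
   hence "e2^2:nonunits V" unfolding e2 by (simp add: mult.commute)
   hence E2: "e2:nonunits V" by (rule nonunits_power[OF V eV(2)])
   have "e1 * e3 * e2:nonunits V" by (intro idealD(4)[OF I _ E2] rD eV)
   from ideal_diff[OF R I n(2) this] have "e3^2:nonunits V" unfolding d by (simp add: mult_ac)
   hence E3: "e3:nonunits V" by (rule nonunits_power[OF V eV(3)])
   have "sigma^3 + B2 * sigma^2 + B4 * sigma + B6 = 0" by (rule rt[OF s])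
   hence "sigma^3 * (1 + e1 + e2 + e3) = 0" unfolding Be by (simp add: ring_pow)
   hence "1 + (e1 + e2 + e3) = 0" using sigma by (simp add: add.assoc)
   hence "1 = e1 + e2 + e3" using neg[of "e1 + e2 + e3"] by (metis add_eq_0_iff2)
   moreover have "e1 + e2 + e3:nonunits V" by (intro idealD(3)[OF I] E1 E2 E3)
   ultimately show False using nonunits_ideal(2)[OF V] by simp
  qed
  with im cV show ?thesis by blast
 qed
 have "finite U" unfolding U_def by simp
 hence "torsion_scaling E 3 r U"
  unfolding torsion_scaling_def using tor nz loc by blast
 thus ?thesis by blast
qed

definition test_level :: nat where "test_level = (if CHAR('a) = 2 then 3 else 2)"

lemma torsion_scaling_ex: "elliptic_curve E ==> EX r U. torsion_scaling E test_level r U"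
 unfolding test_level_def using torsion_scaling_odd[of E] torsion_scaling_even[of E] by simp

lemma test_level_good: "of_nat test_level ~= (0::'a)"
proof -
 have "CHAR('a) dvd 2 ==> CHAR('a) = 2"
  using CHAR_not_1' by (metis prime_nat_iff two_is_prime_nat One_nat_def)
 moreover have "CHAR('a) = 2 ==> ~ CHAR('a) dvd 3" by simp
 ultimately show ?thesis unfolding test_level_def of_nat_eq_0_iff_char_dvd by auto
qed

lemma valring_max:
 assumes V: "valring k V" and fin: "finite U" and nz: "EX u:U. u ~= 0"
 shows "EX sigma:U. sigma ~= 0 & (ALL u:U. u / sigma:V)"
 using fin nz
proof (induction U)
 case empty thus ?case by simp
next
 case (insert v U)
 note R = valringD(1)[OF V]
 note rD = subringD[OF R]
 show ?case
 proof (cases "EX u:U. u ~= 0")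
  case False
  hence "v ~= 0" "ALL u:insert v U. u / v:V" using insert.prems rD(1,2) by auto
  thus ?thesis by blast
 next
  case True
  then obtain sigma where s: "sigma:U" "sigma ~= 0" "!!u. u:U ==> u / sigma:V" using insert.IH by blast
  show ?thesis
  proof (cases "v / sigma:V")
   case True
   thus ?thesis using s by blast
  next
   case False
   hence i: "sigma / v:V" using valringD(3)[OF V, of "v / sigma"] by simp
   have v0: "v ~= 0" using False rD(2) by auto
   have "u / v:V" if "u:insert v U" for u
   proof (cases "u = v")
    case True thus ?thesis using rD(1) v0 by simp
   next
    case False
    hence "(u / sigma) * (sigma / v):V" using that s i rD(3) by blast
    thus ?thesis using s(2) by simp
   qed
   thus ?thesis using v0 by blast
  qed
 qed
qed


section \<open>Comparison of the j-invariants of isogenous curves at a place\<close>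


text \<open>
  At each place, \<open>(1, j)\<close> generates \<open>(sigma\<^sup>6 / Delta)\<close> where sigma is the largest difference of
  torsion abscissae.  The abscissae of torsion points of E' are, up to Frobenius powers and an
  affine map with leading coefficient C, sums of abscissae of torsion points of E, so that
  their differences are bounded by C and sigma.
\<close>
theorem j_invariant_local:
 fixes k :: "'a set"
 assumes E: "elliptic_curve E" and E': "elliptic_curve E'" and psi: "vmap E E' psi q r"
  and n: "of_nat n ~= (0::'a)"
  and lift: "!!P. P:points E ==> emul E' test_level (psi P) = Infty ==> emul E n P = Infty"
  and k: "!!m. of_nat m ~= (0::'a) ==> inverse (of_nat m):k"
 shows "EX s. s ~= 0 & (ALL V. valring k V -->
  (j_invariant E ^ r:V --> s:V & s * j_invariant E' ^ q:V) &
  (j_invariant E ^ r ~: V --> s / j_invariant E ^ r:V & s * j_invariant E' ^ q / j_invariant E ^ r:V))"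
proof -
 define W where "W = kern E psi"
 obtain C D where C: "C ~= 0" and CD: "!!P. P:points E - W ==> xfun (psi P) ^ q = C * tsum E W P ^ r + D"
  and sh: "surj_hom E E' psi" and fq: "frob q" and fr: "frob r"
  using psi unfolding vmap_def W_def by blast
 note hom = surj_hom_basic[OF E E' sh]
 have Wp: "W <= points E" unfolding W_def kern_def by blast
 have q0: "q > 0" and r0: "r > 0" using fq fr by (auto dest: frob_pos)
 define m where "m = (test_level :: nat)"
 obtain rho U where U: "torsion_scaling E m rho U" using torsion_scaling_ex[OF E] unfolding m_def by blast
 obtain rho' U' where U': "torsion_scaling E' m rho' U'" using torsion_scaling_ex[OF E'] unfolding m_def by blast
 define Delta Delta' c c' where "Delta = discriminant E" and "Delta' = discriminant E'" and "c = wc4 E ^ 3" and "c' = wc4 E' ^ 3"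
 have D0: "Delta ~= 0" "Delta' ~= 0" using E E' unfolding Delta_def Delta'_def elliptic_curve_def by auto
 have j: "j_invariant E = c / Delta" "j_invariant E' = c' / Delta'" unfolding j_invariant_def c_def c'_def Delta_def Delta'_def by auto
 define s where "s = Delta' ^ q / (C ^ 6 * Delta ^ r)"
 have s0: "s ~= 0" unfolding s_def using D0 C by simp
 have main: "(j_invariant E ^ r:V --> s:V & s * j_invariant E' ^ q:V) &
  (j_invariant E ^ r ~: V --> s / j_invariant E ^ r:V & s * j_invariant E' ^ q / j_invariant E ^ r:V)"
  if V: "valring k V" for V
 proof -
  note R = valringD(1)[OF V]
  note rD = subringD[OF R]
  note I = nonunits_ideal(1)[OF V]
  have inv: "inverse (of_nat l):V" if "of_nat l ~= (0::'a)" for l using k[OF that] valringD(2)[OF V] by blast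
  have half: "CHAR('a) ~= 2 --> inverse 2:V"
   using inv[OF test_level_good] unfolding test_level_def by (auto split: if_splits)
  obtain sigma where sigma: "sigma:U" "sigma ~= 0" "ALL u:U. u / sigma:V"
   using valring_max[OF V, of U] U unfolding torsion_scaling_def by blast
  have im: "integral_model E V rho sigma" and cV: "c / sigma^6:V" and dV: "Delta / sigma^6:V"
   and unit: "~ (c / sigma^6:nonunits V & Delta / sigma^6:nonunits V)"
   using U V half sigma unfolding torsion_scaling_def c_def Delta_def by blast+
  obtain gamma where gamma: "gamma ^ q = C * sigma ^ r" using nth_root_ex[OF q0] by blast
  have gamma0: "gamma ~= 0" using gamma C sigma(2) q0 by (metis mult_eq_0_iff power_eq_0_iff)
  have small: "(tsum E W P - tsum E W P') / sigma:V"
   if P: "P:points E" "psi P ~= Infty" "emul E' m (psi P) = Infty"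
   and P': "P':points E" "psi P' ~= Infty" "emul E' m (psi P') = Infty" for P P'
  proof -
   have one: "(xfun (eadd E S Q) - rho) / sigma:V" if S: "S:points E" "psi S ~= Infty" "emul E' m (psi S) = Infty" and Q: "Q:W" for S Q
   proof -
    have Qp: "Q:points E" "psi Q = Infty" using Q unfolding W_def kern_def by auto
    have SQ: "eadd E S Q:points E" by (rule eadd_on_curve[OF S(1) Qp(1)])
    have psiSQ: "psi (eadd E S Q) = psi S" using hom(4)[OF S(1) Qp(1)] Qp(2) by simp
    hence "emul E n (eadd E S Q) = Infty" using lift[OF SQ] S(3) unfolding m_def by simp
    moreover have "eadd E S Q ~= Infty" using psiSQ hom(1) S(2) by metis
    ultimately show ?thesis using torsion_integral[OF E V im, of "eadd E S Q" n] SQ n inv[OF n] by blast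
   qed
   have "(tsum E W P - tsum E W P') / sigma = (SUM Q:W. (xfun (eadd E P Q) - rho) / sigma - (xfun (eadd E P' Q) - rho) / sigma)"
    unfolding tsum_def sum_subtractf[symmetric] sum_divide_distrib by (intro sum.cong refl) (simp add: diff_divide_distrib)
   also have "...:V" by (intro subring_sum[OF R] rD one P P')
   finally show ?thesis .
  qed
  have U'V: "u / gamma:V" if u: "u:U'" for u
  proof -
   obtain S S' where S: "S:aff E'" "S':aff E'" "emul E' m S = Infty" "emul E' m S' = Infty" "u = xfun S - xfun S'"
    using U' u unfolding torsion_scaling_def by blast
   obtain P P' where P: "P:points E" "psi P = S" "P':points E" "psi P' = S'"
    using sh S(1,2) unfolding surj_hom_def by (metis Diff_iff imageE)
   have nW: "P:points E - W" "P':points E - W" using P S unfolding W_def kern_def by auto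
   have "u ^ q = xfun (psi P) ^ q - xfun (psi P') ^ q" unfolding S(5) frob_diff[OF fq] P ..
   also have "... = C * (tsum E W P - tsum E W P') ^ r" unfolding CD[OF nW(1)] CD[OF nW(2)] frob_diff[OF fr] by (simp add: algebra_simps)
   finally have "(u / gamma) ^ q = ((tsum E W P - tsum E W P') / sigma) ^ r" unfolding power_divide gamma using C by simp
   also have "...:V" using small P S by (intro subring_power[OF R]) auto
   finally show ?thesis by (rule valring_root[OF V q0])
  qed
  have c'V: "c' / gamma^6:V" and d'V: "Delta' / gamma^6:V"
   using U' V half gamma0 U'V unfolding torsion_scaling_def c'_def Delta'_def by blast+
  have g6: "(gamma^6)^q = C^6 * (sigma^6)^r"
  proof -
   have "(gamma^6)^q = (gamma^q)^6" unfolding power_mult[symmetric] by (simp add: mult.commute)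
   also have "... = C^6 * (sigma^6)^r" unfolding gamma power_mult_distrib power_mult[symmetric] by (simp add: mult.commute)
   finally show ?thesis .
  qed
  have s1: "s = (Delta' / gamma^6) ^ q * (sigma^6 / Delta) ^ r"
   unfolding s_def power_divide g6 using C sigma(2) D0 by (simp add: field_simps)
  have s2: "s * j_invariant E' ^ q = (c' / gamma^6) ^ q * (sigma^6 / Delta) ^ r"
   unfolding s_def j power_divide g6 using C sigma(2) D0 by (simp add: field_simps)
  show ?thesis
  proof (cases "j_invariant E ^ r:V")
   case True
   hence jV: "c / Delta:V" using valring_root[OF V r0] unfolding j by blast
   have "Delta / sigma^6 ~: nonunits V"
   proof
    assume d: "Delta / sigma^6:nonunits V"
    have "c / Delta * (Delta / sigma^6):nonunits V" by (rule idealD(4)[OF I jV d])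
    hence "c / sigma^6:nonunits V" using D0 by simp
    thus False using unit d by blast
   qed
   hence "inverse (Delta / sigma^6):V" using valring_cases[OF V dV] by blast
   hence "sigma^6 / Delta:V" by simp
   hence "s:V" "s * j_invariant E' ^ q:V" unfolding s2 unfolding s1
    by (intro rD(3) subring_power[OF R] c'V d'V; assumption)+
   thus ?thesis using True by blast
  next
   case False
   hence "c / Delta ~: V" using subring_power[OF R, of "c / Delta" r] unfolding j by blast
   hence "inverse (c / Delta):V" "c ~= 0" using valringD(3)[OF V, of "c / Delta"] rD(2) by auto
   hence jV: "Delta / c:V" and c0: "c ~= 0" by simp_all
   have "c / sigma^6 ~: nonunits V"
   proof
    assume d: "c / sigma^6:nonunits V"
    have "Delta / c * (c / sigma^6):nonunits V" by (rule idealD(4)[OF I jV d])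
    hence "Delta / sigma^6:nonunits V" using c0 by simp
    thus False using unit d by blast
   qed
   hence "inverse (c / sigma^6):V" using valring_cases[OF V cV] by blast
   hence i: "sigma^6 / c:V" by simp
   have "s / j_invariant E ^ r = (Delta' / gamma^6) ^ q * (sigma^6 / c) ^ r" "s * j_invariant E' ^ q / j_invariant E ^ r = (c' / gamma^6) ^ q * (sigma^6 / c) ^ r"
    unfolding s2 unfolding s1 unfolding j power_divide using c0 D0 by (simp_all add: field_simps)
   hence "s / j_invariant E ^ r:V" "s * j_invariant E' ^ q / j_invariant E ^ r:V"
    using i by (simp_all only:) (intro rD(3) subring_power[OF R] c'V d'V; assumption)+
   thus ?thesis using False by blast
  qed
 qed
 show ?thesis using s0 main by blast
qed

end

section \<open>Subfields and finite extensions\<close>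

lemma amb_field: "field (amb :: 'a::field ring)"
 by (rule field_from_type_algebra)

lemma amb_simps [simp]: "carrier (amb :: 'a::field ring) = UNIV" "monoid.mult (amb :: 'a ring) = (*)" "monoid.one (amb :: 'a ring) = 1"
 "ring.zero (amb :: 'a ring) = 0" "ring.add (amb :: 'a ring) = (+)"
 by (auto simp: ring_of_type_algebra_def)

lemma amb_inv: "x ~= 0 ==> inv\<^bsub>amb\<^esub> (x :: 'a::field) = inverse x"
proof -
 interpret field "amb :: 'a ring" by (rule amb_field)
 assume "x ~= 0"
 thus ?thesis using inv_unique'[of x "inverse x"] by simp
qed

lemma amb_uminus: "\<ominus>\<^bsub>amb\<^esub> (x :: 'a::field) = - x"
proof -
 interpret field "amb :: 'a ring" by (rule amb_field)
 show ?thesis using minus_equality[of "- x" x] by simp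
qed

lemma subfieldD:
 fixes k :: "'a::field set"
 assumes "subfield k amb"
 shows "0:k" "1:k" "x:k ==> y:k ==> x + y:k" "x:k ==> y:k ==> x * y:k"
  "x:k ==> - x:k" "x:k ==> y:k ==> x - y:k" "x:k ==> inverse x:k" "x:k ==> y:k ==> x / y:k"
proof -
 interpret field "amb :: 'a ring" by (rule amb_field)
 note s = subringE[OF subfieldE(1)[OF assms]]
 show z: "0:k" using s(2) by simp
 show "1:k" using s(3) by simp
 show a: "x + y:k" if "x:k" "y:k" for x y using s(7)[OF that] by simp
 show m: "x * y:k" if "x:k" "y:k" for x y using s(6)[OF that] by simp
 show u: "- x:k" if "x:k" for x using s(5)[OF that] by (simp add: amb_uminus)
 show "x - y:k" if "x:k" "y:k" using a[OF that(1) u[OF that(2)]] by simp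
 show i: "inverse x:k" if "x:k" for x
 proof (cases "x = 0")
  case False
  thus ?thesis using subfield_m_inv(1)[OF assms, of x] that by (simp add: amb_inv)
 qed (use z in simp)
 show "x / y:k" if "x:k" "y:k" using m[OF that(1) i[OF that(2)]] by (simp add: divide_inverse)
qed

lemma subfieldI_type:
 fixes k :: "'a::field set"
 assumes "1:k" "!!x y. x:k ==> y:k ==> x + y:k" "!!x y. x:k ==> y:k ==> x * y:k"
  "!!x. x:k ==> - x:k" "!!x. x:k ==> x ~= 0 ==> inverse x:k"
 shows "subfield k amb"
proof -
 interpret field "amb :: 'a ring" by (rule amb_field)
 have "subring k (amb :: 'a ring)" by (rule subringI) (use assms in "auto simp: amb_uminus")
 thus ?thesis by (rule subfieldI') (use assms in "auto simp: amb_inv")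
qed

lemma subfield_is_subring: "subfield k amb ==> is_subring k"
 unfolding is_subring_def by (auto dest: subfieldD(2,4,6))

lemma subfield_of_nat_inverse: "subfield k amb ==> inverse (of_nat m):(k :: 'a::field set)"
 by (rule subfieldD(7)[OF _ subring_of_nat[OF subfield_is_subring]])

lemma adjoin_subfield: "subfield (adjoin k S) (amb :: 'a::field ring)"
proof -
 interpret field "amb :: 'a ring" by (rule amb_field)
 show ?thesis unfolding adjoin_def by (rule generate_field_is_subfield) simp
qed

lemma adjoin_incl: "k <= adjoin k S" "S <= adjoin k S"
 unfolding adjoin_def by (auto intro: generate_field.incl)

lemma adjoin_min: "subfield M amb ==> k <= M ==> S <= M ==> adjoin k S <= (M :: 'a::field set)"
proof -
 interpret field "amb :: 'a ring" by (rule amb_field)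
 show "subfield M amb ==> k <= M ==> S <= M ==> adjoin k S <= M"
  unfolding adjoin_def by (rule generate_field_min_subfield1) auto
qed

lemma adjoin_adjoin: "adjoin (adjoin k S) T = adjoin k (S Un T)"
proof (rule subset_antisym)
 have "adjoin k S <= adjoin k (S Un T)"
  by (rule adjoin_min[OF adjoin_subfield adjoin_incl(1)]) (use adjoin_incl(2)[of "S Un T" k] in blast)
 thus "adjoin (adjoin k S) T <= adjoin k (S Un T)"
  by (rule adjoin_min[OF adjoin_subfield]) (use adjoin_incl(2)[of "S Un T" k] in blast)
 have "S <= adjoin k S" "adjoin k S <= adjoin (adjoin k S) T" "T <= adjoin (adjoin k S) T" "k <= adjoin k S"
  by (rule adjoin_incl)+
 thus "adjoin k (S Un T) <= adjoin (adjoin k S) T"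
  by (intro adjoin_min[OF adjoin_subfield]) blast+
qed

definition coeffs_in :: "'a::field set => 'a poly => bool" where
 "coeffs_in k p <-> (ALL i. coeff p i:k)"

lemma eval_rev: "ring.eval (amb :: 'a::field ring) (rev xs) x = poly (Poly xs) x"
proof -
 interpret field "amb :: 'a ring" by (rule amb_field)
 show ?thesis
 proof (induction xs)
  case Nil thus ?case by simp
 next
  case (Cons a xs)
  have "eval (rev xs @ [a]) x = eval (rev xs) x * x + a"
   using eval_append_aux[of "rev xs" a x] by simp
  thus ?case using Cons by (simp add: algebra_simps)
 qed
qed

lemma algebraic_over_iff:
 fixes k :: "'a::field set"
 assumes k: "subfield k amb"
 shows "algebraic_over k x <-> (EX p. p ~= 0 & coeffs_in k p & poly p x = 0)"
proof -
 interpret field "amb :: 'a ring" by (rule amb_field)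
 note z = subfieldD(1)[OF k]
 show ?thesis
 proof
  assume "algebraic_over k x"
  then obtain l where l: "l:carrier (univ_poly amb k)" "l ~= []" "eval l x = 0"
   unfolding algebraic_over_def using algebraicE[OF subfieldE(1)[OF k], of x] by auto
  have hd: "hd l ~= 0" "set l <= k" using l(1,2) unfolding univ_poly_def polynomial_def by auto
  define p where "p = Poly (rev l)"
  have "poly p x = 0" using eval_rev[of "rev l" x] l(3) unfolding p_def by simp
  moreover have "coeffs_in k p" 
  proof -
   have "nth_default 0 (rev l) i:k" for i
    using nth_mem[of i "rev l"] hd(2) z by (cases "i < length l") (auto simp: nth_default_def)
   thus ?thesis unfolding coeffs_in_def p_def coeff_Poly_eq by blast
  qed
  moreover have "p ~= 0"
  proof
   assume "p = 0"
   hence "poly.coeff p (length l - 1) = 0" by simp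
   moreover have "poly.coeff p (length l - 1) = hd l"
    unfolding p_def coeff_Poly_eq nth_default_def using l(2) by (simp add: rev_nth hd_conv_nth)
   ultimately show False using hd(1) by simp
  qed
  ultimately show "EX p. p ~= 0 & coeffs_in k p & poly p x = 0" by blast
 next
  assume "EX p. p ~= 0 & coeffs_in k p & poly p x = 0"
  then obtain p where p: "p ~= 0" "coeffs_in k p" "poly p x = 0" by blast
  define l where "l = rev (coeffs p)"
  have "set l <= k" unfolding l_def using p(2) unfolding coeffs_in_def by (auto simp: coeffs_def)
  moreover have "hd l ~= 0" "l ~= []" unfolding l_def hd_rev using p(1) by (simp_all add: last_coeffs_eq_coeff_degree)
  moreover have "eval l x = 0" unfolding l_def eval_rev using p(3) by simp
  ultimately show "algebraic_over k x" unfolding algebraic_over_def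
   by (intro algebraicI[of l]) (auto simp: univ_poly_def polynomial_def)
 qed
qed

abbreviation finite_ext :: "'a::field set => 'a set => bool" where
 "finite_ext F M == ring.finite_dimension amb F M"

lemma finite_ext_adjoin:
 fixes k :: "'a::field set"
 assumes k: "subfield k amb" and S: "finite S" "!!x. x:S ==> algebraic_over k x"
 shows "finite_ext k (adjoin k S)"
proof -
 interpret field "amb :: 'a ring" by (rule amb_field)
 obtain xs where xs: "set xs = S" using finite_list[OF S(1)] by blast
 have alg: "(algebraic over k) x" if "x:set xs" for x using S(2) that unfolding algebraic_over_def xs by simp
 have fin: "finite_dimension k (finite_extension k xs)"
  by (rule finite_extension_finite_dimension(1)[OF k]) (use alg in auto)
 have sf: "subfield (finite_extension k xs) amb" by (rule finite_extension_is_subfield[OF k]) (use alg in auto)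
 have "k <= finite_extension k xs" by (rule finite_extension_incl) auto
 moreover have "set xs <= finite_extension k xs" by (rule finite_extension_mem[OF subfieldE(1)[OF k]]) auto
 ultimately have "adjoin k S <= finite_extension k xs" unfolding xs by (intro adjoin_min sf)
 moreover have "subalgebra k (adjoin k S) amb"
 proof -
  have "subgroup (adjoin k S) (add_monoid (amb :: 'a ring))"
   using subring.axioms(1)[OF subfieldE(1)[OF adjoin_subfield]] .
  moreover have "x * y:adjoin k S" if "x:k" "y:adjoin k S" for x y
   using subfieldD(4)[OF adjoin_subfield] that adjoin_incl(1) by blast
  ultimately show ?thesis unfolding subalgebra_def subalgebra_axioms_def by simp
 qed
 ultimately show ?thesis using subalbegra_incl_imp_finite_dimension[OF k fin] by blast
qed

lemma algebraic_of_finite_ext: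
 fixes k M :: "'a::field set"
 assumes "subfield k amb" "subfield M amb" "finite_ext k M" "x:M"
 shows "algebraic_over k x"
proof -
 interpret field "amb :: 'a ring" by (rule amb_field)
 show ?thesis unfolding algebraic_over_def
  by (rule finite_dimension_imp_algebraic[OF assms(1) subfieldE(1)[OF assms(2)] assms(3,4)])
qed

lemma finite_ext_tower:
 fixes k F M :: "'a::field set"
 assumes "subfield k amb" "subfield F amb" "finite_ext k F" "finite_ext F M"
 shows "finite_ext k M" "ext_degree k M = ext_degree k F * ext_degree F M"
proof -
 interpret field "amb :: 'a ring" by (rule amb_field)
 show "finite_ext k M" "ext_degree k M = ext_degree k F * ext_degree F M"
  unfolding ext_degree_def by (rule telescopic_base_dim[OF assms])+
qed

lemma algebraic_over_mono: "subfield k amb ==> subfield M amb ==> k <= M ==> algebraic_over k x ==> algebraic_over M x"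
proof -
 assume k: "subfield k amb" and M: "subfield M amb" and sub: "k <= M" and a: "algebraic_over k x"
 obtain p where "p ~= 0" "coeffs_in k p" "poly p x = 0" using a algebraic_over_iff[OF k] by blast
 hence "p ~= 0" "coeffs_in M p" "poly p x = 0" using sub unfolding coeffs_in_def by blast+
 thus ?thesis using algebraic_over_iff[OF M] by blast
qed

lemma algebraic_trans:
 assumes k: "subfield k amb" and S: "finite S" "!!x. x:S ==> algebraic_over k x" and y: "algebraic_over (adjoin k S) y"
 shows "algebraic_over k y"
proof -
 have f1: "finite_ext k (adjoin k S)" by (rule finite_ext_adjoin[OF k S])
 have f2: "finite_ext (adjoin k S) (adjoin (adjoin k S) {y})" by (rule finite_ext_adjoin[OF adjoin_subfield]) (use y in auto)
 have "finite_ext k (adjoin (adjoin k S) {y})" by (rule finite_ext_tower(1)[OF k adjoin_subfield f1 f2])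
 moreover have "y:adjoin (adjoin k S) {y}" using adjoin_incl(2) by blast
 ultimately show ?thesis using algebraic_of_finite_ext[OF k adjoin_subfield] by blast
qed

definition lin_indep :: "'a::field set => 'i set => ('i => 'a) => bool" where
 "lin_indep F I b <-> (ALL c. (ALL i:I. c i:F) --> (SUM i:I. c i * b i) = 0 --> (ALL i:I. c i = 0))"

definition lin_span :: "'a::field set => 'i set => ('i => 'a) => 'a set" where
 "lin_span F I b = {x. EX c. (ALL i:I. c i:F) & x = (SUM i:I. c i * b i)}"

lemma combine_sum:
 "length ks = length us ==> ring.combine (amb :: 'a::field ring) ks us = (SUM i<length us. ks ! i * us ! i)"
proof -
 interpret field "amb :: 'a ring" by (rule amb_field)
 show "length ks = length us ==> combine ks us = (SUM i<length us. ks ! i * us ! i)"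
 proof (induction ks us rule: list_induct2)
  case (Cons x xs y ys)
  have "(SUM i<length (y # ys). (x # xs) ! i * (y # ys) ! i) = x * y + (SUM i<length ys. xs ! i * ys ! i)"
   by (simp add: sum.lessThan_Suc_shift del: sum.lessThan_Suc)
  thus ?case using Cons by simp
 qed simp
qed

lemma finite_ext_basis:
 fixes F M :: "'a::field set"
 assumes F: "subfield F amb" and fin: "finite_ext F M"
 shows "EX b. lin_indep F {..<ext_degree F M} b & lin_span F {..<ext_degree F M} b = M"
proof -
 interpret field "amb :: 'a ring" by (rule amb_field)
 define n where "n = ext_degree F M"
 have "dimension n F M" using finite_dimensionE[OF F fin] unfolding n_def ext_degree_def .
 then obtain us where us: "independent F us" "length us = n" "Span F us = M" using exists_base[OF F] by blast
 have "lin_indep F {..<n} (%i. us ! i)"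
 proof -
  have "ALL i<n. c i = 0" if c: "ALL i<n. c i:F" "(SUM i<n. c i * us ! i) = 0" for c
  proof -
   have "combine (map c [0..<n]) us = 0" using c(2) us(2) by (subst combine_sum) auto
   moreover have "set (map c [0..<n]) <= F" using c(1) by auto
   ultimately have "set (take (length us) (map c [0..<n])) <= {0}"
    using independent_imp_trivial_combine[OF F us(1)] by simp
   thus ?thesis using us(2) by (auto simp: subset_iff)
  qed
  thus ?thesis unfolding lin_indep_def by auto
 qed
 moreover have "lin_span F {..<n} (%i. us ! i) = M"
 proof -
  have "x:M" if "x:lin_span F {..<n} (%i. us ! i)" for x
  proof -
   obtain c where c: "ALL i:{..<n}. c i:F" "x = (SUM i<n. c i * us ! i)" using `x:_` unfolding lin_span_def by blast
   have "x = combine (map c [0..<n]) us" using c(2) us(2) by (subst combine_sum) auto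
   moreover have "set (map c [0..<n]) <= F" "length (map c [0..<n]) = length us" using c(1) us(2) by auto
   ultimately have "EX ks. set ks <= F & length ks = length us & x = combine ks us" by blast
   hence "x:Span F us" using Span_mem_iff_length_version[OF F, of us x] by (simp only: amb_simps subset_UNIV)
   thus ?thesis unfolding us(3) .
  qed
  moreover have "x:lin_span F {..<n} (%i. us ! i)" if "x:M" for x
  proof -
   obtain ks where ks: "set ks <= F" "length ks = length us" "x = combine ks us"
    using `x:M` Span_mem_iff_length_version[OF F, of us] unfolding us(3) by auto
   have "x = (SUM i<n. ks ! i * us ! i)" unfolding ks(3) combine_sum[OF ks(2)] us(2) ..
   moreover have "ALL i:{..<n}. ks ! i:F" using ks(1,2) us(2) nth_mem by fastforce
   ultimately show ?thesis unfolding lin_span_def by blast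
  qed
  ultimately show ?thesis by blast
 qed
 ultimately show ?thesis unfolding n_def by blast
qed

lemma homogeneous_system:
 fixes F :: "'a::field set" and a :: "'i => nat => 'a"
 assumes F: "subfield F amb"
 shows "finite I ==> m < card I ==> (!!i j. i:I ==> j < m ==> a i j:F) ==>
  EX c. (ALL i:I. c i:F) & (EX i:I. c i ~= 0) & (ALL j<m. (SUM i:I. c i * a i j) = 0)"
proof (induction m arbitrary: I a)
 case 0
 hence "I ~= {}" by auto
 thus ?case using subfieldD(2)[OF F] by (intro exI[of _ "%_. 1"]) auto
next
 case (Suc m)
 note f = subfieldD[OF F]
 show ?case
 proof (cases "ALL i:I. a i m = 0")
  case True
  obtain c where c: "ALL i:I. c i:F" "EX i:I. c i ~= 0" "ALL j<m. (SUM i:I. c i * a i j) = 0"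
   using Suc.IH[of I a] Suc.prems by auto
  have "(SUM i:I. c i * a i m) = 0" using True by simp
  hence "ALL j<Suc m. (SUM i:I. c i * a i j) = 0" using c(3) less_Suc_eq by auto
  thus ?thesis using c by blast
 next
  case False
  then obtain z where z: "z:I" "a z m ~= 0" by blast
  define J where "J = I - {z}"
  have J: "finite J" "m < card J" "J <= I" "I = insert z J" "z ~: J" using Suc.prems z unfolding J_def by auto
  define a' where "a' i j = a i j - a i m / a z m * a z j" for i j
  have "EX c. (ALL i:J. c i:F) & (EX i:J. c i ~= 0) & (ALL j<m. (SUM i:J. c i * a' i j) = 0)"
   by (rule Suc.IH[OF J(1,2)]) (use J z Suc.prems(3) f in "auto simp: a'_def")
  then obtain c where c: "ALL i:J. c i:F" "EX i:J. c i ~= 0" "!!j. j < m ==> (SUM i:J. c i * a' i j) = 0" by blast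
  define s where "s = (SUM i:J. c i * a i m)"
  define d where "d i = (if i = z then - (s / a z m) else c i)" for i
  have dsum: "(SUM i:I. d i * a i j) = - (s / a z m) * a z j + (SUM i:J. c i * a i j)" for j
  proof -
   have "(SUM i:J. d i * a i j) = (SUM i:J. c i * a i j)" using J(5) by (intro sum.cong refl) (auto simp: d_def)
   thus ?thesis unfolding J(4) using J(1,5) by (simp add: d_def)
  qed
  have s1: "s:F" unfolding s_def by (intro subring_sum[OF subfield_is_subring[OF F]] f) (use c(1) J(3) Suc.prems(3) in auto)
  have "a z m:F" using z Suc.prems(3) by simp
  hence "ALL i:I. d i:F" using c(1) s1 f(5)[OF f(8)] unfolding J(4) d_def by auto
  moreover have "EX i:I. d i ~= 0" using c(2) J(5) unfolding J(4) d_def by auto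
  moreover have "(SUM i:I. d i * a i j) = 0" if "j < Suc m" for j
  proof (cases "j = m")
   case True thus ?thesis unfolding dsum using z(2) by (simp add: s_def)
  next
   case False
   hence "(SUM i:J. c i * a' i j) = 0" using c(3) that by simp
   also have "(SUM i:J. c i * a' i j) = (SUM i:J. c i * a i j) - s / a z m * a z j"
    unfolding a'_def s_def sum_divide_distrib sum_distrib_right sum_subtractf[symmetric]
    by (intro sum.cong refl) (simp add: algebra_simps)
   finally show ?thesis unfolding dsum by simp
  qed
  ultimately show ?thesis by blast
 qed
qed

lemma lin_indep_card_le:
 fixes F :: "'a::field set" and b :: "'i => 'a" and v :: "'j => 'a"
 assumes F: "subfield F amb" and I: "finite I" "lin_indep F I b" and J: "finite J" and sub: "!!i. i:I ==> b i:lin_span F J v"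
 shows "card I <= card J"
proof (rule ccontr)
 assume "~ ?thesis"
 hence lt: "card J < card I" by simp
 obtain e where e: "bij_betw e {..<card J} J" using ex_bij_betw_nat_finite[OF J] by (auto simp: atLeast0LessThan)
 have "ALL i:I. EX c. (ALL j:J. c j:F) & b i = (SUM j:J. c j * v j)" using sub unfolding lin_span_def by blast
 then obtain c where c: "!!i j. i:I ==> j:J ==> c i j:F" "!!i. i:I ==> b i = (SUM j:J. c i j * v j)"
  by metis
 have eJ: "e n:J" if "n < card J" for n using e that unfolding bij_betw_def by auto
 obtain d where d: "ALL i:I. d i:F" "EX i:I. d i ~= 0" "ALL n<card J. (SUM i:I. d i * c i (e n)) = 0"
  using homogeneous_system[OF F I(1) lt, of "%i n. c i (e n)"] c(1) eJ by blast
 have z: "(SUM i:I. d i * c i j) = 0" if "j:J" for j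
 proof -
  have "j:e ` {..<card J}" using bij_betw_imp_surj_on[OF e] that by simp
  then obtain n where "n < card J" "j = e n" by auto
  thus ?thesis using d(3) by blast
 qed
 have "(SUM i:I. d i * b i) = (SUM i:I. SUM j:J. d i * c i j * v j)"
  by (intro sum.cong refl) (simp add: c(2) sum_distrib_left mult.assoc)
 also have "... = (SUM j:J. (SUM i:I. d i * c i j) * v j)" by (subst sum.swap) (simp add: sum_distrib_right)
 also have "... = 0" using z by simp
 finally show False using I(2) d(1,2) unfolding lin_indep_def by blast
qed

section \<open>Heights of algebraic functions\<close>

lemma coeffs_in_simps:
 fixes k :: "'a::field set"
 assumes k: "subfield k amb"
 shows "coeffs_in k 0" "coeffs_in k 1" "coeffs_in k p ==> coeffs_in k q ==> coeffs_in k (p + q)"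
  "coeffs_in k p ==> coeffs_in k (- p)" "coeffs_in k p ==> coeffs_in k q ==> coeffs_in k (p * q)"
  "c:k ==> coeffs_in k (monom c n)" "c:k ==> coeffs_in k [:c:]" "coeffs_in k p ==> coeffs_in k (p ^ n)"
proof -
 note f = subfieldD[OF k] and R = subfield_is_subring[OF k]
 show "coeffs_in k 0" using f(1) by (simp add: coeffs_in_def)
 show one: "coeffs_in k 1" using f(1,2) by (simp add: coeffs_in_def coeff_1)
 show "coeffs_in k p ==> coeffs_in k q ==> coeffs_in k (p + q)" for p q using f(3) by (simp add: coeffs_in_def)
 show "coeffs_in k p ==> coeffs_in k (- p)" for p using f(5) by (simp add: coeffs_in_def)
 show mult: "coeffs_in k p ==> coeffs_in k q ==> coeffs_in k (p * q)" for p q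
  unfolding coeffs_in_def coeff_mult by (intro allI subring_sum[OF R] f(4)) auto
 show "c:k ==> coeffs_in k (monom c n)" for c n using f(1) by (simp add: coeffs_in_def)
 show "c:k ==> coeffs_in k [:c:]" for c using f(1) by (simp add: coeffs_in_def coeff_pCons split: nat.split)
 show "coeffs_in k p ==> coeffs_in k (p ^ n)" for p n by (induction n) (auto intro: one mult)
qed

lemma coeffs_in_sum: "subfield k amb ==> (!!i. i:I ==> coeffs_in k (f i)) ==> coeffs_in k (SUM i:I. f i)"
 by (induction I rule: infinite_finite_induct) (auto intro: coeffs_in_simps(1,3))

lemma poly_in_subfield:
 assumes k: "subfield k amb" and M: "subfield M amb" "k <= M" "x:M" and p: "coeffs_in k p"
 shows "poly p x:M"
 unfolding poly_altdef
 by (intro subring_sum[OF subfield_is_subring[OF M(1)]] subfieldD(4)[OF M(1)] subring_power[OF subfield_is_subring[OF M(1)]] M(3))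
  (use p M(2) in "auto simp: coeffs_in_def")

lemma adjoin_single:
 fixes k :: "'a::field set"
 assumes k: "subfield k amb" and y: "y:adjoin k {t}"
 shows "EX p q. coeffs_in k p & coeffs_in k q & poly q t ~= 0 & y = poly p t / poly q t"
proof -
 note c = coeffs_in_simps[OF k]
 define Q where "Q = {y. EX p q. coeffs_in k p & coeffs_in k q & poly q t ~= 0 & y = poly p t / poly q t}"
 have QI: "y:Q" if "coeffs_in k p" "coeffs_in k q" "poly q t ~= 0" "y = poly p t / poly q t" for y p q
  using that unfolding Q_def by blast
 have "subfield Q amb"
 proof (rule subfieldI_type)
  show "1:Q" by (rule QI[OF c(2) c(2)]) auto
 next
  fix x y assume "x:Q" "y:Q"
  then obtain p q p' q' where x: "coeffs_in k p" "coeffs_in k q" "poly q t ~= 0" "x = poly p t / poly q t"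
   and y: "coeffs_in k p'" "coeffs_in k q'" "poly q' t ~= 0" "y = poly p' t / poly q' t" unfolding Q_def by blast
  show "x + y:Q" 
  proof (rule QI[OF c(3)[OF c(5)[OF x(1) y(2)] c(5)[OF y(1) x(2)]] c(5)[OF x(2) y(2)]])
   show "x + y = poly (p * q' + p' * q) t / poly (q * q') t" using x(3) y(3) unfolding x(4) y(4) by (simp add: add_frac_eq mult.commute)
  qed (use x(3) y(3) in simp)
  show "x * y:Q" by (rule QI[OF c(5)[OF x(1) y(1)] c(5)[OF x(2) y(2)]]) (use x y in auto)
 next
  fix x assume "x:Q"
  then obtain p q where x: "coeffs_in k p" "coeffs_in k q" "poly q t ~= 0" "x = poly p t / poly q t" unfolding Q_def by blast
  show "- x:Q" by (rule QI[OF c(4)[OF x(1)] x(2,3)]) (use x(4) in simp)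
  show "inverse x:Q" if "x ~= 0" by (rule QI[OF x(2,1)]) (use x that in auto)
 qed
 moreover have "k <= Q"
 proof
  fix x assume "x:k"
  show "x:Q" by (rule QI[OF c(7)[OF `x:k`] c(2)]) auto
 qed
 moreover have "t:Q"
  by (rule QI[OF c(6)[OF subfieldD(2)[OF k], of 1] c(2)]) (auto simp: poly_monom)
 ultimately have "adjoin k {t} <= Q" by (intro adjoin_min) auto
 thus ?thesis using y unfolding Q_def by blast
qed

lemma common_denominator:
 fixes k :: "'a::field set"
 assumes k: "subfield k amb" and I: "finite I" "!!i. i:I ==> y i:adjoin k {t}"
 shows "EX d. coeffs_in k d & poly d t ~= 0 & (ALL i:I. EX p. coeffs_in k p & poly d t * y i = poly p t)"
 using I
proof (induction I)
 case empty
 show ?case by (rule exI[of _ 1]) (simp add: coeffs_in_simps(2)[OF k])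
next
 case (insert z I)
 obtain d where d: "coeffs_in k d" "poly d t ~= 0" "!!i. i:I ==> EX p. coeffs_in k p & poly d t * y i = poly p t"
  using insert.IH insert.prems by auto
 obtain p q where pq: "coeffs_in k p" "coeffs_in k q" "poly q t ~= 0" "y z = poly p t / poly q t"
  using adjoin_single[OF k, of "y z"] insert.prems by blast
 note c = coeffs_in_simps(5)[OF k]
 have "EX p. coeffs_in k p & poly (d * q) t * y i = poly p t" if i: "i:insert z I" for i
 proof (cases "i = z")
  case True
  thus ?thesis using c[OF d(1) pq(1)] pq(3,4) by (intro exI[of _ "d * p"]) auto
 next
  case False
  then obtain p' where "coeffs_in k p'" "poly d t * y i = poly p' t" using d(3) i by blast
  thus ?thesis using c[OF pq(2), of p'] by (intro exI[of _ "q * p'"]) (auto simp: mult_ac)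
 qed
 moreover have "coeffs_in k (d * q)" "poly (d * q) t ~= 0" using c d pq by auto
 ultimately show ?case by blast
qed

lemma poly_bounded: "degree p <= n ==> poly p x = (SUM i<=n. coeff p i * (x :: 'a::comm_ring_1) ^ i)"
proof -
 assume d: "degree p <= n"
 have "(SUM i<=n. coeff p i * x ^ i) = (SUM i<=degree p. coeff p i * x ^ i)"
  by (rule sum.mono_neutral_right) (use d in "auto simp: coeff_eq_0")
 thus ?thesis unfolding poly_altdef ..
qed

lemma algebraic_exchange:
 fixes k :: "'a::field set"
 assumes k: "subfield k amb" and j: "algebraic_over (adjoin k {t}) j" "~ algebraic_over k j"
 shows "algebraic_over (adjoin k {j}) t"
proof -
 obtain p where p: "p ~= 0" "coeffs_in (adjoin k {t}) p" "poly p j = 0"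
  using j(1) algebraic_over_iff[OF adjoin_subfield] by blast
 have "EX d. coeffs_in k d & poly d t ~= 0 & (ALL i:{..degree p}. EX q. coeffs_in k q & poly d t * coeff p i = poly q t)"
  by (rule common_denominator[OF k]) (use p(2) in "auto simp: coeffs_in_def")
 then obtain d C where d: "poly d t ~= 0" and C: "!!i. i <= degree p ==> coeffs_in k (C i) & poly d t * coeff p i = poly (C i) t"
  by (metis atMost_iff)
 define n where "n = degree p"
 define m where "m = Max ((%i. degree (C i)) ` {..n})"
 have m: "degree (C i) <= m" if "i <= n" for i unfolding m_def using that by (intro Max_ge) auto
 define g where "g a = (SUM i<=n. monom (coeff (C i) a) i)" for a
 define q where "q = (SUM a<=m. monom (poly (g a) j) a)"
 have gk: "coeffs_in k (g a)" for a unfolding g_def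
  by (intro coeffs_in_sum[OF k] coeffs_in_simps(6)[OF k]) (use C in "auto simp: n_def coeffs_in_def")
 have cq: "coeff q a = (if a <= m then poly (g a) j else 0)" for a
  unfolding q_def coeff_sum by (simp add: if_distrib sum.delta cong: if_cong)
 have "coeffs_in (adjoin k {j}) q"
  unfolding coeffs_in_def cq using poly_in_subfield[OF k adjoin_subfield adjoin_incl(1) _ gk] adjoin_incl(2)[of "{j}" k]
   subfieldD(1)[OF adjoin_subfield] by auto
 moreover have "poly q t = 0"
 proof -
  have "poly q t = (SUM a<=m. SUM i<=n. coeff (C i) a * t ^ a * j ^ i)"
   unfolding q_def g_def poly_sum poly_monom sum_distrib_right by (intro sum.cong refl) (simp add: mult_ac)
  also have "... = (SUM i<=n. (SUM a<=m. coeff (C i) a * t ^ a) * j ^ i)" by (subst sum.swap) (simp add: sum_distrib_right)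
  also have "... = (SUM i<=n. poly d t * coeff p i * j ^ i)"
   by (intro sum.cong refl) (use m C in "simp add: n_def flip: poly_bounded")
  also have "... = poly d t * poly p j" unfolding poly_altdef n_def sum_distrib_left by (simp add: mult.assoc)
  finally show ?thesis using p(3) by simp
 qed
 moreover have "q ~= 0"
 proof
  assume q0: "q = 0"
  have "poly (C n) t ~= 0" using C[of n] d p(1) unfolding n_def by (metis leading_coeff_0_iff mult_eq_0_iff order_refl)
  hence "C n ~= 0" by auto
  then obtain a where a: "coeff (C n) a ~= 0" by (auto simp: poly_eq_iff)
  hence am: "a <= m" using m[of n] le_degree[of "C n" a] by simp
  hence "poly (g a) j = 0" using cq[of a] q0 by simp
  hence "g a = 0" using j(2) gk algebraic_over_iff[OF k] by blast
  moreover have "coeff (g a) n = coeff (C n) a" unfolding g_def coeff_sum by simp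
  ultimately show False using a by simp
 qed
 ultimately show ?thesis using algebraic_over_iff[OF adjoin_subfield] by blast
qed

lemma adjoin_mono: "S <= T ==> adjoin k S <= adjoin (k :: 'a::field set) T"
proof (rule adjoin_min[OF adjoin_subfield adjoin_incl(1)])
 assume "S <= T"
 thus "S <= adjoin k T" using adjoin_incl(2)[of T k] by (rule subset_trans)
qed

lemma ext_degree_pos:
 fixes F M :: "'a::field set"
 assumes F: "subfield F amb" and fin: "finite_ext F M" and M: "1:M"
 shows "ext_degree F M > 0"
proof (rule ccontr)
 assume "~ ?thesis"
 hence z: "ext_degree F M = 0" by simp
 obtain b where "lin_span F {..<ext_degree F M} b = M" using finite_ext_basis[OF F fin] by blast
 thus False using M unfolding z lin_span_def by auto
qed

text \<open>
  A function field K of a curve over k, inside an algebraic closure of K.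
\<close>
locale curve_field = closed_field "TYPE('a)" for k K :: "'a::field set" +
 assumes k: "subfield k amb" and K: "subfield K amb"
  and fg: "EX S. finite S & K = adjoin k S"
  and td: "transcendence_degree_one k K"
  and alg: "!!y. algebraic_over K y"
begin

lemma algebraic_over_transcendental:
 assumes j: "~ algebraic_over k j" shows "algebraic_over (adjoin k {j}) y"
proof -
 obtain t where t: "t:K" "~ algebraic_over k t" "ALL y:K. algebraic_over (adjoin k {t}) y"
  using td unfolding transcendence_degree_one_def by blast
 obtain S where S: "finite S" "K = adjoin k S" using fg by blast
 have KS: "K <= adjoin (adjoin k {t}) S"
  unfolding S(2) adjoin_adjoin by (rule adjoin_mono) blast
 have SK: "S <= K" unfolding S(2) by (rule adjoin_incl)
 have at: "algebraic_over (adjoin k {t}) y" for y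
  by (rule algebraic_trans[OF adjoin_subfield S(1)])
   (use t(3) SK algebraic_over_mono[OF K adjoin_subfield KS alg] in blast)+
 have tj: "algebraic_over (adjoin k {j}) t" by (rule algebraic_exchange[OF k at j])
 have sub: "adjoin k {t} <= adjoin (adjoin k {j}) {t}"
  unfolding adjoin_adjoin by (rule adjoin_mono) blast
 show ?thesis
  by (rule algebraic_trans[OF adjoin_subfield, of "{t}"])
   (use tj algebraic_over_mono[OF adjoin_subfield adjoin_subfield sub at] in simp_all)
qed

text \<open>
  Any finite extension of K containing j computes the height: enlarging it from \<open>K (j)\<close> multiplies
  both degrees by the same number.
\<close>
lemma height_formula:
 assumes T: "finite T" and j: "j:adjoin K T" "~ algebraic_over k j"
 shows "height k K j = ext_degree (adjoin k {j}) (adjoin K T) / ext_degree K (adjoin K T)"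
  and "finite_ext (adjoin k {j}) (adjoin K T)" and "ext_degree K (adjoin K T) > 0"
proof -
 obtain S where S: "finite S" "K = adjoin k S" using fg by blast
 define L where "L = adjoin K T"
 define Kj where "Kj = adjoin K {j}"
 have L: "L = adjoin Kj T"
 proof -
  have "adjoin Kj T <= L" unfolding L_def Kj_def adjoin_adjoin
   by (rule adjoin_min[OF adjoin_subfield adjoin_incl(1)]) (use adjoin_incl(2)[of T K] j(1) in simp)
  moreover have "L <= adjoin Kj T" unfolding L_def Kj_def adjoin_adjoin by (rule adjoin_mono) blast
  ultimately show ?thesis by blast
 qed
 have Kj: "Kj = adjoin (adjoin k {j}) S" unfolding Kj_def S(2) adjoin_adjoin by (simp add: Un_commute)
 have f1: "finite_ext K Kj" unfolding Kj_def by (rule finite_ext_adjoin[OF K]) (use alg in auto)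
 have sKj: "subfield Kj amb" unfolding Kj_def by (rule adjoin_subfield)
 have "K <= Kj" unfolding Kj_def by (rule adjoin_incl)
 hence f2: "finite_ext Kj L" unfolding L by (intro finite_ext_adjoin[OF sKj T] algebraic_over_mono[OF K sKj _ alg])
 have f3: "finite_ext (adjoin k {j}) Kj" unfolding Kj
  by (rule finite_ext_adjoin[OF adjoin_subfield S(1) algebraic_over_transcendental[OF j(2)]])
 note t1 = finite_ext_tower[OF adjoin_subfield sKj f3 f2] and t2 = finite_ext_tower[OF K sKj f1 f2]
 have one: "1:L" unfolding L by (rule subfieldD(2)[OF adjoin_subfield])
 show "finite_ext (adjoin k {j}) (adjoin K T)" using t1(1) unfolding L_def .
 show "ext_degree K (adjoin K T) > 0" using ext_degree_pos[OF K t2(1) one] unfolding L_def .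
 have "ext_degree Kj L > 0" by (rule ext_degree_pos[OF sKj f2 one])
 thus "height k K j = ext_degree (adjoin k {j}) (adjoin K T) / ext_degree K (adjoin K T)"
  unfolding height_def height_via_def L_def[symmetric] Kj_def[symmetric] t1(2) t2(2) using j(2) by simp
qed

lemma height_nonneg: "height k K j >= 0"
 unfolding height_def height_via_def by simp

end

text \<open>
  Repeated reduction by the monic equation; its grading keeps the growth of the degrees linear in u.
\<close>
lemma graded_integral_powers:
 fixes k :: "'a::field set"
 assumes k: "subfield k amb" and g: "graded_integral k y s"
 shows "EX m. ALL u. EX Q. s ^ u = (SUM a<m. s ^ a * poly (Q a) y) & (ALL a<m. coeffs_in k (Q a) & degree (Q a) <= m + u)"
proof -
 obtain m P where P: "s ^ m = (SUM a<m. s ^ a * poly (P a) y)" "!!a. a < m ==> coeffs_in k (P a) & degree (P a) + a <= m"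
  using g unfolding graded_integral_def coeffs_in_def by blast
 obtain m' where m': "m = Suc m'" using P(1) by (cases m) auto
 note c = coeffs_in_simps[OF k]
 have "EX Q. s ^ u = (SUM a<m. s ^ a * poly (Q a) y) & (ALL a<m. coeffs_in k (Q a) & degree (Q a) + a <= m + u)" for u
 proof (induction u)
  case 0
  have "(SUM a<m. s ^ a * poly (if a = 0 then 1 else 0) y) = (SUM a<m. if a = 0 then 1 else 0)" by (intro sum.cong) auto
  thus ?case using c(1,2) m' by (intro exI[of _ "%a. if a = 0 then 1 else 0"]) auto
 next
  case (Suc u)
  then obtain Q where Q: "s ^ u = (SUM a<m. s ^ a * poly (Q a) y)" "!!a. a < m ==> coeffs_in k (Q a) & degree (Q a) + a <= m + u" by blast
  define R where "R a = (if a = 0 then 0 else Q (a - 1)) + Q m' * P a" for a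
  have "s ^ Suc u = (SUM a<m'. s ^ Suc a * poly (Q a) y) + s ^ m * poly (Q m') y"
   unfolding power_Suc[of s u] Q(1) sum_distrib_left m' by (simp add: mult.assoc)
  also have "(SUM a<m'. s ^ Suc a * poly (Q a) y) = (SUM a<m. s ^ a * poly (if a = 0 then 0 else Q (a - 1)) y)"
   unfolding m' sum.lessThan_Suc_shift by simp
  also have "... + s ^ m * poly (Q m') y = (SUM a<m. s ^ a * poly (R a) y)"
   unfolding P(1) sum_distrib_right R_def sum.distrib[symmetric] by (intro sum.cong) (simp_all add: algebra_simps)
  finally have "s ^ Suc u = (SUM a<m. s ^ a * poly (R a) y)" .
  moreover have "coeffs_in k (R a)" if "a < m" for a
   unfolding R_def using that m' by (intro c(3) c(5)) (auto intro: c(1) simp: Q(2) P(2))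
  moreover have "degree (R a) <= m + Suc u - a" if a: "a < m" for a
   unfolding R_def
  proof (rule degree_add_le)
   show "degree (if a = 0 then 0 else Q (a - 1)) <= m + Suc u - a" using Q(2)[of "a - 1"] a by (cases a) auto
   have "degree (Q m' * P a) <= degree (Q m') + degree (P a)" by (rule degree_mult_le)
   thus "degree (Q m' * P a) <= m + Suc u - a" using Q(2)[of m'] P(2)[OF a] a m' by linarith
  qed
  ultimately show ?case by (intro exI[of _ R]) fastforce
 qed
 thus ?thesis by (meson add_leD1)
qed

text \<open>
  The products \<open>e\<^sub>l s\<^sup>n j'\<^sup>i\<close> with \<open>i < q (n + 1)\<close> are independent over k, and up to a common
  denominator they are combinations of the \<open>f\<^sub>t\<close> with polynomials in j of degree at most
  \<open>r n + c\<close> as coefficients; compare dimensions and let n grow.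
\<close>
theorem degree_comparison:
 fixes k L :: "'a::field set"
 assumes k: "subfield k amb" and L: "subfield L amb" and L_mem: "k <= L" "j:L" "j':L" "s:L" and s0: "s ~= 0"
  and f: "L <= lin_span (adjoin k {j}) {..<N} f"
  and e: "!!l. l < N' ==> e l:L" "lin_indep (adjoin k {j'}) {..<N'} e"
  and tr: "~ algebraic_over k j'" "~ algebraic_over k j"
  and gi: "graded_integral k (j ^ r) s" "graded_integral k (j ^ r) (s * j' ^ q)" and q: "q > 0"
 shows "N' * q <= N * r"
proof -
 note c = coeffs_in_simps[OF k] and fL = subfieldD[OF L] and pL = subring_power[OF subfield_is_subring[OF L]]
 define w where "w = s * j' ^ q"
 define M where "M D = {x. EX P. (ALL t<N. coeffs_in k (P t) & degree (P t) <= D) & x = (SUM t<N. poly (P t) j * f t)}" for D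
 have M_zero: "0:M D" for D unfolding M_def using c(1) by (auto intro!: exI[of _ "%_. 0"])
 have M_add: "x + y:M D" if "x:M D" "y:M D" for x y D
 proof -
  obtain P Q where "ALL t<N. coeffs_in k (P t) & degree (P t) <= D" "x = (SUM t<N. poly (P t) j * f t)"
   "ALL t<N. coeffs_in k (Q t) & degree (Q t) <= D" "y = (SUM t<N. poly (Q t) j * f t)" using `x:M D` `y:M D` unfolding M_def by blast
  hence "ALL t<N. coeffs_in k (P t + Q t) & degree (P t + Q t) <= D" "x + y = (SUM t<N. poly (P t + Q t) j * f t)"
   using c(3) by (auto simp: sum.distrib algebra_simps intro: degree_add_le)
  thus ?thesis unfolding M_def by (intro CollectI exI[of _ "%t. P t + Q t"]) blast
 qed
 have M_sum: "(SUM i:I. g i):M D" if "!!i. i:I ==> g i:M D" for I :: "nat set" and g D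
  using that by (induction I rule: infinite_finite_induct) (auto intro: M_zero M_add)
 have M_mult: "poly Q j * x:M (D + d)" if "x:M D" "coeffs_in k Q" "degree Q <= d" for x D Q d
 proof -
  obtain P where P: "!!t. t < N ==> coeffs_in k (P t) & degree (P t) <= D" "x = (SUM t<N. poly (P t) j * f t)"
   using `x:M D` unfolding M_def by blast
  have "coeffs_in k (Q * P t) & degree (Q * P t) <= D + d" if "t < N" for t
  proof -
   have "degree (Q * P t) <= degree Q + degree (P t)" by (rule degree_mult_le)
   thus ?thesis using P(1)[OF that] `degree Q <= d` c(5)[OF `coeffs_in k Q`] by fastforce
  qed
  moreover have "poly Q j * x = (SUM t<N. poly (Q * P t) j * f t)" unfolding P(2) by (simp add: sum_distrib_left mult.assoc)
  ultimately show ?thesis unfolding M_def by (intro CollectI exI[of _ "%t. Q * P t"]) blast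
 qed
 have M_span: "M D <= lin_span k ({..<N} \<times> {..D}) (%(t, i). f t * j ^ i)" for D
 proof
  fix x assume "x:M D"
  then obtain P where P: "!!t. t < N ==> coeffs_in k (P t) & degree (P t) <= D" "x = (SUM t<N. poly (P t) j * f t)"
   unfolding M_def by blast
  have "x = (SUM t<N. SUM i<=D. coeff (P t) i * (f t * j ^ i))"
   unfolding P(2)
  proof (intro sum.cong refl)
   fix t assume "t:{..<N}"
   hence "degree (P t) <= D" using P(1) by simp
   thus "poly (P t) j * f t = (SUM i<=D. coeff (P t) i * (f t * j ^ i))"
    unfolding poly_bounded[of "P t" D j, OF `degree (P t) <= D`] sum_distrib_right by (simp add: mult_ac)
  qed
  also have "... = (SUM z:{..<N} \<times> {..D}. (%(t, i). coeff (P t) i) z * (%(t, i). f t * j ^ i) z)"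
   unfolding sum.cartesian_product by (intro sum.cong refl) (auto split: prod.splits)
  finally have "x = (SUM z:{..<N} \<times> {..D}. (%(t, i). coeff (P t) i) z * (%(t, i). f t * j ^ i) z)" .
  moreover have "ALL z:{..<N} \<times> {..D}. (%(t, i). coeff (P t) i) z:k" using P(1) unfolding coeffs_in_def by auto
  ultimately show "x:lin_span k ({..<N} \<times> {..D}) (%(t, i). f t * j ^ i)" unfolding lin_span_def by blast
 qed
 obtain m where m: "!!u. EX Q. s ^ u = (SUM a<m. s ^ a * poly (Q a) (j ^ r)) & (ALL a<m. coeffs_in k (Q a) & degree (Q a) <= m + u)"
  using graded_integral_powers[OF k gi(1)] by blast
 obtain m' where m': "!!u. EX Q. w ^ u = (SUM a<m'. w ^ a * poly (Q a) (j ^ r)) & (ALL a<m'. coeffs_in k (Q a) & degree (Q a) <= m' + u)"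
  using graded_integral_powers[OF k gi(2)] unfolding w_def by blast
 define T where "T = (%(l, b, a, a'). e l * j' ^ b * s ^ a * w ^ a') ` ({..<N'} \<times> {..<q} \<times> {..<m} \<times> {..<m'})"
 have TL: "T <= L" unfolding T_def w_def using e(1) L_mem by (auto intro!: fL pL)
 have finT: "finite T" unfolding T_def by auto
 obtain d D where d: "coeffs_in k d" "poly d j ~= 0" "!!tau. tau:T ==> poly d j * tau:M D"
 proof -
  have "ALL tau:T. EX g. (ALL t<N. g t:adjoin k {j}) & tau = (SUM t<N. g t * f t)" using f TL unfolding lin_span_def by blast
  then obtain g where g: "!!tau t. tau:T ==> t < N ==> g tau t:adjoin k {j}" "!!tau. tau:T ==> tau = (SUM t<N. g tau t * f t)" by metis
  have "EX d. coeffs_in k d & poly d j ~= 0 & (ALL i:T \<times> {..<N}. EX p. coeffs_in k p & poly d j * (%(tau, t). g tau t) i = poly p j)"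
   by (rule common_denominator[OF k]) (use finT g(1) in auto)
  then obtain d where dd: "coeffs_in k d" "poly d j ~= 0" and "!!i. i:T \<times> {..<N} ==> EX p. coeffs_in k p & poly d j * (%(tau, t). g tau t) i = poly p j"
   by blast
  then obtain P where P: "!!i. i:T \<times> {..<N} ==> coeffs_in k (P i) & poly d j * (%(tau, t). g tau t) i = poly (P i) j" by metis
  define D where "D = Max ((%i. degree (P i)) ` (T \<times> {..<N}))"
  have D: "degree (P i) <= D" if "i:T \<times> {..<N}" for i unfolding D_def using that finT by (intro Max_ge) auto
  have "poly d j * tau:M D" if tau: "tau:T" for tau
  proof -
   have "poly d j * tau = (SUM t<N. poly d j * g tau t * f t)" by (subst g(2)[OF tau]) (simp add: sum_distrib_left mult.assoc)
   also have "... = (SUM t<N. poly (P (tau, t)) j * f t)"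
    by (intro sum.cong refl) (use P tau in force)
   finally have eq: "poly d j * tau = (SUM t<N. poly (P (tau, t)) j * f t)" .
   moreover have "ALL t<N. coeffs_in k (P (tau, t)) & degree (P (tau, t)) <= D" using P D tau by auto
   ultimately show ?thesis unfolding M_def by (intro CollectI exI[of _ "%t. P (tau, t)"]) blast
  qed
  with dd show ?thesis using that by blast
 qed
 define C where "C = D + r * (m + m')"
 have upper: "poly d j * (e l * s ^ n * j' ^ i):M (C + r * n)" if l: "l < N'" and i: "i < q * Suc n" for l i n
 proof -
  define u b where "u = i div q" and "b = i mod q"
  have ui: "u <= n" "b < q" "i = q * u + b" using i q unfolding u_def b_def by (auto simp: div_less_iff_less_mult less_Suc_eq_le[symmetric] mult.commute)
  obtain Q where Q: "s ^ (n - u) = (SUM a<m. s ^ a * poly (Q a) (j ^ r))" "!!a. a < m ==> coeffs_in k (Q a) & degree (Q a) <= m + (n - u)" using m by metis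
  obtain R where R: "w ^ u = (SUM a<m'. w ^ a * poly (R a) (j ^ r))" "!!a. a < m' ==> coeffs_in k (R a) & degree (R a) <= m' + u" using m' by metis
  have "e l * s ^ n * j' ^ i = e l * j' ^ b * s ^ (n - u) * w ^ u"
  proof -
   have "s ^ n = s ^ (n - u) * s ^ u" using ui(1) by (simp flip: power_add)
   thus ?thesis unfolding w_def ui(3) by (simp add: power_add power_mult power_mult_distrib mult_ac)
  qed
  also have "... = (SUM a<m. SUM a'<m'. (e l * j' ^ b * s ^ a * w ^ a') * poly (Q a * R a') (j ^ r))"
   unfolding Q(1) R(1) sum_distrib_left sum_distrib_right
   by (subst sum.swap, intro sum.cong refl) (simp add: mult_ac)
  finally have "poly d j * (e l * s ^ n * j' ^ i) = (SUM a<m. SUM a'<m'. poly (pcompose (Q a * R a') (monom 1 r)) j * (poly d j * (e l * j' ^ b * s ^ a * w ^ a')))"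
   by (simp add: sum_distrib_left poly_pcompose poly_monom mult_ac)
  moreover have "poly (pcompose (Q a * R a') (monom 1 r)) j * (poly d j * (e l * j' ^ b * s ^ a * w ^ a')):M (D + r * (m + m' + n))" if a: "a < m" "a' < m'" for a a'
  proof (rule M_mult)
   show "poly d j * (e l * j' ^ b * s ^ a * w ^ a'):M D" by (rule d(3)) (use l ui a in "force simp: T_def")
   have QR: "coeffs_in k (Q a * R a')" using c(5) Q(2)[OF a(1)] R(2)[OF a(2)] by blast
   have "pcompose (Q a * R a') (monom 1 r) = (SUM i<=degree (Q a * R a'). [:coeff (Q a * R a') i:] * monom 1 r ^ i)"
    unfolding pcompose_altdef poly_altdef by (simp add: degree_map_poly coeff_map_poly)
   also have "coeffs_in k ..."
    by (intro coeffs_in_sum[OF k] c(5) c(7) c(8) c(6) subfieldD(2)[OF k]) (use QR in "auto simp: coeffs_in_def")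
   finally show "coeffs_in k (pcompose (Q a * R a') (monom 1 r))" .
   have "degree (Q a * R a') <= degree (Q a) + degree (R a')" by (rule degree_mult_le)
   also have "... <= m + m' + n" using Q(2)[OF a(1)] R(2)[OF a(2)] ui(1) by linarith
   finally have "degree (Q a * R a') <= m + m' + n" .
   hence "degree (Q a * R a') * degree (monom (1::'a) r) <= r * (m + m' + n)" using degree_monom_le[of "1::'a" r] by (metis mult.commute mult_le_mono)
   thus "degree (pcompose (Q a * R a') (monom 1 r)) <= r * (m + m' + n)" using degree_pcompose_le[of "Q a * R a'" "monom 1 r"] by linarith
  qed
  moreover have "C + r * n = D + r * (m + m' + n)" unfolding C_def by (simp add: algebra_simps)
  ultimately show ?thesis by (simp only:) (intro M_sum, auto)
 qed
 have indep: "lin_indep k ({..<N'} \<times> {..<Z}) (%(l, i). poly d j * (e l * s ^ n * j' ^ i))" for Z n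
 proof -
  have "ALL z:{..<N'} \<times> {..<Z}. g z = 0" if g: "ALL z:{..<N'} \<times> {..<Z}. g z:k"
   "(SUM z:{..<N'} \<times> {..<Z}. g z * (%(l, i). poly d j * (e l * s ^ n * j' ^ i)) z) = 0" for g
  proof -
   define G where "G l = (SUM i<Z. monom (g (l, i)) i)" for l
   have Gk: "coeffs_in k (G l)" if "l < N'" for l unfolding G_def using g(1) that by (intro coeffs_in_sum[OF k] c(6)) auto
   have "0 = (SUM l<N'. SUM i<Z. g (l, i) * (poly d j * (e l * s ^ n * j' ^ i)))"
    unfolding g(2)[symmetric] sum.cartesian_product by (intro sum.cong refl) (auto split: prod.splits)
   also have "... = (poly d j * s ^ n) * (SUM l<N'. poly (G l) j' * e l)"
    unfolding G_def poly_sum poly_monom sum_distrib_left sum_distrib_right by (intro sum.cong refl) (simp add: mult_ac)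
   finally have "(SUM l<N'. poly (G l) j' * e l) = 0" using d(2) s0 by simp
   moreover have "ALL l:{..<N'}. poly (G l) j':adjoin k {j'}"
    using poly_in_subfield[OF k adjoin_subfield adjoin_incl(1) _ Gk] adjoin_incl(2)[of "{j'}" k] by auto
   ultimately have "ALL l:{..<N'}. poly (G l) j' = 0" using e(2) unfolding lin_indep_def by (elim allE[of _ "%l. poly (G l) j'"]) blast
   hence G0: "G l = 0" if "l < N'" for l using tr(1) Gk[OF that] that algebraic_over_iff[OF k] by blast
   have "g (l, i) = 0" if "l < N'" "i < Z" for l i
   proof -
    have "coeff (G l) i = g (l, i)" unfolding G_def coeff_sum using that(2) by simp
    thus ?thesis using G0[OF that(1)] by simp
   qed
   thus ?thesis by auto
  qed
  thus ?thesis unfolding lin_indep_def by blast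
 qed
 have count: "N' * (q * Suc n) <= N * Suc (C + r * n)" for n
 proof -
  have "card ({..<N'} \<times> {..<q * Suc n}) <= card ({..<N} \<times> {..C + r * n})"
  proof (rule lin_indep_card_le[OF k _ indep])
   fix z assume "z:{..<N'} \<times> {..<q * Suc n}"
   hence "(%(l, i). poly d j * (e l * s ^ n * j' ^ i)) z:M (C + r * n)" using upper by auto
   thus "(%(l, i). poly d j * (e l * s ^ n * j' ^ i)) z:lin_span k ({..<N} \<times> {..C + r * n}) (%(t, i). f t * j ^ i)"
    using M_span by blast
  qed auto
  thus ?thesis by (simp add: card_cartesian_product)
 qed
 show ?thesis
 proof (rule ccontr)
  assume "~ ?thesis"
  hence lt: "Suc (N * r) <= N' * q" by simp
  define n where "n = N * Suc C"
  have "Suc (N * r) * Suc n <= N' * q * Suc n" using lt by (rule mult_le_mono1)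
  also have "... <= N * Suc (C + r * n)" using count[of n] by (simp only: mult.assoc)
  also have "... = n + N * r * n" unfolding n_def by (simp add: algebra_simps)
  finally show False by (simp add: algebra_simps)
 qed
qed

context curve_field
begin

lemma graded_integral_algebraic:
 assumes "graded_integral k y s" shows "algebraic_over (adjoin k {y}) s"
proof -
 obtain m P where P: "s ^ m = (SUM a<m. s ^ a * poly (P a) y)" "!!a. a < m ==> coeffs_in k (P a)"
  using assms unfolding graded_integral_def coeffs_in_def by blast
 define A where "A = adjoin k {y}"
 have A: "subfield A amb" "k <= A" "y:A" unfolding A_def using adjoin_subfield[of k "{y}"] adjoin_incl(1)[of k "{y}"] adjoin_incl(2)[of "{y}" k] by auto
 define p where "p = monom 1 m - (SUM a<m. monom (poly (P a) y) a)"
 have "coeff p m = 1" unfolding p_def coeff_diff coeff_sum by simp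
 hence "p ~= 0" by auto
 moreover have "coeffs_in A (monom 1 m + - (SUM a<m. monom (poly (P a) y) a))"
  by (intro coeffs_in_simps(3,4,6)[OF A(1)] coeffs_in_sum[OF A(1)] subfieldD(2)[OF A(1)] poly_in_subfield[OF k A] P(2)) auto
 hence "coeffs_in A p" unfolding p_def by simp
 moreover have "poly p s = 0" unfolding p_def by (simp add: poly_sum poly_monom P(1) mult.commute)
 ultimately show ?thesis unfolding algebraic_over_iff[OF adjoin_subfield] A_def by blast
qed

lemma algebraic_over_root:
 fixes F :: "'a set"
 assumes F: "subfield F amb" and y: "y ^ q:F" and q: "q > 0" shows "algebraic_over F y"
proof -
 define p where "p = monom 1 q + [:- (y ^ q):]"
 have "coeffs_in F p" unfolding p_def
  by (intro coeffs_in_simps(3,6,7)[OF F] subfieldD(2,5)[OF F] y)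
 moreover have "degree p = q" unfolding p_def using q by (subst degree_add_eq_left) (auto simp: degree_monom_eq)
 hence "p ~= 0" using q by auto
 moreover have "poly p y = 0" unfolding p_def by (simp add: poly_monom)
 ultimately show ?thesis unfolding algebraic_over_iff[OF F] by blast
qed

text \<open>
  The degree comparison in the field generated by j, j' and s.  If j' is transcendental
  over k, so is j, because s and \<open>s j' ^ q\<close> are algebraic over \<open>k (j)\<close>.
\<close>
theorem height_comparison:
 assumes s0: "s ~= 0" and gi: "graded_integral k (j ^ r) s" "graded_integral k (j ^ r) (s * j' ^ q)" and q: "q > 0"
 shows "real q * height k K j' <= real r * height k K j"
proof (cases "algebraic_over k j'")
 case True
 hence "height k K j' = 0" unfolding height_def height_via_def by simp
 thus ?thesis using height_nonneg[of j] by simp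
next
 case False
 have tr: "~ algebraic_over k j"
 proof
  assume alg_j: "algebraic_over k j"
  define F where "F = adjoin k {j}"
  have F: "subfield F amb" unfolding F_def by (rule adjoin_subfield)
  have "j:F" unfolding F_def using adjoin_incl(2) by auto
  hence "j ^ r:F" by (rule subring_power[OF subfield_is_subring[OF F]])
  hence sub: "adjoin k {j ^ r} <= F" using adjoin_incl(1)[of k "{j}"] by (intro adjoin_min[OF F]) (auto simp: F_def)
  have algF: "algebraic_over F s" "algebraic_over F (s * j' ^ q)"
   by (rule algebraic_over_mono[OF adjoin_subfield F sub graded_integral_algebraic], rule gi)+
  define F' where "F' = adjoin F {s, s * j' ^ q}"
  have F': "subfield F' amb" unfolding F'_def by (rule adjoin_subfield)
  have "s:F'" "s * j' ^ q:F'" unfolding F'_def using adjoin_incl(2)[of "{s, s * j' ^ q}" F] by auto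
  hence "s * j' ^ q / s:F'" by (intro subfieldD(8)[OF F'])
  hence "j' ^ q:F'" using s0 by simp
  hence "algebraic_over F' j'" by (rule algebraic_over_root[OF F' _ q])
  hence "algebraic_over F j'" unfolding F'_def
  proof (rule algebraic_trans[OF F, rotated 2])
   show "algebraic_over F x" if "x:{s, s * j' ^ q}" for x using that algF by blast
  qed simp
  hence "algebraic_over k j'" unfolding F_def
  proof (rule algebraic_trans[OF k, rotated 2])
   show "algebraic_over k x" if "x:{j}" for x using that alg_j by blast
  qed simp
  thus False using False by blast
 qed
 define T where "T = {j, j', s}"
 define L where "L = adjoin K T"
 have T: "finite T" unfolding T_def by simp
 have TL: "T <= L" unfolding L_def by (rule adjoin_incl)
 hence jL: "j:L" "j':L" "s:L" unfolding T_def by auto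
 have L: "subfield L amb" unfolding L_def by (rule adjoin_subfield)
 obtain S where S: "K = adjoin k S" using fg by blast
 have kL: "k <= L" unfolding L_def using adjoin_incl(1)[of k S, folded S] adjoin_incl(1)[of K T] by (rule subset_trans)
 note h = height_formula[OF T jL(1)[unfolded L_def] tr, folded L_def]
 note h' = height_formula[OF T jL(2)[unfolded L_def] False, folded L_def]
 define N N' where "N = ext_degree (adjoin k {j}) L" and "N' = ext_degree (adjoin k {j'}) L"
 obtain f where f: "lin_span (adjoin k {j}) {..<N} f = L" using finite_ext_basis[OF adjoin_subfield h(2)] unfolding N_def by blast
 obtain e where e: "lin_indep (adjoin k {j'}) {..<N'} e" "lin_span (adjoin k {j'}) {..<N'} e = L"
  using finite_ext_basis[OF adjoin_subfield h'(2)] unfolding N'_def by blast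
 have eL: "e l:L" if "l < N'" for l
 proof -
  have "e l = (SUM i<N'. (if i = l then 1 else 0) * e i)" 
  proof -
   have "(SUM i<N'. (if i = l then 1 else 0) * e i) = (SUM i<N'. if i = l then e i else 0)" by (intro sum.cong) auto
   thus ?thesis using that by simp
  qed
  moreover have "ALL i:{..<N'}. (if i = l then 1 else 0):adjoin k {j'}" using subfieldD(1,2)[OF adjoin_subfield] by auto
  ultimately show ?thesis unfolding e(2)[symmetric] lin_span_def by (intro CollectI exI[of _ "%i. if i = l then 1 else 0"]) blast
 qed
 have "N' * q <= N * r"
  by (rule degree_comparison[OF k L kL jL s0 equalityD2[OF f] eL e(1) False tr gi q])
 hence "real N' * real q <= real N * real r" by (metis of_nat_le_iff of_nat_mult)
 hence "real N' * real q / ext_degree K L <= real N * real r / ext_degree K L" by (intro divide_right_mono) auto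
 thus ?thesis unfolding h(1) h'(1) N_def[symmetric] N'_def[symmetric] by (simp add: mult.commute)
qed

section \<open>The height of the j-invariant under isogenies\<close>

lemma height_vmap_le:
 assumes E: "elliptic_curve E" and E': "elliptic_curve E'" and psi: "vmap E E' psi q r" and n: "of_nat n ~= (0::'a)"
  and lift: "!!P. P:points E ==> emul E' test_level (psi P) = Infty ==> emul E n P = Infty"
 shows "real q * height k K (j_invariant E') <= real r * height k K (j_invariant E)"
proof -
 obtain s where s: "s ~= 0" and V: "!!V. valring k V ==>
  (j_invariant E ^ r:V --> s:V & s * j_invariant E' ^ q:V) &
  (j_invariant E ^ r ~: V --> s / j_invariant E ^ r:V & s * j_invariant E' ^ q / j_invariant E ^ r:V)"
  using j_invariant_local[OF E E' psi n lift, of k] subfield_of_nat_inverse[OF k] by blast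
 have "q > 0" using psi frob_pos unfolding vmap_def by blast
 moreover have "graded_integral k (j_invariant E ^ r) s" "graded_integral k (j_invariant E ^ r) (s * j_invariant E' ^ q)"
  by (rule graded_integralI[OF subfield_is_subring[OF k]]; use V in blast)+
 ultimately show ?thesis by (intro height_comparison[OF s])
qed

text \<open>
  One inequality comes from the dual of phi with respect to multiplication by \<open>beta N\<close>, the other
  from the dual of this dual; in both cases the torsion of order prime to the characteristic that
  is needed for integrality can be lifted.
\<close>
theorem height_isogeny:
 assumes E: "elliptic_curve E" and E': "elliptic_curve E'" and phi: "vmap E E' phi 1 q" and b: "ppart E (kern E phi) beta"
 shows "real q * height k K (j_invariant E) = real beta * height k K (j_invariant E')"
proof -
 obtain N where N: "of_nat N ~= (0::'a)" "!!P. P:kern E phi ==> emul E (beta * N) P = Infty"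
  and beta: "frob beta" "tors E beta <= kern E phi" "card (tors E beta) = beta" using b unfolding ppart_def by blast
 have phih: "surj_hom E E' phi" using phi unfolding vmap_def by blast
 note hom = surj_hom_basic[OF E E' phih]
 have N0: "N > 0" using N(1) by (auto intro: Nat.gr0I)
 have bN: "beta * N > 0" using frob_pos[OF beta(1)] N0 by simp
 have kerN: "kern E phi <= tors E (beta * N)" using N(2) unfolding kern_def by auto
 obtain delta where delta: "vmap E' E delta q beta" and deltaphi: "!!P. P:points E ==> delta (phi P) = emul E (beta * N) P"
  using vmap_dual[OF E E' phi bN kerN vmap_emul_ppart[OF E beta(1,3) N(1)]] by auto
 have deltah: "surj_hom E' E delta" using delta unfolding vmap_def by blast
 note hom' = surj_hom_basic[OF E' E deltah]
 have surj: "EX P:points E. P' = phi P" if "P':points E'" for P' using phih that unfolding surj_hom_def by blast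
 have surj': "EX P:points E'. P' = delta P" if "P':points E" for P' using deltah that unfolding surj_hom_def by blast
 have kill: "phi (emul E l P) = Infty" if "P:points E" "emul E (l * beta) P = Infty" for P l
 proof -
  have "emul E l P:tors E beta" unfolding tors_iff using that emul_emul[OF E that(1)] emul_on_curve[OF E that(1)] by simp
  thus ?thesis using beta(2) unfolding kern_def by blast
 qed
 have good: "of_nat (test_level * N) ~= (0::'a)" using test_level_good N(1) by simp
 have le1: "real q * height k K (j_invariant E) <= real beta * height k K (j_invariant E')"
 proof (rule height_vmap_le[OF E' E delta good])
  fix P' assume P': "P':points E'" "emul E test_level (delta P') = Infty"
  obtain P where P: "P:points E" "P' = phi P" using surj[OF P'(1)] by blast
  have "emul E (test_level * N * beta) P = Infty"
   using P'(2) unfolding P(2) deltaphi[OF P(1)] emul_emul[OF E P(1)] by (simp add: mult_ac)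
  from kill[OF P(1) this] show "emul E' (test_level * N) P' = Infty" unfolding P(2) hom(5)[OF P(1)] .
 qed
 have kerdelta: "kern E' delta <= tors E' N"
 proof
  fix P' assume P': "P':kern E' delta"
  obtain P where P: "P:points E" "P' = phi P" using surj[of P'] P' unfolding kern_def by blast
  have "emul E (N * beta) P = Infty" using P' unfolding kern_def P(2) by (simp add: deltaphi[OF P(1)] mult.commute)
  from kill[OF P(1) this] show "P':tors E' N" using P' unfolding tors_iff P(2) hom(5)[OF P(1)] kern_def by simp
 qed
 obtain epsilon where epsilon: "vmap E E' epsilon beta q" and epsilondelta: "!!P. P:points E' ==> epsilon (delta P) = emul E' N P"
  using vmap_dual[OF E' E delta N0 kerdelta card_tors_good(2)[OF E' N(1)]] by auto
 have le2: "real beta * height k K (j_invariant E') <= real q * height k K (j_invariant E)"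
 proof (rule height_vmap_le[OF E E' epsilon good])
  fix P assume P: "P:points E" "emul E' test_level (epsilon P) = Infty"
  obtain P' where P': "P':points E'" "P = delta P'" using surj'[OF P(1)] by blast
  have "emul E' (test_level * N) P' = Infty"
   using P(2) unfolding P'(2) epsilondelta[OF P'(1)] emul_emul[OF E' P'(1)] by (simp add: mult_ac)
  hence "delta (emul E' (test_level * N) P') = Infty" using hom'(1) by simp
  thus "emul E (test_level * N) P = Infty" unfolding P'(2) hom'(5)[OF P'(1)] .
 qed
 show ?thesis using le1 le2 by simp
qed

end

section \<open>Forms and local rings\<close>

abbreviation (input) "keys == Poly_Mapping.keys"
abbreviation (input) "lookup == Poly_Mapping.lookup"
abbreviation (input) "single == Poly_Mapping.single"

definition mval :: "('v \<Rightarrow>\<^sub>0 nat) => ('v => 'a::comm_ring_1) => 'a" where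
 "mval m x = (PROD v:keys m. x v ^ lookup m v)"

definition wdeg :: "'v set => ('v \<Rightarrow>\<^sub>0 nat) => nat" where
 "wdeg A m = (SUM v:keys m Int A. lookup m v)"

lemma mpol_eval_mval: "mpol_eval p x = (SUM m:keys p. lookup p m * mval m x)"
 unfolding mpol_eval_def mval_def ..

lemma mval_superset: "finite S ==> keys m <= S ==> mval m x = (PROD v:S. x v ^ lookup m v)"
 unfolding mval_def by (rule prod.mono_neutral_left) (auto simp: in_keys_iff)

lemma wdeg_superset: "finite S ==> keys m <= S ==> wdeg A m = (SUM v:S Int A. lookup m v)"
 unfolding wdeg_def by (rule sum.mono_neutral_left) (auto simp: in_keys_iff)

lemma mval_add: "mval (m + n) x = mval m x * mval n x"
proof -
 let ?S = "keys m Un keys n"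
 have "mval (m + n) x = (PROD v:?S. x v ^ lookup (m + n) v)" by (rule mval_superset) (simp_all add: Poly_Mapping.keys_add)
 also have "... = (PROD v:?S. x v ^ lookup m v) * (PROD v:?S. x v ^ lookup n v)"
  by (simp add: lookup_add power_add prod.distrib)
 also have "... = mval m x * mval n x" using mval_superset[of ?S m x] mval_superset[of ?S n x] by simp
 finally show ?thesis .
qed

lemma wdeg_add: "wdeg A (m + n) = wdeg A m + wdeg A n"
proof -
 let ?S = "keys m Un keys n"
 have "wdeg A (m + n) = (SUM v:?S Int A. lookup (m + n) v)" by (rule wdeg_superset) (simp_all add: Poly_Mapping.keys_add)
 also have "... = (SUM v:?S Int A. lookup m v) + (SUM v:?S Int A. lookup n v)" by (simp add: lookup_add sum.distrib)
 also have "... = wdeg A m + wdeg A n" using wdeg_superset[of ?S m A] wdeg_superset[of ?S n A] by simp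
 finally show ?thesis .
qed

lemma wdeg_single: "wdeg A (single v 1) = (if v:A then 1 else 0)"
 unfolding wdeg_def by simp

lemma mval_single: "mval (single v 1) x = x v"
 unfolding mval_def by simp

lemma mpol_eval_add: "mpol_eval (p + q) x = mpol_eval p x + mpol_eval q x"
 unfolding mpol_eval_mval by (rule setsum_keys_plus_distrib) (auto simp: algebra_simps)

lemma mpol_eval_zero: "mpol_eval 0 x = 0" unfolding mpol_eval_mval by simp

lemma mpol_eval_single: "mpol_eval (single m c) x = c * mval m x"
 unfolding mpol_eval_mval by simp

lemma mpol_eval_sum: "mpol_eval (SUM i:I. p i) x = (SUM i:I. mpol_eval (p i) x)"
 by (induction I rule: infinite_finite_induct) (auto simp: mpol_eval_add mpol_eval_zero)

lemma keys_sum_subset: "keys (SUM i:I. p i) <= (UN i:I. keys (p i))"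
 by (induction I rule: infinite_finite_induct) (auto dest: subsetD[OF Poly_Mapping.keys_add])

lemma mpol_product:
 fixes p q :: "('v, 'a::comm_ring_1) mpol"
 shows "EX r. (ALL x. mpol_eval r x = mpol_eval p x * mpol_eval q x) &
  (ALL l:keys r. EX m:keys p. EX n:keys q. l = m + n)"
proof -
 define r where "r = (SUM m:keys p. SUM n:keys q.
  single (m + n) (lookup p m * lookup q n))"
 have "mpol_eval r x = mpol_eval p x * mpol_eval q x" for x
  unfolding r_def mpol_eval_sum mpol_eval_single mval_add mpol_eval_mval[of p] mpol_eval_mval[of q] sum_product
  by (intro sum.cong refl) (simp add: mult_ac)
 moreover have "EX m:keys p. EX n:keys q. l = m + n" if l: "l:keys r" for l
 proof -
  obtain m where m: "m:keys p" "l:keys (SUM n:keys q.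
   single (m + n) (lookup p m * lookup q n))"
   using subsetD[OF keys_sum_subset l[unfolded r_def]] by blast
  obtain n where "n:keys q" "l:keys (single (m + n) (lookup p m * lookup q n))"
   using subsetD[OF keys_sum_subset m(2)] by blast
  thus ?thesis using m(1) by (auto split: if_splits)
 qed
 ultimately show ?thesis by blast
qed

text \<open>Polynomial functions that are homogeneous of degree \<open>d i\<close> in the variables of each block \<open>A i\<close>.\<close>
definition form_fun :: "('i => 'v set) => ('i => nat) => (('v => 'a::comm_ring_1) => 'a) => bool" where
 "form_fun A d f <-> (EX F. (ALL m:keys F. ALL i. wdeg (A i) m = d i) & f = mpol_eval F)"

lemma form_fun_zero: "form_fun A d (%_. 0)"
 unfolding form_fun_def by (intro exI[of _ 0]) (auto simp: mpol_eval_zero)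

lemma form_fun_add: "form_fun A d f ==> form_fun A d g ==> form_fun A d (%x. f x + g x)"
 unfolding form_fun_def
proof (elim exE conjE)
 fix F G assume "ALL m:keys F. ALL i. wdeg (A i) m = d i" "ALL m:keys G. ALL i. wdeg (A i) m = d i"
  and "f = mpol_eval F" "g = mpol_eval G"
 thus "EX H. (ALL m:keys H. ALL i. wdeg (A i) m = d i) & (%x. f x + g x) = mpol_eval H"
  by (intro exI[of _ "F + G"]) (auto simp: mpol_eval_add fun_eq_iff dest: subsetD[OF Poly_Mapping.keys_add])
qed

lemma form_fun_mult: "form_fun A d f ==> form_fun A e g ==> form_fun A (%i. d i + e i) (%x. f x * g x)"
 unfolding form_fun_def
proof (elim exE conjE)
 fix F G assume F: "ALL m:keys F. ALL i. wdeg (A i) m = d i" and G: "ALL m:keys G. ALL i. wdeg (A i) m = e i"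
  and fg: "f = mpol_eval F" "g = mpol_eval G"
 obtain H where H: "ALL x. mpol_eval H x = mpol_eval F x * mpol_eval G x"
  "!!l. l:keys H ==> EX m:keys F. EX n:keys G. l = m + n" using mpol_product[of F G] by blast
 have "wdeg (A i) m = d i + e i" if m: "m:keys H" for m i
  using H(2)[OF m] F G by (auto simp: wdeg_add)
 thus "EX H. (ALL m:keys H. ALL i. wdeg (A i) m = d i + e i) & (%x. f x * g x) = mpol_eval H"
  using H(1) fg by (intro exI[of _ H]) (auto simp: fun_eq_iff)
qed

lemma form_fun_const: "form_fun A (%_. 0) (%_. c)"
 unfolding form_fun_def by (intro exI[of _ "single 0 c"]) (auto simp: wdeg_def mpol_eval_single mval_def fun_eq_iff)

lemma form_fun_var: "form_fun A (%i. if v:A i then 1 else 0) (%x. x v)"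
 unfolding form_fun_def
 by (intro exI[of _ "single (single v 1) 1"]) (auto simp: wdeg_single[simplified] mpol_eval_single mval_single[simplified] fun_eq_iff)

definition pform :: "nat => ('a::field epoint => 'a) => bool" where
 "pform d f <-> (EX F. form_fun (%_::unit. UNIV) (%_. d) F & f = (%P. F (hcoord P)))"

definition bform :: "nat => nat => ('a::field epoint \<times> 'a epoint => 'a) => bool" where
 "bform d e f <-> (EX F. form_fun (%b. if b then range Inl else range Inr) (%b. if b then d else e) F &
  f = (%(P, Q). F (case_sum (hcoord P) (hcoord Q))))"

lemma homogeneous_wdeg: "homogeneous d p <-> (ALL m:keys p. wdeg UNIV m = d)"
 unfolding homogeneous_def wdeg_def by simp

lemma bihomogeneous_wdeg: "bihomogeneous d e p <->
  (ALL m:keys p. ALL b. wdeg (if b then range Inl else range Inr) m = (if b then d else e))"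
 unfolding bihomogeneous_def wdeg_def by (auto split: if_splits)

lemma plane_fractions_pform: "plane_fractions = {(f, g). EX d. pform d f & pform d g}"
 unfolding plane_fractions_def pform_def form_fun_def homogeneous_wdeg by auto

lemma biplane_fractions_bform: "biplane_fractions = {(f, g). EX d e. bform d e f & bform d e g}"
 unfolding biplane_fractions_def bform_def form_fun_def bihomogeneous_wdeg by blast

lemma pform_zero: "pform d (%_. 0)"
 unfolding pform_def by (intro exI[of _ "%_. 0"]) (auto intro: form_fun_zero)
lemma pform_add: "pform d f ==> pform d g ==> pform d (%P. f P + g P)"
 unfolding pform_def using form_fun_add by fastforce
lemma pform_mult: "pform d f ==> pform e g ==> pform (d + e) (%P. f P * g P)"
 unfolding pform_def using form_fun_mult by fastforce
lemma pform_const: "pform 0 (%_. c)"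
 unfolding pform_def by (intro exI[of _ "%_. c"]) (auto intro: form_fun_const)
lemma pform_coord: "pform 1 (%P. hcoord P v)"
 unfolding pform_def using form_fun_var[of "%_::unit. UNIV" v] by (intro exI[of _ "%x. x v"]) simp
lemma pform_cmult: "pform d f ==> pform d (%P. c * f P)"
 using pform_mult[OF pform_const[of c], of d f] by simp
lemma pform_uminus: "pform d f ==> pform d (%P. - f P)"
 using pform_cmult[of d f "- 1"] by simp
lemma pform_diff: "pform d f ==> pform d g ==> pform d (%P. f P - g P)"
 using pform_add[OF _ pform_uminus, of d f g] by simp
lemma pform_power: "pform d f ==> pform (n * d) (%P. f P ^ n)"
 by (induction n) (auto intro: pform_const pform_mult)

lemma bform_add: "bform d e f ==> bform d e g ==> bform d e (%z. f z + g z)"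
 unfolding bform_def using form_fun_add by fastforce
lemma bform_zero: "bform d e (%_. 0)"
 unfolding bform_def by (intro exI[of _ "%_. 0"]) (auto intro: form_fun_zero)
lemma bform_mult: assumes "bform d e f" "bform d' e' g" shows "bform (d + d') (e + e') (%z. f z * g z)"
proof -
 let ?A = "%b. if b then range Inl else range Inr"
 obtain F G where F: "form_fun ?A (%b. if b then d else e) F" "f = (%(P, Q). F (case_sum (hcoord P) (hcoord Q)))"
  and G: "form_fun ?A (%b. if b then d' else e') G" "g = (%(P, Q). G (case_sum (hcoord P) (hcoord Q)))"
  using assms unfolding bform_def by blast
 have "(%b. (if b then d else e) + (if b then d' else e')) = (%b. if b then d + d' else e + e')" by auto
 hence "form_fun ?A (%b. if b then d + d' else e + e') (%x. F x * G x)" using form_fun_mult[OF F(1) G(1)] by simp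
 thus ?thesis unfolding bform_def F(2) G(2) by (intro exI[of _ "%x. F x * G x"]) auto
qed
lemma bform_const: "bform 0 0 (%_. c)"
proof -
 have "(%b. if b then 0 else 0) = (%_. 0::nat)" by auto
 thus ?thesis unfolding bform_def using form_fun_const[of "%b. if b then range Inl else range Inr" c] by (intro exI[of _ "%_. c"]) auto
qed
lemma bform_fst_coord: "bform 1 0 (%z. hcoord (fst z) v :: 'a::field)"
proof -
 have eq: "(%b. if Inl v:(if b then range (Inl :: nat => nat + nat) else range Inr) then 1 else 0) = (%b. if b then 1 else (0::nat))" by auto
 have "form_fun (%b. if b then range Inl else range Inr) (%b. if b then 1 else 0) (%x :: nat + nat => 'a. x (Inl v))"
  by (rule form_fun_var[of "%b. if b then range (Inl :: nat => nat + nat) else range Inr" "Inl v", unfolded eq])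
 thus ?thesis unfolding bform_def by (intro exI[of _ "%x. x (Inl v)"]) (auto simp: fun_eq_iff)
qed
lemma bform_snd_coord: "bform 0 1 (%z. hcoord (snd z) v :: 'a::field)"
proof -
 have eq: "(%b. if Inr v:(if b then range (Inl :: nat => nat + nat) else range Inr) then 1 else 0) = (%b. if b then 0 else (1::nat))" by auto
 have "form_fun (%b. if b then range Inl else range Inr) (%b. if b then 0 else 1) (%x :: nat + nat => 'a. x (Inr v))"
  by (rule form_fun_var[of "%b. if b then range (Inl :: nat => nat + nat) else range Inr" "Inr v", unfolded eq])
 thus ?thesis unfolding bform_def by (intro exI[of _ "%x. x (Inr v)"]) (auto simp: fun_eq_iff)
qed

lemma wdeg_UNIV_0: "wdeg UNIV m = 0 ==> m = 0"
proof (rule poly_mapping_eqI)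
 fix v assume "wdeg UNIV m = 0"
 thus "lookup m v = lookup 0 v"
  unfolding wdeg_def by (cases "v:keys m") (auto simp: in_keys_iff)
qed

lemma monomial_split:
 assumes "wdeg UNIV m = Suc d" shows "EX v m'. m = single v 1 + m' & wdeg UNIV m' = d"
proof -
 obtain v where v: "v:keys m" using assms unfolding wdeg_def by (metis Int_UNIV_right all_not_in_conv sum.empty nat.distinct(1))
 define m' where "m' = m - single v 1"
 have "m = single v 1 + m'"
 proof (rule poly_mapping_eqI)
  fix w
  have "lookup m v > 0" using v by (simp add: in_keys_iff)
  thus "lookup m w = lookup (single v 1 + m') w"
   unfolding m'_def by (cases "w = v") (simp_all add: lookup_add lookup_minus lookup_single_not_eq)
 qed
 moreover from this have "wdeg UNIV m' = d" using assms by (metis wdeg_add wdeg_single UNIV_I add_left_cancel plus_1_eq_Suc)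
 ultimately show ?thesis by blast
qed

lemma pform_induct [consumes 1, case_names zero add cmult one coord]:
 fixes f :: "'a::field epoint => 'a"
 assumes "pform d f"
  and zero: "!!d. R d (%_. 0)" and add: "!!d f g. pform d f ==> pform d g ==> R d f ==> R d g ==> R d (%P. f P + g P)"
  and cmult: "!!d c f. pform d f ==> R d f ==> R d (%P. c * f P)"
  and one: "R 0 (%_. 1)" and coord: "!!d f v. pform d f ==> R d f ==> R (Suc d) (%P. hcoord P v * f P)"
 shows "R d f"
proof -
 have mono: "pform d (%P :: 'a epoint. mval m (hcoord P)) & R d (%P :: 'a epoint. mval m (hcoord P))" if "wdeg UNIV m = d" for d m
  using that
 proof (induction d arbitrary: m)
  case 0
  hence "m = 0" by (rule wdeg_UNIV_0)
  thus ?case using one pform_const[of 1] by (simp add: mval_def)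
 next
  case (Suc d)
  obtain v m' where m: "m = single v 1 + m'" "wdeg UNIV m' = d" using monomial_split[OF Suc.prems] by blast
  have eq: "(%P :: 'a epoint. mval m (hcoord P)) = (%P. hcoord P v * mval m' (hcoord P))" unfolding m(1) mval_add mval_single ..
  note IH = Suc.IH[OF m(2)]
  have "R (Suc d) (%P :: 'a epoint. hcoord P v * mval m' (hcoord P))" by (rule coord[OF conjunct1[OF IH] conjunct2[OF IH]])
  moreover have "pform (Suc d) (%P :: 'a epoint. hcoord P v * mval m' (hcoord P))"
   using pform_mult[OF pform_coord[of v] conjunct1[OF IH]] by simp
  ultimately show ?case unfolding eq by blast
 qed
 obtain F where F: "!!m. m:keys F ==> wdeg UNIV m = d" "f = (%P. mpol_eval F (hcoord P))"
  using assms(1) unfolding pform_def form_fun_def by auto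
 have "pform d (%P :: 'a epoint. SUM m:S. lookup F m * mval m (hcoord P)) & R d (%P :: 'a epoint. SUM m:S. lookup F m * mval m (hcoord P))"
  if "finite S" "S <= keys F" for S
  using that
 proof (induction S)
  case empty thus ?case using zero pform_zero by simp
 next
  case (insert m S)
  have "pform d (%P :: 'a epoint. mval m (hcoord P))" "R d (%P :: 'a epoint. mval m (hcoord P))" using mono[of m d] F(1) insert.prems by auto
  hence "pform d (%P :: 'a epoint. lookup F m * mval m (hcoord P))" "R d (%P :: 'a epoint. lookup F m * mval m (hcoord P))"
   using pform_cmult cmult by blast+
  note mS = this and IH = insert.IH[OF subset_trans[OF subset_insertI insert.prems]]
  show ?case unfolding sum.insert[OF insert.hyps]
   using pform_add[OF mS(1) conjunct1[OF IH]] add[OF mS(1) conjunct1[OF IH] mS(2) conjunct2[OF IH]] by blast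
 qed
 from this[of "keys F"] show ?thesis unfolding F(2) mpol_eval_mval by simp
qed

lemma bform_pform: "pform d f ==> bform d 0 (f o fst) & bform 0 d (f o snd)"
proof (induction rule: pform_induct)
 case (zero d) show ?case by (auto simp: comp_def intro: bform_zero)
next
 case (add d f g) thus ?case by (auto simp: comp_def intro: bform_add)
next
 case (cmult d c f)
 thus ?case using bform_mult[OF bform_const[of c], of d 0 "f o fst"] bform_mult[OF bform_const[of c], of 0 d "f o snd"]
  by (simp add: comp_def)
next
 case one show ?case by (auto simp: comp_def intro: bform_const)
next
 case (coord d f v)
 thus ?case using bform_mult[OF bform_fst_coord[of v], of d 0 "f o fst"] bform_mult[OF bform_snd_coord[of v], of 0 d "f o snd"]
  by (simp add: comp_def)
qed

definition fraction_class :: "(('x => 'a::field) \<times> ('x => 'a)) set => bool" where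
 "fraction_class Fr <-> (ALL c. ((%_. c), (%_. 1)):Fr) & (ALL N D N' D'. (N, D):Fr --> (N', D'):Fr -->
  ((%x. N x * D' x + N' x * D x), (%x. D x * D' x)):Fr & ((%x. N x * N' x), (%x. D x * D' x)):Fr)"

lemma fraction_classI:
 assumes const: "!!c. Q z (%_. c)" and add: "!!d f g. Q d f ==> Q d g ==> Q d (%x. f x + g x)"
  and mult: "!!d e f g. Q d f ==> Q e g ==> Q (m d e) (%x. f x * g x)" and m: "!!d e. m d e = m e d"
  and Fr: "Fr = {(f, g). EX d. Q d f & Q d g}"
 shows "fraction_class Fr"
 unfolding fraction_class_def Fr
proof (intro conjI allI impI)
 show "(%_. c, %_. 1):{(f, g). EX d. Q d f & Q d g}" for c using const by blast
 fix N D N' D' assume "(N, D):{(f, g). EX d. Q d f & Q d g}" "(N', D'):{(f, g). EX d. Q d f & Q d g}"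
 then obtain d e where d: "Q d N" "Q d D" "Q e N'" "Q e D'" by auto
 have "Q (m d e) (%x. N x * D' x + N' x * D x)" using add[OF mult[OF d(1,4)], of "%x. N' x * D x"] mult[OF d(3,2)] m[of e d] by simp
 thus "((%x. N x * D' x + N' x * D x), (%x. D x * D' x)):{(f, g). EX d. Q d f & Q d g}"
  "((%x. N x * N' x), (%x. D x * D' x)):{(f, g). EX d. Q d f & Q d g}" using mult[OF d(2,4)] mult[OF d(1,3)] by auto
qed

lemma fraction_class_plane: "fraction_class plane_fractions"
 by (rule fraction_classI[where Q = pform and z = 0 and m = "(+)"])
  (auto simp: plane_fractions_pform intro: pform_const pform_add pform_mult)

lemma fraction_class_biplane: "fraction_class biplane_fractions"
 by (rule fraction_classI[where Q = "%(d, e). bform d e" and z = "(0, 0)" and m = "%(a, b) (c, d). (a + c, b + d)"])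
  (auto simp: biplane_fractions_bform intro: bform_const bform_add bform_mult)

lemma regular_at_const: "fraction_class Fr ==> regular_at V Fr P (%_. c)"
 unfolding fraction_class_def regular_at_def by (intro bexI[of _ "((%_. c), (%_. 1))"]) auto

lemma regular_at_arith:
 assumes Fr: "fraction_class Fr" and f: "regular_at V Fr P f" and g: "regular_at V Fr P g"
 shows "regular_at V Fr P (%x. f x + g x)" "regular_at V Fr P (%x. f x * g x)"
proof -
 obtain N D where N: "(N, D):Fr" "D P ~= 0" "!!Q. Q:V ==> D Q ~= 0 ==> f Q = N Q / D Q" using f unfolding regular_at_def by blast
 obtain N' D' where N': "(N', D'):Fr" "D' P ~= 0" "!!Q. Q:V ==> D' Q ~= 0 ==> g Q = N' Q / D' Q" using g unfolding regular_at_def by blast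
 have c: "((%x. N x * D' x + N' x * D x), (%x. D x * D' x)):Fr" "((%x. N x * N' x), (%x. D x * D' x)):Fr"
  using Fr N(1) N'(1) unfolding fraction_class_def by blast+
 show "regular_at V Fr P (%x. f x + g x)" unfolding regular_at_def
  by (rule bexI[OF _ c(1)]) (use N(2,3) N'(2,3) in "auto simp: add_frac_eq mult.commute")
 show "regular_at V Fr P (%x. f x * g x)" unfolding regular_at_def
  by (rule bexI[OF _ c(2)]) (use N(2,3) N'(2,3) in auto)
qed

lemma local_ring_simps [simp]: "carrier (local_ring V Fr P) = {f. regular_at V Fr P f}"
 "monoid.mult (local_ring V Fr P) = (%f g x. f x * g x)" "monoid.one (local_ring V Fr P) = (%_. 1)"
 "ring.zero (local_ring V Fr P) = (%_. 0)" "ring.add (local_ring V Fr P) = (%f g x. f x + g x)"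
 unfolding local_ring_def by simp_all

lemma local_ring_ring:
 assumes Fr: "fraction_class Fr" shows "ring (local_ring V Fr P)"
proof (rule ringI)
 show "abelian_group (local_ring V Fr P)"
 proof (rule abelian_groupI)
  fix f assume f: "f:carrier (local_ring V Fr P)"
  have "regular_at V Fr P (%x. (- 1) * f x)" by (rule regular_at_arith(2)[OF Fr regular_at_const[OF Fr]]) (use f in simp)
  thus "EX g:carrier (local_ring V Fr P). g \<oplus>\<^bsub>local_ring V Fr P\<^esub> f = \<zero>\<^bsub>local_ring V Fr P\<^esub>"
   by (intro bexI[of _ "%x. (- 1) * f x"]) auto
 qed (use regular_at_arith[OF Fr] regular_at_const[OF Fr] in "auto simp: add_ac")
 show "monoid (local_ring V Fr P)"
  by (rule monoidI) (use regular_at_arith[OF Fr] regular_at_const[OF Fr] in "auto simp: mult_ac")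
qed (auto simp: algebra_simps)

lemma local_ring_idealI:
 assumes Fr: "fraction_class Fr" and sub: "J <= carrier (local_ring V Fr P)" and z: "(%_. 0):J"
  and add: "!!f g. f:J ==> g:J ==> (%x. f x + g x):J"
  and mult: "!!f g. regular_at V Fr P f ==> g:J ==> (%x. f x * g x):J"
 shows "ideal J (local_ring V Fr P)"
proof -
 interpret ring "local_ring V Fr P" by (rule local_ring_ring[OF Fr])
 have um: "\<ominus>\<^bsub>local_ring V Fr P\<^esub> f = (%x. - f x)" if f: "f:carrier (local_ring V Fr P)" for f
 proof (rule minus_equality)
  have "regular_at V Fr P (%x. (- 1) * f x)" by (rule regular_at_arith(2)[OF Fr regular_at_const[OF Fr]]) (use f in simp)
  thus "(%x. - f x):carrier (local_ring V Fr P)" by simp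
 qed (use f in auto)
 show ?thesis
 proof (rule idealI)
  show "subgroup J (add_monoid (local_ring V Fr P))"
  proof (rule add.subgroupI)
   show "J <= carrier (local_ring V Fr P)" by (rule sub)
   show "J ~= {}" using z by blast
   fix f assume f: "f:J"
   have "(%x. (- 1) * f x):J" by (rule mult[OF regular_at_const[OF Fr] f])
   thus "\<ominus>\<^bsub>local_ring V Fr P\<^esub> f:J" using um[of f] f sub by auto
  qed (use add in auto)
  show "f \<otimes>\<^bsub>local_ring V Fr P\<^esub> g:J" "g \<otimes>\<^bsub>local_ring V Fr P\<^esub> f:J" if "g:J" "f:carrier (local_ring V Fr P)" for f g
   using mult[of f g] that by (auto simp: mult.commute)
 qed (rule ring_axioms)
qed

lemma vanishing_ideal: "fraction_class Fr ==> ideal {f. regular_at V Fr P f & f P = 0} (local_ring V Fr P)"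
 by (rule local_ring_idealI) (auto intro: regular_at_arith regular_at_const)

lemma germ_zero_vanishes: "P:V ==> f:germ_zero V Fr P ==> regular_at V Fr P f & f P = 0"
 unfolding germ_zero_def by auto

lemma genideal_least: "ideal I R ==> S <= I ==> genideal R S <= I"
 unfolding genideal_def by blast

lemma genideal_incl: "S <= genideal R S"
 unfolding genideal_def by blast

lemma genideal_mono: "S <= T ==> genideal R S <= genideal R T"
 unfolding genideal_def by blast

section \<open>The local ring at infinity\<close>

context closed_field
begin

lemma reg_fun_cong: "f:reg E ==> (!!P. P:aff E ==> f P = g P) ==> g:reg (E :: 'a weierstrass)"
proof -
 assume f: "f:reg E" and eq: "!!P. P:aff E ==> f P = g P"
 obtain A B where "regfun E f A B" using f unfolding reg_def by blast
 hence "regfun E g A B" using eq unfolding regfun_def by auto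
 thus ?thesis unfolding reg_def by blast
qed

lemma reg_xfun: "xfun:reg (E :: 'a weierstrass)" using reg_poly[of "[:0, 1:]" E] by (simp add: eta_contract_eq)

lemma regfun_yfun: "regfun E yfun 0 (1 :: 'a poly)" unfolding regfun_def by auto

lemma reg_yfun: "yfun:reg (E :: 'a weierstrass)" using regfun_yfun unfolding reg_def by blast

lemma nonzero_cong: "(!!P. P:aff E ==> f P = g P) ==> nonzero E f = nonzero E g"
 unfolding nonzero_def by auto

lemma pole_cong:
 assumes "f:reg E" "!!P. P:aff E ==> f P = (g P :: 'a)" shows "pole E f = pole E g"
proof -
 obtain A B where "regfun E f A B" using assms(1) unfolding reg_def by blast
 moreover from this have "regfun E g A B" using assms(2) unfolding regfun_def by auto
 ultimately show ?thesis using pole_regfun by metis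
qed

text \<open>
  The functions that are negligible against a pole of order n, including the zero function.
\<close>
definition lowpole :: "'a weierstrass => ('a epoint => 'a) => nat => bool" where
 "lowpole E f n <-> f:reg E & (nonzero E f --> pole E f < n)"

lemma lowpole_mono: "lowpole E f n ==> n <= m ==> lowpole E f m"
 unfolding lowpole_def by auto

lemma lowpole_cong: "lowpole E f n ==> (!!P. P:aff E ==> f P = g P) ==> lowpole E g n"
 using pole_cong[of f E g] nonzero_cong[of E f g] reg_fun_cong[of f E g] unfolding lowpole_def by auto

lemma lowpole_add: assumes "lowpole E f n" "lowpole E g n" shows "lowpole E (%P. f P + g P) n"
proof (cases "nonzero E f & nonzero E g")
 case True
 have "pole E (%P. f P + g P) <= max (pole E f) (pole E g)"
  using assms pole_add_le unfolding lowpole_def by blast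
 thus ?thesis using assms True unfolding lowpole_def by auto
next
 case False
 thus ?thesis
 proof (cases "nonzero E f")
  case True
  hence "g P = 0" if "P:aff E" for P using False that unfolding nonzero_def by blast
  thus ?thesis using lowpole_cong[OF assms(1)] by simp
 next
  case False
  hence "f P = 0" if "P:aff E" for P using that unfolding nonzero_def by blast
  thus ?thesis using lowpole_cong[OF assms(2)] by simp
 qed
qed

lemma lowpole_mult: assumes "lowpole E f n" "lowpole E g (Suc m)" shows "lowpole E (%P. f P * g P) (n + m)"
proof (cases "nonzero E f & nonzero E g")
 case True
 have "pole E (%P. f P * g P) = pole E f + pole E g"
  using assms pole_mult True unfolding lowpole_def by blast
 thus ?thesis using assms True unfolding lowpole_def by auto
next
 case False
 hence "~ nonzero E (%P. f P * g P)" unfolding nonzero_def by auto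
 thus ?thesis using assms unfolding lowpole_def by auto
qed

lemma lowpole_zero: "lowpole E (%_. 0) n" unfolding lowpole_def nonzero_def by simp
lemma lowpole_const: "lowpole E (%_. c) (Suc 0)"
 using pole_poly[of E "[:c:]"] unfolding lowpole_def by simp
lemma lowpole_cmult: "lowpole E f n ==> lowpole E (%P. c * f P) n"
 using lowpole_mult[of E f n "%_. c" 0] lowpole_const by (simp add: mult.commute)
lemma lowpole_diff: "lowpole E f n ==> lowpole E g n ==> lowpole E (%P. f P - g P) n"
 using lowpole_add[of E f n "%P. - 1 * g P"] lowpole_cmult[of E g n "- 1"] by simp
lemma lowpole_xfun: "lowpole E xfun (Suc 2)"
 using pole_poly[of E "[:0, 1:]"] reg_xfun unfolding lowpole_def by (simp add: eta_contract_eq)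
lemma pole_yfun: "pole E yfun = 3" using pole_regfun[OF regfun_yfun] by simp
lemma lowpole_yfun: "lowpole E yfun (Suc 3)" unfolding lowpole_def pole_yfun by (simp add: reg_yfun)

lemma nonzero_yfun: "nonzero E (yfun :: 'a epoint => 'a)"
 using nonzero_line[of E 0 0] by simp

lemma yfun_power: "nonzero E (%P. yfun P ^ d) & pole E (%P. yfun P ^ d) = 3 * d"
proof (induction d)
 case 0
 obtain P where "P:aff E" using infinite_aff[of E] by (metis finite.emptyI ex_in_conv)
 thus ?case using pole_poly[of E "[:1:]"] unfolding nonzero_def by auto
next
 case (Suc d)
 have r: "(%P. yfun P ^ d):reg E" using reg_yfun by blast
 show ?case using nonzero_mult[OF reg_yfun r nonzero_yfun] pole_mult[OF reg_yfun r nonzero_yfun] Suc by (simp add: pole_yfun)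
qed

lemma hcoord_aff: "P ~= Infty ==> hcoord P 0 = xfun P" "P ~= Infty ==> hcoord P 1 = yfun P" "P ~= Infty ==> hcoord P 2 = 1"
 by (cases P; simp)+

lemma hcoord_other: "v > 2 ==> hcoord P v = (0 :: 'a)"
 by (cases P) auto

text \<open>A form of degree d has pole order at most \<open>3 d\<close>, with equality if it does not vanish at infinity.\<close>
lemma pform_lowpole: "pform d F ==> lowpole E (%P. F P - F Infty * yfun P ^ d) (3 * d)"
proof (induction rule: pform_induct)
 case (zero d) thus ?case by (simp add: lowpole_zero)
next
 case (add d f g)
 thus ?case using lowpole_cong[OF lowpole_add[OF add(3,4)]] by (simp add: algebra_simps)
next
 case (cmult d c f)
 thus ?case using lowpole_cong[OF lowpole_cmult[OF cmult(2), of c]] by (simp add: algebra_simps)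
next
 case one thus ?case by (simp add: lowpole_zero)
next
 case (coord d f v)
 have y: "lowpole E (%P. yfun P ^ d) (Suc (3 * d))" unfolding lowpole_def using yfun_power[of E d] reg_yfun by auto
 have f: "lowpole E f (Suc (3 * d))"
  using lowpole_cong[OF lowpole_add[OF lowpole_mono[OF coord(2), of "Suc (3 * d)"] lowpole_cmult[OF y, of "f Infty"]]] by simp
 consider "v = 0" | "v = 1" | "v = 2" | "v > 2" by linarith
 thus ?case
 proof cases
  case 1
  have "lowpole E (%P. f P * xfun P) (Suc (3 * d) + 2)" by (rule lowpole_mult[OF f lowpole_xfun])
  moreover have "Suc (3 * d) + 2 = 3 * Suc d" by simp
  ultimately have "lowpole E (%P. f P * xfun P) (3 * Suc d)" by metis
  thus ?thesis by (rule lowpole_cong) (simp add: 1 hcoord_aff(1))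
 next
  case 2
  have "lowpole E (%P. (f P - f Infty * yfun P ^ d) * yfun P) (3 * d + 3)" by (rule lowpole_mult[OF coord(2) lowpole_yfun])
  moreover have "3 * d + 3 = 3 * Suc d" by simp
  ultimately have "lowpole E (%P. (f P - f Infty * yfun P ^ d) * yfun P) (3 * Suc d)" by metis
  thus ?thesis by (rule lowpole_cong) (simp add: 2 hcoord_aff(2)[simplified] algebra_simps)
 next
  case 3
  have "lowpole E f (3 * Suc d)" by (rule lowpole_mono[OF f]) simp
  thus ?thesis by (rule lowpole_cong) (simp add: 3 hcoord_aff(3))
 next
  case 4
  show ?thesis by (rule lowpole_cong[OF lowpole_zero]) (use 4 in "auto simp: hcoord_other")
 qed
qed

lemma pform_pole:
 assumes F: "pform d (F :: 'a epoint => 'a)"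
 shows "lowpole E F (Suc (3 * d))" "F Infty = 0 ==> lowpole E F (3 * d)"
  "F Infty ~= 0 ==> nonzero E F & pole E F = 3 * d"
proof -
 note l = pform_lowpole[OF F, of E]
 have y: "lowpole E (%P. F Infty * yfun P ^ d) (Suc (3 * d))"
  by (rule lowpole_cmult) (use yfun_power[of E d] reg_yfun in "auto simp: lowpole_def")
 show low: "lowpole E F (Suc (3 * d))"
  using lowpole_cong[OF lowpole_add[OF lowpole_mono[OF l, of "Suc (3 * d)"] y]] by simp
 show "F Infty = 0 ==> lowpole E F (3 * d)" using l by (simp add: eta_contract_eq)
 show "nonzero E F & pole E F = 3 * d" if nz: "F Infty ~= 0"
 proof (rule ccontr)
  assume "~ ?thesis"
  hence "lowpole E F (3 * d)" using low unfolding lowpole_def by auto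
  from lowpole_diff[OF this l] have "lowpole E (%P. F Infty * yfun P ^ d) (3 * d)" by (rule lowpole_cong) simp
  from lowpole_cmult[OF this, of "1 / F Infty"] have "lowpole E (%P. yfun P ^ d) (3 * d)" using nz by simp
  thus False using yfun_power[of E d] unfolding lowpole_def by simp
 qed
qed

definition form_on :: "'a weierstrass => nat => ('a epoint => 'a) => bool" where
 "form_on E d h <-> (EX F. pform d F & (ALL P:aff E. F P = h P))"

lemma form_on_add: "form_on E d f ==> form_on E d g ==> form_on E d (%P. f P + g P)"
proof -
 assume "form_on E d f" "form_on E d g"
 then obtain F G where "pform d F" "ALL P:aff E. F P = f P" "pform d G" "ALL P:aff E. G P = g P" unfolding form_on_def by blast
 thus ?thesis unfolding form_on_def by (intro exI[of _ "%P. F P + G P"]) (auto intro: pform_add)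
qed
lemma form_on_cmult: "form_on E d f ==> form_on E d (%P. c * f P)"
proof -
 assume "form_on E d f"
 then obtain F where "pform d F" "ALL P:aff E. F P = f P" unfolding form_on_def by blast
 thus ?thesis unfolding form_on_def by (intro exI[of _ "%P. c * F P"]) (auto intro: pform_cmult)
qed
lemma form_on_zero: "form_on E d (%_. 0)" unfolding form_on_def using pform_zero by blast
lemma form_on_sum: "(!!i. i:I ==> form_on E d (f i)) ==> form_on E d (%P. SUM i:I. f i P)"
 by (induction I rule: infinite_finite_induct) (auto intro: form_on_zero form_on_add)
lemma form_on_cong: "form_on E d f ==> (!!P. P:aff E ==> f P = g P) ==> form_on E d g"
 unfolding form_on_def by auto

text \<open>For \<open>i \<ge> 3\<close> the curve equation trades \<open>x\<^sup>3\<close> for terms with a smaller exponent of x.\<close>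
lemma form_on_monomial:
 "2 * i + 3 * l <= 3 * d ==> form_on E d (%P. xfun P ^ i * yfun P ^ l)"
proof (induction i arbitrary: l rule: less_induct)
 case (less i)
 show ?case
 proof (cases "i < 3")
  case True
  hence le: "i + l <= d" using less.prems by linarith
  have "pform (i * 1 + (l * 1 + (d - i - l) * 1)) (%P. hcoord P 0 ^ i * (hcoord P 1 ^ l * hcoord P 2 ^ (d - i - l)) :: 'a)"
   by (intro pform_mult pform_power pform_coord)
  hence "pform d (%P. hcoord P 0 ^ i * (hcoord P 1 ^ l * hcoord P 2 ^ (d - i - l)) :: 'a)" using le by simp
  moreover have "ALL P:aff E. hcoord P 0 ^ i * (hcoord P 1 ^ l * hcoord P 2 ^ (d - i - l)) = xfun P ^ i * yfun P ^ l"
   by (auto elim!: aff_cases)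
  ultimately show ?thesis unfolding form_on_def by blast
 next
  case False
  define m where "m = i - 3"
  have i: "i = m + 3" using False unfolding m_def by simp
  have IH: "form_on E d (%P. xfun P ^ i' * yfun P ^ l')" if "i' < i" "2 * i' + 3 * l' <= 2 * i + 3 * l" for i' l'
   by (rule less.IH[OF that(1)]) (use that(2) less.prems in linarith)
  let ?g = "%P. xfun P ^ m * yfun P ^ (l + 2) + wa1 E * (xfun P ^ (m + 1) * yfun P ^ (l + 1)) + wa3 E * (xfun P ^ m * yfun P ^ (l + 1))
   + (- wa2 E) * (xfun P ^ (m + 2) * yfun P ^ l) + (- wa4 E) * (xfun P ^ (m + 1) * yfun P ^ l) + (- wa6 E) * (xfun P ^ m * yfun P ^ l)"
  have "form_on E d ?g"
   by (intro form_on_add form_on_cmult IH) (auto simp: i)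
  thus ?thesis
  proof (rule form_on_cong)
   fix P assume P: "P:aff E"
   then obtain x y where xy: "P = Aff x y" "Aff x y:points E" by (rule aff_cases)
   have "?g P = x ^ m * y ^ l * (y ^ 2 + wa1 E * x * y + wa3 E * y - wa2 E * x ^ 2 - wa4 E * x - wa6 E)"
    unfolding xy(1) by (simp add: ring_pow)
   also have "... = x ^ m * y ^ l * x ^ 3" using xy(2) unfolding Aff_on_curve by simp
   finally show "?g P = xfun P ^ i * yfun P ^ l" unfolding xy(1) i by (simp add: power_add mult_ac)
  qed
 qed
qed

lemma reg_form_on:
 assumes "lowpole E h (Suc (3 * d))" shows "form_on E d h"
proof -
 obtain A B where AB: "regfun E h A B" using assms unfolding lowpole_def reg_def by blast
 have po: "nonzero E h ==> (if B = 0 then 2 * degree A else max (2 * degree A) (2 * degree B + 3)) <= 3 * d"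
  using assms pole_regfun[OF AB] unfolding lowpole_def by auto
 show ?thesis
 proof (cases "nonzero E h")
  case False
  thus ?thesis by (intro form_on_cong[OF form_on_zero]) (auto simp: nonzero_def)
 next
  case True
  have a: "2 * degree A <= 3 * d" using po[OF True] by (auto split: if_splits)
  have b: "2 * degree B + 3 <= 3 * d" if "B ~= 0" using po[OF True] that by auto
  have "form_on E d (%P. (SUM i<=degree A. coeff A i * (xfun P ^ i * yfun P ^ 0)) + (SUM i<=degree B. coeff B i * (xfun P ^ i * yfun P ^ 1)))"
  proof (rule form_on_add)
   show "form_on E d (%P. SUM i<=degree A. coeff A i * (xfun P ^ i * yfun P ^ 0))"
    by (intro form_on_sum form_on_cmult form_on_monomial) (use a in auto)
   show "form_on E d (%P. SUM i<=degree B. coeff B i * (xfun P ^ i * yfun P ^ 1))"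
   proof (cases "B = 0")
    case True thus ?thesis by (simp add: form_on_zero)
   next
    case False
    show ?thesis by (intro form_on_sum form_on_cmult form_on_monomial) (use b[OF False] in auto)
   qed
  qed
  thus ?thesis
  proof (rule form_on_cong)
   fix P assume P: "P:aff E"
   show "(SUM i<=degree A. coeff A i * (xfun P ^ i * yfun P ^ 0)) + (SUM i<=degree B. coeff B i * (xfun P ^ i * yfun P ^ 1)) = h P"
    unfolding regfun_eval[OF AB P] poly_altdef by (simp add: sum_distrib_right mult.assoc)
  qed
 qed
qed

text \<open>Functions that are regular at infinity are quotients \<open>A / B\<close> where the pole of \<open>A\<close> is at most that of B.\<close>
lemma regular_at_infinity_quotient:
 assumes "f:carrier (elocal E Infty)"
 shows "EX A:reg E. EX B:reg E. nonzero E B & (ALL P:aff E. B P ~= 0 --> f P = (A P :: 'a) / B P) &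
  lowpole E A (Suc (pole E B)) & (f Infty = 0 --> lowpole E A (pole E B))"
proof -
 obtain d N D where d: "pform d N" "pform d D" "D Infty ~= 0" "!!Q. Q:points E ==> D Q ~= 0 ==> f Q = N Q / D Q"
  using assms unfolding local_ring_simps regular_at_def plane_fractions_pform by blast
 note D = pform_pole(3)[OF d(2,3), of E] and N = pform_pole[OF d(1), of E]
 have fI: "f Infty = N Infty / D Infty" using d(3,4) by (simp add: Infty_on_curve)
 show ?thesis
  by (rule bexI[of _ N], rule bexI[of _ D]) (use D N pform_pole(1)[OF d(2), of E] d(3,4) fI in "auto simp: lowpole_def")
qed

lemma regular_at_infinityI:
 assumes A: "A:reg E" and B: "B:reg E" "nonzero E B" and low: "lowpole E A (Suc (pole E B))" and T: "finite T"
 shows "EX v. (lowpole E A (pole E B) --> v = 0) &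
  (ALL f. (ALL P:aff E - T. f P * B P = (A P :: 'a)) --> f Infty = v --> f:carrier (elocal E Infty))"
proof -
 define W where "W = xfun ` (T Int aff E)"
 define p where "p = (PROD t:W. [:- t, 1:])"
 have finW: "finite W" unfolding W_def using T by simp
 have p0: "p ~= 0" unfolding p_def using finW by simp
 define b where "b = pole E B + 2 * degree p"
 define e where "e = b mod 3"
 define d where "d = b div 3 + e"
 have de: "b + 2 * e = 3 * d" unfolding d_def e_def by simp
 define C where "C P = poly (p * monom 1 e) (xfun P)" for P :: "'a epoint"
 have Creg: "C:reg E" unfolding C_def by (rule reg_poly)
 have pC: "pole E C = 2 * degree p + 2 * e" unfolding C_def pole_poly using p0 by (simp add: degree_mult_eq degree_monom_eq)
 have Cnz: "nonzero E C"
 proof -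
  have "p * monom 1 e ~= 0" using p0 by simp
  hence "finite {x. poly (p * monom 1 e) x = 0}" by (rule poly_roots_finite)
  then obtain x where "poly (p * monom 1 e) x ~= 0" using cofinite_inhabited by blast
  moreover obtain y where "Aff x y:points E" using point_above by blast
  ultimately show ?thesis unfolding nonzero_def C_def by (intro bexI[of _ "Aff x y"]) auto
 qed
 have pD: "pole E (%P. B P * C P) = 3 * d" unfolding pole_mult[OF B(1) Creg B(2) Cnz] pC using de by (simp add: b_def)
 have C_low: "lowpole E C (Suc (2 * degree p + 2 * e))" using Creg pC unfolding lowpole_def by simp
 have "form_on E d (%P. B P * C P)" by (rule reg_form_on) (use B(1) Creg pD in "auto simp: lowpole_def")
 then obtain D where D: "pform d D" "!!P. P:aff E ==> D P = B P * C P" unfolding form_on_def by blast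
 have D0: "D Infty ~= 0"
 proof
  assume "D Infty = 0"
  from lowpole_cong[OF pform_pole(2)[OF D(1) this, of E] D(2)] have "lowpole E (%P. B P * C P) (3 * d)" .
  thus False using pD nonzero_mult[OF B(1) Creg B(2) Cnz] unfolding lowpole_def by simp
 qed
 have "lowpole E (%P. A P * C P) (Suc (pole E B) + (2 * degree p + 2 * e))" by (rule lowpole_mult[OF low C_low])
 moreover have "Suc (pole E B) + (2 * degree p + 2 * e) = Suc (3 * d)" using de unfolding b_def by simp
 ultimately have "lowpole E (%P. A P * C P) (Suc (3 * d))" by metis
 then obtain N where N: "pform d N" "!!P. P:aff E ==> N P = A P * C P" using reg_form_on unfolding form_on_def by blast
 have v0: "N Infty = 0" if "lowpole E A (pole E B)"
 proof (rule ccontr)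
  assume "N Infty ~= 0"
  hence n: "nonzero E N & pole E N = 3 * d" by (rule pform_pole(3)[OF N(1)])
  have "lowpole E (%P. A P * C P) (pole E B + (2 * degree p + 2 * e))" by (rule lowpole_mult[OF that C_low])
  moreover have "pole E B + (2 * degree p + 2 * e) = 3 * d" using de unfolding b_def by simp
  ultimately have "lowpole E (%P. A P * C P) (3 * d)" by metis
  hence "lowpole E N (3 * d)" by (rule lowpole_cong) (simp add: N(2))
  thus False using n unfolding lowpole_def by simp
 qed
 have "f:carrier (elocal E Infty)" if f: "ALL P:aff E - T. f P * B P = A P" "f Infty = N Infty / D Infty" for f
 proof -
  have "f Q = N Q / D Q" if Q: "Q:points E" "D Q ~= 0" for Q
  proof (cases "Q = Infty")
   case True thus ?thesis using f(2) by simp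
  next
   case False
   hence Qa: "Q:aff E" using Q(1) by blast
   have nz: "B Q ~= 0" "C Q ~= 0" using Q(2) D(2)[OF Qa] by auto
   have "poly p (xfun Q) ~= 0" using nz(2) unfolding C_def by auto
   hence "xfun Q ~: W" unfolding p_def poly_prod using finW by (auto simp: prod_zero_iff)
   hence "Q ~: T" using Qa unfolding W_def by blast
   hence "f Q * B Q = A Q" using f(1) Qa by blast
   hence "f Q = A Q / B Q" using nz(1) by (simp add: nonzero_eq_divide_eq)
   thus ?thesis unfolding N(2)[OF Qa] D(2)[OF Qa] using nz by simp
  qed
  thus ?thesis using N(1) D(1) D0 unfolding local_ring_simps regular_at_def plane_fractions_pform by blast
 qed
 thus ?thesis using v0 by (intro exI[of _ "N Infty / D Infty"]) auto
qed


section \<open>Isogenies on coordinates\<close>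


lemma xfun_eneg [simp]: "xfun (eneg E P) = xfun P"
 by (cases P) auto

lemma reg_eneg_regfun: "regfun E f A B ==> regfun E (%P. f (eneg E P)) (A - B * ytrace E) (- B :: 'a poly)"
 unfolding regfun_def
proof (intro allI impI)
 fix x y assume f: "ALL x y. Aff x y:points E --> f (Aff x y) = poly A x + poly B x * y" and P: "Aff x y:points E"
 have "eneg E (Aff x y):points E" by (rule eneg_on_curve[OF P])
 thus "f (eneg E (Aff x y)) = poly (A - B * ytrace E) x + poly (- B) x * y"
  using f unfolding eneg_Aff_poly by (simp add: algebra_simps)
qed

lemma pform_reg: "pform d F ==> F:reg (E :: 'a weierstrass)"
 using pform_pole(1)[of d F E] unfolding lowpole_def by blast

lemma xfun_regular: "Q:aff E' ==> (xfun :: 'a epoint => 'a):carrier (elocal E' Q)"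
proof -
 assume Q: "Q:aff E'"
 have 1: "hcoord R 2 ~= 0 --> xfun R = hcoord R 0 / hcoord R 2" for R :: "'a epoint" by (cases R) auto
 have 2: "hcoord Q 2 ~= 0" using Q by (cases Q) auto
 have 3: "((%R :: 'a epoint. hcoord R 0), (%R. hcoord R 2)):plane_fractions"
  unfolding plane_fractions_pform using pform_coord by blast
 show ?thesis unfolding local_ring_simps regular_at_def mem_Collect_eq by (rule bexI[OF _ 3]) (use 1 2 in simp)
qed

text \<open>The functions \<open>1 / x\<close> and \<open>x / y\<close>, extended by 0 at infinity.\<close>
definition winv :: "'a epoint => 'a" where "winv P = (if P = Infty then 0 else 1 / xfun P)"
definition zpar :: "'a epoint => 'a" where "zpar P = (if P = Infty then 0 else xfun P / yfun P)"

lemma nonzero_xfun: "nonzero E (xfun :: 'a epoint => 'a)" using nonzero_x_minus[of E 0] by simp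

lemma pole_xfun: "pole E (xfun :: 'a epoint => 'a) = 2"
 using pole_poly[of E "[:0, 1:]"] by (simp add: eta_contract_eq)

text \<open>
  Order of vanishing at infinity of functions that are quotients of elements of the coordinate ring
  outside of finitely many points, and may have arbitrary values there.
\<close>
definition ord_ge :: "'a weierstrass => nat => ('a epoint => 'a) => bool" where
 "ord_ge E n f <-> (EX A B T. A:reg E & B:reg E & nonzero E B & finite T & (ALL P:aff E - T. f P * B P = A P) &
  (nonzero E A --> pole E A + n <= pole E B))"

definition ord_eq :: "'a weierstrass => nat => ('a epoint => 'a) => bool" where
 "ord_eq E n f <-> (EX A B T. A:reg E & B:reg E & nonzero E A & nonzero E B & finite T & (ALL P:aff E - T. f P * B P = A P) &
  pole E A + n = pole E B)"

lemma quotient_unique: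
 assumes "A:reg E" "B:reg E" "A':reg E" "B':reg E" "finite T" "finite T'"
  and "!!P. P:aff E - T ==> f P * B P = A P" "!!P. P:aff E - T' ==> f P * B' P = (A' P :: 'a)" "P:aff E"
 shows "A P * B' P = A' P * B P"
proof (rule reg_eqI[of "%P. A P * B' P" E "%P. A' P * B P" "T Un T'"])
 fix P assume P: "P:aff E - (T Un T')"
 have a: "A P = f P * B P" "A' P = f P * B' P" using assms(7)[of P] assms(8)[of P] P by auto
 show "A P * B' P = A' P * B P" unfolding a by (simp add: mult_ac)
qed (use assms in auto)

lemma ord_ge_eq_le:
 assumes "ord_ge E n f" "ord_eq E m f" shows "n <= m"
proof -
 obtain A B T where A: "A:reg E" "B:reg E" "nonzero E B" "finite T" "!!P. P:aff E - T ==> f P * B P = A P"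
  "nonzero E A ==> pole E A + n <= pole E B" using assms(1) unfolding ord_ge_def by blast
 obtain A' B' T' where A': "A':reg E" "B':reg E" "nonzero E A'" "nonzero E B'" "finite T'" "!!P. P:aff E - T' ==> f P * B' P = A' P"
  "pole E A' + m = pole E B'" using assms(2) unfolding ord_eq_def by blast
 have eq: "A P * B' P = A' P * B P" if "P:aff E" for P
  by (rule quotient_unique[OF A(1,2) A'(1,2) A(4) A'(5) A(5) A'(6) that])
 have "nonzero E (%P. A' P * B P)" by (rule nonzero_mult[OF A'(1) A(2) A'(3) A(3)])
 hence nA: "nonzero E A" using eq unfolding nonzero_def by (metis mult_eq_0_iff)
 have "pole E A + pole E B' = pole E (%P. A P * B' P)" by (rule pole_mult[symmetric, OF A(1) A'(2) nA A'(4)])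
 also have "... = pole E (%P. A' P * B P)" by (rule pole_cong) (use A(1) A'(2) eq in auto)
 also have "... = pole E A' + pole E B" by (rule pole_mult[OF A'(1) A(2) A'(3) A(3)])
 finally show ?thesis using A(6)[OF nA] A'(7) by linarith
qed

lemma ord_ge_add:
 assumes "ord_ge E n f" "ord_ge E n g" shows "ord_ge E n (%P. f P + g P)"
proof -
 obtain A B T where A: "A:reg E" "B:reg E" "nonzero E B" "finite T" "!!P. P:aff E - T ==> f P * B P = A P"
  "nonzero E A ==> pole E A + n <= pole E B" using assms(1) unfolding ord_ge_def by blast
 obtain A' B' T' where A': "A':reg E" "B':reg E" "nonzero E B'" "finite T'" "!!P. P:aff E - T' ==> g P * B' P = A' P"
  "nonzero E A' ==> pole E A' + n <= pole E B'" using assms(2) unfolding ord_ge_def by blast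
 define h where "h P = A P * B' P + A' P * B P" for P
 have hr: "h:reg E" unfolding h_def by (intro reg_add reg_mult A A')
 have eq: "(f P + g P) * (B P * B' P) = h P" if P: "P:aff E - (T Un T')" for P
 proof -
  have "f P * B P = A P" "g P * B' P = A' P" using A(5)[of P] A'(5)[of P] P by auto
  moreover have "(f P + g P) * (B P * B' P) = (f P * B P) * B' P + (g P * B' P) * B P" by (simp add: algebra_simps)
  ultimately show ?thesis unfolding h_def by simp
 qed
 have pB: "pole E (%P. B P * B' P) = pole E B + pole E B'" by (rule pole_mult[OF A(2) A'(2) A(3) A'(3)])
 have bound: "pole E h + n <= pole E B + pole E B'" if nh: "nonzero E h"
 proof -
  have p1: "nonzero E A ==> pole E (%P. A P * B' P) + n <= pole E B + pole E B'"
   using pole_mult[OF A(1) A'(2) _ A'(3)] A(6) by simp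
  have p2: "nonzero E A' ==> pole E (%P. A' P * B P) + n <= pole E B + pole E B'"
   using pole_mult[OF A'(1) A(2) _ A(3)] A'(6) by simp
  consider "nonzero E A" "nonzero E A'" | "~ nonzero E A" "nonzero E A'" | "nonzero E A" "~ nonzero E A'" | "~ nonzero E A" "~ nonzero E A'" by blast
  thus ?thesis
  proof cases
   case 1
   have "pole E h <= max (pole E (%P. A P * B' P)) (pole E (%P. A' P * B P))"
    unfolding h_def by (rule pole_add_le) (use A A' in auto)
   thus ?thesis using p1[OF 1(1)] p2[OF 1(2)] by linarith
  next
   case 2
   have "pole E h = pole E (%P. A' P * B P)" by (rule pole_cong[OF hr]) (use 2(1) in "auto simp: h_def nonzero_def")
   thus ?thesis using p2[OF 2(2)] by simp
  next
   case 3
   have "pole E h = pole E (%P. A P * B' P)" by (rule pole_cong[OF hr]) (use 3(2) in "auto simp: h_def nonzero_def")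
   thus ?thesis using p1[OF 3(1)] by simp
  next
   case 4
   hence "~ nonzero E h" unfolding nonzero_def h_def by auto
   thus ?thesis using nh by blast
  qed
 qed
 show ?thesis unfolding ord_ge_def
 proof (intro exI conjI)
  show "h:reg E" by (rule hr)
  show "(%P. B P * B' P):reg E" by (rule reg_mult[OF A(2) A'(2)])
  show "nonzero E (%P. B P * B' P)" by (rule nonzero_mult[OF A(2) A'(2) A(3) A'(3)])
  show "finite (T Un T')" using A(4) A'(4) by simp
  show "ALL P:aff E - (T Un T'). (f P + g P) * (B P * B' P) = h P" using eq by blast
  show "nonzero E h --> pole E h + n <= pole E (%P. B P * B' P)" using bound pB by simp
 qed
qed

lemma ord_ge_mult:
 assumes "ord_ge E m f" "ord_ge E n g" shows "ord_ge E (m + n) (%P. f P * g P)"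
proof -
 obtain A B T where A: "A:reg E" "B:reg E" "nonzero E B" "finite T" "!!P. P:aff E - T ==> f P * B P = A P"
  "nonzero E A ==> pole E A + m <= pole E B" using assms(1) unfolding ord_ge_def by blast
 obtain A' B' T' where A': "A':reg E" "B':reg E" "nonzero E B'" "finite T'" "!!P. P:aff E - T' ==> g P * B' P = A' P"
  "nonzero E A' ==> pole E A' + n <= pole E B'" using assms(2) unfolding ord_ge_def by blast
 show ?thesis unfolding ord_ge_def
 proof (intro exI conjI)
  show "(%P. A P * A' P):reg E" "(%P. B P * B' P):reg E" by (intro reg_mult A A')+
  show "nonzero E (%P. B P * B' P)" by (rule nonzero_mult[OF A(2) A'(2) A(3) A'(3)])
  show "finite (T Un T')" using A(4) A'(4) by simp
  show "ALL P:aff E - (T Un T'). (f P * g P) * (B P * B' P) = A P * A' P"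
  proof
   fix P assume P: "P:aff E - (T Un T')"
   hence a: "A P = f P * B P" "A' P = g P * B' P" using A(5)[of P] A'(5)[of P] by auto
   show "(f P * g P) * (B P * B' P) = A P * A' P" unfolding a by (simp add: mult_ac)
  qed
  show "nonzero E (%P. A P * A' P) --> pole E (%P. A P * A' P) + (m + n) <= pole E (%P. B P * B' P)"
  proof
   assume "nonzero E (%P. A P * A' P)"
   hence n: "nonzero E A" "nonzero E A'" unfolding nonzero_def by auto
   thus "pole E (%P. A P * A' P) + (m + n) <= pole E (%P. B P * B' P)"
    using pole_mult[OF A(1) A'(1) n] pole_mult[OF A(2) A'(2) A(3) A'(3)] A(6)[OF n(1)] A'(6)[OF n(2)] by simp
  qed
 qed
qed

lemma regular_ord_ge:
 assumes "f:carrier (elocal E Infty)" shows "ord_ge E 0 f" "f Infty = 0 ==> ord_ge E 1 f"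
proof -
 obtain A B where A: "A:reg E" "B:reg E" "nonzero E B" "ALL P:aff E. B P ~= 0 --> f P = A P / B P"
  "lowpole E A (Suc (pole E B))" "f Infty = 0 --> lowpole E A (pole E B)"
  using regular_at_infinity_quotient[OF assms] by blast
 define T where "T = {P:aff E. B P = 0}"
 have T: "finite T" unfolding T_def by (rule finite_zeros[OF A(2,3)])
 have eq: "ALL P:aff E - T. f P * B P = A P"
 proof
  fix P assume P: "P:aff E - T"
  hence nz: "B P ~= 0" unfolding T_def by blast
  hence "f P = A P / B P" using A(4) P by blast
  thus "f P * B P = A P" using nz by simp
 qed
 show "ord_ge E 0 f" unfolding ord_ge_def
  by (intro exI[of _ A] exI[of _ B] exI[of _ T]) (use A(1-3) T eq A(5) in "auto simp: lowpole_def")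
 show "ord_ge E 1 f" if "f Infty = 0" unfolding ord_ge_def
  by (intro exI[of _ A] exI[of _ B] exI[of _ T]) (use A(1-3) T eq mp[OF A(6) that] in "auto simp: lowpole_def")
qed

lemma ord_ge_regular:
 assumes "ord_ge E 0 f"
 shows "EX v. f(Infty := v):carrier (elocal E Infty)" and "ord_ge E 1 f ==> f(Infty := 0):carrier (elocal E Infty)"
proof -
 have *: "EX v. (n = 1 --> v = 0) & f(Infty := v):carrier (elocal E Infty)" if n: "ord_ge E n f" for n
 proof -
  obtain A B T where A: "A:reg E" "B:reg E" "nonzero E B" "finite T" "!!P. P:aff E - T ==> f P * B P = A P"
   "nonzero E A ==> pole E A + n <= pole E B" using n unfolding ord_ge_def by blast
  have l: "lowpole E A (Suc (pole E B))" using A(1,6) unfolding lowpole_def by auto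
  have l1: "n = 1 ==> lowpole E A (pole E B)" using A(1,6) unfolding lowpole_def by auto
  obtain v where v: "lowpole E A (pole E B) --> v = 0"
   "!!g. (ALL P:aff E - T. g P * B P = A P) ==> g Infty = v ==> g:carrier (elocal E Infty)"
   using regular_at_infinityI[OF A(1-3) l A(4)] by blast
  have "f(Infty := v):carrier (elocal E Infty)" by (rule v(2)) (use A(5) in auto)
  thus ?thesis using v(1) l1 by blast
 qed
 show "EX v. f(Infty := v):carrier (elocal E Infty)" using *[OF assms] by blast
 show "f(Infty := 0):carrier (elocal E Infty)" if "ord_ge E 1 f" using *[OF that] by auto
qed

lemma vanishing_order_ideal: "ideal {f:carrier (elocal E Infty). ord_ge E n f} (elocal E Infty)"
proof (rule local_ring_idealI[OF fraction_class_plane])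
 have "ord_ge E n (%_. 0)"
 proof -
  obtain P where "P:aff E" using infinite_aff[of E] by (metis finite.emptyI ex_in_conv)
  hence "nonzero E (%_. 1)" "~ nonzero E (%_. 0)" unfolding nonzero_def by auto
  thus ?thesis unfolding ord_ge_def by (intro exI[of _ "%_. 0"] exI[of _ "%_. 1"] exI[of _ "{}"]) auto
 qed
 thus "(%_. 0):{f:carrier (elocal E Infty). ord_ge E n f}" using regular_at_const[OF fraction_class_plane] by simp
 fix f g assume g: "g:{f:carrier (elocal E Infty). ord_ge E n f}"
 show "(%x. f x + g x):{f:carrier (elocal E Infty). ord_ge E n f}" if "f:{f:carrier (elocal E Infty). ord_ge E n f}"
  using that g regular_at_arith(1)[OF fraction_class_plane] ord_ge_add by auto
 show "(%x. f x * g x):{f:carrier (elocal E Infty). ord_ge E n f}" if f: "regular_at (points E) plane_fractions Infty f"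
 proof -
  have "ord_ge E (0 + n) (%x. f x * g x)" by (rule ord_ge_mult[OF regular_ord_ge(1)]) (use f g in auto)
  thus ?thesis using f g regular_at_arith(2)[OF fraction_class_plane] by auto
 qed
qed auto

lemma ord_geI:
 assumes "A:reg E" "B:reg E" "nonzero E B" "!!P. P:aff E ==> B P ~= 0 ==> f P * B P = A P"
  and "pole E A + n <= pole E B"
 shows "ord_ge E n f"
proof -
 have "finite {P:aff E. B P = 0}" by (rule finite_zeros[OF assms(2,3)])
 moreover have "ALL P:aff E - {P:aff E. B P = 0}. f P * B P = A P" using assms(4) by blast
 ultimately show ?thesis unfolding ord_ge_def using assms(1-3,5) by blast
qed

lemma ord_ge_mono: "ord_ge E n f ==> m <= n ==> ord_ge E m f"
 unfolding ord_ge_def by (meson add_left_mono le_trans)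

lemma winv_regular: "winv:carrier (elocal E Infty)"
proof -
 have "pole E (%_. 1) = 0" using pole_poly[of E "[:1:]"] by simp
 hence "ord_ge E 1 winv"
  by (intro ord_geI[of "%_. 1" E xfun] reg_const reg_xfun nonzero_xfun) (auto simp: winv_def pole_xfun)
 from ord_ge_regular(2)[OF ord_ge_mono[OF this] this] have "winv(Infty := 0):carrier (elocal E Infty)" by simp
 moreover have "winv(Infty := 0) = (winv :: 'a epoint => 'a)" by (auto simp: winv_def fun_eq_iff)
 ultimately show ?thesis by metis
qed

lemma zpar_regular: "zpar:carrier (elocal E Infty)"
proof -
 have "ord_ge E 1 zpar"
  by (intro ord_geI[of xfun E yfun] reg_xfun reg_yfun nonzero_yfun) (auto simp: zpar_def pole_xfun pole_yfun)
 from ord_ge_regular(2)[OF ord_ge_mono[OF this] this] have "zpar(Infty := 0):carrier (elocal E Infty)" by simp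
 moreover have "zpar(Infty := 0) = (zpar :: 'a epoint => 'a)" by (auto simp: zpar_def fun_eq_iff)
 ultimately show ?thesis by metis
qed

lemma isogeny_surj_hom: "isogeny E E' phi ==> surj_hom E E' phi"
 unfolding isogeny_def surj_hom_def by blast

lemma isogeny_surj: "isogeny E E' phi ==> Q:points E' ==> EX P:points E. phi P = Q"
 unfolding isogeny_def by (metis imageE)

lemma emorphism_pull: "isogeny E E' phi ==> P:points E ==> f:carrier (elocal E' (phi P)) ==> f o phi:carrier (elocal E P)"
 unfolding isogeny_def emorphism_def by blast

lemma regular_quotient:
 assumes P: "P:aff E" and f: "f:carrier (elocal E P)"
 shows "EX N:reg E. EX D:reg E. nonzero E D & D P ~= 0 & (ALL Q:points E. D Q ~= 0 --> f Q = (N Q :: 'a) / D Q)"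
proof -
 obtain d N D where d: "pform d N" "pform d D" "D P ~= 0" "ALL Q:points E. D Q ~= 0 --> f Q = N Q / D Q"
  using f unfolding local_ring_simps regular_at_def plane_fractions_pform by blast
 have "nonzero E D" using P d(3) unfolding nonzero_def by blast
 thus ?thesis using pform_reg d by blast
qed

lemma even_function_is_poly:
 assumes E: "elliptic_curve (E :: 'a weierstrass)" and f: "f:reg E" and T: "finite T" "!!P. P:aff E - T ==> f (eneg E P) = f P"
 shows "EX A. ALL P:aff E. f P = poly A (xfun P)"
proof -
 obtain A B where AB: "regfun E f A B" using f unfolding reg_def by blast
 note u = regfun_unique[OF reg_eneg_regfun[OF AB] AB T]
 have "B = 0"
 proof (rule ccontr)
  assume B: "B ~= 0"
  have "B * ytrace E = 0" using u(1) by simp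
  hence "ytrace E = 0" using B by simp
  hence a: "wa1 E = 0" "wa3 E = 0" unfolding ytrace_def by auto
  have "B + B = - B + B" using u(2) by (simp only:)
  hence "B + B = 0" by (simp only: add.left_inverse)
  hence "coeff (B + B) (degree B) = 0" by (simp only: coeff_0)
  moreover have "coeff (B + B) (degree B) = 2 * coeff B (degree B)" by (simp only: coeff_add mult_2)
  ultimately have "2 * coeff B (degree B) = 0" by (simp only:)
  hence two: "(2::'a) = 0" using B by simp
  have "(4::'a) = 2 * 2" by simp
  hence four: "(4::'a) = 0" unfolding two by simp
  have "wb2 E = 0" "wb4 E = 0" "wb6 E = 0" unfolding wb2_def wb4_def wb6_def a two four by simp_all
  hence "discriminant E = 0" unfolding discriminant_def by simp
  thus False using E unfolding elliptic_curve_def by simp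
 qed
 thus ?thesis using regfun_eval[OF AB] by (intro exI[of _ A]) simp
qed

text \<open>
  The function \<open>x' \<circ> phi\<close> is even, hence a quotient of two polynomials in x; comparing with the
  local presentations of \<open>x' \<circ> phi\<close> and of \<open>(1 / x') \<circ> phi\<close> at a point shows where it is defined.
\<close>
theorem isogeny_xmap:
 assumes E: "elliptic_curve (E :: 'a weierstrass)" and E': "elliptic_curve E'" and phi: "isogeny E E' phi"
 shows "EX a c. xmap E E' phi a c"
proof -
 note sh = isogeny_surj_hom[OF phi] and pull = emorphism_pull[OF phi]
 note hom = surj_hom_basic[OF E E' sh]
 define f where "f P = xfun (phi P)" for P
 have fpull: "f:carrier (elocal E P)" if P: "P:aff E" "phi P ~= Infty" for P
 proof -
  have Pp: "P:points E" using P(1) by blast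
  have "phi P:aff E'" using hom(2)[OF Pp] P(2) by blast
  hence "xfun o phi:carrier (elocal E P)" using pull[OF Pp] xfun_regular by blast
  thus ?thesis by (simp add: f_def[abs_def] comp_def)
 qed
 obtain P0 where P0: "P0:aff E" "phi P0 ~= Infty"
 proof -
  obtain Q where Q: "Q:aff E'" using infinite_aff[of E'] by (metis finite.emptyI ex_in_conv)
  then obtain P where P: "P:points E" "phi P = Q" using isogeny_surj[OF phi] by blast
  have "P ~= Infty" using P(2) Q hom(1) by auto
  thus ?thesis using that[of P] P Q by blast
 qed
 obtain N0 D0 where N0: "N0:reg E" "D0:reg E" "nonzero E D0" "ALL Q:points E. D0 Q ~= 0 --> f Q = N0 Q / D0 Q"
  using regular_quotient[OF P0(1) fpull[OF P0]] by blast
 define n where "n = nrm E D0"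
 have n0: "n ~= 0" unfolding n_def by (rule nrm_nonzero[OF N0(2,3)])
 have D0n: "D0 P * D0 (eneg E P) = poly n (xfun P)" if "P:aff E" for P
  using nrm_eval[OF N0(2), of "xfun P" "yfun P"] aff_coords[OF that] that unfolding n_def by auto
 obtain A0 B0 where "regfun E D0 A0 B0" using N0(2) unfolding reg_def by blast
 hence Dbar: "(%P. D0 (eneg E P)):reg E" using reg_eneg_regfun unfolding reg_def by blast
 define A1 where "A1 P = N0 P * D0 (eneg E P)" for P
 have A1r: "A1:reg E" unfolding A1_def by (rule reg_mult[OF N0(1) Dbar])
 define T1 where "T1 = {P:aff E. xfun P:{x. poly n x = 0}}"
 have T1: "finite T1" unfolding T1_def by (intro finite_xfun_fibre poly_roots_finite n0)
 have fn: "f P * poly n (xfun P) = A1 P" if P: "P:aff E - T1" for P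
 proof -
  have "poly n (xfun P) ~= 0" using P unfolding T1_def by blast
  hence "D0 P ~= 0" using D0n[of P] P by auto
  hence "f P * D0 P = N0 P" using N0(4) P by simp
  hence "f P * D0 P * D0 (eneg E P) = A1 P" unfolding A1_def by simp
  thus ?thesis using D0n[of P] P by (simp add: mult.assoc)
 qed
 have feven: "f (eneg E P) = f P" if "P:aff E" for P using hom(3)[of P] that unfolding f_def by simp
 have "A1 (eneg E P) = A1 P" if P: "P:aff E - T1" for P
 proof -
  have neg: "eneg E P:aff E" using P eneg_on_curve[of P E] by (cases P) auto
  hence "eneg E P:aff E - T1" using P unfolding T1_def by auto
  thus ?thesis using fn[of P] fn[of "eneg E P"] P feven[of P] by simp
 qed
 then obtain A where A: "ALL P:aff E. A1 P = poly A (xfun P)" using even_function_is_poly[OF E A1r T1] by blast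
 obtain a c where ac: "c ~= 0" "A * c = a * n" "!!x. ~ (poly a x = 0 & poly c x = 0)" using reduced_fraction[OF n0, of A] by blast
 have fc: "f P * poly c (xfun P) = poly a (xfun P)" if P: "P:aff E - T1" for P
 proof -
  have nz: "poly n (xfun P) ~= 0" using P unfolding T1_def by blast
  have "poly (A * c) (xfun P) = poly (a * n) (xfun P)" unfolding ac(2) ..
  hence "A1 P * poly c (xfun P) = poly a (xfun P) * poly n (xfun P)" using A P by simp
  moreover have "(f P * poly c (xfun P)) * poly n (xfun P) = (f P * poly n (xfun P)) * poly c (xfun P)" by (simp only: mult_ac)
  ultimately have "(f P * poly c (xfun P)) * poly n (xfun P) = poly a (xfun P) * poly n (xfun P)" unfolding fn[OF P] by (simp only:)
  thus ?thesis using nz mult_right_cancel by blast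
 qed
 have notconst: "a ~= smult kappa c" for kappa
 proof
  assume k: "a = smult kappa c"
  define S where "S = T1 Un {P:aff E. xfun P:{x. poly c x = 0}}"
  have S: "finite S" unfolding S_def using T1 finite_xfun_fibre[OF poly_roots_finite[OF ac(1)]] by simp
  have fk: "f P = kappa" if "P:aff E - S" for P
   using fc[of P] that unfolding k S_def by auto
  have "aff E' <= phi ` S Un {Q:aff E'. xfun Q:{kappa}}"
  proof
   fix Q assume Q: "Q:aff E'"
   then obtain P where P: "P:points E" "phi P = Q" using isogeny_surj[OF phi] by blast
   have "P:aff E" using P Q hom(1) by auto
   thus "Q:phi ` S Un {Q:aff E'. xfun Q:{kappa}}" using fk[of P] P(2) Q unfolding f_def by (cases "P:S") auto
  qed
  moreover have "finite (phi ` S Un {Q:aff E'. xfun Q:{kappa}})" using S finite_xfun_fibre[of "{kappa}" E'] by simp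
  ultimately show False using infinite_aff[of E'] finite_subset by blast
 qed
 define T2 where "T2 = T1 Un {P:aff E. xfun P:{x. poly a x = 0}}"
 have a0: "a ~= 0" using notconst[of 0] by simp
 have T2: "finite T2" unfolding T2_def using T1 finite_xfun_fibre[OF poly_roots_finite[OF a0]] by simp
 have notI: "phi P ~= Infty & xfun (phi P) ~= 0" if "P:aff E - T2" for P
 proof -
  have "poly a (xfun P) ~= 0" "P:aff E - T1" using that unfolding T2_def by auto
  hence nz: "xfun (phi P) ~= 0" using fc[of P] unfolding f_def by auto
  moreover from this have "phi P ~= Infty" by (auto simp: xfun_def)
  ultimately show ?thesis by blast
 qed
 have inv: "winv (phi P) * poly a (xfun P) = poly c (xfun P)" if P: "P:aff E - T2" for P
 proof -
  have "f P * poly c (xfun P) = poly a (xfun P)" using fc[of P] P unfolding T2_def by blast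
  thus ?thesis using notI[OF P] unfolding winv_def f_def by (auto simp: field_simps)
 qed
 have aff_pt: "(phi P = Infty <-> poly c (xfun P) = 0) & (phi P ~= Infty --> xfun (phi P) * poly c (xfun P) = poly a (xfun P))"
  if P: "P:aff E" for P
 proof (cases "phi P = Infty")
  case False
  obtain N D where ND: "N:reg E" "D:reg E" "nonzero E D" "D P ~= 0" "ALL Q:points E. D Q ~= 0 --> f Q = N Q / D Q"
   using regular_quotient[OF P fpull[OF P False]] by blast
  have "N P * poly c (xfun P) = poly a (xfun P) * D P"
  proof (rule reg_eqI[of "%P. N P * poly c (xfun P)" E "%P. poly a (xfun P) * D P" "T1 Un {P:aff E. D P = 0}"])
   fix Q assume Q: "Q:aff E - (T1 Un {P:aff E. D P = 0})"
   hence e: "N Q = f Q * D Q" "poly a (xfun Q) = f Q * poly c (xfun Q)" using ND(5) fc[of Q] by auto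
   show "N Q * poly c (xfun Q) = poly a (xfun Q) * D Q" unfolding e by (simp add: mult_ac)
  qed (use ND(1,2) T1 finite_zeros[OF ND(2,3)] P in "auto intro!: reg_mult")
  moreover have "N P = f P * D P" using ND(4,5) P by simp
  ultimately have "D P * (f P * poly c (xfun P)) = D P * poly a (xfun P)" by (simp add: mult_ac)
  hence "f P * poly c (xfun P) = poly a (xfun P)" using ND(4) by simp
  moreover from this have "poly c (xfun P) ~= 0" using ac(3)[of "xfun P"] by auto
  ultimately show ?thesis using False unfolding f_def by simp
 next
  case True
  have Pp: "P:points E" using P by blast
  have "winv o phi:carrier (elocal E P)" using pull[OF Pp] winv_regular True by metis
  then obtain N D where ND: "N:reg E" "D:reg E" "nonzero E D" "D P ~= 0" "ALL Q:points E. D Q ~= 0 --> (winv o phi) Q = N Q / D Q"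
   using regular_quotient[OF P] by blast
  have "N P * poly a (xfun P) = poly c (xfun P) * D P"
  proof (rule reg_eqI[of "%P. N P * poly a (xfun P)" E "%P. poly c (xfun P) * D P" "T2 Un {P:aff E. D P = 0}"])
   fix Q assume Q: "Q:aff E - (T2 Un {P:aff E. D P = 0})"
   hence e: "N Q = winv (phi Q) * D Q" "poly c (xfun Q) = winv (phi Q) * poly a (xfun Q)" using ND(5) inv[of Q] by auto
   show "N Q * poly a (xfun Q) = poly c (xfun Q) * D Q" unfolding e by (simp add: mult_ac)
  qed (use ND(1,2) T2 finite_zeros[OF ND(2,3)] P in "auto intro!: reg_mult")
  moreover have "N P = 0"
  proof -
   have "(winv o phi) P = N P / D P" using ND(4,5) Pp by blast
   moreover have "(winv o phi) P = 0" using True by (simp add: winv_def)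
   ultimately show ?thesis using ND(4) by simp
  qed
  ultimately show ?thesis using True ND(4) by simp
 qed
 have "degree c < degree a"
 proof -
  have "winv o phi:carrier (elocal E Infty)" using pull[OF Infty_on_curve] winv_regular hom(1) by metis
  moreover have "(winv o phi) Infty = 0" using hom(1) by (simp add: winv_def)
  ultimately have "ord_ge E 1 (winv o phi)" by (rule regular_ord_ge(2))
  then obtain A2 B2 T where A2: "A2:reg E" "B2:reg E" "nonzero E B2" "finite T" "ALL P:aff E - T. (winv o phi) P * B2 P = A2 P"
   "nonzero E A2 --> pole E A2 + 1 <= pole E B2" unfolding ord_ge_def by blast
  have pr: "(%P. poly a (xfun P)):reg E" "(%P. poly c (xfun P)):reg E" by simp_all
  have eq: "A2 P * poly a (xfun P) = poly c (xfun P) * B2 P" if P: "P:aff E" for P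
   by (rule quotient_unique[OF A2(1,2) pr(2,1) A2(4) T2 _ _ P, of "winv o phi"]) (use A2(5) inv in auto)
  have nzp: "nonzero E (%P. poly p (xfun P))" if p0: "p ~= 0" for p
  proof -
   obtain x where "poly p x ~= 0" using cofinite_inhabited[OF poly_roots_finite[OF p0]] by blast
   moreover obtain y where "Aff x y:points E" using point_above by blast
   ultimately show ?thesis unfolding nonzero_def by (intro bexI[of _ "Aff x y"]) auto
  qed
  note nza = nzp[OF a0] and nzc = nzp[OF ac(1)]
  have "nonzero E (%P. poly c (xfun P) * B2 P)" by (rule nonzero_mult[OF pr(2) A2(2) nzc A2(3)])
  hence nA: "nonzero E A2" using eq unfolding nonzero_def by (metis mult_eq_0_iff)
  have "pole E A2 + 2 * degree a = pole E (%P. A2 P * poly a (xfun P))"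
   unfolding pole_mult[OF A2(1) pr(1) nA nza] pole_poly ..
  also have "... = pole E (%P. poly c (xfun P) * B2 P)" by (rule pole_cong[OF reg_mult[OF A2(1) pr(1)] eq])
  also have "... = 2 * degree c + pole E B2" unfolding pole_mult[OF pr(2) A2(2) nzc A2(3)] pole_poly ..
  finally show ?thesis using mp[OF A2(6) nA] by linarith
 qed
 thus ?thesis unfolding xmap_def using sh ac(3) aff_pt by blast
qed


section \<open>Kernels of isogenies at infinity\<close>


lemma nonzero_poly_xfun: "p ~= 0 ==> nonzero E (%P. poly p (xfun P) :: 'a)"
proof -
 assume p0: "p ~= 0"
 obtain x where "poly p x ~= 0" using cofinite_inhabited[OF poly_roots_finite[OF p0]] by blast
 moreover obtain y where "Aff x y:points E" using point_above by blast
 ultimately show ?thesis unfolding nonzero_def by (intro bexI[of _ "Aff x y"]) auto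
qed

lemma xmap_denominator_nonzero: "xmap E E' phi a c ==> a ~= 0 & c ~= 0"
proof -
 assume x: "xmap E E' phi a c"
 hence d: "degree c < degree a" and n: "!!x. ~ (poly a x = 0 & poly c x = 0)" unfolding xmap_def by auto
 obtain x where "poly a x = 0" using root_exists[of a] d by auto
 hence "c ~= 0" using n[of x] by auto
 thus ?thesis using d by auto
qed

lemma xmap_finite_preimage:
 assumes x: "xmap E E' phi a c" and S: "finite S" shows "finite {P:aff E. phi P:S}"
proof -
 have nz: "a ~= 0" "c ~= 0" using xmap_denominator_nonzero[OF x] by auto
 have pt: "!!P. P:aff E ==> (phi P = Infty <-> poly c (xfun P) = 0) & (phi P ~= Infty --> xfun (phi P) * poly c (xfun P) = poly a (xfun P))"
  and dac: "degree c < degree a" using x unfolding xmap_def by auto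
 define Z where "Z = {x. poly c x = 0} Un (UN s:S. {x. poly (a - smult (xfun s) c) x = 0})"
 have ne: "a - smult s c ~= 0" for s
 proof
  assume "a - smult s c = 0"
  hence "degree a <= degree c" using degree_smult_le[of s c] by simp
  thus False using dac by simp
 qed
 have "finite Z" unfolding Z_def by (intro finite_UnI finite_UN_I poly_roots_finite S nz(2) ne)
 hence "finite {P:aff E. xfun P:Z}" by (rule finite_xfun_fibre)
 moreover have "{P:aff E. phi P:S} <= {P:aff E. xfun P:Z}"
 proof
  fix P assume P: "P:{P:aff E. phi P:S}"
  show "P:{P:aff E. xfun P:Z}"
  proof (cases "phi P = Infty")
   case True thus ?thesis using P pt[of P] unfolding Z_def by auto
  next
   case False
   hence "poly (a - smult (xfun (phi P)) c) (xfun P) = 0" using P pt[of P] by auto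
   thus ?thesis using P unfolding Z_def by blast
  qed
 qed
 ultimately show ?thesis by (rule finite_subset[rotated])
qed

lemma pole_mult3:
 assumes "f:reg E" "g:reg E" "h:reg E" "nonzero E f" "nonzero E g" "nonzero E h"
 shows "(%P. f P * g P * h P :: 'a):reg E" "nonzero E (%P. f P * g P * h P)"
  "pole E (%P. f P * g P * h P) = pole E f + pole E g + pole E h"
 using nonzero_mult[OF reg_mult[OF assms(1,2)] assms(3) nonzero_mult[OF assms(1,2,4,5)] assms(6)]
  pole_mult[OF reg_mult[OF assms(1,2)] assms(3) nonzero_mult[OF assms(1,2,4,5)] assms(6)]
  pole_mult[OF assms(1,2,4,5)] reg_mult[OF reg_mult[OF assms(1,2)] assms(3)] by simp_all

text \<open>If f vanishes at infinity, then \<open>f\<^sup>2 x'\<close> is regular there, and so is its pullback.\<close>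
lemma pullback_order_ge:
 assumes E: "elliptic_curve (E :: 'a weierstrass)" and E': "elliptic_curve E'" and phi: "isogeny E E' phi"
  and x: "xmap E E' phi a c" and e: "degree a = degree c + e"
  and f: "f:carrier (elocal E' Infty)" "f Infty = 0"
 shows "ord_ge E e (f o phi)"
proof -
 have phi0: "phi Infty = Infty" using surj_hom_basic(1)[OF E E' isogeny_surj_hom[OF phi]] .
 have nz: "a ~= 0" "c ~= 0" using xmap_denominator_nonzero[OF x] by auto
 have pt: "!!P. P:aff E ==> (phi P = Infty <-> poly c (xfun P) = 0) & (phi P ~= Infty --> xfun (phi P) * poly c (xfun P) = poly a (xfun P))"
  using x unfolding xmap_def by auto
 obtain A' B' T' where A': "A':reg E'" "B':reg E'" "nonzero E' B'" "finite T'" "ALL P:aff E' - T'. f P * B' P = A' P"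
  "nonzero E' A' --> pole E' A' + 1 <= pole E' B'" using regular_ord_ge(2)[OF f] unfolding ord_ge_def by blast
 define F where "F P = f P * f P * xfun P" for P
 have "ord_ge E' 0 F" unfolding ord_ge_def
 proof (intro exI conjI)
  show "(%P. A' P * A' P * xfun P):reg E'" "(%P. B' P * B' P):reg E'" by (intro reg_mult reg_xfun A')+
  show "nonzero E' (%P. B' P * B' P)" by (rule nonzero_mult[OF A'(2,2,3,3)])
  show "finite T'" by (rule A'(4))
  show "ALL P:aff E' - T'. F P * (B' P * B' P) = A' P * A' P * xfun P"
  proof
   fix P assume "P:aff E' - T'"
   hence a: "A' P = f P * B' P" using A'(5) by simp
   show "F P * (B' P * B' P) = A' P * A' P * xfun P" unfolding a F_def by (simp add: mult_ac)
  qed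
  show "nonzero E' (%P. A' P * A' P * xfun P) --> pole E' (%P. A' P * A' P * xfun P) + 0 <= pole E' (%P. B' P * B' P)"
  proof
   assume "nonzero E' (%P. A' P * A' P * xfun P)"
   hence n: "nonzero E' A'" unfolding nonzero_def by auto
   show "pole E' (%P. A' P * A' P * xfun P) + 0 <= pole E' (%P. B' P * B' P)"
    using pole_mult3(3)[OF A'(1,1) reg_xfun n n nonzero_xfun] pole_mult[OF A'(2,2,3,3)] mp[OF A'(6) n]
    by (simp add: pole_xfun)
  qed
 qed
 then obtain v where v: "F(Infty := v):carrier (elocal E' Infty)" using ord_ge_regular(1) by blast
 have "F(Infty := v) o phi:carrier (elocal E Infty)" using emorphism_pull[OF phi Infty_on_curve] v phi0 by metis
 from regular_ord_ge(1)[OF this] obtain A B T where A: "A:reg E" "B:reg E" "nonzero E B" "finite T"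
  "ALL P:aff E - T. (F(Infty := v) o phi) P * B P = A P" "nonzero E A --> pole E A + 0 <= pole E B"
  unfolding ord_ge_def by blast
 have "f o phi:carrier (elocal E Infty)" using emorphism_pull[OF phi Infty_on_curve] f(1) phi0 by metis
 from regular_ord_ge(1)[OF this] obtain A1 B1 T1 where A1: "A1:reg E" "B1:reg E" "nonzero E B1" "finite T1"
  "ALL P:aff E - T1. (f o phi) P * B1 P = A1 P" unfolding ord_ge_def by blast
 define S where "S = T Un T1 Un {P:aff E. xfun P:{x. poly c x = 0}}"
 have S: "finite S" unfolding S_def using A(4) A1(4) finite_xfun_fibre[OF poly_roots_finite[OF nz(2)]] by simp
 have pr: "(%P. poly a (xfun P)):reg E" "(%P. poly c (xfun P)):reg E" by simp_all
 let ?l = "%P. A P * (B1 P * B1 P) * poly c (xfun P)" and ?r = "%P. A1 P * A1 P * poly a (xfun P) * B P"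
 have lr: "?l:reg E" "?r:reg E" by (intro reg_mult A A1 pr)+
 have eq: "?l P = ?r P" if P: "P:aff E" for P
 proof (rule reg_eqI[OF lr S _ P])
  fix P assume P: "P:aff E - S"
  have c0: "poly c (xfun P) ~= 0" using P unfolding S_def by blast
  have nI: "phi P ~= Infty" and a: "poly a (xfun P) = xfun (phi P) * poly c (xfun P)" using pt[of P] P c0 by auto
  have T: "P:aff E - T" "P:aff E - T1" using P unfolding S_def by auto
  have AB: "A P = F (phi P) * B P" "A1 P = f (phi P) * B1 P" using bspec[OF A(5) T(1)] bspec[OF A1(5) T(2)] nI by simp_all
  show "?l P = ?r P" unfolding a AB F_def by (simp add: mult_ac)
 qed
 have "pole E A1 + e <= pole E B1" if n1: "nonzero E A1"
 proof -
  note nza = nonzero_poly_xfun[OF nz(1), of E] and nzc = nonzero_poly_xfun[OF nz(2), of E]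
  note R3 = pole_mult3[OF A1(1,1) pr(1) n1 n1 nza]
  have nr: "nonzero E ?r" by (rule nonzero_mult[OF R3(1) A(2) R3(2) A(3)])
  hence nA: "nonzero E A" using eq unfolding nonzero_def by (metis mult_eq_0_iff)
  note BB = nonzero_mult[OF A1(2,2,3,3)] reg_mult[OF A1(2,2)] pole_mult[OF A1(2,2,3,3)]
  note L3 = pole_mult3[OF A(1) BB(2) pr(2) nA BB(1) nzc]
  have "pole E ?l = pole E ?r" by (rule pole_cong[OF lr(1) eq])
  hence "pole E A + (pole E B1 + pole E B1) + 2 * degree c = pole E A1 + pole E A1 + 2 * degree a + pole E B"
   unfolding L3(3) BB(3) pole_mult[OF R3(1) A(2) R3(2) A(3)] R3(3) pole_poly .
  thus ?thesis using mp[OF A(6) nA] e by linarith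
 qed
 thus ?thesis unfolding ord_ge_def using A1 by blast
qed

text \<open>
  With \<open>z = x / y\<close>, the function \<open>z\<^sup>2 x\<close> is a unit at infinity, since its inverse \<open>F = y\<^sup>2 / x\<^sup>3\<close> is
  regular there.  So the pullback of z vanishes to half the order of the pole of \<open>x' \<circ> phi\<close>.
\<close>
lemma pullback_zpar_order:
 assumes E: "elliptic_curve (E :: 'a weierstrass)" and E': "elliptic_curve E'" and phi: "isogeny E E' phi"
  and x: "xmap E E' phi a c" and e: "degree a = degree c + e"
 shows "ord_eq E e (zpar o phi)"
proof -
 have phi0: "phi Infty = Infty" using surj_hom_basic(1)[OF E E' isogeny_surj_hom[OF phi]] .
 have nz: "a ~= 0" "c ~= 0" using xmap_denominator_nonzero[OF x] by auto
 have pt: "!!P. P:aff E ==> (phi P = Infty <-> poly c (xfun P) = 0) & (phi P ~= Infty --> xfun (phi P) * poly c (xfun P) = poly a (xfun P))"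
  using x unfolding xmap_def by auto
 have z0: "zpar Infty = 0" by (simp add: zpar_def)
 obtain A1 B1 T1 where A1: "A1:reg E" "B1:reg E" "nonzero E B1" "finite T1" "ALL P:aff E - T1. (zpar o phi) P * B1 P = A1 P"
  "nonzero E A1 --> pole E A1 + e <= pole E B1"
  using pullback_order_ge[OF E E' phi x e zpar_regular z0] unfolding ord_ge_def by blast
 define F where "F P = yfun P * yfun P / (xfun P * xfun P * xfun P)" for P :: "'a epoint"
 note x3 = pole_mult3[OF reg_xfun reg_xfun reg_xfun nonzero_xfun nonzero_xfun nonzero_xfun, of E']
 have "ord_ge E' 0 F"
 proof (rule ord_geI[of "%P. yfun P * yfun P" E' "%P. xfun P * xfun P * xfun P"])
  show "(%P. yfun P * yfun P):reg E'" by (rule reg_mult[OF reg_yfun reg_yfun])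
  show "pole E' (%P. yfun P * yfun P) + 0 <= pole E' (%P. xfun P * xfun P * xfun P)"
   using pole_mult[OF reg_yfun reg_yfun nonzero_yfun nonzero_yfun, of E'] x3(3) by (simp add: pole_xfun pole_yfun)
 qed (use x3 in "auto simp: F_def")
 then obtain v where v: "F(Infty := v):carrier (elocal E' Infty)" using ord_ge_regular(1) by blast
 have "F(Infty := v) o phi:carrier (elocal E Infty)" using emorphism_pull[OF phi Infty_on_curve] v phi0 by metis
 from regular_ord_ge(1)[OF this] obtain A B T where A: "A:reg E" "B:reg E" "nonzero E B" "finite T"
  "ALL P:aff E - T. (F(Infty := v) o phi) P * B P = A P" "nonzero E A --> pole E A + 0 <= pole E B"
  unfolding ord_ge_def by blast
 define Z where "Z = {Q:aff E'. xfun Q = 0} Un {Q:aff E'. yfun Q = 0} Un {Infty}"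
 have "finite Z" unfolding Z_def using finite_zeros[OF reg_xfun nonzero_xfun, of E'] finite_zeros[OF reg_yfun nonzero_yfun, of E'] by simp
 hence Z: "finite {P:aff E. phi P:Z}" by (rule xmap_finite_preimage[OF x])
 define S where "S = T Un T1 Un {P:aff E. phi P:Z}"
 have S: "finite S" unfolding S_def using A(4) A1(4) Z by simp
 have pr: "(%P. poly a (xfun P)):reg E" "(%P. poly c (xfun P)):reg E" by simp_all
 let ?l = "%P. A1 P * A1 P * poly a (xfun P) * A P" and ?r = "%P. B1 P * B1 P * poly c (xfun P) * B P"
 have lr: "?l:reg E" "?r:reg E" by (intro reg_mult A A1 pr)+
 have eq: "?l P = ?r P" if P: "P:aff E" for P
 proof (rule reg_eqI[OF lr S _ P])
  fix P assume P: "P:aff E - S"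
  have Zn: "phi P ~: Z" and Pa: "P:aff E" using P unfolding S_def by auto
  have Pp: "P:points E" using Pa by blast
  have nI: "phi P ~= Infty" using Zn unfolding Z_def by blast
  have "phi P:aff E'" using surj_hom_basic(2)[OF E E' isogeny_surj_hom[OF phi] Pp] nI by blast
  hence xy: "xfun (phi P) ~= 0" "yfun (phi P) ~= 0" using Zn unfolding Z_def by auto
  have a: "poly a (xfun P) = xfun (phi P) * poly c (xfun P)" using pt[OF Pa] nI by auto
  have T: "P:aff E - T" "P:aff E - T1" using P unfolding S_def by auto
  have AB: "A P = F (phi P) * B P" "A1 P = zpar (phi P) * B1 P" using bspec[OF A(5) T(1)] bspec[OF A1(5) T(2)] nI by simp_all
  have one: "zpar (phi P) * zpar (phi P) * xfun (phi P) * F (phi P) = 1" using xy nI unfolding zpar_def F_def by simp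
  have "?l P = (zpar (phi P) * zpar (phi P) * xfun (phi P) * F (phi P)) * ?r P" unfolding a AB by (simp only: mult_ac)
  thus "?l P = ?r P" unfolding one by simp
 qed
 note nza = nonzero_poly_xfun[OF nz(1), of E] and nzc = nonzero_poly_xfun[OF nz(2), of E]
 note R3 = pole_mult3[OF A1(2,2) pr(2) A1(3,3) nzc]
 have nr: "nonzero E ?r" by (rule nonzero_mult[OF R3(1) A(2) R3(2) A(3)])
 have nA: "nonzero E A" "nonzero E A1" using nr eq unfolding nonzero_def by (metis mult_eq_0_iff)+
 note L3 = pole_mult3[OF A1(1,1) pr(1) nA(2,2) nza]
 have "pole E ?l = pole E ?r" by (rule pole_cong[OF lr(1) eq])
 hence "pole E A1 + pole E A1 + 2 * degree a + pole E A = pole E B1 + pole E B1 + 2 * degree c + pole E B"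
  unfolding pole_mult[OF R3(1) A(2) R3(2) A(3)] pole_mult[OF L3(1) A(1) L3(2) nA(1)] R3(3) L3(3) pole_poly .
 hence "pole E A1 + e = pole E B1" using mp[OF A(6) nA(1)] mp[OF A1(6) nA(2)] e by linarith
 thus ?thesis unfolding ord_eq_def using A1 nA by blast
qed

lemma germ_zero_order: "f:egerm_zero E Infty ==> ord_ge E n (f :: 'a epoint => 'a)"
proof -
 assume "f:egerm_zero E Infty"
 then obtain d D where D: "pform d D" "D Infty ~= 0" "ALL Q:points E. D Q ~= 0 --> f Q = 0"
  unfolding germ_zero_def plane_fractions_pform by blast
 have "pole E (%_. 0) = 0" "~ nonzero E (%_. 0)" using pole_poly[of E 0] unfolding nonzero_def by auto
 moreover have "finite {P:aff E. D P = 0}" using finite_zeros[OF pform_reg[OF D(1)]] pform_pole(3)[OF D(1,2)] by blast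
 moreover have "ALL P:aff E - {P:aff E. D P = 0}. f P * D P = 0" using D(3) by auto
 ultimately show ?thesis unfolding ord_ge_def using pform_reg[OF D(1)] pform_pole(3)[OF D(1,2)] reg_const by blast
qed

lemma kernel_scheme_order:
 assumes E: "elliptic_curve (E :: 'a weierstrass)" and E': "elliptic_curve E'" and phi: "isogeny E E' phi"
  and x: "xmap E E' phi a c" and e: "degree a = degree c + e" and h: "h:kernel_scheme E E' phi Infty"
 shows "ord_ge E e h"
proof -
 have phi0: "phi Infty = Infty" using surj_hom_basic(1)[OF E E' isogeny_surj_hom[OF phi]] .
 have gens: "{f o phi |f. f:origin_subscheme E' (phi Infty)} Un egerm_zero E Infty <= {f:carrier (elocal E Infty). ord_ge E e f}"
 proof -
  have "f o phi:carrier (elocal E Infty) & ord_ge E e (f o phi)" if "f:origin_subscheme E' (phi Infty)" for f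
  proof -
   have f: "f:carrier (elocal E' Infty)" "f Infty = 0" using that unfolding phi0 origin_subscheme_def by auto
   have "f o phi:carrier (elocal E Infty)" using emorphism_pull[OF phi Infty_on_curve] f(1) phi0 by metis
   thus ?thesis using pullback_order_ge[OF E E' phi x e f] by blast
  qed
  moreover have "f:carrier (elocal E Infty) & ord_ge E e f" if "f:egerm_zero E Infty" for f
   using germ_zero_order[OF that] that unfolding germ_zero_def by blast
  ultimately show ?thesis by blast
 qed
 have "kernel_scheme E E' phi Infty <= {f:carrier (elocal E Infty). ord_ge E e f}"
  unfolding kernel_scheme_def by (rule genideal_least[OF vanishing_order_ideal gens])
 thus ?thesis using h by blast
qed

lemma kernel_scheme_vanishes:
 assumes phi: "isogeny E E' phi" and P: "P:points E" "phi P = Infty" and h: "h:kernel_scheme E E' phi P"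
 shows "h:carrier (elocal E P)" "h P = (0 :: 'a)"
proof -
 have "{f o phi |f. f:origin_subscheme E' (phi P)} Un egerm_zero E P <= {f. regular_at (points E) plane_fractions P f & f P = 0}"
 proof -
  have "regular_at (points E) plane_fractions P (f o phi) & (f o phi) P = 0" if "f:origin_subscheme E' (phi P)" for f
  proof -
   have f: "f:carrier (elocal E' (phi P))" "f (phi P) = 0" using that P(2) unfolding origin_subscheme_def by auto
   show ?thesis using emorphism_pull[OF phi P(1) f(1)] f(2) by simp
  qed
  moreover have "regular_at (points E) plane_fractions P f & f P = 0" if "f:egerm_zero E P" for f
   by (rule germ_zero_vanishes[OF P(1) that])
  ultimately show ?thesis by blast
 qed
 hence "kernel_scheme E E' phi P <= {f. regular_at (points E) plane_fractions P f & f P = 0}"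
  unfolding kernel_scheme_def by (rule genideal_least[OF vanishing_ideal[OF fraction_class_plane]])
 thus "h:carrier (elocal E P)" "h P = 0" using h by auto
qed

lemma kernel_scheme_one: "phi P ~= Infty ==> (%_. 1):kernel_scheme E E' phi (P :: 'a epoint)"
proof -
 assume "phi P ~= Infty"
 hence "(%_. 1):origin_subscheme E' (phi P)" unfolding origin_subscheme_def using regular_at_const[OF fraction_class_plane] by simp
 moreover have "(%_. 1) = (%_. 1) o phi" by auto
 ultimately have "(%_. 1):{f o phi |f. f:origin_subscheme E' (phi P)} Un egerm_zero E P" by blast
 thus ?thesis unfolding kernel_scheme_def by (rule subsetD[OF genideal_incl])
qed

lemma kernel_scheme_pullback: "phi P = Infty ==> f:carrier (elocal E' Infty) ==> f Infty = 0 ==> f o phi:kernel_scheme E E' phi (P :: 'a epoint)"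
proof -
 assume "phi P = Infty" "f:carrier (elocal E' Infty)" "f Infty = 0"
 hence "f:origin_subscheme E' (phi P)" unfolding origin_subscheme_def by simp
 hence "f o phi:{f o phi |f. f:origin_subscheme E' (phi P)} Un egerm_zero E P" by blast
 thus ?thesis unfolding kernel_scheme_def by (rule subsetD[OF genideal_incl])
qed

end

section \<open>Slices of product ideals\<close>

lemma pform_prod: "finite S ==> (!!v. v:S ==> pform (d v) (g v)) ==> pform (SUM v:S. d v) (%P. PROD v:S. g v P)"
 by (induction S rule: finite_induct) (auto intro: pform_const pform_mult)

lemma pform_sum: "(!!i. i:S ==> pform d (f i)) ==> pform d (%P. SUM i:S. f i P)"
 by (induction S rule: infinite_finite_induct) (auto intro: pform_zero pform_add)

lemma bform_slice:
 fixes f :: "'a::field epoint \<times> 'a epoint => 'a"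
 assumes "bform d e f" shows "pform d (%P. f (P, Q))"
proof -
 obtain F where F: "!!m b. m:keys F ==> wdeg (if b then range Inl else range Inr) m = (if b then d else e)"
   "f = (%(P, Q). mpol_eval F (case_sum (hcoord P) (hcoord Q)))"
  using assms unfolding bform_def form_fun_def by blast
 let ?d = "%v. if v:range Inl then 1 else 0"
 have "pform d (%P. mval m (case_sum (hcoord P) (hcoord Q)))" if m: "m:keys F" for m
 proof -
  have "pform (?d v) (%P. case_sum (hcoord P) (hcoord Q) v)" for v
   by (cases v) (auto intro: pform_coord[simplified] pform_const)
  hence "pform (SUM v:keys m. lookup m v * ?d v) (%P. mval m (case_sum (hcoord P) (hcoord Q)))"
   unfolding mval_def by (intro pform_prod pform_power) simp_all
  moreover have "(SUM v:keys m. lookup m v * ?d v) = wdeg (range Inl) m"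
   unfolding wdeg_def by (subst sum.inter_restrict) (auto intro: sum.cong)
  ultimately show ?thesis using F(1)[OF m, of True] by simp
 qed
 thus ?thesis unfolding F(2) mpol_eval_mval by (auto intro!: pform_sum pform_cmult)
qed

context closed_field
begin

lemma regular_proj:
 fixes P Q :: "'a epoint"
 shows "f:carrier (elocal E P) ==> f o fst:carrier (eelocal E (P, Q))"
  and "f:carrier (elocal E Q) ==> f o snd:carrier (eelocal E (P, Q))"
proof -
 assume "f:carrier (elocal E P)"
 then obtain d N D where d: "pform d N" "pform d D" "D P ~= 0" "ALL R:points E. D R ~= 0 --> f R = N R / D R"
  unfolding local_ring_simps regular_at_def plane_fractions_pform by blast
 have "(N o fst, D o fst):biplane_fractions" unfolding biplane_fractions_bform using bform_pform[OF d(1)] bform_pform[OF d(2)] by blast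
 thus "f o fst:carrier (eelocal E (P, Q))" unfolding local_ring_simps regular_at_def using d(3,4)
  by (intro CollectI bexI[rotated]) auto
next
 assume "f:carrier (elocal E Q)"
 then obtain d N D where d: "pform d N" "pform d D" "D Q ~= 0" "ALL R:points E. D R ~= 0 --> f R = N R / D R"
  unfolding local_ring_simps regular_at_def plane_fractions_pform by blast
 have "(N o snd, D o snd):biplane_fractions" unfolding biplane_fractions_bform using bform_pform[OF d(1)] bform_pform[OF d(2)] by blast
 thus "f o snd:carrier (eelocal E (P, Q))" unfolding local_ring_simps regular_at_def using d(3,4)
  by (intro CollectI bexI[rotated]) auto
qed

lemma regular_slice:
 assumes "F:carrier (eelocal E (P, Q :: 'a epoint))" and Q: "Q:points E"
 shows "(%R. F (R, Q)):carrier (elocal E P)"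
proof -
 obtain d e N D where d: "bform d e N" "bform d e D" "D (P, Q) ~= 0" "ALL z:points E \<times> points E. D z ~= 0 --> F z = N z / D z"
  using assms(1) unfolding local_ring_simps regular_at_def biplane_fractions_bform by blast
 have "(%R. N (R, Q), %R. D (R, Q)):plane_fractions" unfolding plane_fractions_pform using bform_slice d(1,2) by blast
 thus ?thesis unfolding local_ring_simps regular_at_def using d(3,4) Q by (intro CollectI bexI[rotated]) auto
qed

lemma local_ideal_add: "ideal J (local_ring V Fr P) ==> f:J ==> g:J ==> (%x. f x + g x):J"
proof -
 assume J: "ideal J (local_ring V Fr P)" "f:J" "g:J"
 show ?thesis using additive_subgroup.a_closed[OF ideal.axioms(1)[OF J(1)] J(2,3)] by simp
qed

lemma local_ideal_mult: "ideal J (local_ring V Fr P) ==> f:carrier (local_ring V Fr P) ==> g:J ==> (%x. f x * g x):J"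
proof -
 assume J: "ideal J (local_ring V Fr P)" "f:carrier (local_ring V Fr P)" "g:J"
 interpret ideal J "local_ring V Fr P" by (rule J(1))
 show ?thesis using I_l_closed[OF J(3,2)] by simp
qed

lemma local_ideal_zero: "ideal J (local_ring V Fr P) ==> (%_. 0):J"
proof -
 assume J: "ideal J (local_ring V Fr P)"
 show ?thesis using additive_subgroup.zero_closed[OF ideal.axioms(1)[OF J]] by simp
qed

lemma local_ideal_one: "ideal J (local_ring V Fr P) ==> (%_. 1):J ==> J = carrier (local_ring V Fr P)"
proof -
 assume J: "ideal J (local_ring V Fr P)" "(%_. 1):J"
 interpret ideal J "local_ring V Fr P" by (rule J(1))
 show ?thesis using one_imp_carrier J(2) by simp
qed

text \<open>
  Functions that agree on the neighbourhood of P where F does not vanish have the same germ.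
\<close>
lemma local_ideal_cong:
 assumes J: "ideal J (elocal E P)" "egerm_zero E P <= J" "f':J" and f: "f:carrier (elocal E (P :: 'a epoint))"
  and F: "pform d F" "F P ~= 0" "!!R. R:points E ==> F R ~= 0 ==> f R = f' R"
 shows "f:J"
proof -
 have "(%R. - 1):carrier (elocal E P)" using regular_at_const[OF fraction_class_plane] by simp
 from local_ideal_mult[OF J(1) this J(3)] have m: "(%R. - 1 * f' R):J" .
 have "J <= carrier (elocal E P)" by (rule additive_subgroup.a_subset[OF ideal.axioms(1)[OF J(1)]])
 hence "regular_at (points E) plane_fractions P (%R. - 1 * f' R)" using m by auto
 from regular_at_arith(1)[OF fraction_class_plane _ this, of f] f
 have "(%R. f R + - 1 * f' R):carrier (elocal E P)" by simp
 moreover have "(%_. 0, F):plane_fractions" unfolding plane_fractions_pform using F(1) pform_zero by blast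
 ultimately have "(%R. f R + - 1 * f' R):egerm_zero E P" unfolding germ_zero_def using F(2,3) by auto
 hence "(%R. f R + - 1 * f' R):J" by (rule subsetD[OF J(2)])
 from local_ideal_add[OF J(1) this J(3)] show ?thesis by simp
qed

text \<open>
  Restriction to \<open>y = Q\<close> maps the ideal of \<open>I \<times> J\<close> into that of \<open>I\<close> when Q is a point of J.
\<close>
lemma product_ideal_slice:
 fixes E :: "'a weierstrass"
 assumes I: "ideal (I P) (elocal E P)" "egerm_zero E P <= I P" and J: "J Q <= carrier (elocal E Q)" "ALL g:J Q. g Q = 0"
  and Q: "Q:points E" and F: "F:product_ideal E I J P Q"
 shows "(%R. F (R, Q)):I P"
proof -
 let ?K = "{F. regular_at (points E \<times> points E) biplane_fractions (P, Q) F & (%R. F (R, Q)):I P}"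
 have "ideal ?K (eelocal E (P, Q))"
 proof (rule local_ring_idealI[OF fraction_class_biplane])
  fix f g assume "regular_at (points E \<times> points E) biplane_fractions (P, Q) f" "g:?K"
  thus "(%x. f x * g x):?K" using regular_at_arith(2)[OF fraction_class_biplane, of _ _ f g]
   local_ideal_mult[OF I(1) regular_slice[OF _ Q, of f]] by simp
 qed (use regular_at_arith(1)[OF fraction_class_biplane] regular_at_const[OF fraction_class_biplane] local_ideal_add[OF I(1)] local_ideal_zero[OF I(1)] in auto)
 moreover have "{f o fst | f. f:I P} Un {g o snd | g. g:J Q} Un eegerm_zero E (P, Q) <= ?K"
 proof (intro Un_least subsetI)
  fix F :: "'a epoint \<times> 'a epoint => 'a" assume "F:{f o fst | f. f:I P}"
  then obtain f where f: "F = f o fst" "f:I P" by blast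
  thus "F:?K" using regular_proj(1)[of f E P Q] additive_subgroup.a_subset[OF ideal.axioms(1)[OF I(1)]] by (auto simp: comp_def)
 next
  fix F :: "'a epoint \<times> 'a epoint => 'a" assume "F:{g o snd | g. g:J Q}"
  then obtain g where g: "F = g o snd" "g:J Q" by blast
  hence "g Q = 0" using J(2) by blast
  thus "F:?K" using g regular_proj(2)[of g E Q P] J(1) local_ideal_zero[OF I(1)] by (auto simp: comp_def)
 next
  fix F assume F: "F:eegerm_zero E (P, Q)"
  hence Fr: "F:carrier (eelocal E (P, Q))" unfolding germ_zero_def by blast
  obtain N D where ND: "(N, D):biplane_fractions" and D: "D (P, Q) ~= 0" "ALL z:points E \<times> points E. D z ~= 0 --> F z = 0"
   using F unfolding germ_zero_def by blast
  obtain d e where bD: "bform d e D" using ND unfolding biplane_fractions_bform by blast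
  have "(%R. F (R, Q)):I P"
   by (rule local_ideal_cong[OF I local_ideal_zero[OF I(1)] regular_slice[OF Fr Q] bform_slice[OF bD]]) (use D Q in auto)
  thus "F:?K" using Fr by simp
 qed
 ultimately have "product_ideal E I J P Q <= ?K" unfolding product_ideal_def by (rule genideal_least)
 thus ?thesis using F by blast
qed


section \<open>Sums and intersections of kernels\<close>


lemma isogeny_vmap:
 assumes E: "elliptic_curve (E :: 'a weierstrass)" and E': "elliptic_curve E'" and phi: "isogeny E E' phi"
 shows "EX e a c. xmap E E' phi a c & degree a = degree c + e & vmap E E' phi 1 e"
proof -
 obtain a c where x: "xmap E E' phi a c" using isogeny_xmap[OF E E' phi] by blast
 obtain q C D where q: "frob q" "C ~= 0" "degree a = degree c + q"
  "ALL P:points E - kern E phi. xfun (phi P) = C * tsum E (kern E phi) P ^ q + D"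
  using trace_formula[OF E E' x] by blast
 have "vmap E E' phi 1 q" unfolding vmap_def
  using isogeny_surj_hom[OF phi] finite_kern[OF E E' x] q(1,2,4) by auto
 thus ?thesis using x q(3) by blast
qed

lemma kernel_scheme_ideal:
 assumes phi: "isogeny E E' phi" and P: "P:points (E :: 'a weierstrass)"
 shows "ideal (kernel_scheme E E' phi P) (elocal E P)"
proof -
 interpret ring "elocal E P" by (rule local_ring_ring[OF fraction_class_plane])
 have "{f o phi |f. f:origin_subscheme E' (phi P)} Un egerm_zero E P <= carrier (elocal E P)"
 proof -
  have "f o phi:carrier (elocal E P)" if "f:origin_subscheme E' (phi P)" for f
   using emorphism_pull[OF phi P] that unfolding origin_subscheme_def by blast
  moreover have "egerm_zero E P <= carrier (elocal E P)" unfolding germ_zero_def by blast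
  ultimately show ?thesis by blast
 qed
 thus ?thesis unfolding kernel_scheme_def by (rule genideal_ideal)
qed

lemma ord_ge_divide:
 assumes "ord_ge E m f" "ord_eq E n g" "n <= m" shows "ord_ge E 0 (%P. f P / g P)"
proof -
 obtain A B T where A: "A:reg E" "B:reg E" "nonzero E B" "finite T" "ALL P:aff E - T. f P * B P = A P"
  "nonzero E A --> pole E A + m <= pole E B" using assms(1) unfolding ord_ge_def by blast
 obtain A' B' T' where A': "A':reg E" "B':reg E" "nonzero E A'" "nonzero E B'" "finite T'" "ALL P:aff E - T'. g P * B' P = A' P"
  "pole E A' + n = pole E B'" using assms(2) unfolding ord_eq_def by blast
 define S where "S = T Un T' Un {P:aff E. A' P = 0}"
 have S: "finite S" unfolding S_def using A(4) A'(5) finite_zeros[OF A'(1,3)] by simp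
 show ?thesis unfolding ord_ge_def
 proof (intro exI conjI)
  show "(%P. A P * B' P):reg E" "(%P. B P * A' P):reg E" by (intro reg_mult A A')+
  show "nonzero E (%P. B P * A' P)" by (rule nonzero_mult[OF A(2) A'(1) A(3) A'(3)])
  show "finite S" by (rule S)
  show "ALL P:aff E - S. f P / g P * (B P * A' P) = A P * B' P"
  proof
   fix P assume P: "P:aff E - S"
   have T: "P:aff E - T" "P:aff E - T'" and nz: "A' P ~= 0" using P unfolding S_def by auto
   have a: "A P = f P * B P" "A' P = g P * B' P" using bspec[OF A(5) T(1)] bspec[OF A'(6) T(2)] by simp_all
   have "g P ~= 0" using nz a(2) by auto
   thus "f P / g P * (B P * A' P) = A P * B' P" unfolding a by simp
  qed
  show "nonzero E (%P. A P * B' P) --> pole E (%P. A P * B' P) + 0 <= pole E (%P. B P * A' P)"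
  proof
   assume "nonzero E (%P. A P * B' P)"
   hence n: "nonzero E A" unfolding nonzero_def by auto
   show "pole E (%P. A P * B' P) + 0 <= pole E (%P. B P * A' P)"
    using pole_mult[OF A(1) A'(2) n A'(4)] pole_mult[OF A(2) A'(1) A(3) A'(3)] mp[OF A(6) n] A'(7) assms(3) by linarith
  qed
 qed
qed

lemma egerm_zero_kernel: "egerm_zero E P <= kernel_scheme E E' phi (P :: 'a epoint)"
proof -
 have "egerm_zero E P <= {f o phi |f. f:origin_subscheme E' (phi P)} Un egerm_zero E P" by blast
 also have "... <= kernel_scheme E E' phi P" unfolding kernel_scheme_def by (rule genideal_incl)
 finally show ?thesis .
qed

text \<open>At infinity the order of vanishing decides.\<close>
lemma kernel_scheme_mono:
 assumes E: "elliptic_curve (E :: 'a weierstrass)" and E1: "elliptic_curve E1" and E2: "elliptic_curve E2"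
  and phi: "isogeny E E1 phi" and psi: "isogeny E E2 psi"
  and x1: "xmap E E1 phi a1 c1" "degree a1 = degree c1 + e1" and x2: "xmap E E2 psi a2 c2" "degree a2 = degree c2 + e2"
  and le: "e2 <= e1"
 shows "kernel_scheme E E1 phi Infty <= kernel_scheme E E2 psi Infty"
proof -
 have O: "phi Infty = Infty" "psi Infty = Infty"
  using surj_hom_basic(1)[OF E E1 isogeny_surj_hom[OF phi]] surj_hom_basic(1)[OF E E2 isogeny_surj_hom[OF psi]] by auto
 note J = kernel_scheme_ideal[OF psi Infty_on_curve]
 have z0: "zpar Infty = 0" by (simp add: zpar_def)
 define zeta where "zeta = zpar o psi"
 have zetaJ: "zeta:kernel_scheme E E2 psi Infty" unfolding zeta_def by (rule kernel_scheme_pullback[where phi = psi and f = zpar, OF O(2) zpar_regular z0])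
 have "g o phi:kernel_scheme E E2 psi Infty" if g: "g:origin_subscheme E1 (phi Infty)" for g
 proof -
  have gr: "g:carrier (elocal E1 Infty)" "g Infty = 0" using g O unfolding origin_subscheme_def by auto
  define h where "h = g o phi"
  have "ord_ge E 0 (%P. h P / zeta P)" unfolding h_def zeta_def
   by (rule ord_ge_divide[OF pullback_order_ge[OF E E1 phi x1 gr] pullback_zpar_order[OF E E2 psi x2] le])
  then obtain v where v: "(%P. h P / zeta P)(Infty := v):carrier (elocal E Infty)" using ord_ge_regular(1) by blast
  have hr: "h:carrier (elocal E Infty)" unfolding h_def by (rule emorphism_pull[OF phi Infty_on_curve]) (use gr O in simp)
  define Z where "Z = {R:aff E2. xfun R = 0} Un {R:aff E2. yfun R = 0} Un {Infty}"
  have "finite Z" unfolding Z_def using finite_zeros[OF reg_xfun nonzero_xfun, of E2] finite_zeros[OF reg_yfun nonzero_yfun, of E2] by simp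
  hence T: "finite {P:aff E. psi P:Z}" by (rule xmap_finite_preimage[OF x2(1)])
  define F where "F P = (PROD t:{P:aff E. psi P:Z}. hcoord P 1 - yfun t * hcoord P 2)" for P
  have "pform (SUM t:{P:aff E. psi P:Z}. 1) F" unfolding F_def
   by (intro pform_prod[OF T] pform_diff pform_cmult pform_coord)
  moreover have "F Infty ~= 0" unfolding F_def by simp
  moreover have "h P = ((%P. h P / zeta P)(Infty := v)) P * zeta P" if P: "P:points E" "F P ~= 0" for P
  proof (cases "P = Infty")
   case False
   then obtain x y where xy: "P = Aff x y" by (cases P) auto
   have "psi P ~: Z"
   proof
    assume "psi P:Z"
    hence "P:{P:aff E. psi P:Z}" using P(1) False by simp
    moreover have "hcoord P 1 - yfun P * hcoord P 2 = 0" unfolding xy by simp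
    ultimately have "F P = 0" unfolding F_def using T by (auto intro: prod_zero)
    thus False using P(2) by simp
   qed
   moreover have "psi P:points E2" using surj_hom_basic(2)[OF E E2 isogeny_surj_hom[OF psi] P(1)] .
   ultimately have "zeta P ~= 0" unfolding Z_def zeta_def zpar_def by auto
   thus ?thesis using False by simp
  qed (simp add: h_def zeta_def O gr z0)
  ultimately show ?thesis unfolding h_def[symmetric]
   by (rule local_ideal_cong[OF J egerm_zero_kernel local_ideal_mult[OF J v zetaJ] hr])
 qed
 hence "{f o phi |f. f:origin_subscheme E1 (phi Infty)} Un egerm_zero E Infty <= kernel_scheme E E2 psi Infty"
  using egerm_zero_kernel[of E Infty E2 psi] by blast
 thus ?thesis unfolding kernel_scheme_def[of E E1 phi Infty] by (rule genideal_least[OF J])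
qed

lemma product_ideal_subset:
 fixes E :: "'a weierstrass"
 assumes I: "I P <= carrier (elocal E P)" and J: "J Q <= carrier (elocal E Q)"
 shows "product_ideal E I J P Q <= carrier (eelocal E (P, Q))"
proof -
 let ?S = "{f o fst | f. f:I P} Un {g o snd | g. g:J Q} Un eegerm_zero E (P, Q)"
 have S: "?S <= carrier (eelocal E (P, Q))"
  using regular_proj(1)[of _ E P Q] regular_proj(2)[of _ E Q P] I J unfolding germ_zero_def by blast
 have "ideal (carrier (eelocal E (P, Q))) (eelocal E (P, Q))" by (rule ring.oneideal[OF local_ring_ring[OF fraction_class_biplane]])
 thus "product_ideal E I J P Q <= carrier (eelocal E (P, Q))" unfolding product_ideal_def by (rule genideal_least[OF _ S])
qed

lemma product_ideal_one:
 fixes E :: "'a weierstrass"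
 assumes "(%_. 1):I P | (%_. 1):J Q" and h: "h:carrier (eelocal E (P, Q))"
 shows "h:product_ideal E I J P Q"
proof -
 let ?S = "{f o fst | f. f:I P} Un {g o snd | g. g:J Q} Un eegerm_zero E (P, Q)"
 have one: "(%_. 1):?S"
 proof -
  have a: "(%_. 1) = (%_::'a epoint. 1::'a) o fst" and b: "(%_. 1) = (%_::'a epoint. 1::'a) o snd" by auto
  show ?thesis using assms(1)
  proof
   assume "(%_. 1):I P"
   thus ?thesis using a by blast
  next
   assume "(%_. 1):J Q"
   thus ?thesis using b by blast
  qed
 qed
 have "h:M" if M: "ideal M (eelocal E (P, Q))" "?S <= M" for M
 proof -
  have "(%_. 1):M" using one M(2) by (rule subsetD[rotated])
  thus ?thesis using local_ideal_one[OF M(1)] h by blast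
 qed
 thus ?thesis unfolding product_ideal_def genideal_def by blast
qed

text \<open>
  The ideals of \<open>A\<close> and B contain that of Y at those points P and - P where both
  have one, so that \<open>A \<times> B\<close> lies in \<open>Y \<times> Y\<close> there and addition maps it into Y.
\<close>
lemma scheme_sum_mem:
 fixes E :: "'a weierstrass"
 assumes X: "finite_subgroup_scheme E Y" and f: "f:Y Infty"
  and cases: "!!P Q. P:points E ==> Q:points E ==> eadd E P Q = Infty ==>
   (%_. 1):A P | (%_. 1):B Q | Y P <= A P & Y Q <= B Q"
 shows "f:scheme_sum E A B Infty"
proof -
 have idl: "Y P <= carrier (elocal E P)" if "P:points E" for P
 proof -
  have "ideal (Y P) (elocal E P)" using X that unfolding finite_subgroup_scheme_def finite_closed_subscheme_def by blast
  thus ?thesis by (rule additive_subgroup.a_subset[OF ideal.axioms(1)])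
 qed
 have fr: "f:carrier (elocal E Infty)" by (rule subsetD[OF idl[OF Infty_on_curve] f])
 have "(%(x, y). f (eadd E x y)):product_ideal E A B P Q" if P: "P:points E" "Q:points E" "eadd E P Q = Infty" for P Q
 proof -
  have "f:Y (eadd E P Q)" using f P(3) by simp
  hence YY: "(%(x, y). f (eadd E x y)):product_ideal E Y Y P Q"
   using X P(1,2) unfolding finite_subgroup_scheme_def by blast
  hence car: "(%(x, y). f (eadd E x y)):carrier (eelocal E (P, Q))"
   by (rule subsetD[OF product_ideal_subset[where I = Y and J = Y and P = P and Q = Q, OF idl[OF P(1)] idl[OF P(2)]]])
  consider "(%_. 1):A P | (%_. 1):B Q" | "Y P <= A P" "Y Q <= B Q" using cases[OF P] by blast
  thus ?thesis
  proof cases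
   case 1 thus ?thesis by (rule product_ideal_one[OF _ car])
  next
   case 2
   hence "{f o fst | f. f:Y P} Un {g o snd | g. g:Y Q} Un eegerm_zero E (P, Q)
    <= {f o fst | f. f:A P} Un {g o snd | g. g:B Q} Un eegerm_zero E (P, Q)" by blast
   hence "product_ideal E Y Y P Q <= product_ideal E A B P Q" unfolding product_ideal_def by (rule genideal_mono)
   thus ?thesis using YY by blast
  qed
 qed
 thus ?thesis unfolding scheme_sum_def using fr by blast
qed


section \<open>The inequality\<close>


definition quotient_map :: "'a weierstrass => 'a ideal_family => 'a weierstrass => ('a epoint => 'a epoint) => nat => bool" where
 "quotient_map E Y E' phi e <-> elliptic_curve E' & isogeny E E' phi & (ALL P:points E. kernel_scheme E E' phi P = Y P) &
  vmap E E' phi 1 e & (EX a c. xmap E E' phi a c & degree a = degree c + e)"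

lemma quotient_map_exists:
 assumes E: "elliptic_curve E" and Y: "is_quotient E Y E'" shows "EX phi e. quotient_map E Y E' phi e"
proof -
 obtain phi where phi: "elliptic_curve E'" "isogeny E E' phi" "ALL P:points E. kernel_scheme E E' phi P = Y P"
  using Y unfolding is_quotient_def by blast
 obtain e a c where "xmap E E' phi a c" "degree a = degree c + e" "vmap E E' phi 1 e" using isogeny_vmap[OF E phi(1,2)] by blast
 thus ?thesis unfolding quotient_map_def using phi by blast
qed

lemma quotient_mapD:
 assumes E: "elliptic_curve E" and q: "quotient_map E Y E' phi e"
 shows "P:points E ==> phi P = Infty ==> h:Y P ==> h P = 0"
  and "P:points E ==> Y P <= carrier (elocal E P)"
  and "P:points E ==> phi P ~= Infty ==> (%_. 1):Y P"
  and "P:points E ==> (%_. 0):Y P"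
  and "h:Y Infty ==> ord_ge E e h" and "zpar o phi:Y Infty" and "ord_eq E e (zpar o phi)"
  and "phi Infty = Infty" and "subgroup (kern E phi) (egroup E)" and "finite (kern E phi)"
  and "P:points E ==> ideal (Y P) (elocal E P)" and "P:points E ==> egerm_zero E P <= Y P"
proof -
 have E': "elliptic_curve E'" and phi: "isogeny E E' phi" and k: "!!P. P:points E ==> kernel_scheme E E' phi P = Y P" and v: "vmap E E' phi 1 e"
  using q unfolding quotient_map_def by auto
 obtain a c where x: "xmap E E' phi a c" "degree a = degree c + e" using q unfolding quotient_map_def by blast
 show "h P = 0" if "P:points E" "phi P = Infty" "h:Y P" for P h
  by (rule kernel_scheme_vanishes(2)[OF phi that(1,2)]) (simp add: k that)
 show "egerm_zero E P <= Y P" if "P:points E" for P using egerm_zero_kernel[of E P E' phi] unfolding k[OF that] .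
 show idl: "ideal (Y P) (elocal E P)" if "P:points E" for P using kernel_scheme_ideal[OF phi that] unfolding k[OF that] .
 show "Y P <= carrier (elocal E P)" if "P:points E" for P
  by (rule additive_subgroup.a_subset[OF ideal.axioms(1)[OF idl[OF that]]])
 show "(%_. 0):Y P" if "P:points E" for P by (rule local_ideal_zero[OF idl[OF that]])
 show "(%_. 1):Y P" if "P:points E" "phi P ~= Infty" for P using kernel_scheme_one[where phi = phi and P = P and E = E and E' = E', OF that(2)] unfolding k[OF that(1)] .
 show "ord_ge E e h" if "h:Y Infty" for h using kernel_scheme_order[OF E E' phi x] that k[OF Infty_on_curve] by blast
 show phi0: "phi Infty = Infty" using surj_hom_basic(1)[OF E E' isogeny_surj_hom[OF phi]] .
 have z0: "zpar Infty = 0" by (simp add: zpar_def)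
 have "zpar o phi:kernel_scheme E E' phi Infty" by (rule kernel_scheme_pullback[where phi = phi and f = zpar, OF phi0 zpar_regular z0])
 thus "zpar o phi:Y Infty" using k[OF Infty_on_curve] by simp
 show "ord_eq E e (zpar o phi)" by (rule pullback_zpar_order[OF E E' phi x])
 show "subgroup (kern E phi) (egroup E)" by (rule kern_subgroup[OF E E' isogeny_surj_hom[OF phi]])
 show "finite (kern E phi)" using v unfolding vmap_def by blast
qed

text \<open>
  At infinity the order of vanishing decides.  Another point Q of both kernels is reached by the
  group law of Y2: the functions in question are invariant under translation by Q.
\<close>
lemma quotient_map_mono:
 assumes E: "elliptic_curve E" and q1: "quotient_map E Y1 E1 phi1 e1" and q2: "quotient_map E Y2 E2 phi2 e2" and le: "e2 <= e1"
  and Y2: "finite_subgroup_scheme E Y2" and Q: "Q:points E" "phi1 Q = Infty" "phi2 Q = Infty"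
 shows "Y1 Q <= Y2 Q"
proof -
 have 1: "elliptic_curve E1" "isogeny E E1 phi1" and k1: "!!P. P:points E ==> kernel_scheme E E1 phi1 P = Y1 P" using q1 unfolding quotient_map_def by auto
 have 2: "elliptic_curve E2" "isogeny E E2 phi2" and k2: "!!P. P:points E ==> kernel_scheme E E2 phi2 P = Y2 P" using q2 unfolding quotient_map_def by auto
 obtain a1 c1 where x1: "xmap E E1 phi1 a1 c1" "degree a1 = degree c1 + e1" using q1 unfolding quotient_map_def by blast
 obtain a2 c2 where x2: "xmap E E2 phi2 a2 c2" "degree a2 = degree c2 + e2" using q2 unfolding quotient_map_def by blast
 have sub: "Y1 Infty <= Y2 Infty"
  using kernel_scheme_mono[OF E 1(1) 2(1) 1(2) 2(2) x1 x2 le] unfolding k1[OF Infty_on_curve] k2[OF Infty_on_curve] .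
 note J = quotient_mapD(11)[OF E q2 Q(1)] and Z = quotient_mapD(12)[OF E q2 Q(1)]
 note hom1 = surj_hom_basic[OF E 1(1) isogeny_surj_hom[OF 1(2)]] and hom2 = surj_hom_basic[OF E 2(1) isogeny_surj_hom[OF 2(2)]]
 have nQ: "eneg E Q:points E" by (rule eneg_on_curve[OF Q(1)])
 have n: "phi1 (eneg E Q) = Infty" "phi2 (eneg E Q) = Infty" using hom1(3)[OF Q(1)] hom2(3)[OF Q(1)] Q(2,3) by auto
 have v: "ALL g:Y2 (eneg E Q). g (eneg E Q) = 0" using quotient_mapD(1)[OF E q2 nQ n(2)] by blast
 have O: "eadd E Q (eneg E Q) = Infty" by (simp add: eadd_eq_Infty)
 have "g o phi1:Y2 Q" if g: "g:origin_subscheme E1 (phi1 Q)" for g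
 proof -
  have gr: "g:carrier (elocal E1 Infty)" "g Infty = 0" using g Q(2) unfolding origin_subscheme_def by auto
  have "g o phi1:Y1 Infty"
   using kernel_scheme_pullback[where phi = phi1 and f = g, OF hom1(1) gr] k1[OF Infty_on_curve] by blast
  hence "g o phi1:Y2 (eadd E Q (eneg E Q))" using sub O by auto
  hence "(%(x, y). (g o phi1) (eadd E x y)):product_ideal E Y2 Y2 Q (eneg E Q)"
   using Y2 Q(1) nQ unfolding finite_subgroup_scheme_def by blast
  from product_ideal_slice[where I = Y2 and J = Y2, OF J Z quotient_mapD(2)[OF E q2 nQ] v nQ this] n
  have T: "(%R. (g o phi1) (eadd E R (eneg E Q))):Y2 Q" by simp
  show ?thesis
  proof (rule local_ideal_cong[OF J Z T _ pform_const[of 1]])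
   show "g o phi1:carrier (elocal E Q)" by (rule emorphism_pull[OF 1(2) Q(1)]) (use gr Q(2) in simp)
   show "(g o phi1) R = (g o phi1) (eadd E R (eneg E Q))" if "R:points E" for R
    using hom1(4)[OF that nQ] n(1) by (simp add: eadd_Infty_right)
  qed simp
 qed
 hence "{f o phi1 |f. f:origin_subscheme E1 (phi1 Q)} Un egerm_zero E Q <= Y2 Q" using Z by blast
 from genideal_least[OF J this] show ?thesis unfolding k1[OF Q(1), symmetric] kernel_scheme_def .
qed

text \<open>
  The pullback of \<open>z = x / y\<close> from the quotient by the more inseparable of the two subgroup schemes
  belongs to the ideal of their sum.
\<close>
lemma sum_inseparability_le:
 assumes E: "elliptic_curve E" and G: "finite_subgroup_scheme E G" and H: "finite_subgroup_scheme E H"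
  and qG: "quotient_map E G EG phiG eG" and qH: "quotient_map E H EH phiH eH" and qS: "quotient_map E (scheme_sum E G H) ES phiS eS"
 shows "eS <= max eG eH"
proof -
 note dG = quotient_mapD[OF E qG] and dH = quotient_mapD[OF E qH] and dS = quotient_mapD[OF E qS]
 have EG: "elliptic_curve EG" "isogeny E EG phiG" and EH: "elliptic_curve EH" "isogeny E EH phiH"
  using qG qH unfolding quotient_map_def by auto
 have opp: "phi P = Infty <-> phi Q = Infty"
  if "elliptic_curve E'" "isogeny E E' phi" and PQ: "P:points E" "Q:points E" "eadd E P Q = Infty" for E' phi P Q
 proof -
  note hom = surj_hom_basic[OF E that(1) isogeny_surj_hom[OF that(2)]]
  have "Q = eneg E P" using PQ(3) unfolding eadd_eq_Infty .
  hence "phi Q = eneg E' (phi P)" using hom(3)[OF PQ(1)] by simp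
  thus ?thesis by (cases "phi P") auto
 qed
 show ?thesis
 proof (cases "eH <= eG")
  case True
  have "zpar o phiG:scheme_sum E G H Infty"
  proof (rule scheme_sum_mem[OF G dG(6)])
   fix P Q assume PQ: "P:points E" "Q:points E" "eadd E P Q = Infty"
   show "(%_. 1):G P | (%_. 1):H Q | G P <= G P & G Q <= H Q"
    using dG(3)[OF PQ(1)] dH(3)[OF PQ(2)] quotient_map_mono[OF E qG qH True H PQ(2)] opp[OF EG PQ] by blast
  qed
  from ord_ge_eq_le[OF dS(5)[OF this] dG(7)] show ?thesis by simp
 next
  case False
  hence le: "eG <= eH" by simp
  have "zpar o phiH:scheme_sum E G H Infty"
  proof (rule scheme_sum_mem[OF H dH(6)])
   fix P Q assume PQ: "P:points E" "Q:points E" "eadd E P Q = Infty"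
   show "(%_. 1):G P | (%_. 1):H Q | H P <= G P & H Q <= H Q"
    using dG(3)[OF PQ(1)] dH(3)[OF PQ(2)] quotient_map_mono[OF E qH qG le G PQ(1)] opp[OF EH PQ] by blast
  qed
  from ord_ge_eq_le[OF dS(5)[OF this] dH(7)] show ?thesis by simp
 qed
qed

text \<open>
  Otherwise the constant 1 would belong to the ideal of the sum, but its pullback does not vanish at \<open>(P, Q)\<close>.
\<close>
lemma kern_sum:
 assumes E: "elliptic_curve E"
  and qG: "quotient_map E G EG phiG eG" and qH: "quotient_map E H EH phiH eH" and qS: "quotient_map E (scheme_sum E G H) ES phiS eS"
  and P: "P:points E" "phiG P = Infty" and Q: "Q:points E" "phiH Q = Infty"
 shows "phiS (eadd E P Q) = Infty"
proof (rule ccontr)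
 assume nI: "phiS (eadd E P Q) ~= Infty"
 have "(%_. 1):scheme_sum E G H (eadd E P Q)"
  by (rule quotient_mapD(3)[OF E qS _ nI]) (rule eadd_on_curve[OF P(1) Q(1)])
 hence one: "(%(x, y). 1):product_ideal E G H P Q" using P(1) Q(1) unfolding scheme_sum_def by blast
 have G: "ideal (G P) (elocal E P)" "egerm_zero E P <= G P" by (rule quotient_mapD(11,12)[OF E qG P(1)])+
 have v: "ALL h:H Q. h Q = 0" using quotient_mapD(1)[OF E qH Q] by blast
 have "(%R. 1):G P"
  using product_ideal_slice[where I = G and J = H, OF G quotient_mapD(2)[OF E qH Q(1)] v Q(1) one] by simp
 from quotient_mapD(1)[OF E qG P this] show False by simp
qed

lemma scheme_inter_iff: "f:scheme_inter E G H P <-> (EX g:G P. EX h:H P. f = (%x. g x + h x :: 'a))"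
 unfolding scheme_inter_def set_add_def' by auto

lemma kern_inter:
 assumes E: "elliptic_curve E"
  and qG: "quotient_map E G EG phiG eG" and qH: "quotient_map E H EH phiH eH" and qI: "quotient_map E (scheme_inter E G H) EI phiI eI"
  and P: "P:points E" "phiG P = Infty" "phiH P = Infty"
 shows "phiI P = Infty"
proof (rule ccontr)
 assume nI: "phiI P ~= Infty"
 have "(%_. 1):scheme_inter E G H P" by (rule quotient_mapD(3)[OF E qI P(1) nI])
 then obtain g h where gh: "g:G P" "h:H P" "(%_. 1) = (%x. g x + h x)" unfolding scheme_inter_iff by blast
 have "g P = 0" "h P = 0" using quotient_mapD(1)[OF E qG P(1,2) gh(1)] quotient_mapD(1)[OF E qH P(1,3) gh(2)] by auto
 moreover have "1 = g P + h P" using gh(3) by (rule fun_cong)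
 ultimately show False by simp
qed

text \<open>
  The pulled back local parameters of both quotients belong to the ideal of the intersection.
\<close>
lemma inter_inseparability_le:
 assumes E: "elliptic_curve E"
  and qG: "quotient_map E G EG phiG eG" and qH: "quotient_map E H EH phiH eH" and qI: "quotient_map E (scheme_inter E G H) EI phiI eI"
 shows "eI <= min eG eH"
proof -
 note dG = quotient_mapD[OF E qG] and dH = quotient_mapD[OF E qH] and dI = quotient_mapD[OF E qI]
 have "zpar o phiG = (%x. (zpar o phiG) x + 0)" "zpar o phiH = (%x. 0 + (zpar o phiH) x)" by auto
 hence "zpar o phiG:scheme_inter E G H Infty" "zpar o phiH:scheme_inter E G H Infty"
  unfolding scheme_inter_iff using dG(6) dH(6) dG(4)[OF Infty_on_curve] dH(4)[OF Infty_on_curve] by fast+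
 thus ?thesis using ord_ge_eq_le[OF dI(5) dG(7)] ord_ge_eq_le[OF dI(5) dH(7)] by simp
qed

end

text \<open>
  The right-hand side is smallest if the larger numerator is over the larger denominator.
\<close>
lemma oppositely_sorted:
 fixes eG eH eS eI bG bH bS bI :: real
 assumes pos: "bG > 0" "bH > 0" "eG >= 0" "eH >= 0"
  and "eS <= max eG eH" "eI <= min eG eH" "max bG bH <= bS" "min bG bH <= bI" and "eS >= 0" "eI >= 0"
 shows "eS / bS + eI / bI <= eG / bG + eH / bH"
proof -
 have "eS / bS <= max eG eH / max bG bH" by (rule frac_le) (use assms in auto)
 moreover have "eI / bI <= min eG eH / min bG bH" by (rule frac_le) (use assms in auto)
 moreover have "max eG eH / max bG bH + min eG eH / min bG bH <= eG / bG + eH / bH"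
 proof -
  have *: "a / s + b / t <= a / t + b / s" if "b <= a" "t <= s" "t > 0" for a b s t :: real
  proof -
   have "1 / s <= 1 / t" using that by (intro divide_left_mono) auto
   hence "(a - b) * (1 / s) <= (a - b) * (1 / t)" by (rule mult_left_mono) (use that in simp)
   thus ?thesis by (simp add: diff_divide_distrib left_diff_distrib)
  qed
  show ?thesis
   using *[of eH eG bH bG] *[of eG eH bG bH] *[of eH eG bG bH] *[of eG eH bH bG] pos
   by (cases "eG <= eH"; cases "bG <= bH") (auto simp: max_def min_def)
 qed
 ultimately show ?thesis by linarith
qed

context curve_field
begin

text \<open>
  The four heights are the multiples \<open>e / b\<close> of \<open>h (j E)\<close>, where e is the inseparability degree
  and b the order of the p-primary part.
\<close>
theorem height_inequality:
 assumes E: "elliptic_curve E" and G: "finite_subgroup_scheme E G" and H: "finite_subgroup_scheme E H"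
  and "is_quotient E (scheme_sum E G H) E_sum" "is_quotient E (scheme_inter E G H) E_inter"
  and "is_quotient E G E_G" "is_quotient E H E_H"
 shows "height k K (j_invariant E_sum) + height k K (j_invariant E_inter)
   <= height k K (j_invariant E_G) + height k K (j_invariant E_H)"
proof -
 obtain phiS eS where qS: "quotient_map E (scheme_sum E G H) E_sum phiS eS" using quotient_map_exists[OF E assms(4)] by blast
 obtain phiI eI where qI: "quotient_map E (scheme_inter E G H) E_inter phiI eI" using quotient_map_exists[OF E assms(5)] by blast
 obtain phiG eG where qG: "quotient_map E G E_G phiG eG" using quotient_map_exists[OF E assms(6)] by blast
 obtain phiH eH where qH: "quotient_map E H E_H phiH eH" using quotient_map_exists[OF E assms(7)] by blast
 have bex: "EX beta. ppart E (kern E phi) beta" if "quotient_map E Y E' phi e" for Y E' phi e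
  by (rule ppart_exists[OF E quotient_mapD(10,9)[OF E that]])
 obtain bS where bS: "ppart E (kern E phiS) bS" using bex[OF qS] by blast
 obtain bI where bI: "ppart E (kern E phiI) bI" using bex[OF qI] by blast
 obtain bG where bG: "ppart E (kern E phiG) bG" using bex[OF qG] by blast
 obtain bH where bH: "ppart E (kern E phiH) bH" using bex[OF qH] by blast
 have pos: "b > 0" if "ppart E W b" for W b using that frob_pos unfolding ppart_def by blast
 define h where "h = height k K (j_invariant E)"
 have h0: "h >= 0" unfolding h_def by (rule height_nonneg)
 have ht: "height k K (j_invariant E') = (e / b) * h" if q: "quotient_map E Y E' phi e" and b: "ppart E (kern E phi) b" for Y E' phi e b
 proof -
  have "elliptic_curve E'" "vmap E E' phi 1 e" using q unfolding quotient_map_def by auto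
  hence "real e * h = real b * height k K (j_invariant E')" unfolding h_def by (rule height_isogeny[OF E _ _ b])
  thus ?thesis using pos[OF b] by (simp add: field_simps)
 qed
 have pS: "eS <= max eG eH" by (rule sum_inseparability_le[OF E G H qG qH qS])
 have pI: "eI <= min eG eH" by (rule inter_inseparability_le[OF E qG qH qI])
 have GS: "kern E phiG <= kern E phiS"
 proof
  fix P assume "P:kern E phiG"
  hence P: "P:points E" "phiG P = Infty" unfolding kern_def by auto
  have "phiS (eadd E P Infty) = Infty" by (rule kern_sum[OF E qG qH qS P Infty_on_curve quotient_mapD(8)[OF E qH]])
  thus "P:kern E phiS" unfolding kern_def using P(1) by (simp add: eadd_Infty_right)
 qed
 have HS: "kern E phiH <= kern E phiS"
 proof
  fix P assume "P:kern E phiH"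
  hence P: "P:points E" "phiH P = Infty" unfolding kern_def by auto
  have "phiS (eadd E Infty P) = Infty" by (rule kern_sum[OF E qG qH qS Infty_on_curve quotient_mapD(8)[OF E qG] P])
  thus "P:kern E phiS" unfolding kern_def using P(1) by simp
 qed
 have GHI: "kern E phiG Int kern E phiH <= kern E phiI" unfolding kern_def using kern_inter[OF E qG qH qI] by blast
 have tG: "frob bG" "tors E bG <= kern E phiG" "card (tors E bG) = bG" and tH: "frob bH" "tors E bH <= kern E phiH" "card (tors E bH) = bH"
  using bG bH unfolding ppart_def by auto
 have "bG <= bS" by (rule ppart_mono[OF E bS subset_trans[OF tG(2) GS] tG(1,3)])
 moreover have "bH <= bS" by (rule ppart_mono[OF E bS subset_trans[OF tH(2) HS] tH(1,3)])
 ultimately have mS: "max bG bH <= bS" by simp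
 have mI: "min bG bH <= bI"
 proof (cases "bG <= bH")
  case True
  have "tors E bG <= tors E bH" by (rule tors_mono[OF E frob_le_imp_dvd[OF tG(1) tH(1) True]])
  hence "tors E bG <= kern E phiI" using tG(2) tH(2) GHI by blast
  from ppart_mono[OF E bI this tG(1,3)] show ?thesis by simp
 next
  case False
  hence le: "bH <= bG" by simp
  have "tors E bH <= tors E bG" by (rule tors_mono[OF E frob_le_imp_dvd[OF tH(1) tG(1) le]])
  hence "tors E bH <= kern E phiI" using tG(2) tH(2) GHI by blast
  from ppart_mono[OF E bI this tH(1,3)] show ?thesis by simp
 qed
 have "real eS / real bS + real eI / real bI <= real eG / real bG + real eH / real bH"
  by (rule oppositely_sorted) (use pos[OF bG] pos[OF bH] pS pI mS mI in "auto simp: max_def min_def split: if_splits")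
 hence "(eS / bS + eI / bI) * h <= (eG / bG + eH / bH) * h" using h0 by (rule mult_right_mono)
 thus ?thesis unfolding ht[OF qS bS] ht[OF qI bI] ht[OF qG bG] ht[OF qH bH] by (simp add: distrib_right)
qed

end

lemma curve_field_of_curve:
 fixes k K :: "'a::field set"
 assumes k: "perfect_subfield k" and C: "curve_with_function_field k n C K" and ac: "algebraic_closure amb K"
 shows "curve_field k K"
proof -
 have cf: "closed_field TYPE('a)" by (rule closed_field_of_algebraic_closure[OF ac])
 obtain x where x: "K = adjoin k {x i / x j | i j. i <= n & j <= n & x j ~= 0}"
  using C unfolding curve_with_function_field_def function_field_of_def by blast
 have "finite {x i / x j | i j. i <= n & j <= n & x j ~= 0}"
 proof (rule finite_subset)
  show "{x i / x j | i j. i <= n & j <= n & x j ~= 0} <= (%(i, j). x i / x j) ` ({..n} \<times> {..n})" by auto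
 qed simp
 hence fg: "EX S. finite S & K = adjoin k S" using x by blast
 have k': "subfield k amb" using k unfolding perfect_subfield_def by blast
 have K': "subfield K amb" unfolding x by (rule adjoin_subfield)
 have td: "transcendence_degree_one k K" using C unfolding curve_with_function_field_def by blast
 have alg: "algebraic_over K y" for y
  using algebraic_closure.algebraic_extension[OF ac, of y] unfolding algebraic_over_def by simp
 show ?thesis
  by (intro curve_field.intro curve_field_axioms.intro cf k' K' fg td alg)
qed

theorem corollary3:
  fixes k K :: "'a::field set"
    and n :: nat and C :: "(nat, 'a) mpol set"
    and E E_G E_H E_sum E_inter :: "'a weierstrass"
    and G H :: "'a ideal_family"
  assumes "perfect_subfield k"
    and "curve_with_function_field k n C K"
    and "algebraic_closure amb K"
    and "elliptic_curve E"
    and "finite_subgroup_scheme E G"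
    and "finite_subgroup_scheme E H"
    and "is_quotient E (scheme_sum E G H) E_sum"
    and "is_quotient E (scheme_inter E G H) E_inter"
    and "is_quotient E G E_G"
    and "is_quotient E H E_H"
  shows "height k K (j_invariant E_sum) + height k K (j_invariant E_inter)
       \<le> height k K (j_invariant E_G) + height k K (j_invariant E_H)"
proof -
 interpret curve_field k K by (rule curve_field_of_curve[OF assms(1-3)])
 show ?thesis by (rule height_inequality[OF assms(4-10)])
qed

end
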